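(* Let $G$ be an $\{\mathrm{ISK}_4, \text{diamond}, \text{bowtie}, \text{prism}, K_{3,3}\}$-free graph, and let $x$ be the center of a proper wheel in $G$. Let $W=(C,x)$ be a proper wheel in $G$ with center $x$ having the minimum number of spokes among all proper wheels with center $x$. Then (i) every connected component of $G\setminus N[x]$ contains the interior of at most one sector of $W$; and (ii) for every $u\in N(x)$, the component $D$ of $G\setminus (N[x]\setminus\{u\})$ containing $u$ contains the interiors of at most two sectors of $W$, and if $S_1,S_2$ are sectors with $S_1^*\subseteq V(D)$ and $S_2^*\subseteq V(D)$, then $V(S_1)\cap V(S_2)\neq\emptyset$.
   Context: "$H$-free" means no induced subgraph isomorphic to $H$; $\mathrm{ISK}_4$-free means no induced subdivision of $K_4$. Diamond: $K_4$ minus an edge. Bowtie: two triangles sharing one vertex. Prism: three vertex-disjoint paths $a_i\ldots b_i$ ($i=1,2,3$) of length $\ge1$ with $a_1a_2a_3$ and $b_1b_2b_3$ triangles and no other edges between the paths. $N[x]$ is the closed neighborhood. For a path $S$, $S^*$ is its set of internal vertices (its interior). A hole is an induced cycle of length at least four. A wheel $W=(C,x)$ (center $x$) consists of a hole $C$ and a vertex $x\notin V(C)$ with at least three neighbors in $V(C)$; $V(W)=V(C)\cup\{x\}$; spokes are the neighbors of $x$ in $C$; a sector is a subpath of $C$ whose ends are spokes and whose interior contains no spoke. A vertex $v$ is proper for $W$ if $v\in V(W)$, or all neighbors of $v$ in $V(C)$ lie in one sector and, if $v$ has more than two neighbors in $V(C)$, then $vx\in E(G)$. $W$ is proper in $G$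 if every vertex of $G$ is proper for $W$; $x$ is the center of a proper wheel in $G$ if some proper wheel in $G$ has center $x$.
   Formalization: In (i) and (ii) only sectors with nonempty interior are considered: a sector of length one has empty interior, contained in every component, and counting it makes both parts false (e.g. G a wheel with four spokes and exactly one sector of length one). *)

theory Defs
  imports "Graph_Theory.Graph_Theory"
begin

text \<open>Finite simple graphs are modelled by \<^locale>\<open>pair_graph\<close>. The pair representation matters for
  subdivisions: the library's subdivision relation keeps the arc type together with its
  head and tail functions, so over an arbitrary arc type the arcs of the \<open>K\<^sub>4\<close> being subdivided
  need not exist.\<close>

definition induced_free :: "('a pair_pre_digraph \<Rightarrow> bool) \<Rightarrow> 'a pair_pre_digraph \<Rightarrow> bool" where
  "induced_free P G \<longleftrightarrow> \<not> (\<exists>H. induced_subgraph (with_proj H) (with_proj G) \<and> P H)"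

definition is_K33 :: "'a pair_pre_digraph \<Rightarrow> bool" where
  "is_K33 H \<longleftrightarrow> K\<^bsub>3,3\<^esub> (with_proj H)"

definition is_subdivided_K4 :: "'a pair_pre_digraph \<Rightarrow> bool" where
  "is_subdivided_K4 H \<longleftrightarrow> (\<exists>K. K\<^bsub>4\<^esub> (with_proj K) \<and> subdivision_pair K H)"

definition is_diamond :: "'a pair_pre_digraph \<Rightarrow> bool" where
  "is_diamond H \<longleftrightarrow> (\<exists>a b c d. distinct [a, b, c, d] \<and> pverts H = {a, b, c, d}
     \<and> parcs H = symcl {(a,b), (a,c), (a,d), (b,c), (b,d)})"

definition is_bowtie :: "'a pair_pre_digraph \<Rightarrow> bool" where
  "is_bowtie H \<longleftrightarrow> (\<exists>a b c d e. distinct [a, b, c, d, e] \<and> pverts H = {a, b, c, d, e}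
     \<and> parcs H = symcl {(a,b), (b,c), (c,a), (a,d), (d,e), (e,a)})"

definition is_prism :: "'a pair_pre_digraph \<Rightarrow> bool" where
  "is_prism H \<longleftrightarrow> (\<exists>p q r. 2 \<le> length p \<and> 2 \<le> length q \<and> 2 \<le> length r \<and> distinct (p @ q @ r)
     \<and> pverts H = set p \<union> set q \<union> set r
     \<and> parcs H = symcl (set (vwalk_arcs p) \<union> set (vwalk_arcs q) \<union> set (vwalk_arcs r)
         \<union> {(hd p, hd q), (hd q, hd r), (hd r, hd p)}
         \<union> {(last p, last q), (last q, last r), (last r, last p)}))"

definition nbhd :: "'a pair_pre_digraph \<Rightarrow> 'a \<Rightarrow> 'a set" where
  "nbhd G x = {y. x \<rightarrow>\<^bsub>with_proj G\<^esub> y}"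

definition closed_nbhd :: "'a pair_pre_digraph \<Rightarrow> 'a \<Rightarrow> 'a set" where
  "closed_nbhd G x = insert x (nbhd G x)"

text \<open>Being induced, a hole is determined by its vertex set, which is how it is represented.\<close>

definition hole :: "'a pair_pre_digraph \<Rightarrow> 'a set \<Rightarrow> bool" where
  "hole G C \<longleftrightarrow> (\<exists>es. pre_digraph.cycle (with_proj G) es \<and> 4 \<le> length es
     \<and> C = fst ` set es \<and> arcs (with_proj G \<restriction> C) = symcl (set es))"

definition spokes :: "'a pair_pre_digraph \<Rightarrow> 'a set \<Rightarrow> 'a \<Rightarrow> 'a set" where
  "spokes G C x = nbhd G x \<inter> C"

definition wheel :: "'a pair_pre_digraph \<Rightarrow> 'a set \<Rightarrow> 'a \<Rightarrow> bool" where
  "wheel G C x \<longleftrightarrow> hole G C \<and> x \<in> pverts G \<and> x \<notin> C \<and> 3 \<le> card (spokes G C x)"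

definition path_interior :: "'a list \<Rightarrow> 'a set" where
  "path_interior p = set (butlast (tl p))"

definition sector_path :: "'a pair_pre_digraph \<Rightarrow> 'a set \<Rightarrow> 'a \<Rightarrow> 'a list \<Rightarrow> bool" where
  "sector_path G C x p \<longleftrightarrow> vpath p (with_proj G \<restriction> C) \<and> 2 \<le> length p
     \<and> hd p \<in> spokes G C x \<and> last p \<in> spokes G C x \<and> path_interior p \<inter> spokes G C x = {}"

text \<open>Each sector is traversed by two lists, one in each direction; since a wheel has at least three
  spokes, its sectors are distinguished by their vertex sets, so these are what is counted.

  A sector of length one has empty interior and is not regarded as having its interior inside
  \<open>X\<close>. Otherwise it would count for every \<open>X\<close>: a wheel with one sector of length one and three
  longer ones is, as a graph of its own, free of all the excluded configurations, yet each
  component of the non-neighbours of its center would contain two interiors.\<close>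

definition sectors_with_interior_in ::
    "'a pair_pre_digraph \<Rightarrow> 'a set \<Rightarrow> 'a \<Rightarrow> 'a set \<Rightarrow> 'a set set" where
  "sectors_with_interior_in G C x X =
     {set p |p. sector_path G C x p \<and> path_interior p \<noteq> {} \<and> path_interior p \<subseteq> X}"

definition proper_vertex :: "'a pair_pre_digraph \<Rightarrow> 'a set \<Rightarrow> 'a \<Rightarrow> 'a \<Rightarrow> bool" where
  "proper_vertex G C x v \<longleftrightarrow> v \<in> insert x C
     \<or> (\<exists>p. sector_path G C x p \<and> nbhd G v \<inter> C \<subseteq> set p)
       \<and> (card (nbhd G v \<inter> C) > 2 \<longrightarrow> x \<in> nbhd G v)"

definition proper_wheel :: "'a pair_pre_digraph \<Rightarrow> 'a set \<Rightarrow> 'a \<Rightarrow> bool" where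
  "proper_wheel G C x \<longleftrightarrow> wheel G C x \<and> (\<forall>v \<in> pverts G. proper_vertex G C x v)"

text \<open>Graphs being symmetric digraphs, connected components are strong components.\<close>

definition components_without ::
    "'a pair_pre_digraph \<Rightarrow> 'a set \<Rightarrow> ('a, 'a \<times> 'a) pre_digraph set" where
  "components_without G X = pre_digraph.sccs (with_proj G \<restriction> (pverts G - X))"

end

theory Submission
  imports Defs
begin

text \<open>Every vertex lies in at most one triangle, and no connected set sends exactly three edges, with
  three different ends, to a disjoint induced cycle: otherwise there is a subdivided \<open>K\<^sub>4\<close> or a prism.

  Call \<^emph>\<open>detour\<close> a hole that consists of an arc of the rim and a path off the rim, and that has fewer
  spokes than the rim. A path through non-neighbours of \<open>x\<close> between two places of the rim that are
  separated by spokes yields a detour, and so does a path through a single neighbour of \<open>x\<close> between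
  the interiors of two disjoint sectors. So it is enough to exclude detours. A vertex that is
  improper for a minimal detour is a neighbour of \<open>x\<close> attached to both sectors at one of at most two
  spokes; exchanging these spokes for such vertices turns the detour into a proper wheel with
  center \<open>x\<close> and fewer spokes, against the choice of \<open>W\<close>.\<close>

section \<open>Induced paths and cycles\<close>

text \<open>Hence every wheel in question has at least four spokes, and a lower bound of three can
  always be raised to four. The obstacle is that a detour need not be the rim of a proper wheel.
  Minimality has to survive every local exchange, so the length of the path off the rim counts
  before the number of spokes, and that before the total length. Cutting through a neighbour of
  \<open>x\<close> can put a second spoke next to the one on the path; for this reason the path of a
  detour may have two consecutive spokes at an end, and the uniqueness of triangles keeps other
  spokes away from them. At most two places need repair because an improper neighbour of
  \<open>x\<close> sits beside the first or the last spoke of the arc. In the last claim, three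
  pairwise meeting sectors either share a spoke, which has only two neighbours on the rim, or close
  up to a rim with just three spokes.\<close>

lemma card_le_one_eq: "finite S \<Longrightarrow> card S \<le> 1 \<Longrightarrow> a \<in> S \<Longrightarrow> b \<in> S \<Longrightarrow> a = b"
  using card_le_Suc0_iff_eq by (metis One_nat_def)

locale sgraph =
  fixes V :: "'a set" and E :: "'a \<Rightarrow> 'a \<Rightarrow> bool"
  assumes finite_V: "finite V"
    and E_sym: "E a b \<Longrightarrow> E b a"
    and E_irrefl: "\<not> E a a"
    and E_V: "E a b \<Longrightarrow> a \<in> V"
begin

lemma E_commute: "E a b \<longleftrightarrow> E b a"
  using E_sym by blast

fun ipath :: "'a list \<Rightarrow> bool" where
  "ipath [] \<longleftrightarrow> True"
| "ipath (a # xs) \<longleftrightarrow> a \<in> V \<and> a \<notin> set xs \<and> ipath xs \<and> (\<forall>b\<in>set xs. E a b \<longleftrightarrow> b = hd xs)"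

fun icyc :: "'a list \<Rightarrow> bool" where
  "icyc [] \<longleftrightarrow> False"
| "icyc (a # xs) \<longleftrightarrow> 2 \<le> length xs \<and> a \<in> V \<and> a \<notin> set xs \<and> ipath xs
     \<and> (\<forall>b\<in>set xs. E a b \<longleftrightarrow> b = hd xs \<or> b = last xs)"

definition conn :: "'a set \<Rightarrow> bool" where
  "conn Q \<longleftrightarrow> Q \<noteq> {} \<and> Q \<subseteq> V \<and> (\<forall>a\<in>Q. \<forall>b\<in>Q. (a, b) \<in> {(u, w). u \<in> Q \<and> w \<in> Q \<and> E u w}\<^sup>*)"

lemma ipath_distinct: "ipath xs \<Longrightarrow> distinct xs"
  by (induction xs) auto

lemma ipath_V: "ipath xs \<Longrightarrow> set xs \<subseteq> V"
  by (induction xs) auto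

lemma ipath_append:
  "ipath (xs @ ys) \<longleftrightarrow> ipath xs \<and> ipath ys \<and> set xs \<inter> set ys = {}
     \<and> (\<forall>a\<in>set xs. \<forall>b\<in>set ys. E a b \<longleftrightarrow> a = last xs \<and> b = hd ys)"
proof (induction xs)
  case (Cons a xs)
  show ?case
  proof (cases "xs = []")
    case False
    then have ls: "last (a # xs) = last xs" "last xs \<in> set xs" "hd (xs @ ys) = hd xs" "hd xs \<in> set xs"
      by auto
    show ?thesis
      unfolding append_Cons ipath.simps Cons.IH ls
      using ls(2,4) by (auto 0 3)
  qed auto
qed auto

text \<open>Cutting a cycle at two places leaves two induced paths whose only connections are the
  two pairs of facing ends. Both directions matter: cycles are taken apart this way and also
  assembled from a path and an arc.\<close>

lemma icyc_append:
  assumes "xs \<noteq> []" "ys \<noteq> []"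
  shows "icyc (xs @ ys) \<longleftrightarrow> 3 \<le> length (xs @ ys) \<and> ipath xs \<and> ipath ys \<and> set xs \<inter> set ys = {}
     \<and> (\<forall>a\<in>set xs. \<forall>b\<in>set ys. E a b \<longleftrightarrow> a = last xs \<and> b = hd ys \<or> a = hd xs \<and> b = last ys)"
proof -
  obtain a zs where xs: "xs = a # zs" using assms(1) by (cases xs) auto
  show ?thesis
  proof (cases "zs = []")
    case True
    then show ?thesis using assms(2) by (auto simp: xs)
  next
    case False
    have 1: "last xs = last zs" "last zs \<in> set zs" "hd xs = a" "last (zs @ ys) = last ys" "last ys \<in> set ys"
      "hd (zs @ ys) = hd zs" "hd zs \<in> set zs" "hd ys \<in> set ys"
      using False assms(2) by (auto simp: xs)
    show ?thesis
    proof (cases "3 \<le> length (xs @ ys) \<and> a \<notin> set zs \<and> a \<notin> set ys \<and> set zs \<inter> set ys = {}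
        \<and> ipath zs \<and> ipath ys \<and> a \<in> V")
      case True
      have "icyc (xs @ ys) \<longleftrightarrow> (\<forall>b\<in>set zs. \<forall>c\<in>set ys. E b c \<longleftrightarrow> b = last zs \<and> c = hd ys)
          \<and> (\<forall>b\<in>set zs. E a b \<longleftrightarrow> b = hd zs) \<and> (\<forall>c\<in>set ys. E a c \<longleftrightarrow> c = last ys)"
        using True 1 unfolding xs append_Cons icyc.simps ipath_append 1(4,6)
        by (auto 0 3)
      also have "\<dots> \<longleftrightarrow> 3 \<le> length (xs @ ys) \<and> ipath xs \<and> ipath ys \<and> set xs \<inter> set ys = {}
     \<and> (\<forall>a\<in>set xs. \<forall>b\<in>set ys. E a b \<longleftrightarrow> a = last xs \<and> b = hd ys \<or> a = hd xs \<and> b = last ys)"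
        using True 1 unfolding 1(1,3) unfolding xs
        by (auto 0 3)
      finally show ?thesis .
    next
      case False
      then show ?thesis unfolding xs append_Cons icyc.simps ipath_append by auto
    qed
  qed
qed

lemma icyc_distinct: "icyc xs \<Longrightarrow> distinct xs"
  by (cases xs) (auto dest: ipath_distinct)

lemma icyc_V: "icyc xs \<Longrightarrow> set xs \<subseteq> V"
  by (cases xs) (auto dest: ipath_V)

lemma icyc_rot: "icyc (xs @ ys) \<Longrightarrow> icyc (ys @ xs)"
proof (cases "xs = [] \<or> ys = []")
  case False
  assume a: "icyc (xs @ ys)"
  have "E a b \<longleftrightarrow> a = last ys \<and> b = hd xs \<or> a = hd ys \<and> b = last xs"
    if "a \<in> set ys" "b \<in> set xs" for a b
    using a False that E_commute[of a b] by (auto simp: icyc_append)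
  then show ?thesis using a False by (simp add: icyc_append Int_commute)
qed auto

lemma ipath_rev: "ipath (rev xs) \<longleftrightarrow> ipath xs"
proof (induction xs)
  case (Cons a xs)
  show ?case using Cons.IH
    by (auto simp: ipath_append last_rev E_commute)
qed auto

lemma icyc_rev: "icyc xs \<Longrightarrow> icyc (rev xs)"
proof -
  assume a: "icyc xs"
  then obtain b ys where xs: "xs = b # ys" by (cases xs) auto
  with a have ys: "ys \<noteq> []" by auto
  have "icyc ([b] @ rev ys)" using a ys by (auto simp: xs ipath_rev hd_rev last_rev)
  then have "icyc (rev ys @ [b])" by (rule icyc_rot)
  then show ?thesis by (simp add: xs)
qed

lemma ipath_sub: "ipath (xs @ ys @ zs) \<Longrightarrow> ipath ys"
  by (auto simp: ipath_append)

lemma icyc_sub: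
  assumes "icyc (xs @ ys @ zs)" "xs @ zs \<noteq> []"
  shows "ipath ys"
proof (cases "ys = []")
  case False
  have "icyc (ys @ zs @ xs)" using assms(1) icyc_rot[of xs "ys @ zs"] by simp
  then show ?thesis using False assms(2) by (subst (asm) icyc_append) auto
qed auto

lemma icyc_cross:
  assumes "icyc (xs @ ys)" "a \<in> set xs" "b \<in> set ys"
  shows "E a b \<longleftrightarrow> a = last xs \<and> b = hd ys \<or> a = hd xs \<and> b = last ys"
  using assms by (subst (asm) icyc_append) auto

text \<open>A vertex that sees only the two ends of a proper arc closes it to an induced cycle. The
  rest \<open>ys\<close> is nonempty so that \<open>xs\<close> is an induced path.\<close>

lemma icyc_cut:
  assumes "icyc (xs @ ys)" "2 \<le> length xs" "ys \<noteq> []" "v \<in> V" "v \<notin> set xs"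
    and "E v (hd xs)" "E v (last xs)" "\<And>b. b \<in> set (butlast (tl xs)) \<Longrightarrow> \<not> E v b"
  shows "icyc (v # xs)"
proof -
  have p: "ipath xs" using icyc_sub[of "[]" xs ys] assms by auto
  obtain a bs where xs: "xs = a # bs" using assms(2) by (cases xs) auto
  then obtain ms c where bs: "bs = ms @ [c]" using assms(2) by (cases bs rule: rev_cases) auto
  show ?thesis using assms p by (auto simp: xs bs)
qed

lemma conn_walk:
  assumes "ipath xs" "set xs \<subseteq> Q" "a \<in> set xs" "b \<in> set xs"
  shows "(a, b) \<in> {(u, w). u \<in> Q \<and> w \<in> Q \<and> E u w}\<^sup>*"
proof -
  let ?R = "{(u, w). u \<in> Q \<and> w \<in> Q \<and> E u w}"
  have "ipath xs \<Longrightarrow> set xs \<subseteq> Q \<Longrightarrow> c \<in> set xs \<Longrightarrow> (hd xs, c) \<in> ?R\<^sup>*" for c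
  proof (induction xs)
    case (Cons d xs)
    show ?case
    proof (cases "c = d")
      case False
      then have c: "c \<in> set xs" "xs \<noteq> []" using Cons.prems by auto
      then have "(d, hd xs) \<in> ?R" using Cons.prems by auto
      moreover have "(hd xs, c) \<in> ?R\<^sup>*" using Cons c by auto
      ultimately show ?thesis unfolding list.sel by (rule converse_rtrancl_into_rtrancl)
    qed simp
  qed simp
  then have 1: "(hd xs, a) \<in> ?R\<^sup>*" "(hd xs, b) \<in> ?R\<^sup>*" using assms by auto
  have "sym ?R" by (auto simp: sym_def E_commute)
  then have "sym (?R\<^sup>*)" by (rule sym_rtrancl)
  then have "(a, hd xs) \<in> ?R\<^sup>*" using 1(1) by (auto simp: sym_def)
  then show ?thesis using 1(2) by (rule rtrancl_trans)
qed

text \<open>Every point of \<open>D\<close> reaches a neighbour of \<open>x\<close> without leaving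
  \<open>D\<close>. Thus several segments of a cycle are joined into one connected set through the
  hub.\<close>

lemma conn_star:
  assumes x: "x \<in> V"
    and D: "\<And>d. d \<in> D \<Longrightarrow> \<exists>s. ipath s \<and> d \<in> set s \<and> set s \<subseteq> D \<and> (\<exists>q\<in>set s. E x q)"
  shows "conn (insert x D)"
proof -
  let ?Q = "insert x D"
  let ?R = "{(u, w). u \<in> ?Q \<and> w \<in> ?Q \<and> E u w}"
  have sy: "sym (?R\<^sup>*)" by (rule sym_rtrancl) (auto simp: sym_def E_commute)
  have "(x, d) \<in> ?R\<^sup>*" if d: "d \<in> ?Q" for d
  proof (cases "d = x")
    case False
    then obtain s q where s: "ipath s" "d \<in> set s" "set s \<subseteq> D" "q \<in> set s" "E x q" using D d by blast
    then have "(x, q) \<in> ?R" by auto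
    moreover have "(q, d) \<in> ?R\<^sup>*" using s by (intro conn_walk[of s]) auto
    ultimately show ?thesis by (rule converse_rtrancl_into_rtrancl)
  qed simp
  then have "(a, b) \<in> ?R\<^sup>*" if "a \<in> ?Q" "b \<in> ?Q" for a b
    using that sy by (meson rtrancl_trans symD)
  moreover have "?Q \<subseteq> V" using x D ipath_V by blast
  ultimately show ?thesis unfolding conn_def by blast
qed

end

text \<open>The only two consequences of the excluded subgraphs used before sectors are compared
  with graphs again. The three edges of a tripod have different ends on \<open>H\<close>, but may
  share their ends in \<open>Q\<close>.\<close>

locale tgraph = sgraph +
  assumes no_tripod: "\<lbrakk>icyc H; conn Q; set H \<inter> Q = {};
      card {(h, q). h \<in> set H \<and> q \<in> Q \<and> E h q} = 3;
      inj_on fst {(h, q). h \<in> set H \<and> q \<in> Q \<and> E h q}\<rbrakk> \<Longrightarrow> False"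
    and triangle_unique: "\<lbrakk>E a b; E b c; E a c; E a d; E d e; E a e\<rbrakk> \<Longrightarrow> {b, c} = {d, e}"

section \<open>Spokes of a fixed hub and the basic tripod count\<close>

locale hub = tgraph +
  fixes x
  assumes x_V: "x \<in> V"
begin

definition sp :: "'a list \<Rightarrow> nat" where
  "sp L = length (filter (E x) L)"

lemma sp_simps[simp]:
  "sp [] = 0" "sp (a # L) = (if E x a then 1 else 0) + sp L" "sp (L @ M) = sp L + sp M" "sp (rev L) = sp L"
  by (auto simp: sp_def rev_filter[symmetric])

lemma sp_0_iff: "sp L = 0 \<longleftrightarrow> (\<forall>a\<in>set L. \<not> E x a)"
  by (auto simp: sp_def filter_empty_conv)

lemma sp_0D: "sp L = 0 \<Longrightarrow> a \<in> set L \<Longrightarrow> \<not> E x a"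
  by (simp add: sp_0_iff)

lemma sp_pos_iff: "0 < sp L \<longleftrightarrow> (\<exists>a\<in>set L. E x a)"
  using sp_0_iff[of L] by auto

lemma sp_card: "distinct L \<Longrightarrow> sp L = card {h\<in>set L. E x h}"
  unfolding sp_def by (metis distinct_card distinct_filter set_filter)

lemma first_spoke:
  assumes "0 < sp L"
  obtains A q B where "L = A @ q # B" "E x q" "sp A = 0"
proof -
  have "\<exists>a\<in>set L. E x a" using assms sp_pos_iff by auto
  then obtain A q B where "L = A @ q # B" "E x q" "\<forall>a\<in>set A. \<not> E x a"
    using split_list_first_prop[of L "E x"] by blast
  then show thesis using that by (auto simp: sp_0_iff)
qed

lemma last_spoke:
  assumes "0 < sp L"
  obtains A q B where "L = A @ q # B" "E x q" "sp B = 0"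
proof -
  have "\<exists>a\<in>set L. E x a" using assms sp_pos_iff by auto
  then obtain A q B where "L = A @ q # B" "E x q" "\<forall>a\<in>set B. \<not> E x a"
    using split_list_last_prop[of L "E x"] by blast
  then show thesis using that by (auto simp: sp_0_iff)
qed

lemma outer_spokes:
  assumes "2 \<le> sp L"
  obtains A q M q' B where "L = A @ q # M @ q' # B" "E x q" "E x q'" "sp A = 0" "sp B = 0"
proof -
  obtain A q L' where 1: "L = A @ q # L'" "E x q" "sp A = 0" using first_spoke[of L] assms by auto
  then have "0 < sp L'" using assms by auto
  then obtain M q' B where "L' = M @ q' # B" "E x q'" "sp B = 0" using last_spoke by blast
  then show thesis using 1 that by auto
qed

lemma conn_seg: "ipath s \<Longrightarrow> 0 < sp s \<Longrightarrow> conn (insert x (set s))"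
  by (rule conn_star[OF x_V]) (auto simp: sp_pos_iff)

lemma conn_seg2:
  "ipath s \<Longrightarrow> 0 < sp s \<Longrightarrow> ipath t \<Longrightarrow> 0 < sp t \<Longrightarrow> conn (insert x (set s \<union> set t))"
  by (rule conn_star[OF x_V]) (metis UnE Un_upper1 Un_upper2 sp_pos_iff)

text \<open>The cycle of \<open>no_tripod\<close> is \<open>v # S1\<close>; the connected set is \<open>x\<close> together with parts of
  \<open>S2\<close>, so its attachments are the spokes in \<open>S1\<close>, the two ends of \<open>S1\<close>, and \<open>v\<close>.\<close>

lemma tripod_count:
  assumes cyc: "icyc (S1 @ S2)" and S2: "S2 \<noteq> []" and H: "icyc (v # S1)"
    and x: "x \<notin> set (S1 @ S2)" "x \<noteq> v" and v: "v \<notin> set S2"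
    and D: "D \<subseteq> set S2" "conn (insert x D)"
    and h: "last S2 \<in> D \<Longrightarrow> \<not> E x (hd S1)" "hd S2 \<in> D \<Longrightarrow> \<not> E x (last S1)"
    and W: "{q\<in>insert x D. E v q} = W" "card W \<le> 1"
    and s: "sp S1 + (if last S2 \<in> D then 1 else 0) + (if hd S2 \<in> D then 1 else 0) + card W = 3"
  shows False
proof -
  let ?Q = "insert x D"
  let ?A = "{(h, q). h \<in> set (v # S1) \<and> q \<in> ?Q \<and> E h q}"
  note c1 = W(2)[folded W(1)]
  have S1: "S1 \<noteq> []" "2 \<le> length S1" "v \<notin> set S1" "distinct S1" using H by (auto dest: ipath_distinct)
  obtain a bs where ab: "S1 = a # bs" using S1(1) by (cases S1) auto
  then have ab': "bs \<noteq> []" using S1(2) by auto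
  have ne: "hd S1 \<noteq> last S1" using S1(4) ab ab' by (auto dest: last_in_set)
  have ends: "hd S1 \<in> set S1" "last S1 \<in> set S1" using S1 by auto
  have cr: "E h q \<longleftrightarrow> h = last S1 \<and> q = hd S2 \<or> h = hd S1 \<and> q = last S2"
    if "h \<in> set S1" "q \<in> D" for h q
    using icyc_cross[OF cyc that(1)] that(2) D by auto
  have finD: "finite D" using D(1) finite_subset by blast
  \<comment> \<open>The attachments come in four disjoint kinds: spokes in \<open>S1\<close>, the
    two connections between the ends of \<open>S1\<close> and \<open>S2\<close>, and the neighbours
    of \<open>v\<close>. Their sizes add up to the sum in \<open>s\<close>.\<close>
  define A1 where "A1 = (\<lambda>h. (h, x)) ` {h\<in>set S1. E x h}"
  define A2 where "A2 = (if last S2 \<in> D then {(hd S1, last S2)} else {})"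
  define A3 where "A3 = (if hd S2 \<in> D then {(last S1, hd S2)} else {})"
  define A4 where "A4 = (\<lambda>q. (v, q)) ` {q\<in>?Q. E v q}"
  have A: "?A = A1 \<union> A2 \<union> A3 \<union> A4"
    unfolding A1_def A2_def A3_def A4_def using cr ends x D by (auto simp: E_commute)
  have xD: "x \<notin> D" using x D by auto
  have c: "card A1 = sp S1" "card A4 = card {q\<in>?Q. E v q}"
    unfolding A1_def A4_def sp_card[OF S1(4)] by (auto intro!: card_image inj_onI)
  have fin: "finite A1" "finite A2" "finite A3" "finite A4" unfolding A1_def A2_def A3_def A4_def using finD by auto
  have d: "A1 \<inter> A2 = {}" "(A1 \<union> A2) \<inter> A3 = {}" "(A1 \<union> A2 \<union> A3) \<inter> A4 = {}"
    unfolding A1_def A2_def A3_def A4_def using ne S1 ends xD x by (auto split: if_splits)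
  have c23: "card A2 = (if last S2 \<in> D then 1 else 0)" "card A3 = (if hd S2 \<in> D then 1 else 0)"
    unfolding A2_def A3_def by auto
  have "card (A1 \<union> A2 \<union> A3 \<union> A4) = card (A1 \<union> A2 \<union> A3) + card A4"
    by (rule card_Un_disjoint) (use fin d in auto)
  also have "card (A1 \<union> A2 \<union> A3) = card (A1 \<union> A2) + card A3"
    by (rule card_Un_disjoint) (use fin d in auto)
  also have "card (A1 \<union> A2) = card A1 + card A2"
    by (rule card_Un_disjoint) (use fin d in auto)
  finally have "card ?A = 3" unfolding A c c23 W(1) using s by linarith
  moreover have "inj_on fst ?A"
  proof (rule inj_onI)
    fix p r assume pr: "p \<in> ?A" "r \<in> ?A" "fst p = fst r"
    obtain h q q' where e: "p = (h, q)" "r = (h, q')" using pr(3) by (metis prod.collapse)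
    have hq: "h \<in> set (v # S1)" "q \<in> ?Q" "q' \<in> ?Q" "E h q" "E h q'" using pr e by auto
    have "q = q'"
    proof (cases "h = v")
      case True
      have "q \<in> {q\<in>?Q. E v q}" "q' \<in> {q\<in>?Q. E v q}" using hq True by auto
      moreover have "finite {q\<in>?Q. E v q}" using finD by simp
      ultimately show ?thesis using card_le_one_eq[OF _ c1] by blast
    next
      case False
      then have hS: "h \<in> set S1" using hq by auto
      \<comment> \<open>A spoke in \<open>S1\<close> has no second attachment: only an end of
        \<open>S1\<close> can see \<open>D\<close>, and \<open>h\<close> keeps \<open>D\<close> away
        from ends that are spokes.\<close>
      have k: "E x h \<Longrightarrow> \<not> (z \<in> D \<and> E h z)" for z using cr[OF hS, of z] h by metis
      have "q = q'" if "q \<in> D" "q' \<in> D"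
        using cr[OF hS that(1)] cr[OF hS that(2)] hq(4,5) ne by metis
      then show ?thesis using hq(2-5) k E_commute[of h x] by (metis insert_iff)
    qed
    then show "p = r" using e by simp
  qed
  moreover have "set (v # S1) \<inter> ?Q = {}" using x v D S1 icyc_distinct[OF cyc] by auto
  ultimately show False using no_tripod[OF H D(2)] by blast
qed

end

section \<open>Attachments to a hole with a hub\<close>

context hub
begin

text \<open>The connected set of a tripod may be the single vertex \<open>v\<close>. For
  \<open>v = x\<close> no cycle has exactly three spokes, which is the origin of the constant four
  below.\<close>

lemma three_spokes:
  assumes "icyc L" "v \<in> V" "v \<notin> set L" "card {h\<in>set L. E v h} = 3"
  shows False
proof -
  let ?A = "{(h, q). h \<in> set L \<and> q \<in> {v} \<and> E h q}"
  have A: "?A = (\<lambda>h. (h, v)) ` {h\<in>set L. E v h}" by (auto simp: E_commute)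
  have "card ?A = 3" unfolding A using assms(4) by (subst card_image) (auto intro: inj_onI)
  moreover have "inj_on fst ?A" by (auto intro: inj_onI)
  moreover have "conn {v}" using assms by (auto simp: conn_def)
  ultimately show False using no_tripod[of L "{v}"] assms by auto
qed

lemma sp_not_3:
  assumes "icyc L" "x \<notin> set L"
  shows "sp L \<noteq> 3"
  using three_spokes[OF assms(1) x_V assms(2)] sp_card[OF icyc_distinct[OF assms(1)]] by metis

text \<open>Fewer than four spokes would mean one or two, three being excluded, and then
  \<open>Z\<close> carries at least two. Segments of \<open>Z\<close> from one or both ends up to
  the nearest spoke, joined through \<open>x\<close>, supply the missing feet of a tripod on the
  cycle \<open>v # c # I @ [c']\<close>.\<close>

lemma two_nbrs:
  assumes cyc: "icyc (c # I @ c' # Z)" and x: "x \<notin> set (c # I @ c' # Z)" "x \<noteq> v"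
    and v: "v \<in> V" "v \<notin> set (c # I @ c' # Z)" "E v c" "E v c'" "\<And>b. b \<in> set (I @ Z) \<Longrightarrow> \<not> E v b"
      "\<not> E v x"
    and s: "0 < sp I" "0 < sp Z" "4 \<le> sp (c # I @ c' # Z)"
  shows "4 \<le> sp (c # I @ [c'])"
proof (rule ccontr)
  assume small: "\<not> 4 \<le> sp (c # I @ [c'])"
  let ?S1 = "c # I @ [c']"
  have cyc': "icyc (?S1 @ Z)" using cyc by simp
  have Z: "Z \<noteq> []" using s(2) by auto
  have H: "icyc (v # ?S1)" using v Z by (intro icyc_cut[OF cyc']) auto
  have ip: "ipath Z" using icyc_sub[of ?S1 Z "[]"] cyc' by auto
  have dO: "distinct Z" using ip ipath_distinct by auto
  have none: "{q\<in>insert x D. E v q} = {}" if "D \<subseteq> set Z" for D using v that by auto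
  have m: "sp ?S1 \<noteq> 3" using sp_not_3[OF H] x v(6) by (auto simp: E_commute)
  have base: False if "D \<subseteq> set Z" "conn (insert x D)" "last Z \<in> D \<Longrightarrow> \<not> E x c" "hd Z \<in> D \<Longrightarrow> \<not> E x c'"
    "sp ?S1 + (if last Z \<in> D then 1 else 0) + (if hd Z \<in> D then 1 else 0) = 3" for D
    by (rule tripod_count[OF cyc' Z H, of D, OF _ _ _ _ _ _ _ none[OF that(1)]])
      (use that x v in \<open>auto simp del: sp_simps\<close>)
  have 2: "2 \<le> sp Z" using s(3) small m by auto
  then obtain A q M q' B where Oq: "Z = A @ q # M @ q' # B" "E x q" "E x q'" "sp A = 0" "sp B = 0"
    by (rule outer_spokes)
  have ips: "ipath (A @ [q])" "ipath (q' # B)"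
    using ipath_sub[of "[]" "A @ [q]" "M @ q' # B"] ipath_sub[of "A @ q # M" "q' # B" "[]"] ip Oq by auto
  have hl: "hd Z \<in> set (A @ [q])" "last Z \<in> set (q' # B)" "hd Z \<notin> set (q' # B)" "last Z \<notin> set (A @ [q])"
    using dO Oq by (cases A; auto)+
  have c1: "conn (insert x (set (A @ [q])))" using conn_seg[of "A @ [q]"] ips Oq by auto
  have c2: "conn (insert x (set (q' # B)))" using conn_seg[of "q' # B"] ips Oq by auto
  have c3: "conn (insert x (set (A @ [q]) \<union> set (q' # B)))"
    using conn_seg2[of "A @ [q]" "q' # B"] ips Oq by auto
  have sub: "set (A @ [q]) \<subseteq> set Z" "set (q' # B) \<subseteq> set Z" using Oq by auto
  \<comment> \<open>Since \<open>I\<close> contains a spoke, a count of one leaves both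
    \<open>c\<close> and \<open>c'\<close> free of spokes, and a count of two leaves at least one of
    them free. Segments are attached exactly at free ends.\<close>
  consider "sp ?S1 = 1" "\<not> E x c" "\<not> E x c'" | "sp ?S1 = 2" "\<not> E x c'" | "sp ?S1 = 2" "\<not> E x c"
  proof -
    have "0 < sp ?S1" using s(1) by simp
    then have "sp ?S1 = 1 \<or> sp ?S1 = 2" using small m by linarith
    then show ?thesis using that s(1) by (auto split: if_splits)
  qed
  then show False
  proof cases
    case 1
    then show ?thesis using base[of "set (A @ [q]) \<union> set (q' # B)"] c3 sub hl by auto
  next
    case 2
    then show ?thesis using base[of "set (A @ [q])"] c1 sub(1) hl by simp
  next
    case 3
    then show ?thesis using base[of "set (q' # B)"] c2 sub(2) hl by simp
  qed
qed

text \<open>The feet on the cycle \<open>v # c # I @ [c']\<close> are its single spoke on the arc,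
  the vertex \<open>c\<close>, reached along \<open>O3\<close>, and \<open>v\<close>, which sees
  \<open>x\<close> directly. As \<open>O1\<close> is nonempty, the segment starting at
  \<open>q\<close> does not touch \<open>c'\<close>.\<close>

lemma hub_nbr_leg:
  assumes cyc: "icyc (c # I @ c' # O1 @ q # O3)" and x: "x \<notin> set (c # I @ c' # O1 @ q # O3)" "x \<noteq> v"
    and v: "v \<in> V" "v \<notin> set (c # I @ c' # O1 @ q # O3)" "E v c" "E v c'" "\<And>b. b \<in> set I \<Longrightarrow> \<not> E v b"
      "E v x" "\<And>b. b \<in> set (q # O3) \<Longrightarrow> \<not> E v b"
    and s: "sp (c # I @ [c']) = 1" "\<not> E x c" "E x q" "O1 \<noteq> []"
  shows False
proof -
  let ?S1 = "c # I @ [c']" and ?Z = "O1 @ q # O3"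
  have cyc': "icyc (?S1 @ ?Z)" using cyc by simp
  have H: "icyc (v # ?S1)" using v by (intro icyc_cut[OF cyc']) auto
  have ip: "ipath (q # O3)" using icyc_sub[of "?S1 @ O1" "q # O3" "[]"] cyc' by auto
  have dO: "distinct ?Z" using icyc_distinct[OF cyc'] by auto
  have vv: "{p\<in>insert x (set (q # O3)). E v p} = {x}" using v by auto
  have cn: "conn (insert x (set (q # O3)))" using conn_seg[of "q # O3"] ip s by auto
  have hl: "hd ?Z \<notin> set (q # O3)" "last ?Z \<in> set (q # O3)" using dO s(4) by (auto simp: hd_append disjoint_iff)
  show False
    by (rule tripod_count[OF cyc' _ H _ _ _ _ cn _ _ vv]) (use x v s hl in \<open>auto simp del: sp_simps\<close>)
qed

text \<open>If \<open>J2\<close> has a spoke, the two spokes of \<open>y # J1 @ [p]\<close> are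
  completed by the end of \<open>J2\<close> reaching \<open>y\<close>. Otherwise counting makes
  \<open>p'\<close> the only spoke of \<open>p' # J2 @ [y]\<close>, and the connected set formed by
  \<open>x\<close> and \<open>J1 @ [p]\<close> also reaches \<open>y\<close> and
  \<open>v\<close>.\<close>

lemma mid_one_nbr_aux:
  assumes cyc: "icyc (y # J1 @ p # M @ p' # J2)" and x: "x \<notin> set (y # J1 @ p # M @ p' # J2)" "x \<noteq> v"
    and v: "v \<in> V" "v \<notin> set (y # J1 @ p # M @ p' # J2)" "E v y" "E v p" "E v p'"
      "\<And>b. b \<in> set (J1 @ J2) \<Longrightarrow> \<not> E v b" "\<not> E v x"
    and s: "sp M \<le> 1" "4 \<le> sp (y # J1 @ p # M @ p' # J2)"
    and n: "sp (y # J1 @ [p]) = 2" "sp (p' # J2 @ [y]) \<le> 2" and y: "\<not> E x y"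
  shows False
proof -
  have c1: "icyc ((y # J1 @ [p]) @ (M @ p' # J2))" using cyc by simp
  have c2: "icyc ((p' # J2 @ [y]) @ (J1 @ p # M))" using icyc_rot[of "y # J1 @ p # M" "p' # J2"] cyc
    icyc_rot[of "p' # J2" "y # J1 @ p # M"] by simp
  have H1: "icyc (v # y # J1 @ [p])" using v by (intro icyc_cut[OF c1]) auto
  have H2: "icyc (v # p' # J2 @ [y])" using v by (intro icyc_cut[OF c2]) auto
  have d: "distinct (y # J1 @ p # M @ p' # J2)" using icyc_distinct[OF cyc] .
  show False
  proof (cases "sp J2 = 0")
    case False
    then obtain A q B where J2: "J2 = A @ q # B" "E x q" "sp B = 0" using last_spoke[of J2] by auto
    have ip: "ipath (q # B)" using icyc_sub[of "y # J1 @ p # M @ p' # A" "q # B" "[]"] cyc J2 by auto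
    have cn: "conn (insert x (set (q # B)))" using conn_seg[of "q # B"] ip J2 by auto
    have hl: "last (M @ p' # J2) \<in> set (q # B)" "hd (M @ p' # J2) \<notin> set (q # B)"
      using d J2 by (cases M; auto)+
    have vv: "{z\<in>insert x (set (q # B)). E v z} = {}" using v J2 by auto
    show False
      by (rule tripod_count[OF c1 _ H1 _ _ _ _ cn _ _ vv]) (use x v n hl y J2 in \<open>auto simp del: sp_simps\<close>)
  next
    case True
    have M: "M \<noteq> []" and p': "E x p'" and sM: "sp J1 + (if E x p then 1 else 0) = 2"
      using True n y s by (auto split: if_splits)
    have ip: "ipath (J1 @ [p])" using icyc_sub[of "[y]" "J1 @ [p]" "M @ p' # J2"] cyc by auto
    have cn: "conn (insert x (set (J1 @ [p])))" using conn_seg[of "J1 @ [p]"] ip sM by auto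
    have hl: "last (J1 @ p # M) \<notin> set (J1 @ [p])" "hd (J1 @ p # M) \<in> set (J1 @ [p])"
      using d M by (cases M rule: rev_cases; cases J1; auto)+
    have vv: "{z\<in>insert x (set (J1 @ [p])). E v z} = {p}" using v by auto
    show False
      by (rule tripod_count[OF c2 _ H2 _ _ _ _ cn _ _ vv]) (use x v y n M hl p' True in \<open>auto\<close>)
  qed
qed

text \<open>The cycle \<open>v # p' # J2 @ [y]\<close> has two spokes, and the segment from the last
  spoke of \<open>J1 @ [p]\<close> up to \<open>p\<close> sees \<open>v\<close>. This is a tripod
  unless the segment begins right after \<open>y\<close>, and then its first vertex forms a triangle
  with \<open>x\<close> and \<open>y\<close>.\<close>

lemma mid_one_nbr_spoke_aux:
  assumes cyc: "icyc (y # J1 @ p # M @ p' # J2)" and x: "x \<notin> set (y # J1 @ p # M @ p' # J2)" "x \<noteq> v"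
    and v: "v \<in> V" "v \<notin> set (y # J1 @ p # M @ p' # J2)" "E v y" "E v p" "E v p'"
      "\<And>b. b \<in> set (J1 @ J2) \<Longrightarrow> \<not> E v b" "\<not> E v x"
    and s: "0 < sp M" and n: "0 < sp (J1 @ [p])" "sp (p' # J2 @ [y]) = 2" and y: "E x y"
  shows "J1 @ [p] \<noteq> [] \<and> E x (hd (J1 @ [p])) \<and> E y (hd (J1 @ [p]))"
proof (rule ccontr)
  assume ng: "\<not> ?thesis"
  have c2: "icyc ((p' # J2 @ [y]) @ (J1 @ p # M))" using icyc_rot[of "y # J1 @ p # M" "p' # J2"] cyc
    icyc_rot[of "p' # J2" "y # J1 @ p # M"] by simp
  have H2: "icyc (v # p' # J2 @ [y])" using v by (intro icyc_cut[OF c2]) auto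
  have d: "distinct (y # J1 @ p # M @ p' # J2)" using icyc_distinct[OF cyc] .
  have M: "M \<noteq> []" using s by auto
  have yE: "E y (hd (J1 @ [p]))" using icyc_cross[of "[y]" "J1 @ p # M @ p' # J2" y "hd (J1 @ [p])"] cyc
    by (auto simp: hd_append)
  with ng have nh: "\<not> E x (hd (J1 @ [p]))" by auto
  obtain A q B where J: "J1 @ [p] = A @ q # B" "E x q" "sp B = 0" using last_spoke[OF n(1)] by blast
  have A: "A \<noteq> []" using nh J by auto
  have ip: "ipath (q # B)" using icyc_sub[of "y # A" "q # B" "M @ p' # J2"] cyc J(1)
    by (metis append.assoc append_Cons append_Nil append_is_Nil_conv list.simps(3))
  have cn: "conn (insert x (set (q # B)))" using conn_seg[of "q # B"] ip J by auto
  have Js: "set (q # B) \<subseteq> set (J1 @ [p])" "p \<in> set (q # B)" unfolding J(1)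
    using J(1) by (auto, metis last_ConsL last_ConsR last_append last_in_set list.distinct(1) snoc_eq_iff_butlast)
  have dJ: "distinct (A @ q # B)" using d unfolding J(1)[symmetric] by auto
  have hl: "last (J1 @ p # M) \<notin> set (q # B)" "hd (J1 @ p # M) \<notin> set (q # B)"
  proof -
    have "last (J1 @ p # M) \<in> set M" using M by auto
    then show "last (J1 @ p # M) \<notin> set (q # B)" using d Js(1) by (auto simp: disjoint_iff)
    have "hd (J1 @ p # M) = hd A" using J(1) A by (metis append.assoc append_Cons append_Nil hd_append2 snoc_eq_iff_butlast)
    then show "hd (J1 @ p # M) \<notin> set (q # B)" using dJ A by (auto simp: disjoint_iff)
  qed
  have vv: "{z\<in>insert x (set (q # B)). E v z} = {p}" using v Js by auto
  show False
    by (rule tripod_count[OF c2 _ H2 _ _ _ _ cn _ _ vv]) (use x v n M hl Js in \<open>auto simp del: sp_simps\<close>)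
qed

text \<open>If \<open>y\<close> is a spoke, the preceding lemma finds a triangle on the edge between
  \<open>x\<close> and \<open>y\<close> on either side of \<open>y\<close>, against uniqueness. If
  it is not, the total of four leaves exactly two spokes on one of the two arcs at
  \<open>y\<close>.\<close>

lemma mid_one_nbr:
  assumes cyc: "icyc (y # J1 @ p # M @ p' # J2)" and x: "x \<notin> set (y # J1 @ p # M @ p' # J2)" "x \<noteq> v"
    and v: "v \<in> V" "v \<notin> set (y # J1 @ p # M @ p' # J2)" "E v y" "E v p" "E v p'"
      "\<And>b. b \<in> set (J1 @ J2) \<Longrightarrow> \<not> E v b" "\<not> E v x"
    and s: "sp M \<le> 1" "4 \<le> sp (y # J1 @ p # M @ p' # J2)"
    and n: "sp (y # J1 @ [p]) \<le> 2" "sp (p' # J2 @ [y]) \<le> 2"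
  shows False
proof -
  have "icyc (rev (J1 @ p # M @ p' # J2) @ [y])" using icyc_rev[OF cyc] by simp
  then have cycr: "icyc (y # rev J2 @ p' # rev M @ p # rev J1)"
    using icyc_rot[of "rev (J1 @ p # M @ p' # J2)" "[y]"] by simp
  show False
  proof (cases "E x y")
    case True
    then have M: "0 < sp M" and 1: "sp (y # J1 @ [p]) = 2" "sp (p' # J2 @ [y]) = 2" using s n by auto
    have 2: "0 < sp (J1 @ [p])" "0 < sp (rev J2 @ [p'])" using 1 True by auto
    have a: "E x (hd (J1 @ [p])) \<and> E y (hd (J1 @ [p]))"
      using mid_one_nbr_spoke_aux[OF cyc x v M 2(1) 1(2) True] by blast
    have b: "E x (hd (rev J2 @ [p'])) \<and> E y (hd (rev J2 @ [p']))"
      using mid_one_nbr_spoke_aux[OF cycr, of v] x v M 1(1) 2(2) True by auto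
    have "{y, hd (J1 @ [p])} = {y, hd (rev J2 @ [p'])}"
      using triangle_unique[of x y "hd (J1 @ [p])" y "hd (rev J2 @ [p'])"] a b True by auto
    moreover have "hd (J1 @ [p]) \<in> set (J1 @ [p])" "hd (rev J2 @ [p']) \<in> set (rev J2 @ [p'])"
      by (meson hd_in_set snoc_eq_iff_butlast)+
    ultimately show ?thesis using icyc_distinct[OF cyc] by (auto simp: doubleton_eq_iff)
  next
    case False
    then have "sp (y # J1 @ [p]) = 2 \<or> sp (p' # J2 @ [y]) = 2" using s n by (auto split: if_splits)
    then show ?thesis
    proof
      assume "sp (y # J1 @ [p]) = 2"
      then show ?thesis using mid_one_nbr_aux[OF cyc x v s] n False by auto
    next
      assume "sp (p' # J2 @ [y]) = 2"
      then show ?thesis using mid_one_nbr_aux[OF cycr, of v] x v s n False by auto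
    qed
  qed
qed

text \<open>The main cycle runs through \<open>v\<close> and along \<open>G\<close> between
  \<open>y'\<close> and \<open>y\<close>; the connected set is built on the other side so that it
  reaches \<open>y\<close>, \<open>y'\<close> and \<open>v\<close> once each. A spoke among
  \<open>y\<close>, \<open>y'\<close> is reached from \<open>x\<close> directly, which explains the
  cases. Only when \<open>y'\<close> is a spoke and \<open>G\<close> is nonempty does the cycle
  through \<open>p\<close> serve instead.\<close>

lemma mid_two_nbrs_aux:
  assumes cyc: "icyc (y # J1 @ p # M @ p' # J2 @ y' # G)" and x: "x \<notin> set (y # J1 @ p # M @ p' # J2 @ y' # G)" "x \<noteq> v"
    and v: "v \<in> V" "v \<notin> set (y # J1 @ p # M @ p' # J2 @ y' # G)" "E v y" "E v p" "E v p'" "E v y'"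
      "\<And>b. b \<in> set (J1 @ J2 @ G) \<Longrightarrow> \<not> E v b" "\<not> E v x"
    and s: "sp M \<le> 1" "sp G = 0" "4 \<le> sp (y # J1 @ p # M @ p' # J2 @ y' # G)"
    and n: "sp (y # J1 @ [p]) = 2" "sp (p' # J2 @ [y']) \<le> 2"
  shows False
proof -
  have c1: "icyc ((y # J1 @ [p]) @ (M @ p' # J2 @ y' # G))" using cyc by simp
  have c5: "icyc ((y' # G @ [y]) @ (J1 @ p # M @ p' # J2))"
    using icyc_rot[of "y # J1 @ p # M @ p' # J2" "y' # G"] cyc by simp
  have H1: "icyc (v # y # J1 @ [p])" using v by (intro icyc_cut[OF c1]) auto
  have H5: "icyc (v # y' # G @ [y])" using v by (intro icyc_cut[OF c5]) auto
  have d: "distinct (y # J1 @ p # M @ p' # J2 @ y' # G)" using icyc_distinct[OF cyc] .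
  have n2: "1 \<le> sp (p' # J2 @ [y'])" using n s by auto
  have i1: "ipath (J1 @ [p])" using icyc_sub[of "[y]" "J1 @ [p]" "M @ p' # J2 @ y' # G"] cyc by auto
  have i2: "ipath (p' # J2)" using icyc_sub[of "y # J1 @ p # M" "p' # J2" "y' # G"] cyc by auto
  show False
  proof (cases "E x y'")
    case True
    show False
    proof (cases "G = []")
      case False
      have cn: "conn (insert x (set [y']))" using conn_seg[of "[y']"] True icyc_V[OF cyc] by auto
      have hl: "last (M @ p' # J2 @ y' # G) \<notin> set [y']" "hd (M @ p' # J2 @ y' # G) \<notin> set [y']"
        using d False by (cases M; auto)+
      have vv: "{z\<in>insert x (set [y']). E v z} = {y'}" using v by auto
      show ?thesis
        by (rule tripod_count[OF c1 _ H1 _ _ _ _ cn _ _ vv]) (use x v n hl in \<open>auto simp del: sp_simps\<close>)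
    next
      case G: True
      have yy: "E y y'" using icyc_cross[of "[y]" "J1 @ p # M @ p' # J2 @ y' # G" y y'] cyc G by auto
      \<comment> \<open>Here \<open>v\<close>, \<open>y\<close>, \<open>y'\<close> form a triangle,
        and a second spoke would give another triangle at \<open>y\<close>.\<close>
      have y: "\<not> E x y"
      proof
        assume "E x y"
        then have "{x, y'} = {v, y'}" using triangle_unique[of y x y' v y'] True yy v by (auto simp: E_commute)
        then show False using x True v(8) by (auto simp: doubleton_eq_iff E_commute)
      qed
      have cn: "conn (insert x (set (J1 @ [p])))" by (rule conn_seg[OF i1]) (use n y in auto)
      have hl: "last (J1 @ p # M @ p' # J2) \<notin> set (J1 @ [p])" "hd (J1 @ p # M @ p' # J2) \<in> set (J1 @ [p])"
        using d by (cases J2 rule: rev_cases; cases J1; auto)+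
      have vv: "{z\<in>insert x (set (J1 @ [p])). E v z} = {p}" using v by auto
      show ?thesis
        by (rule tripod_count[OF c5 _ H5 _ _ _ _ cn _ _ vv]) (use x v n hl y True G in auto)
    qed
  next
    case y': False
    have l2: "last (J1 @ p # M @ p' # J2) \<in> set (p' # J2)" "hd (J1 @ p # M @ p' # J2) \<notin> set (p' # J2)"
      using d by (cases J1; auto)+
    show False
    proof (cases "E x y")
      case True
      have cn: "conn (insert x (set (p' # J2)))" by (rule conn_seg[OF i2]) (use n2 y' in auto)
      have vv: "{z\<in>insert x (set (p' # J2)). E v z} = {p'}" using v by auto
      show ?thesis
        by (rule tripod_count[OF c5 _ H5 _ _ _ _ cn _ _ vv]) (use x v n l2 y' True s in auto)
    next
      case y: False
      show False
      proof (cases "sp J2 = 0")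
        case False
        then obtain A q B where J2: "J2 = A @ q # B" "E x q" "sp B = 0" using last_spoke[of J2] by auto
        have iq: "ipath (q # B)" using ipath_sub[of "p' # A" "q # B" "[]"] i2 J2 by auto
        have cn: "conn (insert x (set (J1 @ [p]) \<union> set (q # B)))"
          by (rule conn_seg2[OF i1 _ iq]) (use n y J2 in auto)
        have hl: "last (J1 @ p # M @ p' # J2) \<in> set (J1 @ [p]) \<union> set (q # B)"
          "hd (J1 @ p # M @ p' # J2) \<in> set (J1 @ [p]) \<union> set (q # B)"
          using d J2 by (cases J1; auto)+
        have vv: "{z\<in>insert x (set (J1 @ [p]) \<union> set (q # B)). E v z} = {p}" using v J2 by auto
        show ?thesis
          by (rule tripod_count[OF c5 _ H5 _ _ _ _ cn _ _ vv]) (use x v n hl y y' s J2 in auto)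
      next
        case True
        then have p': "E x p'" and "0 < sp J1" using n2 n y y' by (auto split: if_splits)
        then obtain A q B where J1: "J1 = A @ q # B" "E x q" "sp A = 0" using first_spoke[of J1] by auto
        have iq: "ipath (A @ [q])" using ipath_sub[of "[]" "A @ [q]" "B @ [p]"] i1 J1 by auto
        have cn: "conn (insert x (set (A @ [q]) \<union> set (p' # J2)))"
          by (rule conn_seg2[OF iq _ i2]) (use p' J1 in auto)
        have hl: "last (J1 @ p # M @ p' # J2) \<in> set (A @ [q]) \<union> set (p' # J2)"
          "hd (J1 @ p # M @ p' # J2) \<in> set (A @ [q]) \<union> set (p' # J2)"
          using d J1 by (cases A; auto)+
        have vv: "{z\<in>insert x (set (A @ [q]) \<union> set (p' # J2)). E v z} = {p'}" using v J1 by auto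
        show ?thesis
          by (rule tripod_count[OF c5 _ H5 _ _ _ _ cn _ _ vv]) (use x v n hl y y' s J1 in auto)
      qed
    qed
  qed
qed

lemma mid_two_nbrs:
  assumes cyc: "icyc (y # J1 @ p # M @ p' # J2 @ y' # G)" and x: "x \<notin> set (y # J1 @ p # M @ p' # J2 @ y' # G)" "x \<noteq> v"
    and v: "v \<in> V" "v \<notin> set (y # J1 @ p # M @ p' # J2 @ y' # G)" "E v y" "E v p" "E v p'" "E v y'"
      "\<And>b. b \<in> set (J1 @ J2 @ G) \<Longrightarrow> \<not> E v b" "\<not> E v x"
    and s: "sp M \<le> 1" "sp G = 0" "4 \<le> sp (y # J1 @ p # M @ p' # J2 @ y' # G)"
    and n: "sp (y # J1 @ [p]) \<le> 2" "sp (p' # J2 @ [y']) \<le> 2"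
  shows False
proof -
  have "icyc (rev G @ y' # rev J2 @ p' # rev M @ p # rev J1 @ [y])" using icyc_rev[OF cyc] by simp
  then have cycr: "icyc (y' # rev J2 @ p' # rev M @ p # rev J1 @ y # rev G)"
    using icyc_rot[of "rev G" "y' # rev J2 @ p' # rev M @ p # rev J1 @ [y]"] by simp
  have "sp (y # J1 @ [p]) = 2 \<or> sp (p' # J2 @ [y']) = 2" using s n by auto
  then show False
  proof
    assume "sp (y # J1 @ [p]) = 2"
    then show ?thesis using mid_two_nbrs_aux[OF cyc x v s] n by auto
  next
    assume "sp (p' # J2 @ [y']) = 2"
    then show ?thesis using mid_two_nbrs_aux[OF cycr, of v] x v s n by auto
  qed
qed

end

section \<open>Neighbours separated by spokes\<close>

context hub
begin

text \<open>No two neighbours of \<open>v\<close> on the cycle have spokes strictly between them on both sides. If there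
  are at least four spokes, this means that all neighbours lie in one sector.\<close>

definition nosep :: "'a list \<Rightarrow> 'a \<Rightarrow> bool" where
  "nosep L v \<longleftrightarrow> (\<forall>X c Y c' Z. L = X @ c # Y @ c' # Z \<longrightarrow> E v c \<longrightarrow> E v c' \<longrightarrow> sp Y = 0 \<or> sp (X @ Z) = 0)"

lemma nosepD: "nosep (X @ c # Y @ c' # Z) v \<Longrightarrow> E v c \<Longrightarrow> E v c' \<Longrightarrow> sp Y = 0 \<or> sp (X @ Z) = 0"
  unfolding nosep_def by (elim allE[of _ X] allE[of _ c] allE[of _ Y] allE[of _ c'] allE[of _ Z]) simp

text \<open>With positions instead of decompositions, two cuts of one list are compared by linear
  arithmetic; \<open>nosep_inner\<close> and \<open>nosep_outer\<close> depend on this.\<close>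

lemma nosep_index:
  "nosep L v \<longleftrightarrow> (\<forall>i j. i < j \<longrightarrow> j < length L \<longrightarrow> E v (L ! i) \<longrightarrow> E v (L ! j) \<longrightarrow>
     (\<forall>r. i < r \<longrightarrow> r < j \<longrightarrow> \<not> E x (L ! r)) \<or> (\<forall>r < length L. r < i \<or> j < r \<longrightarrow> \<not> E x (L ! r)))"
    (is "_ \<longleftrightarrow> ?R")
proof
  assume ns: "nosep L v"
  show ?R
  proof (intro allI impI)
    fix i j assume ij: "i < j" "j < length L" "E v (L ! i)" "E v (L ! j)"
    define X Y Z where "X = take i L" and "Y = take (j - Suc i) (drop (Suc i) L)" and "Z = drop (Suc j) L"
    have L: "L = X @ L ! i # Y @ L ! j # Z"
    proof -
      have "drop (Suc i) L = Y @ drop j L" unfolding Y_def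
        using ij append_take_drop_id[of "j - Suc i" "drop (Suc i) L"] by (simp add: drop_drop)
      moreover have "drop j L = L ! j # Z" unfolding Z_def using ij by (simp add: Cons_nth_drop_Suc)
      ultimately show ?thesis using id_take_nth_drop[of i L] ij unfolding X_def by simp
    qed
    have len: "length X = i" "length Y = j - Suc i" unfolding X_def Y_def using ij by auto
    have "sp Y = 0 \<or> sp (X @ Z) = 0" using nosepD[of X "L ! i" Y "L ! j" Z v] ns L ij by metis
    then show "(\<forall>r. i < r \<longrightarrow> r < j \<longrightarrow> \<not> E x (L ! r)) \<or> (\<forall>r < length L. r < i \<or> j < r \<longrightarrow> \<not> E x (L ! r))"
    proof
      assume y: "sp Y = 0"
      have "\<not> E x (L ! r)" if "i < r" "r < j" for r
      proof -
        have "L ! r = Y ! (r - Suc i)" unfolding Y_def using that ij by (simp add: nth_take nth_drop)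
        then show ?thesis using y len that by (simp add: sp_0_iff)
      qed
      then show ?thesis by blast
    next
      assume xz: "sp (X @ Z) = 0"
      have "\<not> E x (L ! r)" if "r < length L" "r < i \<or> j < r" for r
      proof -
        have "L ! r \<in> set X \<union> set Z"
        proof (cases "r < i")
          case True
          then have "L ! r = X ! r" unfolding X_def by simp
          then show ?thesis using True len by simp
        next
          case False
          then have "L ! r = Z ! (r - Suc j)" "r - Suc j < length Z" unfolding Z_def using that by auto
          then show ?thesis by simp
        qed
        then show ?thesis using xz by (auto simp: sp_0_iff)
      qed
      then show ?thesis by blast
    qed
  qed
next
  assume R: ?R
  show "nosep L v" unfolding nosep_def
  proof (intro allI impI)
    fix X c Y c' Z assume L: "L = X @ c # Y @ c' # Z" and cc: "E v c" "E v c'"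
    let ?i = "length X" and ?j = "length X + Suc (length Y)"
    have i: "L ! ?i = c" "L ! ?j = c'" "?j < length L" using L by (auto simp: nth_append)
    have y: "L ! (?i + Suc m) = Y ! m" if "m < length Y" for m using L that by (auto simp: nth_append)
    have xx: "L ! m = X ! m" if "m < length X" for m using L that by (auto simp: nth_append)
    have z: "L ! (?j + Suc m) = Z ! m" "?j + Suc m < length L" if "m < length Z" for m
      using L that by (auto simp: nth_append)
    consider "\<forall>r. ?i < r \<longrightarrow> r < ?j \<longrightarrow> \<not> E x (L ! r)" | "\<forall>r < length L. r < ?i \<or> ?j < r \<longrightarrow> \<not> E x (L ! r)"
      using R[rule_format, of ?i ?j] i cc by auto
    then show "sp Y = 0 \<or> sp (X @ Z) = 0"
    proof cases
      case 1
      then have "\<not> E x (Y ! m)" if "m < length Y" for m using y[OF that] that 1[rule_format, of "?i + Suc m"] by simp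
      then show ?thesis by (auto simp: sp_0_iff in_set_conv_nth)
    next
      case 2
      then have "\<not> E x (X ! m)" if "m < length X" for m using xx[OF that] that L 2[rule_format, of m] by auto
      moreover have "\<not> E x (Z ! m)" if "m < length Z" for m using z[OF that] 2[rule_format, of "?j + Suc m"] by simp
      ultimately have "sp (X @ Z) = 0" unfolding sp_0_iff by (auto simp: in_set_conv_nth)
      then show ?thesis by blast
    qed
  qed
qed

lemma nosep_one:
  assumes "L = X @ c # Z" "\<And>b. b \<in> set (X @ Z) \<Longrightarrow> \<not> E v b"
  shows "nosep L v"
proof -
  show ?thesis unfolding nosep_def
  proof (intro allI impI)
    fix X' c1 Y c2 Z' assume a: "L = X' @ c1 # Y @ c2 # Z'" "E v c1" "E v c2"
    have "c1 \<in> set L" "c2 \<in> set L" using a(1) by auto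
    then have cc: "c1 = c" "c2 = c" using a(2,3) assms by auto
    have "c \<notin> set X" "c \<notin> set Z" using a(2) assms(2)[of c] cc by auto
    then have "Z = Y @ c # Z'" using assms(1) a(1) cc append_Cons_eq_iff[of c X Z X' "Y @ c # Z'"] by auto
    then show "sp Y = 0 \<or> sp (X' @ Z') = 0" using \<open>c \<notin> set Z\<close> by auto
  qed
qed

lemma nosep_none:
  assumes "\<And>b. b \<in> set L \<Longrightarrow> \<not> E v b"
  shows "nosep L v"
  unfolding nosep_def using assms by auto

lemma nosep_inner:
  assumes L: "L = X @ c # Y @ c' # Z" and n: "\<And>b. b \<in> set (X @ Z) \<Longrightarrow> \<not> E v b" and s: "sp Y = 0"
  shows "nosep L v"
proof -
  have k: "length X \<le> k \<and> k \<le> length X + Suc (length Y)" if "k < length L" "E v (L ! k)" for k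
  proof (rule ccontr)
    assume "\<not> ?thesis"
    then have "L ! k \<in> set X \<union> set Z" using that(1) unfolding L
      by (auto simp: nth_append nth_Cons' not_le)
    then show False using n that by auto
  qed
  have "\<not> E x (L ! r)" if "length X < r" "r < length X + Suc (length Y)" for r
  proof -
    have "L ! r = Y ! (r - Suc (length X))" using that unfolding L by (auto simp: nth_append nth_Cons')
    then show ?thesis using s that by (simp add: sp_0_iff)
  qed
  note nx = this
  show ?thesis unfolding nosep_index
  proof (intro allI impI disjI1)
    fix i j r assume a: "i < j" "j < length L" "E v (L ! i)" "E v (L ! j)" "i < r" "r < j"
    have "length X \<le> i" "j \<le> length X + Suc (length Y)" using k[of i] k[of j] a by auto
    then show "\<not> E x (L ! r)" using nx[of r] a by linarith
  qed
qed

lemma nosep_outer: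
  assumes L: "L = X @ c # Y @ c' # Z" and n: "\<And>b. b \<in> set Y \<Longrightarrow> \<not> E v b" and s: "sp (X @ Z) = 0"
  shows "nosep L v"
proof -
  let ?i = "length X" and ?j = "length X + Suc (length Y)"
  have k: "k \<le> ?i \<or> ?j \<le> k" if "k < length L" "E v (L ! k)" for k
  proof (rule ccontr)
    assume "\<not> ?thesis"
    then have "L ! k \<in> set Y" using that(1) unfolding L
      by (auto simp: nth_append nth_Cons' not_le)
    then show False using n that by auto
  qed
  have xz: "\<not> E x (L ! r)" if "r < length L" "r < ?i \<or> ?j < r" for r
  proof -
    have "L ! r \<in> set X \<union> set Z" using that unfolding L by (auto simp: nth_append nth_Cons')
    then show ?thesis using s by (auto simp: sp_0_iff)
  qed
  show ?thesis unfolding nosep_index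
  proof (intro allI impI)
    fix i j assume a: "i < j" "j < length L" "E v (L ! i)" "E v (L ! j)"
    have ki: "i \<le> ?i \<or> ?j \<le> i" and kj: "j \<le> ?i \<or> ?j \<le> j" using k a by auto
    show "(\<forall>r. i < r \<longrightarrow> r < j \<longrightarrow> \<not> E x (L ! r)) \<or> (\<forall>r < length L. r < i \<or> j < r \<longrightarrow> \<not> E x (L ! r))"
    proof (cases "j \<le> ?i \<or> ?j \<le> i")
      case True
      then have "\<not> E x (L ! r)" if "i < r" "r < j" for r using that xz[of r] a by auto
      then show ?thesis by blast
    next
      case False
      then have "i \<le> ?i" "?j \<le> j" using ki kj by auto
      then have "\<not> E x (L ! r)" if "r < length L" "r < i \<or> j < r" for r using that xz[of r] by auto
      then show ?thesis by blast
    qed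
  qed
qed

text \<open>When the moved vertex is one of the two neighbours, the stretch between them and the
  stretch around them change places; the condition is symmetric in the two.\<close>

lemma nosep_rot1:
  assumes "nosep (a # L) v"
  shows "nosep (L @ [a]) v"
  unfolding nosep_def
proof (intro allI impI)
  fix X c Y c' Z assume L: "L @ [a] = X @ c # Y @ c' # Z" and cc: "E v c" "E v c'"
  show "sp Y = 0 \<or> sp (X @ Z) = 0"
  proof (cases Z rule: rev_cases)
    case Nil
    then have "L @ [a] = (X @ c # Y) @ [c']" using L by simp
    then have L': "L = X @ c # Y" "c' = a" by (metis append1_eq_conv)+
    have "nosep ([] @ a # X @ c # Y) v" using assms L' by simp
    then have "sp X = 0 \<or> sp ([] @ Y) = 0" using nosepD[of "[]" a X c Y v] cc L' by metis
    then show ?thesis using Nil by auto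
  next
    case (snoc Z' b)
    have "L @ [a] = (X @ c # Y @ c' # Z') @ [b]" using L snoc by simp
    then have "L = X @ c # Y @ c' # Z'" "a = b" by (metis append1_eq_conv)+
    then have "nosep ((a # X) @ c # Y @ c' # Z') v" using assms by simp
    then have "sp Y = 0 \<or> sp ((a # X) @ Z') = 0" using nosepD[of "a # X" c Y c' Z' v] cc by metis
    then show ?thesis using snoc \<open>a = b\<close> by auto
  qed
qed

lemma nosep_rot: "nosep (A @ B) v \<Longrightarrow> nosep (B @ A) v"
proof (induction A arbitrary: B)
  case (Cons a A)
  have "nosep (A @ B @ [a]) v" using nosep_rot1[of a "A @ B" v] Cons.prems by simp
  then have "nosep ((B @ [a]) @ A) v" using Cons.IH[of "B @ [a]"] by simp
  then show ?case by simp
qed simp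

lemma nosep_rev: "nosep L v \<Longrightarrow> nosep (rev L) v"
  unfolding nosep_def
proof (intro allI impI)
  fix X c Y c' Z
  assume ns: "\<forall>X c Y c' Z. L = X @ c # Y @ c' # Z \<longrightarrow> E v c \<longrightarrow> E v c' \<longrightarrow> sp Y = 0 \<or> sp (X @ Z) = 0"
    and L: "rev L = X @ c # Y @ c' # Z" and cc: "E v c" "E v c'"
  have "rev (rev L) = rev Z @ c' # rev Y @ c # rev X" unfolding L by simp
  then have "L = rev Z @ c' # rev Y @ c # rev X" by simp
  then have "sp (rev Y) = 0 \<or> sp (rev Z @ rev X) = 0" using ns[rule_format, of "rev Z" c' "rev Y" c "rev X"] cc by simp
  then show "sp Y = 0 \<or> sp (X @ Z) = 0" by auto
qed

lemma first_nbr: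
  assumes "\<exists>h\<in>set L. E v h"
  obtains X c Z where "L = X @ c # Z" "E v c" "\<And>b. b \<in> set X \<Longrightarrow> \<not> E v b"
proof -
  obtain X c Z where "L = X @ c # Z" "E v c" "\<forall>b\<in>set X. \<not> E v b" using split_list_first_prop[OF assms] by blast
  then show thesis using that[of X c Z] by blast
qed

lemma last_nbr:
  assumes "\<exists>h\<in>set L. E v h"
  obtains X c Z where "L = X @ c # Z" "E v c" "\<And>b. b \<in> set Z \<Longrightarrow> \<not> E v b"
proof -
  obtain X c Z where "L = X @ c # Z" "E v c" "\<forall>b\<in>set Z. \<not> E v b" using split_list_last_prop[OF assms] by blast
  then show thesis using that[of X c Z] by blast
qed

end

section \<open>Detours\<close>

lemma (in tgraph) tripod3:
  assumes H: "icyc H" and Q: "conn Q" and d: "set H \<inter> Q = {}"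
    and abc: "a \<in> set H" "b \<in> set H" "c \<in> set H" "a \<noteq> b" "b \<noteq> c" "a \<noteq> c"
    and q: "qa \<in> Q" "qb \<in> Q" "qc \<in> Q" "E a qa" "E b qb" "E c qc"
    and only: "\<And>h q. h \<in> set H \<Longrightarrow> q \<in> Q \<Longrightarrow> E h q \<Longrightarrow> (h, q) \<in> {(a, qa), (b, qb), (c, qc)}"
  shows False
proof -
  have A: "{(h, q). h \<in> set H \<and> q \<in> Q \<and> E h q} = {(a, qa), (b, qb), (c, qc)}"
    using only abc q by auto
  have "card {(a, qa), (b, qb), (c, qc)} = 3" using abc by auto
  moreover have "inj_on fst {(a, qa), (b, qb), (c, qc)}" using abc by auto
  ultimately show False using no_tripod[OF H Q d] A by simp
qed

context sgraph
begin

lemma icyc_cut2: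
  assumes "icyc (c # I @ c' # Z)" "Z \<noteq> []" "v \<in> V" "v \<notin> set (c # I @ [c'])" "E v c" "E v c'"
    "\<And>b. b \<in> set I \<Longrightarrow> \<not> E v b"
  shows "icyc (v # c # I @ [c'])"
  by (rule icyc_cut[of "c # I @ [c']" Z]) (use assms in auto)

lemma conn_union:
  assumes "conn A" "conn B" "a \<in> A" "b \<in> B" "E a b"
  shows "conn (A \<union> B)"
proof -
  let ?R = "\<lambda>Q. {(u, w). u \<in> Q \<and> w \<in> Q \<and> E u w}"
  have mono: "?R A \<subseteq> ?R (A \<union> B)" "?R B \<subseteq> ?R (A \<union> B)" by auto
  have sy: "sym ((?R (A \<union> B))\<^sup>*)" by (rule sym_rtrancl) (auto simp: sym_def E_commute)
  have A: "(a, u) \<in> (?R (A \<union> B))\<^sup>*" if "u \<in> A" for u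
  proof -
    have "(a, u) \<in> (?R A)\<^sup>*" using assms that unfolding conn_def by blast
    then show ?thesis using rtrancl_mono[OF mono(1)] by blast
  qed
  have ab: "(a, b) \<in> ?R (A \<union> B)" using assms by auto
  have B: "(a, u) \<in> (?R (A \<union> B))\<^sup>*" if "u \<in> B" for u
  proof -
    have "(b, u) \<in> (?R B)\<^sup>*" using assms that unfolding conn_def by blast
    then have "(b, u) \<in> (?R (A \<union> B))\<^sup>*" using rtrancl_mono[OF mono(2)] by blast
    then show ?thesis using ab by (rule converse_rtrancl_into_rtrancl[rotated])
  qed
  have "(u, w) \<in> (?R (A \<union> B))\<^sup>*" if "u \<in> A \<union> B" "w \<in> A \<union> B" for u w
  proof -
    have "(a, u) \<in> (?R (A \<union> B))\<^sup>*" "(a, w) \<in> (?R (A \<union> B))\<^sup>*" using that A B by auto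
    then show ?thesis using sy by (meson rtrancl_trans symD)
  qed
  then show ?thesis using assms unfolding conn_def by blast
qed

lemma conn_ipath: "ipath p \<Longrightarrow> p \<noteq> [] \<Longrightarrow> conn (set p)"
  unfolding conn_def using conn_walk[of p "set p"] ipath_V by auto

end

text \<open>A proper wheel in terms of lists. \<open>C_nosep\<close> holds for every enumeration of
  the rim, so that each argument can read it from a convenient vertex; \<open>C_four\<close>
  improves the three spokes of a wheel by excluding the value three.\<close>

locale wheel_ctx = hub +
  fixes C :: "'a set"
  assumes C_cyc: "\<exists>cs. icyc cs \<and> set cs = C"
    and x_C: "x \<notin> C"
    and C_nosep: "\<lbrakk>icyc cs; set cs = C; v \<in> V; v \<notin> C; v \<noteq> x\<rbrakk> \<Longrightarrow> nosep cs v"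
    and C_two: "\<lbrakk>v \<in> V; v \<notin> C; v \<noteq> x; \<not> E v x\<rbrakk> \<Longrightarrow> card {h\<in>C. E v h} \<le> 2"
    and C_four: "4 \<le> card {h\<in>C. E x h}"
begin

definition n :: nat where "n = card {h\<in>C. E x h}"

lemma n4: "4 \<le> n" using C_four n_def by simp

lemma sp_C: "icyc cs \<Longrightarrow> set cs = C \<Longrightarrow> sp cs = n"
  unfolding n_def using sp_card[OF icyc_distinct] by auto

text \<open>Two consecutive spokes at an end arise when a path is cut at its spoke and continued by
  a neighbour of \<open>x\<close>, or when the whole path consists of two adjacent neighbours of
  \<open>x\<close>. Admitting them keeps the detours closed under the exchanges made below.\<close>

definition gp :: "'a list \<Rightarrow> bool" where
  "gp P \<longleftrightarrow> sp P \<le> 1 \<or> (\<exists>Q u u'. (P = Q @ [u, u'] \<or> P = [u', u] @ Q) \<and> sp Q = 0 \<and> E x u \<and> E x u')"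

text \<open>\<open>A\<close> is the part of the rim that is bypassed. Three spokes are all that has
  to be checked when a detour is built; \<open>detourD\<close> returns four.\<close>

definition detour :: "'a list \<Rightarrow> 'a list \<Rightarrow> bool" where
  "detour P B \<longleftrightarrow> icyc (P @ B) \<and> P \<noteq> [] \<and> B \<noteq> [] \<and> set P \<inter> insert x C = {}
     \<and> (\<exists>A. icyc (B @ A) \<and> set (B @ A) = C) \<and> gp P \<and> 3 \<le> sp (P @ B) \<and> sp (P @ B) < n"

lemma gp_rev: "gp P \<Longrightarrow> gp (rev P)"
proof -
  assume "gp P"
  then consider "sp P \<le> 1" | Q u u' where "P = Q @ [u, u']" "sp Q = 0" "E x u" "E x u'"
    | Q u u' where "P = [u', u] @ Q" "sp Q = 0" "E x u" "E x u'" unfolding gp_def by blast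
  then show ?thesis
  proof cases
    case 2
    then have "rev P = [u', u] @ rev Q" "sp (rev Q) = 0" by auto
    then show ?thesis unfolding gp_def using 2 by blast
  next
    case 3
    then have "rev P = rev Q @ [u, u']" "sp (rev Q) = 0" by auto
    then show ?thesis unfolding gp_def using 3 by blast
  qed (simp add: gp_def)
qed

lemma arc_rev: "icyc (B @ A) \<Longrightarrow> icyc (rev B @ rev A)"
  using icyc_rev[of "B @ A"] icyc_rot[of "rev A" "rev B"] by simp

lemma detour_rev: "detour P B \<Longrightarrow> detour (rev P) (rev B)"
proof -
  assume F: "detour P B"
  then obtain A where A: "icyc (B @ A)" "set (B @ A) = C" unfolding detour_def by blast
  then have "icyc (rev B @ rev A)" "set (rev B @ rev A) = C" using arc_rev by auto
  then show ?thesis using F gp_rev arc_rev[of P B] unfolding detour_def by auto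
qed

lemma detourD:
  assumes "detour P B"
  shows "icyc (P @ B)" "P \<noteq> []" "B \<noteq> []" "set P \<inter> insert x C = {}" "set B \<subseteq> C" "gp P"
    "x \<notin> set (P @ B)" "4 \<le> sp (P @ B)" "sp (P @ B) < n"
proof -
  show 1: "icyc (P @ B)" "P \<noteq> []" "B \<noteq> []" "set P \<inter> insert x C = {}" "set B \<subseteq> C" "gp P" "sp (P @ B) < n"
    using assms unfolding detour_def by auto
  then show x: "x \<notin> set (P @ B)" using x_C by auto
  show "4 \<le> sp (P @ B)" using sp_not_3[OF 1(1) x] assms unfolding detour_def by linarith
qed

lemma detour_arc:
  assumes "detour P B"
  obtains A where "icyc (B @ A)" "set (B @ A) = C" "sp P < sp A" "sp B + sp A = n"
proof -
  obtain A where A: "icyc (B @ A)" "set (B @ A) = C" using assms unfolding detour_def by blast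
  then have "sp B + sp A = n" using sp_C by force
  then show thesis using that A detourD(9)[OF assms] by simp
qed

text \<open>A shortcut through a vertex off the rim: path and arc both shrink, and the arc beyond
  \<open>y\<close> joins the bypassed part. Minimality of a detour is mostly exploited through such
  cuts, at either end or inside the path.\<close>

lemma detour_cut:
  assumes F: "detour P B" and P: "P = Pn @ p # Pz" and B: "B = Ba @ y # Bb"
    and v: "v \<in> V" "v \<notin> C" "v \<noteq> x" "v \<notin> set P" "E v p" "E v y" "\<And>b. b \<in> set (Pz @ Ba) \<Longrightarrow> \<not> E v b"
    and ne: "Pn @ Bb \<noteq> []" and g: "gp (v # p # Pz)"
    and s: "3 \<le> sp (v # p # Pz @ Ba @ [y])" "sp (v # p # Pz @ Ba @ [y]) < n"
  shows "detour (v # p # Pz) (Ba @ [y])"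
proof -
  have "icyc (p # (Pz @ Ba) @ y # (Bb @ Pn))"
    using icyc_rot[of Pn "p # Pz @ Ba @ y # Bb"] detourD(1)[OF F] P B by simp
  then have "icyc (v # p # (Pz @ Ba) @ [y])"
    by (rule icyc_cut2) (use v ne B detourD(5)[OF F] P in auto)
  then have c: "icyc (v # p # Pz @ Ba @ [y])" by simp
  obtain A where A: "icyc (B @ A)" "set (B @ A) = C" using detour_arc[OF F] by blast
  have "icyc ((Ba @ [y]) @ (Bb @ A)) \<and> set ((Ba @ [y]) @ (Bb @ A)) = C" using A B by auto
  then show ?thesis using c g s v detourD[OF F] P unfolding detour_def by auto
qed

lemma detour_cut':
  assumes F: "detour P B" and P: "P = Pa @ p # Pm" and B: "B = Bc @ y # Bd"
    and v: "v \<in> V" "v \<notin> C" "v \<noteq> x" "v \<notin> set P" "E v p" "E v y" "\<And>b. b \<in> set (Pa @ Bd) \<Longrightarrow> \<not> E v b"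
    and ne: "Pm @ Bc \<noteq> []" and g: "gp (Pa @ [p, v])"
    and s: "3 \<le> sp (Pa @ [p, v] @ y # Bd)" "sp (Pa @ [p, v] @ y # Bd) < n"
  shows "detour (Pa @ [p, v]) (y # Bd)"
proof -
  have "detour (v # p # rev Pa) (rev Bd @ [y])"
    by (rule detour_cut[OF detour_rev[OF F], of "rev Pm" p "rev Pa" "rev Bd" y "rev Bc"])
      (use P B v ne gp_rev[OF g] s in auto)
  then show ?thesis using detour_rev[of "v # p # rev Pa" "rev Bd @ [y]"] by simp
qed

lemma detour_short:
  assumes F: "detour P B" and P: "P = Pa @ p # M @ p' # Pz" and M: "M \<noteq> []"
    and v: "v \<in> V" "v \<notin> C" "v \<noteq> x" "v \<notin> set P" "E v p" "E v p'" "\<And>b. b \<in> set (Pa @ Pz @ B) \<Longrightarrow> \<not> E v b"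
    and g: "gp (Pa @ [p, v, p'] @ Pz)"
    and s: "3 \<le> sp (Pa @ [p, v, p'] @ Pz @ B)" "sp (Pa @ [p, v, p'] @ Pz @ B) < n"
  shows "detour (Pa @ [p, v, p'] @ Pz) B"
proof -
  have "icyc (p' # (Pz @ B @ Pa) @ p # M)"
    using icyc_rot[of "Pa @ p # M" "p' # Pz @ B"] detourD(1)[OF F] P by simp
  then have "icyc (v # p' # (Pz @ B @ Pa) @ [p])"
    by (rule icyc_cut2) (use v M P detourD(5)[OF F] in auto)
  then have "icyc ((Pa @ [p, v, p'] @ Pz) @ B)"
    using icyc_rot[of "v # p' # Pz @ B" "Pa @ [p]"] by simp
  moreover obtain A where "icyc (B @ A)" "set (B @ A) = C" using detour_arc[OF F] by blast
  ultimately show ?thesis using g s v detourD[OF F] P unfolding detour_def by auto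
qed

text \<open>The length of the path comes first because links found near a detour yield detours with
  a shorter path but no control over the spokes. The total length only breaks ties.\<close>

definition min_detour :: "'a list \<Rightarrow> 'a list \<Rightarrow> bool" where
  "min_detour P B \<longleftrightarrow> detour P B \<and> (\<forall>P' B'. detour P' B' \<longrightarrow> length P < length P' \<or> (length P = length P' \<and>
     (sp (P @ B) < sp (P' @ B') \<or> (sp (P @ B) = sp (P' @ B') \<and> length (P @ B) \<le> length (P' @ B')))))"

lemma min_detour_rev: "min_detour P B \<Longrightarrow> min_detour (rev P) (rev B)"
  unfolding min_detour_def using detour_rev[of P B] detour_rev[of "rev P" "rev B"]
  by (metis detour_rev length_append length_rev rev_rev_ident sp_simps(3) sp_simps(4))

lemma min_detour_ex:
  assumes "detour P B"
  obtains P' B' where "min_detour P' B'"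
proof -
  let ?r = "inv_image (less_than <*lex*> less_than <*lex*> less_than)
     (\<lambda>(P, B). (length P, sp (P @ B), length (P @ B)))"
  have wf: "wf ?r" by (intro wf_inv_image wf_lex_prod wf_less_than)
  have mem: "(P, B) \<in> {(P, B). detour P B}" using assms by simp
  obtain z where z: "z \<in> {(P, B). detour P B}" "\<And>y. (y, z) \<in> ?r \<Longrightarrow> y \<notin> {(P, B). detour P B}"
    by (rule wfE_min[OF wf mem]) (rule that)
  obtain P1 B1 where z1: "z = (P1, B1)" by (cases z)
  have "min_detour P1 B1" unfolding min_detour_def
  proof (intro conjI allI impI)
    show "detour P1 B1" using z z1 by simp
    fix P' B' assume "detour P' B'"
    then have "((P', B'), (P1, B1)) \<notin> ?r" using z(2)[of "(P', B')"] z1 by auto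
    then show "length P1 < length P' \<or> (length P1 = length P' \<and>
     (sp (P1 @ B1) < sp (P' @ B') \<or> (sp (P1 @ B1) = sp (P' @ B') \<and> length (P1 @ B1) \<le> length (P' @ B'))))"
      by (auto simp: in_lex_prod not_less)
  qed
  then show thesis by (rule that)
qed

lemma min_detour_less:
  assumes "min_detour P B" "detour P' B'" "length P' < length P"
  shows False
proof -
  have "length P < length P' \<or> length P = length P'"
    using assms(1,2) unfolding min_detour_def by blast
  then show False using assms(3) by linarith
qed

lemma min_detour_le:
  assumes "min_detour P B" "detour P' B'" "length P' \<le> length P" "sp (P' @ B') \<le> sp (P @ B)"
    "sp (P' @ B') < sp (P @ B) \<or> length (P' @ B') < length (P @ B)"
  shows False
proof -
  have "length P < length P' \<or> (length P = length P' \<and>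
     (sp (P @ B) < sp (P' @ B') \<or> (sp (P @ B) = sp (P' @ B') \<and> length (P @ B) \<le> length (P' @ B'))))"
    using assms(1,2) unfolding min_detour_def by blast
  then show False using assms(3-5) by linarith
qed

text \<open>A single vertex would see both ends of the arc, so by \<open>nosep\<close> on the rim
  either the interior of the arc or the bypassed part has no spoke. The bypassed part has more
  spokes than the path, and an arc with spoke-free interior leaves at most three spokes in
  all.\<close>

lemma detour_length2:
  assumes F: "detour P B"
  shows "2 \<le> length P"
proof (rule ccontr)
  assume "\<not> 2 \<le> length P"
  then obtain p where P: "P = [p]" using detourD(2)[OF F] by (cases P; cases "tl P") auto
  obtain A where A: "icyc (B @ A)" "set (B @ A) = C" "sp P < sp A" using detour_arc[OF F] by blast
  have 4: "4 \<le> sp (P @ B)" using detourD[OF F] by blast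
  then have "3 \<le> sp B" unfolding P by (auto split: if_splits)
  then have lB: "2 \<le> length B" unfolding sp_def using length_filter_le[of "E x" B] by linarith
  then obtain t B' where B1: "B = t # B'" "B' \<noteq> []" by (cases B) (auto simp: Suc_le_eq)
  then obtain m s where B2: "B = t # m @ [s]" by (metis append_butlast_last_id)
  have e: "E p t" "E p s" using detourD(1)[OF F] unfolding P B2 by auto
  have "p \<in> V" "p \<notin> C" "p \<noteq> x" using icyc_V[OF detourD(1)[OF F]] detourD(4)[OF F] P by auto
  then have "nosep ([] @ t # m @ s # A) p" using C_nosep[OF A(1,2)] B2 by auto
  from nosepD[OF this e] have "sp m = 0 \<or> sp ([] @ A) = 0" .
  then show False using 4 A(3) P B2 by (auto split: if_splits)
qed

end

lemma sublist_between:
  assumes "q \<in> set L" "q' \<in> set L"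
  obtains Qa M Qb where "L = Qa @ M @ Qb" "M \<noteq> []" "hd M = q \<and> last M = q' \<or> hd M = q' \<and> last M = q"
proof -
  obtain A B where L: "L = A @ q # B" using assms(1) by (meson split_list)
  consider "q' = q" | "q' \<in> set A" | "q' \<in> set B" using assms(2) L by auto
  then show thesis
  proof cases
    case 1
    then show ?thesis using that[of A "[q]" B] L by simp
  next
    case 2
    then obtain A1 A2 where "A = A1 @ q' # A2" by (meson split_list)
    then show ?thesis using that[of A1 "q' # A2 @ [q]" B] L by simp
  next
    case 3
    then obtain B1 B2 where "B = B1 @ q' # B2" by (meson split_list)
    then show ?thesis using that[of A "q # B1 @ [q']" B2] L by simp
  qed
qed

section \<open>Paths without spokes between separated places of the rim\<close>

context wheel_ctx
begin

definition rim :: "'a list \<Rightarrow> bool" where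
  "rim cs \<longleftrightarrow> icyc cs \<and> set cs = C"

lemma rim_rot: "rim (A @ B) \<Longrightarrow> rim (B @ A)"
  unfolding rim_def using icyc_rot by auto

lemma rim_rev: "rim A \<Longrightarrow> rim (rev A)"
  unfolding rim_def using icyc_rev by auto

lemma rim_flip: "rim (s # I @ t # Z) \<Longrightarrow> rim (s # rev Z @ t # rev I)"
  using rim_rev[of "s # I @ t # Z"] rim_rot[of "rev Z @ t # rev I" "[s]"] by simp

lemma rim_swap: "rim (s # I @ t # Z) \<Longrightarrow> rim (t # Z @ s # I)"
  using rim_rot[of "s # I" "t # Z"] by simp

lemma rim_sp: "rim cs \<Longrightarrow> sp cs = n"
  unfolding rim_def using sp_C by blast

lemma rim_start:
  assumes "s \<in> C"
  obtains L where "rim (s # L)"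
proof -
  obtain cs where cs: "rim cs" using C_cyc unfolding rim_def by blast
  then have "s \<in> set cs" using assms unfolding rim_def by simp
  then obtain A B where "cs = A @ s # B" by (meson split_list)
  then have "rim (s # B @ A)" using rim_rot[of A "s # B"] cs by simp
  then show thesis by (rule that)
qed

lemma detourI:
  assumes "icyc (P @ B)" "P \<noteq> []" "B \<noteq> []" "set P \<inter> insert x C = {}" "rim (B @ A)" "gp P"
    "3 \<le> sp (P @ B)" "sp (P @ B) < n"
  shows "detour P B"
  unfolding detour_def using assms(5)[unfolded rim_def] by (intro conjI exI[of _ A] assms) auto

text \<open>The spokes counted lie strictly between; \<open>s\<close> and \<open>t\<close> may be
  spokes themselves.\<close>

definition sepC :: "'a \<Rightarrow> 'a \<Rightarrow> bool" where
  "sepC s t \<longleftrightarrow> (\<exists>I Z. rim (s # I @ t # Z) \<and> 0 < sp I \<and> 0 < sp Z)"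

lemma sepCI: "rim (s # I @ t # Z) \<Longrightarrow> 0 < sp I \<Longrightarrow> 0 < sp Z \<Longrightarrow> sepC s t"
  unfolding sepC_def by (intro exI conjI)

lemma sepC_sym: "sepC s t \<Longrightarrow> sepC t s"
proof -
  assume "sepC s t"
  then obtain I Z where "rim (s # I @ t # Z)" "0 < sp I" "0 < sp Z" unfolding sepC_def by (elim exE conjE)
  then show ?thesis using sepCI[of t Z s I] rim_swap by simp
qed

definition link :: "'a list \<Rightarrow> 'a \<Rightarrow> 'a \<Rightarrow> bool" where
  "link Q s t \<longleftrightarrow> ipath Q \<and> Q \<noteq> [] \<and> set Q \<inter> insert x C = {} \<and> sp Q = 0
     \<and> E (hd Q) s \<and> E (last Q) t \<and> sepC s t"

lemma link_rev: "link Q s t \<Longrightarrow> link (rev Q) t s"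
  unfolding link_def using sepC_sym by (auto simp: ipath_rev hd_rev last_rev)

definition min_link :: "'a list \<Rightarrow> 'a \<Rightarrow> 'a \<Rightarrow> bool" where
  "min_link Q s t \<longleftrightarrow> link Q s t \<and> (\<forall>Q' s' t'. link Q' s' t' \<longrightarrow> length Q \<le> length Q')"

lemma min_link_rev: "min_link Q s t \<Longrightarrow> min_link (rev Q) t s"
  unfolding min_link_def using link_rev by simp

lemma linkD:
  assumes "link Q s t"
  shows "ipath Q" "Q \<noteq> []" "set Q \<inter> insert x C = {}" "sp Q = 0" "E (hd Q) s" "E (last Q) t" "sepC s t"
    "set Q \<subseteq> V"
  using assms ipath_V unfolding link_def by auto

lemma nosep_sepC:
  assumes "v \<in> V" "v \<notin> C" "v \<noteq> x" "E v s" "E v t" "sepC s t"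
  shows False
proof -
  obtain I Z where r: "rim (s # I @ t # Z)" "0 < sp I" "0 < sp Z"
    using assms(6) unfolding sepC_def by (elim exE conjE)
  have "nosep (s # I @ t # Z) v" using C_nosep r(1) assms unfolding rim_def by blast
  then show False using nosepD[of "[]" s I t Z v] assms(4,5) r by simp
qed

lemma link_length2: "link Q s t \<Longrightarrow> 2 \<le> length Q"
proof (rule ccontr)
  assume l: "link Q s t" "\<not> 2 \<le> length Q"
  then obtain q where Q: "Q = [q]" using linkD(2) by (cases Q; cases "tl Q") auto
  show False using nosep_sepC[of q s t] linkD[OF l(1)] Q by auto
qed

lemma min_link_sub:
  assumes m: "min_link (Qa @ M @ Qb) s t" and M: "M \<noteq> []" "E (hd M) w" "E (last M) w'" "sepC w w'"
  shows "Qa = [] \<and> Qb = []"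
proof -
  have l: "link (Qa @ M @ Qb) s t" using m unfolding min_link_def by blast
  have "link M w w'" using linkD[OF l] M ipath_sub[of Qa M Qb] unfolding link_def by auto
  then have "length (Qa @ M @ Qb) \<le> length M" using m unfolding min_link_def by blast
  then show ?thesis by simp
qed

text \<open>A spoke between \<open>s\<close> and \<open>w\<close> would separate them, and
  \<open>q\<close> alone would be a shorter link. If \<open>q\<close> were the only vertex of the
  link that sees \<open>w\<close>, its rim neighbours would be just \<open>s\<close> and
  \<open>w\<close>, and the cycle \<open>q # s # I1 @ [w]\<close> would form a tripod with the rest
  of the rim and the rest of the link. The second vertex that sees \<open>w\<close> then rules out
  spokes in \<open>I2\<close>.\<close>

lemma min_link_attach_hd:
  assumes m: "min_link (q # Qb) s t" and r: "rim (s # I1 @ w # I2 @ t # Z)"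
    and s: "0 < sp (I1 @ w # I2)" "0 < sp Z" and w: "E q w"
  shows "sp I1 = 0 \<and> sp I2 = 0 \<and> (\<exists>q'\<in>set Qb. E q' w)"
proof -
  have l: "link (q # Qb) s t" using m unfolding min_link_def by blast
  note L = linkD[OF l]
  have Qb: "Qb \<noteq> []" using link_length2[OF l] by auto
  have 1: "sp I1 = 0"
  proof (rule ccontr)
    assume "sp I1 \<noteq> 0"
    then have "sepC s w" using sepCI[of s I1 w "I2 @ t # Z"] r s by simp
    then show False using min_link_sub[of "[]" "[q]" Qb s t s w] m w L Qb by simp
  qed
  have far: "\<not> E q' c" if "q' \<in> set Qb" "sepC c t" for q' c
  proof
    assume e: "E q' c"
    obtain Ba Bb where B: "Qb = Ba @ q' # Bb" using \<open>q' \<in> set Qb\<close> by (meson split_list)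
    show False using min_link_sub[of "q # Ba" "q' # Bb" "[]" s t c t] m L B e \<open>sepC c t\<close> by simp
  qed
  have sI: "\<not> E q' c" if "q' \<in> set Qb" "c \<in> set (s # I1)" for q' c
  proof -
    obtain Ca Cb where c: "s # I1 = Ca @ c # Cb" using \<open>c \<in> set (s # I1)\<close> by (meson split_list)
    have "rim (c # (Cb @ w # I2) @ t # (Z @ Ca))"
      using rim_rot[of Ca "c # Cb @ w # I2 @ t # Z"] r c by (metis append.assoc append_Cons)
    moreover have "0 < sp (Cb @ w # I2)" using 1 s by auto
    ultimately have "sepC c t" using sepCI[of c "Cb @ w # I2" t "Z @ Ca"] s by simp
    then show ?thesis using far that by blast
  qed
  have qV: "q \<in> V" "q \<notin> C" "q \<noteq> x" "\<not> E q x" using L E_commute by auto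
  have dist: "distinct (s # I1 @ w # I2 @ t # Z)" and C: "set (s # I1 @ w # I2 @ t # Z) = C"
    and cyc: "icyc (s # I1 @ w # I2 @ t # Z)"
    using r icyc_distinct unfolding rim_def by blast+
  have q2: "c = s \<or> c = w" if "c \<in> C" "E q c" for c
  proof (rule ccontr)
    assume c: "\<not> (c = s \<or> c = w)"
    have "{s, w, c} \<subseteq> {h\<in>C. E q h}" using that L w C by auto
    moreover have "card {s, w, c} = 3" using c dist by auto
    moreover have "finite {h\<in>C. E q h}" using C by (metis finite_Collect_conjI finite_set Collect_mem_eq)
    ultimately have "3 \<le> card {h\<in>C. E q h}" using card_mono by metis
    then show False using C_two[OF qV] by simp
  qed
  have ex: "\<exists>q'\<in>set Qb. E q' w"
  proof (rule ccontr)
    assume no: "\<not> ?thesis"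
    have H: "icyc (q # s # I1 @ [w])"
      by (rule icyc_cut2[of s I1 w "I2 @ t # Z"]) (use cyc qV C L w q2 dist in auto)
    have ip: "ipath (I2 @ t # Z)" using icyc_sub[of "s # I1 @ [w]" "I2 @ t # Z" "[]"] cyc by simp
    have ipQ: "ipath Qb" using L by simp
    have c1: "conn (set (I2 @ t # Z))" using conn_ipath[OF ip] by simp
    have c2: "conn (set Qb)" using conn_ipath[OF ipQ Qb] .
    \<comment> \<open>The rest of the rim and the rest of the link are joined at \<open>t\<close>,
      which the last vertex of the link sees.\<close>
    have "conn (set (I2 @ t # Z) \<union> set Qb)"
      by (rule conn_union[OF c1 c2, of t "last Qb"]) (use Qb L E_commute in auto)
    then show False
    proof (rule tripod3[OF H, of _ s w q "last (t # Z)" "hd (I2 @ t # Z)" "hd Qb"])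
      have cross: "E a b \<longleftrightarrow> a = w \<and> b = hd (I2 @ t # Z) \<or> a = s \<and> b = last (t # Z)"
        if "a \<in> set (s # I1 @ [w])" "b \<in> set (I2 @ t # Z)" for a b
        using icyc_cross[of "s # I1 @ [w]" "I2 @ t # Z" a b] cyc that by simp
      show "E s (last (t # Z))" "E w (hd (I2 @ t # Z))" using cross[of s "last (t # Z)"] cross[of w "hd (I2 @ t # Z)"]
        by (cases I2; auto)+
      show "E q (hd Qb)" using L Qb by (cases Qb) auto
      show "set (q # s # I1 @ [w]) \<inter> (set (I2 @ t # Z) \<union> set Qb) = {}" using L C dist qV by auto
      show "(h, p) \<in> {(s, last (t # Z)), (w, hd (I2 @ t # Z)), (q, hd Qb)}"
        if h: "h \<in> set (q # s # I1 @ [w])" and p: "p \<in> set (I2 @ t # Z) \<union> set Qb" and e: "E h p" for h p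
      proof (cases "h = q")
        case True
        have "p \<notin> set (I2 @ t # Z)" using q2[of p] True e dist C by auto
        then have "p \<in> set Qb" using p by blast
        then have "p = hd Qb" using L True e by auto
        then show ?thesis using True by simp
      next
        case False
        then have h': "h \<in> set (s # I1 @ [w])" using h by simp
        have "p \<notin> set Qb" using h' sI[of p h] no e E_commute by auto
        then have "p \<in> set (I2 @ t # Z)" using p by blast
        then show ?thesis using cross[OF h'] e by auto
      qed
    qed (use L dist C qV Qb in \<open>auto simp: hd_append\<close>)
  qed
  then obtain q' where q': "q' \<in> set Qb" "E q' w" by blast
  have "sp I2 = 0"
  proof (rule ccontr)
    assume "sp I2 \<noteq> 0"
    moreover have "rim (w # I2 @ t # (Z @ s # I1))" using rim_rot[of "s # I1" "w # I2 @ t # Z"] r by simp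
    ultimately have "sepC w t" using sepCI[of w I2 t "Z @ s # I1"] s by simp
    then show False using far q' by blast
  qed
  then show ?thesis using 1 ex by blast
qed

text \<open>An attachment of an inner vertex is limited by shorter links directly, one at an end by
  \<open>min_link_attach_hd\<close> in one of the two directions. A neighbour in \<open>tl Q\<close>
  is recorded so that attachments on different sides of the rim are joined by a subpath that misses
  the first vertex and is therefore shorter.\<close>

lemma min_link_attach:
  assumes m: "min_link Q s t" and r: "rim (s # I1 @ w # I2 @ t # Z)"
    and s: "0 < sp (I1 @ w # I2)" "0 < sp Z" and w: "q \<in> set Q" "E q w"
  shows "sp I1 = 0 \<and> sp I2 = 0 \<and> (\<exists>q'\<in>set (tl Q). E q' w)"
proof -
  have l: "link Q s t" using m unfolding min_link_def by blast
  note L = linkD[OF l]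
  obtain Qa Qb where Q: "Q = Qa @ q # Qb" using w by (meson split_list)
  show ?thesis
  proof (cases "Qa = []")
    case True
    then show ?thesis using min_link_attach_hd[of q Qb s t I1 w I2 Z] m r s w Q by simp
  next
    case False
    then have ex: "\<exists>q'\<in>set (tl Q). E q' w" using w Q by (cases Qa) auto
    have "sp I1 = 0 \<and> sp I2 = 0"
    proof (cases "Qb = []")
      case True
      have "min_link (q # rev Qa) t s" using min_link_rev[OF m] Q True by simp
      moreover have "rim (t # rev I2 @ w # rev I1 @ s # rev Z)"
        using rim_flip[OF rim_swap[of s "I1 @ w # I2" t Z]] r by simp
      ultimately show ?thesis using min_link_attach_hd[of q "rev Qa" t s "rev I2" w "rev I1" "rev Z"] s w by auto
    next
      case Qb: False
      have "sp I1 = 0"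
      proof (rule ccontr)
        assume "sp I1 \<noteq> 0"
        then have "sepC s w" using sepCI[of s I1 w "I2 @ t # Z"] r s by simp
        then show False using min_link_sub[of "[]" "Qa @ [q]" Qb s t s w] m w L Qb False Q by simp
      qed
      moreover have "sp I2 = 0"
      proof (rule ccontr)
        assume "sp I2 \<noteq> 0"
        moreover have "rim (w # I2 @ t # (Z @ s # I1))" using rim_rot[of "s # I1" "w # I2 @ t # Z"] r by simp
        ultimately have "sepC w t" using sepCI[of w I2 t "Z @ s # I1"] s by simp
        then show False using min_link_sub[of Qa "q # Qb" "[]" s t w t] m w L False Q Qb by simp
      qed
      ultimately show ?thesis by blast
    qed
    then show ?thesis using ex by blast
  qed
qed

text \<open>By minimality only the first vertex of the link sees \<open>s\<close> and only the last
  one sees \<open>t\<close>. Separated vertices are not adjacent, so \<open>I\<close> is nonempty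
  and the arc along \<open>Z\<close> is an induced path.\<close>

lemma min_link_clean_cyc:
  assumes m: "min_link Q s t" and r: "rim (s # I @ t # Z)" and clean: "\<And>q z. q \<in> set Q \<Longrightarrow> z \<in> set Z \<Longrightarrow> \<not> E q z"
  shows "icyc (Q @ t # Z @ [s])"
proof -
  have l: "link Q s t" using m unfolding min_link_def by blast
  note L = linkD[OF l]
  have Cr: "set (s # I @ t # Z) = C" "distinct (s # I @ t # Z)" using r icyc_distinct unfolding rim_def by blast+
  have "rim (t # Z @ s # I)" using rim_swap[OF r] .
  then have ip: "ipath (t # Z @ [s])" if "I \<noteq> []" using icyc_sub[of "[]" "t # Z @ [s]" I] that unfolding rim_def by simp
  have I: "I \<noteq> []"
  proof
    assume "I = []"
    then have 1: "E s t" using r unfolding rim_def by simp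
    obtain I' Z' where r': "rim (s # I' @ t # Z')" "0 < sp I'" "0 < sp Z'" using L(7) unfolding sepC_def by (elim exE conjE)
    then have i: "icyc (s # I' @ t # Z')" unfolding rim_def by blast
    have "I' \<noteq> []" "Z' \<noteq> []" using r' by auto
    then show False using icyc_cross[of "[s]" "I' @ t # Z'" s t] i icyc_distinct[OF i] 1 by (cases I') auto
  qed
  have hdQ: "q = hd Q" if h: "q \<in> set Q" "E q s" for q
  proof -
    obtain Qa Qb where Q: "Q = Qa @ q # Qb" using h by (meson split_list)
    then have "Qa = []" using min_link_sub[of Qa "q # Qb" "[]" s t s t] m L h by simp
    then show ?thesis using Q by simp
  qed
  have laQ: "q = last Q" if h: "q \<in> set Q" "E q t" for q
  proof -
    obtain Qa Qb where Q: "Q = Qa @ q # Qb" using h by (meson split_list)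
    then have "Qb = []" using min_link_sub[of "[]" "Qa @ [q]" Qb s t s t] m L h by (simp add: hd_append split: if_splits)
    then show ?thesis using Q by simp
  qed
  have "E a b \<longleftrightarrow> a = last Q \<and> b = hd (t # Z @ [s]) \<or> a = hd Q \<and> b = last (t # Z @ [s])"
    if "a \<in> set Q" "b \<in> set (t # Z @ [s])" for a b
    using that hdQ laQ clean L Cr by auto
  moreover have "set Q \<inter> set (t # Z @ [s]) = {}" using L Cr by auto
  ultimately show ?thesis using icyc_append[of Q "t # Z @ [s]"] L ip[OF I] link_length2[OF l] by auto
qed

lemma min_link_clean:
  assumes m: "min_link Q s t" and r: "rim (s # I @ t # Z)" "0 < sp I"
    and clean: "\<And>q z. q \<in> set Q \<Longrightarrow> z \<in> set Z \<Longrightarrow> \<not> E q z"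
    and s: "3 \<le> sp (t # Z @ [s])"
  shows "detour Q (t # Z @ [s])"
proof -
  have l: "link Q s t" using m unfolding min_link_def by blast
  note L = linkD[OF l]
  have "rim ((t # Z @ [s]) @ I)" using rim_swap[OF r(1)] by simp
  moreover have "sp (Q @ t # Z @ [s]) < n" using rim_sp[OF r(1)] r(2) L by simp
  moreover have "gp Q" "3 \<le> sp (Q @ t # Z @ [s])" using L s unfolding gp_def by auto
  ultimately show ?thesis using min_link_clean_cyc[OF m r(1) clean] L detourI by blast
qed

text \<open>The link closes up with one of the two sides of the rim. It cannot attach inside both,
  and an attachment inside one forces exactly one spoke there, which leaves at least three for the
  other. Without attachments, both sides fall short only if each has two inner spokes and
  \<open>s\<close>, \<open>t\<close> are not spokes; then one side, with its two spokes, and the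
  segment from \<open>s\<close> to the first spoke of the other side give a tripod.\<close>

lemma min_link_detour:
  assumes m: "min_link Q s t"
  shows "\<exists>B. detour Q B"
proof (rule ccontr)
  assume no: "\<not> ?thesis"
  have l: "link Q s t" using m unfolding min_link_def by blast
  note L = linkD[OF l]
  obtain I Z where r: "rim (s # I @ t # Z)" "0 < sp I" "0 < sp Z" using L(7) unfolding sepC_def by (elim exE conjE)
  have r': "rim (s # rev Z @ t # rev I)" using rim_flip r by blast
  have tot: "sp I + sp Z + sp [s] + sp [t] = n" using rim_sp[OF r(1)] by simp
  have i1: "\<exists>q'\<in>set (tl Q). E q' w \<and> sp I = 1 \<and> E x w" if w: "w \<in> set I" "q \<in> set Q" "E q w" for w q
  proof -
    obtain I1 I2 where I: "I = I1 @ w # I2" using w by (meson split_list)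
    then have "sp I1 = 0 \<and> sp I2 = 0 \<and> (\<exists>q'\<in>set (tl Q). E q' w)"
      using min_link_attach[OF m, of I1 w I2 Z q] r w by simp
    then show ?thesis using I r(2) by (auto split: if_splits)
  qed
  have z1: "\<exists>q'\<in>set (tl Q). E q' w \<and> sp Z = 1 \<and> E x w" if w: "w \<in> set Z" "q \<in> set Q" "E q w" for w q
  proof -
    obtain I2 I1 where I: "Z = I2 @ w # I1" using w by (meson split_list)
    then have "sp (rev I1) = 0 \<and> sp (rev I2) = 0 \<and> (\<exists>q'\<in>set (tl Q). E q' w)"
      using min_link_attach[OF m, of "rev I1" w "rev I2" "rev I" q] r r' w by auto
    then show ?thesis using I r(3) by (auto split: if_splits)
  qed
  have nb: "\<not> (w \<in> set I \<and> w' \<in> set Z \<and> q \<in> set Q \<and> q' \<in> set Q \<and> E q w \<and> E q' w')" for w w' q q'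
  proof
    assume a: "w \<in> set I \<and> w' \<in> set Z \<and> q \<in> set Q \<and> q' \<in> set Q \<and> E q w \<and> E q' w'"
    obtain p where p: "p \<in> set (tl Q)" "E p w" "sp I = 1" "E x w" using i1 a by blast
    obtain p' where p': "p' \<in> set (tl Q)" "E p' w'" "sp Z = 1" "E x w'" using z1 a by blast
    \<comment> \<open>One spoke inside each side and four in total make \<open>s\<close> and
      \<open>t\<close> spokes, and these separate \<open>w\<close> from \<open>w'\<close>.\<close>
    have st: "E x s" "E x t" using tot n4 p p' by (auto split: if_splits)
    obtain I1 I2 where I: "I = I1 @ w # I2" using a by (meson split_list)
    obtain Z1 Z2 where Z: "Z = Z1 @ w' # Z2" using a by (meson split_list)
    have "rim (w # (I2 @ t # Z1) @ w' # (Z2 @ s # I1))" using rim_rot[of "s # I1" "w # I2 @ t # Z"] r I Z by simp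
    then have sep: "sepC w w'" using sepCI[of w "I2 @ t # Z1" w' "Z2 @ s # I1"] st by simp
    obtain Qa M Qb where M: "tl Q = Qa @ M @ Qb" "M \<noteq> []" "hd M = p \<and> last M = p' \<or> hd M = p' \<and> last M = p"
      using sublist_between[OF p(1) p'(1)] by blast
    have Q: "Q = (hd Q # Qa) @ M @ Qb" using L(2) M(1) by (cases Q) auto
    have "\<exists>a b. E (hd M) a \<and> E (last M) b \<and> sepC a b" using M(3) p p' sep sepC_sym by blast
    then obtain a b where "E (hd M) a" "E (last M) b" "sepC a b" by blast
    then show False using min_link_sub[of "hd Q # Qa" M Qb s t a b] m Q M(2) by simp
  qed
  show False
  proof (cases "\<exists>q\<in>set Q. \<exists>w\<in>set I. E q w")
    case True
    then have "sp I = 1" using i1 by blast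
    then have "3 \<le> sp (t # Z @ [s])" using tot n4 by simp
    moreover have "\<not> E q z" if "q \<in> set Q" "z \<in> set Z" for q z using nb True that by blast
    ultimately show False using min_link_clean[OF m r(1,2)] no by blast
  next
    case I: False
    show False
    proof (cases "\<exists>q\<in>set Q. \<exists>w\<in>set Z. E q w")
      case True
      then have "sp Z = 1" using z1 by blast
      then have "3 \<le> sp (t # rev I @ [s])" using tot n4 by simp
      then show False using min_link_clean[OF m r'] no I r by auto
    next
      case Z: False
      have "\<not> 3 \<le> sp (t # rev I @ [s])" using min_link_clean[OF m r'] no I r by auto
      moreover have "\<not> 3 \<le> sp (t # Z @ [s])" using min_link_clean[OF m r(1,2)] no Z by auto
      ultimately have s: "sp [s] = 0" "sp [t] = 0" "sp I = 2" "sp Z = 2" using tot n4 by auto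
      obtain A z M z' B where Zs: "Z = A @ z # M @ z' # B" "E x z" "E x z'" "sp A = 0" "sp B = 0"
        using outer_spokes[of Z] s(4) by (metis order_refl)
      have M: "sp M = 0" using s Zs by simp
      obtain Ia w Ib where Is: "I = Ia @ w # Ib" "E x w" "sp Ia = 0" using first_spoke[OF r(2)] .
      have Ib: "0 < sp Ib" using s Is by simp
      have cyc: "icyc (s # I @ t # Z)" and C: "set (s # I @ t # Z) = C" using r unfolding rim_def by auto
      have dist: "distinct (s # I @ t # Z)" using icyc_distinct[OF cyc] .
      have H: "icyc (Q @ t # Z @ [s])" using min_link_clean_cyc[OF m r(1)] Z by blast
      have ip: "ipath (Ia @ [w])" using icyc_sub[of "[s]" "Ia @ [w]" "Ib @ t # Z"] cyc Is by simp
      have "conn (insert x (set (Ia @ [w])))" using conn_seg[OF ip] Is by simp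
      then show False
      proof (rule tripod3[OF H, of _ z z' s x x "hd (Ia @ [w])"])
        have lIb: "last I \<notin> set (Ia @ [w])" using dist Is Ib by (cases Ib) auto
        have cross: "E a b \<longleftrightarrow> a = s \<and> b = hd I \<or> a = t \<and> b = last I" if "a \<in> set (t # Z @ [s])" "b \<in> set I" for a b
          using icyc_cross[of "t # Z @ [s]" I a b] icyc_rot[of "s # I" "t # Z"] cyc that by simp
        have hdI: "hd I = hd (Ia @ [w])" using Is by (cases Ia) auto
        show "E s (hd (Ia @ [w]))" using cross[of s "hd I"] Is hdI by (cases Ia) auto
        show "set (Q @ t # Z @ [s]) \<inter> insert x (set (Ia @ [w])) = {}" using L C dist Is x_C by auto
        show "(h, p) \<in> {(z, x), (z', x), (s, hd (Ia @ [w]))}"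
          if h: "h \<in> set (Q @ t # Z @ [s])" and p: "p \<in> insert x (set (Ia @ [w]))" and e: "E h p" for h p
        proof (cases "p = x")
          case True
          then have "E x h" using e E_commute by blast
          then have "h \<notin> set Q" "h \<noteq> s" "h \<noteq> t" "h \<notin> set A" "h \<notin> set M" "h \<notin> set B"
            using L(4) s Zs M sp_0D by (auto split: if_splits)
          then show ?thesis using h True Zs by auto
        next
          case False
          then have p: "p \<in> set (Ia @ [w])" using p by simp
          then have pI: "p \<in> set I" using Is by auto
          then have "h \<notin> set Q" using I e by blast
          then have "h \<in> set (t # Z @ [s])" using h by auto
          then have "h = s \<and> p = hd I" using cross pI e lIb p by blast
          then show ?thesis using hdI by simp
        qed
      qed (use Zs dist E_commute in \<open>auto simp: hd_append\<close>)
    qed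
  qed
qed

text \<open>A shortest link may end elsewhere on the rim, so only the length of the path is
  controlled.\<close>

lemma link_detour:
  assumes "link Q s t"
  obtains P B where "detour P B" "length P \<le> length Q"
proof -
  let ?M = "\<lambda>(Q, s, t). link Q s t"
  have "\<exists>z. ?M z \<and> (\<forall>y. ?M y \<longrightarrow> length (fst z) \<le> length (fst y))"
    by (rule ex_has_least_nat[of ?M "(Q, s, t)"]) (simp add: assms)
  then obtain z where z: "?M z" "\<And>y. ?M y \<Longrightarrow> length (fst z) \<le> length (fst y)" by blast
  obtain Q' s' t' where z': "z = (Q', s', t')" by (cases z)
  have "min_link Q' s' t'" unfolding min_link_def using z z' by auto
  then obtain B where "detour Q' B" using min_link_detour by blast
  moreover have "length Q' \<le> length Q" using z(2)[of "(Q, s, t)"] assms z' by simp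
  ultimately show thesis by (rule that)
qed

end

section \<open>Vertices attached to a minimal detour\<close>

lemma card_pair_le: "S \<subseteq> {a, b} \<Longrightarrow> card S \<le> 2"
proof -
  assume "S \<subseteq> {a, b}"
  then have "card S \<le> card {a, b}" by (rule card_mono[rotated]) simp
  also have "\<dots> \<le> 2" by (simp add: card_insert_if)
  finally show ?thesis .
qed

context sgraph
begin

text \<open>The third case singles out the first and the last neighbour; there may be more of them
  in \<open>M\<close>.\<close>

lemma nbr_cases:
  obtains (none) "\<And>b. b \<in> set L \<Longrightarrow> \<not> E v b"
  | (one) X c Z where "L = X @ c # Z" "E v c" "\<And>b. b \<in> set (X @ Z) \<Longrightarrow> \<not> E v b"
  | (two) X c M c' Z where "L = X @ c # M @ c' # Z" "E v c" "E v c'" "\<And>b. b \<in> set (X @ Z) \<Longrightarrow> \<not> E v b"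
proof (cases "\<exists>b\<in>set L. E v b")
  case False
  then show thesis using none by blast
next
  case True
  then obtain X c Y where 1: "L = X @ c # Y" "E v c" "\<forall>b\<in>set X. \<not> E v b"
    by (metis split_list_first_prop)
  show thesis
  proof (cases "\<exists>b\<in>set Y. E v b")
    case False
    then show thesis using one[of X c Y] 1 by auto
  next
    case True
    then obtain M c' Z where "Y = M @ c' # Z" "E v c'" "\<forall>b\<in>set Z. \<not> E v b"
      by (metis split_list_last_prop)
    then show thesis using two[of X c M c' Z] 1 by auto
  qed
qed

end

section \<open>Rim vertices and non-neighbours of the hub against a minimal detour\<close>

context wheel_ctx
begin

lemma gp_suffix:
  assumes "gp (X @ Y)"
  shows "gp Y"
proof (cases "sp Y \<le> 1")
  case True
  then show ?thesis unfolding gp_def by blast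
next
  case False
  then obtain Q u u' where Q: "X @ Y = Q @ [u, u'] \<or> X @ Y = [u', u] @ Q" "sp Q = 0" "E x u" "E x u'"
    using assms unfolding gp_def by auto
  have X: "sp X = 0"
  proof -
    have "sp (X @ Y) = 2" using Q(1)
    proof
      assume "X @ Y = Q @ [u, u']"
      then show ?thesis using Q(2-4) by simp
    next
      assume "X @ Y = [u', u] @ Q"
      then show ?thesis using Q(2-4) by simp
    qed
    then show ?thesis using False by simp
  qed
  from Q(1) show ?thesis
  proof
    assume a: "X @ Y = Q @ [u, u']"
    have "\<exists>Q'. Q = X @ Q' \<and> Y = Q' @ [u, u']"
    proof -
      obtain W where W: "X = Q @ W \<and> W @ Y = [u, u'] \<or> X @ W = Q \<and> Y = W @ [u, u']"
        using a unfolding append_eq_append_conv2 by blast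
      then show ?thesis
      proof
        assume W: "X = Q @ W \<and> W @ Y = [u, u']"
        then have "W = []" using X Q(3) by (cases W) auto
        then show ?thesis using W by simp
      qed auto
    qed
    then obtain Q' where "Q = X @ Q'" "Y = Q' @ [u, u']" by blast
    then show ?thesis using Q unfolding gp_def by auto
  next
    assume "X @ Y = [u', u] @ Q"
    then have "X = []" using X Q(4) by (cases X) auto
    then show ?thesis using assms by simp
  qed
qed

text \<open>The asymmetric half of \<open>gp\<close>; it can be assumed after reversing the path.\<close>

definition pend :: "'a list \<Rightarrow> bool" where
  "pend P \<longleftrightarrow> sp P \<le> 1 \<or> (\<exists>Q u u'. P = Q @ [u, u'] \<and> sp Q = 0 \<and> E x u \<and> E x u')"

lemma gp_pend: "gp P \<Longrightarrow> pend P \<or> pend (rev P)"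
proof -
  assume "gp P"
  then consider "sp P \<le> 1" | Q u u' where "P = Q @ [u, u']" "sp Q = 0" "E x u" "E x u'"
    | Q u u' where "P = [u', u] @ Q" "sp Q = 0" "E x u" "E x u'" unfolding gp_def by blast
  then show ?thesis
  proof cases
    case 3
    then have "rev P = rev Q @ [u, u']" "sp (rev Q) = 0" by auto
    then show ?thesis using 3 unfolding pend_def by blast
  qed (auto simp: pend_def)
qed

lemma pend_split:
  assumes "pend (X @ Y)" "2 \<le> sp (X @ Y)"
  obtains u u' Q where "X @ Y = Q @ [u, u']" "sp Q = 0" "E x u" "E x u'"
  using assms unfolding pend_def by fastforce

lemma pend_pre:
  assumes "pend (X @ Y)" "Y \<noteq> []"
  shows "sp X \<le> 1"
proof (cases "sp (X @ Y) \<le> 1")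
  case True
  then show ?thesis by simp
next
  case False
  then obtain u u' Q where Q: "X @ Y = Q @ [u, u']" "sp Q = 0" "E x u" "E x u'"
    using pend_split[OF assms(1)] by (metis Suc_1 not_less_eq_eq One_nat_def)
  obtain Y' z where Y: "Y = Y' @ [z]" using assms(2) by (metis append_butlast_last_id)
  then have "X @ Y' = Q @ [u]" using Q(1) by (metis append.assoc append_Cons append_Nil butlast_snoc)
  then have "sp (X @ Y') = 1" using Q by simp
  then show ?thesis by simp
qed

lemma pend_suf:
  assumes "pend (X @ Y)" "sp W = 0"
  shows "gp (W @ Y)"
proof (cases "sp Y \<le> 1")
  case True
  then show ?thesis using assms unfolding gp_def by simp
next
  case False
  then obtain u u' Q where Q: "X @ Y = Q @ [u, u']" "sp Q = 0" "E x u" "E x u'"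
    using pend_split[OF assms(1)] by (metis Suc_1 not_less_eq_eq One_nat_def sp_simps(3) add_leD2)
  have "sp (X @ Y) = 2" using Q by simp
  then have X: "sp X = 0" using False by simp
  obtain W' where W': "X = Q @ W' \<and> W' @ Y = [u, u'] \<or> X @ W' = Q \<and> Y = W' @ [u, u']"
    using Q(1) unfolding append_eq_append_conv2 by blast
  have "\<exists>Q'. Y = Q' @ [u, u'] \<and> sp Q' = 0"
    using W'
  proof
    assume W: "X = Q @ W' \<and> W' @ Y = [u, u']"
    then have "W' = []" using X Q(3) by (cases W') auto
    then show ?thesis using W by (intro exI[of _ "[]"]) simp
  qed (use Q in auto)
  then obtain Q' where "W @ Y = (W @ Q') @ [u, u']" "sp (W @ Q') = 0" using assms(2) by auto
  then show ?thesis using Q unfolding gp_def by blast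
qed

lemma pend_bridge:
  assumes P: "pend (X @ M @ Y)" "M \<noteq> []" "Y \<noteq> []" and v: "\<not> E x v"
  shows "gp (X @ v # Y)"
proof (cases "sp X = 0")
  case True
  then show ?thesis using pend_suf[of "X @ M" Y "X @ [v]"] assms by simp
next
  case False
  show ?thesis
  proof (cases "sp (X @ M @ Y) \<le> 1")
    case True
    then show ?thesis using v unfolding gp_def by simp
  next
    case big: False
    then obtain u u' Q where Q: "X @ M @ Y = Q @ [u, u']" "sp Q = 0" "E x u" "E x u'"
      using pend_split[OF P(1)] by (metis Suc_1 not_less_eq_eq One_nat_def)
    obtain z Y' where Y: "Y = z # Y'" using P(3) by (cases Y) auto
    obtain m M' where M: "M = m # M'" using P(2) by (cases M) auto
    have "length (X @ M @ Y) = length Q + 2" using Q by simp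
    then have "length X \<le> length Q" using Y M by simp
    then obtain W where "Q = X @ W" using Q(1) by (metis append_eq_append_conv_if append_eq_conv_conj)
    then show ?thesis using Q(2) False by simp
  qed
qed

text \<open>The bypassed part has more spokes than the path, hence at least one, so
  \<open>nosep\<close> on the rim leaves only the inner alternative.\<close>

lemma nosep_arc:
  assumes F: "detour P B" and v: "v \<in> V" "v \<notin> C" "v \<noteq> x" and B: "B = X @ c # Y @ c' # Z" and e: "E v c" "E v c'"
  shows "sp Y = 0"
proof -
  obtain A where A: "icyc (B @ A)" "set (B @ A) = C" "sp P < sp A" using detour_arc[OF F] by blast
  have "nosep (X @ c # Y @ c' # (Z @ A)) v" using C_nosep[OF A(1,2) v] B by simp
  from nosepD[OF this e] A(3) show ?thesis by simp
qed

lemma detour_spokes: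
  assumes F: "detour P B"
  shows "sp P \<le> 2" "sp P \<le> 1 \<Longrightarrow> 3 \<le> sp B" "2 \<le> sp B"
proof -
  show 1: "sp P \<le> 2" using detourD(6)[OF F] unfolding gp_def by auto
  show "sp P \<le> 1 \<Longrightarrow> 3 \<le> sp B" "2 \<le> sp B" using detourD(8)[OF F] 1 by auto
qed

lemma detour_ends:
  assumes F: "detour P B"
  obtains t m s where "B = t # m @ [s]"
proof -
  have "2 \<le> length B" using detour_spokes(3)[OF F] length_filter_le[of "E x" B] unfolding sp_def by linarith
  then obtain t B' where B1: "B = t # B'" "B' \<noteq> []" by (cases B) (auto simp: Suc_le_eq)
  then have "B = t # butlast B' @ [last B']" by simp
  then show thesis by (rule that)
qed

text \<open>If \<open>A2\<close> had more spokes, it would pay to leave the path for the rim. Let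
  \<open>w\<close> be the first vertex of \<open>A1 @ [v]\<close> that sees \<open>p # Pz\<close>.
  The part of the path after the last neighbour of \<open>w\<close> bypasses a stretch of the rim
  with more spokes than it has itself. This part is a link from \<open>w\<close> to the start of the
  arc if it has no spoke, and otherwise the path of a detour whose arc is extended up to
  \<open>w\<close>. In both cases a shorter path results.\<close>

lemma min_detour_outside_suffix:
  assumes m: "min_detour P B" and r: "rim (B @ A)" and A: "A = A1 @ v # A2" and P: "P = Pn @ p # Pz"
    and Pn: "Pn \<noteq> []" and e: "E v p"
  shows "sp A2 \<le> sp (p # Pz)"
proof (rule ccontr)
  assume no: "\<not> ?thesis"
  have F: "detour P B" using m unfolding min_detour_def by blast
  note D = detourD[OF F]
  have "\<exists>w\<in>set (A1 @ [v]). \<exists>q\<in>set (p # Pz). E w q" using e by auto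
  then obtain B1 w B3 where w: "A1 @ [v] = B1 @ w # B3" "\<exists>q\<in>set (p # Pz). E w q"
      "\<forall>y\<in>set B1. \<not> (\<exists>q\<in>set (p # Pz). E y q)"
    using split_list_first_prop[of "A1 @ [v]" "\<lambda>w. \<exists>q\<in>set (p # Pz). E w q"] by blast
  define B2 where "B2 = B3 @ A2"
  have A': "A = B1 @ w # B2" using A w(1) unfolding B2_def by (metis append.assoc append_Cons append_Nil)
  have s2: "sp A2 \<le> sp B2" unfolding B2_def by simp
  obtain Z1 r' Z2 where z: "p # Pz = Z1 @ r' # Z2" "E w r'" "\<And>b. b \<in> set Z2 \<Longrightarrow> \<not> E w b"
    using last_nbr[OF w(2)] by blast
  have sz: "sp (r' # Z2) \<le> sp (p # Pz)" using z(1) by simp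
  have big: "sp (r' # Z2) < sp B2" using no s2 sz by linarith
  have lt: "length (r' # Z2) < length P"
  proof -
    have "length (r' # Z2) \<le> length (p # Pz)" using z(1) by simp
    then show ?thesis using P Pn by (cases Pn) auto
  qed
  have P': "P = (Pn @ Z1) @ r' # Z2" using P z(1) by simp
  have cyc: "icyc (B @ A)" and C: "set (B @ A) = C" using r unfolding rim_def by auto
  obtain t m s where B: "B = t # m @ [s]" using detour_ends[OF F] .
  have ipP: "ipath (r' # Z2)" using icyc_sub[of "Pn @ Z1" "r' # Z2" B] D(1) D(3) P' by simp
  show False
  proof (cases "sp (r' # Z2) = 0")
    case True
    have "rim (t # (m @ s # B1) @ w # B2)" using r B A' by simp
    moreover have "0 < sp (m @ s # B1)" using detour_spokes(3)[OF F] B by (auto split: if_splits)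
    moreover have "0 < sp B2" using big by linarith
    ultimately have "sepC t w" by (rule sepCI)
    then have sep: "sepC w t" by (rule sepC_sym)
    have "E (last (r' # Z2)) t" using icyc_cross[of P B "last P" t] D B P' by (auto split: if_splits)
    then have "link (r' # Z2) w t" unfolding link_def using ipP True z(2) E_commute sep D(4) P' by auto
    then obtain P2 B2' where "detour P2 B2'" "length P2 \<le> length (r' # Z2)" by (rule link_detour)
    then show False using min_detour_less[OF m] lt by (meson le_less_trans)
  next
    case False
    have B2: "B2 \<noteq> []" using big by auto
    have ipB: "ipath (B @ B1 @ [w])" using icyc_sub[of "[]" "B @ B1 @ [w]" B2] cyc A' B2 by simp
    have hP: "hd P \<notin> set (r' # Z2)"
      using icyc_distinct[OF D(1)] P' Pn by (cases Pn) auto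
    have cr: "E a b \<longleftrightarrow> a = last (r' # Z2) \<and> b = hd (B @ B1 @ [w]) \<or> a = hd (r' # Z2) \<and> b = last (B @ B1 @ [w])"
      if a: "a \<in> set (r' # Z2)" and b: "b \<in> set (B @ B1 @ [w])" for a b
    proof -
      have aP: "a \<in> set P" using a P' by auto
      have aC: "a \<notin> C" using aP D(4) by auto
      have wB: "w \<notin> set B" using icyc_distinct[OF cyc] A' by auto
      have d: "hd B \<noteq> w" "hd (B @ B1 @ [w]) = hd B" using wB D(3) by auto
      have lP: "last P = last (r' # Z2)" using P' by simp
      consider "b \<in> set B" | "b \<in> set B1" | "b = w" using b by auto
      then show ?thesis
      proof cases
        case 1
        have "E a b \<longleftrightarrow> a = last P \<and> b = hd B" using icyc_cross[OF D(1) aP 1] a hP by blast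
        then show ?thesis using d lP 1 wB by auto
      next
        case 2
        then have "\<not> E a b" using w(3) a z(1) E_commute by auto
        moreover have "b \<noteq> w" "b \<noteq> hd B" using 2 icyc_distinct[OF cyc] A' D(3) B by auto
        ultimately show ?thesis using d by auto
      next
        case 3
        have "E a w \<longleftrightarrow> a = r'" using a z E_commute by auto
        then show ?thesis using 3 d by auto
      qed
    qed
    have dj: "set (r' # Z2) \<inter> set (B @ B1 @ [w]) = {}" using D(4) P' C A' by auto
    have len: "3 \<le> length ((r' # Z2) @ (B @ B1 @ [w]))" using B by simp
    have H: "icyc ((r' # Z2) @ (B @ B1 @ [w]))"
      using icyc_append[of "r' # Z2" "B @ B1 @ [w]"] ipP ipB cr dj len by blast
    have R: "rim ((B @ B1 @ [w]) @ B2)" using r A' by simp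
    have n: "sp (B @ B1 @ [w]) + sp B2 = n" using rim_sp[OF R] by simp
    have "detour (r' # Z2) (B @ B1 @ [w])"
    proof (rule detourI[OF H _ _ _ R])
      show "set (r' # Z2) \<inter> insert x C = {}" using D(4) P' by auto
      show "gp (r' # Z2)" using gp_suffix D(6) P' by blast
      have "sp P = sp (Pn @ Z1) + sp (r' # Z2)" using P' by simp
      moreover have "1 \<le> sp (r' # Z2)" using False by linarith
      ultimately have "3 \<le> sp (r' # Z2) + sp B" using detour_spokes[OF F] by linarith
      then show "3 \<le> sp ((r' # Z2) @ B @ B1 @ [w])" by simp
      show "sp ((r' # Z2) @ B @ B1 @ [w]) < n" using n big by simp
    qed auto
    then show False using min_detour_less[OF m] lt by blast
  qed
qed

lemma min_detour_outside_prefix: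
  assumes m: "min_detour P B" and r: "rim (B @ A)" and A: "A = A1 @ v # A2" and P: "P = Pa @ p # R"
    and R: "R \<noteq> []" and e: "E v p"
  shows "sp A1 \<le> sp (Pa @ [p])"
proof -
  have "rim (rev B @ rev A)" using rim_rot[of "rev A" "rev B"] rim_rev[OF r] by simp
  from min_detour_outside_suffix[OF min_detour_rev[OF m] this, of "rev A2" v "rev A1" "rev R" p "rev Pa"]
  show ?thesis using A P R e by simp
qed

text \<open>Since \<open>sp P < sp A\<close>, the bounds of the two preceding lemmas can hold
  together only if they are tight, \<open>v\<close> is a spoke and no spoke lies strictly between
  its first and last neighbour on the path. A vertex of the bypassed arc sees \<open>B\<close> only
  from the first or last place of \<open>A\<close>.\<close>

lemma detour_outside:
  assumes m: "min_detour P B" and r: "rim (B @ A)" and v: "v \<in> set A"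
  shows "nosep (P @ B) v \<and> (\<not> E v x \<longrightarrow> card {h\<in>set (P @ B). E v h} \<le> 2)"
proof -
  have F: "detour P B" using m unfolding min_detour_def by blast
  note D = detourD[OF F]
  have cyc: "icyc (B @ A)" and C: "set (B @ A) = C" using r unfolding rim_def by auto
  have dist: "distinct (B @ A)" using icyc_distinct[OF cyc] .
  obtain t mm s where B: "B = t # mm @ [s]" using detour_ends[OF F] .
  obtain A1 A2 where A: "A = A1 @ v # A2" using v by (meson split_list)
  have nA: "sp B + sp A = n" using rim_sp[OF r] by simp
  then have sA: "sp P < sp A1 + sp [v] + sp A2" using D(9) A by simp
  have Bn: "E v b \<longleftrightarrow> b = s \<and> A1 = [] \<or> b = t \<and> A2 = []" if "b \<in> set B" for b
  proof -
    have "E b v \<longleftrightarrow> b = s \<and> v = hd A \<or> b = t \<and> v = last A"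
      using icyc_cross[OF cyc that v] B by simp
    moreover have "v = hd A \<longleftrightarrow> A1 = []" using A dist by (cases A1) auto
    moreover have "v = last A \<longleftrightarrow> A2 = []" using A dist by (cases A2 rule: rev_cases) auto
    ultimately show ?thesis using E_commute by blast
  qed
  have mid: "\<not> E v b" if "b \<in> set mm" for b using Bn[of b] that B dist by auto
  have vt: "E v t \<longleftrightarrow> A2 = []" and vs: "E v s \<longleftrightarrow> A1 = []" using Bn[of t] Bn[of s] B dist by auto
  have one: "sp [v] \<le> 1" by simp
  show ?thesis
  proof (cases "A1 = [] \<and> A2 = []")
    case True
    then have "sp P < sp [v]" using sA by simp
    then have "sp P = 0" "E v x" using E_commute by (auto split: if_splits)
    moreover have "nosep (P @ B) v" by (rule nosep_outer[of _ P t mm s "[]"]) (use B mid \<open>sp P = 0\<close> in auto)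
    ultimately show ?thesis by blast
  next
    case nb: False
    show ?thesis
    proof (rule nbr_cases[of P v])
      assume none: "\<And>b. b \<in> set P \<Longrightarrow> \<not> E v b"
      have "\<exists>X c Z. P @ B = X @ c # Z \<and> (\<forall>b\<in>set (X @ Z). \<not> E v b)"
      proof (cases "A1 = []")
        case True
        then show ?thesis using none mid vt vs nb B
          by (intro exI[of _ "P @ t # mm"] exI[of _ s] exI[of _ "[]"]) auto
      next
        case False
        then show ?thesis using none mid vs B
          by (intro exI[of _ P] exI[of _ t] exI[of _ "mm @ [s]"]) auto
      qed
      then obtain X c Z where X: "P @ B = X @ c # Z" "\<And>b. b \<in> set (X @ Z) \<Longrightarrow> \<not> E v b" by blast
      have "{h\<in>set (P @ B). E v h} \<subseteq> {c}" using X by auto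
      then have "card {h\<in>set (P @ B). E v h} \<le> 1" using card_mono[of "{c}"] by fastforce
      then show ?thesis using nosep_one[OF X] by linarith
    next
      fix Pa p Pz assume P: "P = Pa @ p # Pz" and e: "E v p" and no: "\<And>b. b \<in> set (Pa @ Pz) \<Longrightarrow> \<not> E v b"
      have "{h\<in>set (P @ B). E v h} \<subseteq> {p, if A1 = [] then s else t}" using P no B mid vt vs nb by auto
      then have "card {h\<in>set (P @ B). E v h} \<le> card {p, if A1 = [] then s else t}" by (rule card_mono[rotated]) simp
      moreover have "card {p, if A1 = [] then s else t} \<le> 2" by (simp add: card_insert_if)
      ultimately have c: "card {h\<in>set (P @ B). E v h} \<le> 2" by linarith
      have "nosep (P @ B) v"
      proof (cases "A1 = []")
        case True
        have "sp Pa = 0"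
        proof (cases "Pa = []")
          case False
          then have "sp A2 \<le> sp (p # Pz)" using min_detour_outside_suffix[OF m r A P _ e] by blast
          then show ?thesis using sA True P one by simp
        qed simp
        then show ?thesis
          by (intro nosep_outer[of _ Pa p "Pz @ t # mm" s "[]"]) (use P B no mid vt nb True in auto)
      next
        case A1: False
        show ?thesis
        proof (cases "A2 = []")
          case True
          have "sp Pz = 0"
          proof (cases "Pz = []")
            case False
            then have "sp A1 \<le> sp (Pa @ [p])" using min_detour_outside_prefix[OF m r A P _ e] by blast
            then show ?thesis using sA True P one by simp
          qed simp
          then show ?thesis
            by (intro nosep_inner[of _ Pa p Pz t "mm @ [s]"]) (use P B no mid vs A1 in auto)
        next
          case False
          then show ?thesis by (intro nosep_one[of _ Pa p "Pz @ B"]) (use P B no mid vs vt A1 in auto)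
        qed
      qed
      then show ?thesis using c by blast
    next
      fix Pa pf M pj Pz
      assume P: "P = Pa @ pf # M @ pj # Pz" and e: "E v pf" "E v pj" and no: "\<And>b. b \<in> set (Pa @ Pz) \<Longrightarrow> \<not> E v b"
      have 2: "sp A2 \<le> sp (pj # Pz)"
        by (rule min_detour_outside_suffix[OF m r A, of "Pa @ pf # M" pj Pz]) (use P e in auto)
      have 1: "sp A1 \<le> sp (Pa @ [pf])"
        by (rule min_detour_outside_prefix[OF m r A, of Pa pf "M @ pj # Pz"]) (use P e in auto)
      have sP: "sp P = sp (Pa @ [pf]) + sp M + sp (pj # Pz)" using P by simp
      have v1: "sp [v] = 1" "sp M = 0" "sp A1 = sp (Pa @ [pf])" "sp A2 = sp (pj # Pz)"
        using sP 1 2 sA one by linarith+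
      have vx: "E v x" using v1(1) E_commute by (auto split: if_splits)
      have "nosep (P @ B) v"
      proof (cases "A1 = []")
        case True
        then have "sp (Pa @ [pf]) = 0" using v1 by simp
        then show ?thesis
          by (intro nosep_outer[of _ "Pa @ pf # M" pj "Pz @ t # mm" s "[]"]) (use P B no mid vt nb True v1 in auto)
      next
        case A1: False
        show ?thesis
        proof (cases "A2 = []")
          case True
          then have "sp (pj # Pz) = 0" using v1 by simp
          then show ?thesis
            by (intro nosep_inner[of _ Pa pf "M @ pj # Pz" t "mm @ [s]"]) (use P B no mid vs A1 v1 in auto)
        next
          case False
          then show ?thesis by (intro nosep_inner[of _ Pa pf M pj "Pz @ B"]) (use P B no mid vs vt A1 v1 in auto)
        qed
      qed
      then show ?thesis using vx by blast
    qed
  qed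
qed

lemma detour_nonnbr_no_path_nbr:
  assumes F: "detour P B" and v: "v \<in> V" "v \<notin> C" "v \<noteq> x" "v \<notin> set P" "\<not> E v x"
    and P: "\<And>b. b \<in> set P \<Longrightarrow> \<not> E v b"
  shows "card {h\<in>set (P @ B). E v h} \<le> 2"
proof -
  have "finite {h\<in>C. E v h}" using C_cyc by (metis finite_Collect_conjI finite_set Collect_mem_eq)
  then have "card {h\<in>set (P @ B). E v h} \<le> card {h\<in>C. E v h}"
    by (rule card_mono) (use P detourD(5)[OF F] in auto)
  then show ?thesis using C_two v by fastforce
qed

lemma detour_no_path_nbr:
  assumes F: "detour P B" and v: "v \<in> V" "v \<notin> C" "v \<noteq> x"
    and P: "\<And>b. b \<in> set P \<Longrightarrow> \<not> E v b"
  shows "nosep (P @ B) v"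
proof (rule nbr_cases[of B v])
  assume "\<And>b. b \<in> set B \<Longrightarrow> \<not> E v b"
  then show ?thesis using P by (intro nosep_none) auto
next
  fix X c Z assume "B = X @ c # Z" "\<And>b. b \<in> set (X @ Z) \<Longrightarrow> \<not> E v b"
  then show ?thesis using P by (intro nosep_one[of _ "P @ X" c Z]) auto
next
  fix X c M c' Z assume a: "B = X @ c # M @ c' # Z" "E v c" "E v c'" "\<And>b. b \<in> set (X @ Z) \<Longrightarrow> \<not> E v b"
  have "sp M = 0" using nosep_arc[OF F v a(1-3)] .
  then show ?thesis using P a by (intro nosep_inner[of _ "P @ X" c M c' Z]) auto
qed

text \<open>Bridging a nonempty stretch \<open>M\<close> by \<open>v\<close> is again a detour, so
  by minimality \<open>M\<close> is a single vertex that is not a spoke. Then \<open>v\<close> has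
  at most three neighbours on the cycle, and three is excluded.\<close>

lemma detour_nonnbr_no_arc_nbr:
  assumes m: "min_detour P B" and v: "v \<in> V" "v \<notin> C" "v \<noteq> x" "v \<notin> set P" "\<not> E v x" and pe: "pend P"
    and B: "\<And>b. b \<in> set B \<Longrightarrow> \<not> E v b"
  shows "nosep (P @ B) v \<and> card {h\<in>set (P @ B). E v h} \<le> 2"
proof (rule nbr_cases[of P v])
  assume n: "\<And>b. b \<in> set P \<Longrightarrow> \<not> E v b"
  then have "{h\<in>set (P @ B). E v h} = {}" using B by auto
  then show ?thesis using n B nosep_none[of "P @ B" v] by (metis (no_types, lifting) Un_iff card.empty set_append zero_le)
next
  fix X c Z assume a: "P = X @ c # Z" "\<And>b. b \<in> set (X @ Z) \<Longrightarrow> \<not> E v b"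
  then have "{h\<in>set (P @ B). E v h} \<subseteq> {c, c}" using B by auto
  then have "card {h\<in>set (P @ B). E v h} \<le> 2" by (rule card_pair_le)
  moreover have "nosep (P @ B) v" using a B by (intro nosep_one[of _ X c "Z @ B"]) auto
  ultimately show ?thesis by blast
next
  fix Pa pf M pj Pz assume P: "P = Pa @ pf # M @ pj # Pz" and e: "E v pf" "E v pj"
    and no: "\<And>b. b \<in> set (Pa @ Pz) \<Longrightarrow> \<not> E v b"
  have F: "detour P B" using m unfolding min_detour_def by blast
  note D = detourD[OF F]
  have xv: "\<not> E x v" using v(5) E_commute by blast
  have M: "sp M = 0 \<and> length M \<le> 1"
  proof (cases "M = []")
    case False
    have g: "gp (Pa @ [pf, v, pj] @ Pz)"
      using pend_bridge[of "Pa @ [pf]" M "pj # Pz" v] pe P False xv by simp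
    have "sp (Pa @ pf # M) \<le> 1" using pend_pre[of "Pa @ pf # M" "pj # Pz"] pe P by simp
    then have sM: "sp M \<le> 1" by simp
    have tot: "sp (Pa @ [pf, v, pj] @ Pz @ B) + sp M = sp (P @ B)" using P xv by simp
    have d: "detour (Pa @ [pf, v, pj] @ Pz) B"
      by (rule detour_short[OF F P False v(1-4) e _ g]) (use no B tot sM D(8,9) in \<open>auto simp: algebra_simps\<close>)
    have l: "length (Pa @ [pf, v, pj] @ Pz) + length M = length P + 1" "1 \<le> length M" using P False by (auto simp: Suc_le_eq)
    show ?thesis
    proof (rule ccontr)
      assume "\<not> (sp M = 0 \<and> length M \<le> 1)"
      then show False using min_detour_le[OF m d] l tot by (auto simp: algebra_simps)
    qed
  qed simp
  have ns: "nosep (P @ B) v" using P M no B by (intro nosep_inner[of _ Pa pf M pj "Pz @ B"]) auto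
  have "card {h\<in>set (P @ B). E v h} \<le> 2"
  proof (cases "\<exists>b\<in>set M. E v b")
    case True
    then obtain q where q: "M = [q]" "E v q" using M by (cases M) auto
    have "{h\<in>set (P @ B). E v h} = {pf, q, pj}" using P q e no B by auto
    moreover have "card {pf, q, pj} = 3" using icyc_distinct[OF D(1)] P q by auto
    moreover have "v \<notin> set (P @ B)" using v D(5) by auto
    ultimately show ?thesis using three_spokes[OF D(1) v(1)] by auto
  next
    case False
    then have "{h\<in>set (P @ B). E v h} \<subseteq> {pf, pj}" using P no B by auto
    then show ?thesis by (rule card_pair_le)
  qed
  then show ?thesis using ns by blast
qed

text \<open>If the two neighbours were separated, both cycles through \<open>v\<close> would have at
  least four spokes by \<open>two_nbrs\<close>, and each fewer than the detour. The half is chosen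
  so that the path does not grow: \<open>Pa\<close> is dropped if it is nonempty, and otherwise the
  path shrinks to \<open>[p, v]\<close>.\<close>

lemma detour_nonnbr_single:
  assumes m: "min_detour P B" and v: "v \<in> V" "v \<notin> C" "v \<noteq> x" "v \<notin> set P" "\<not> E v x" and pe: "pend P"
    and P: "P = Pa @ p # Pz" "E v p" "\<And>b. b \<in> set (Pa @ Pz) \<Longrightarrow> \<not> E v b"
    and B: "B = Ba @ y # Bb" "E v y" "\<And>b. b \<in> set (Ba @ Bb) \<Longrightarrow> \<not> E v b"
  shows "nosep (P @ B) v"
proof (rule ccontr)
  assume no: "\<not> ?thesis"
  have F: "detour P B" using m unfolding min_detour_def by blast
  note D = detourD[OF F]
  have xv: "\<not> E x v" using v(5) E_commute by blast
  have eq: "P @ B = Pa @ p # (Pz @ Ba) @ y # Bb" using P(1) B(1) by simp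
  have i: "0 < sp (Pz @ Ba)"
    using no nosep_inner[of "P @ B" Pa p "Pz @ Ba" y Bb v] eq P(3) B(3) by (metis Un_iff neq0_conv set_append)
  have o: "0 < sp (Pa @ Bb)"
    using no nosep_outer[of "P @ B" Pa p "Pz @ Ba" y Bb v] eq P(3) B(3) by (metis Un_iff neq0_conv set_append)
  have cyc: "icyc (p # (Pz @ Ba) @ y # (Bb @ Pa))" using icyc_rot[of Pa "p # (Pz @ Ba) @ y # Bb"] D(1) eq by simp
  have vB: "v \<notin> set B" using v D(5) by auto
  have tot: "sp (P @ B) = sp (p # (Pz @ Ba) @ y # (Bb @ Pa))" using eq by simp
  have 1: "4 \<le> sp (p # (Pz @ Ba) @ [y])"
    by (rule two_nbrs[OF cyc, of v]) (use v vB P B D(7,8) i o tot xv in auto)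
  have cyc': "icyc (y # (Bb @ Pa) @ p # (Pz @ Ba))" using icyc_rot[of "p # Pz @ Ba" "y # Bb @ Pa"] cyc by simp
  have 2: "4 \<le> sp (y # (Bb @ Pa) @ [p])"
    by (rule two_nbrs[OF cyc', of v]) (use v vB P B D(7,8) i o tot xv in auto)
  show False
  proof (cases "Pa = []")
    case False
    have g: "gp (v # p # Pz)" using pend_suf[of Pa "p # Pz" "[v]"] pe P xv by simp
    have "sp (v # p # Pz @ Ba @ [y]) + sp (Pa @ Bb) = sp (P @ B)" using tot xv by simp
    moreover have "4 \<le> sp (v # p # Pz @ Ba @ [y])" using 1 by simp
    moreover have d: "detour (v # p # Pz) (Ba @ [y])"
      by (rule detour_cut[OF F P(1) B(1) v(1-4) P(2) B(2) _ _ g]) (use P B False D(9) o calculation in auto)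
    moreover have "length (v # p # Pz) \<le> length P" using P(1) False by (cases Pa) auto
    ultimately show False using min_detour_le[OF m d] o by auto
  next
    case True
    have g: "gp (Pa @ [p, v])" using True xv unfolding gp_def by simp
    have "sp (Pa @ [p, v] @ y # Bb) + sp (Pz @ Ba) = sp (P @ B)" using tot xv by simp
    moreover have "4 \<le> sp (Pa @ [p, v] @ y # Bb)" using 2 by simp
    moreover have d: "detour (Pa @ [p, v]) (y # Bb)"
      by (rule detour_cut'[OF F P(1) B(1) v(1-4) P(2) B(2) _ _ g]) (use P B i D(9) calculation in auto)
    moreover have "length (Pa @ [p, v]) \<le> length P" using True detour_length2[OF F] by simp
    ultimately show False using min_detour_le[OF m d] i by auto
  qed
qed

text \<open>Pair the first path neighbour with the last arc neighbour, or the last path neighbour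
  with the first arc neighbour. The resulting cycles through \<open>v\<close> have at most two
  spokes, since with more they would be smaller detours. This is the situation excluded by
  \<open>mid_one_nbr\<close> and \<open>mid_two_nbrs\<close>.\<close>

lemma detour_nonnbr_multiple:
  assumes m: "min_detour P B" and v: "v \<in> V" "v \<notin> C" "v \<noteq> x" "v \<notin> set P" "\<not> E v x" and pe: "pend P"
    and P: "P = Pa @ pf # M @ pj # Pz" "E v pf" "E v pj" "\<And>b. b \<in> set (Pa @ Pz) \<Longrightarrow> \<not> E v b"
    and B: "\<exists>b\<in>set B. E v b"
  shows False
proof -
  have F: "detour P B" using m unfolding min_detour_def by blast
  note D = detourD[OF F]
  have xv: "\<not> E x v" using v(5) E_commute by blast
  have vB: "v \<notin> set (P @ B)" using v D(5) by auto
  have not3: "card {h\<in>set (P @ B). E v h} \<noteq> 3" using three_spokes[OF D(1) v(1) vB] by blast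
  have dist: "distinct (P @ B)" using icyc_distinct[OF D(1)] .
  have pp: "sp (Pa @ pf # M) \<le> 1" using pend_pre[of "Pa @ pf # M" "pj # Pz"] pe P by simp
  have h1: "sp (Pa @ [pf, v] @ y # Bd) \<le> 2"
    if B: "B = Bc @ y # Bd" "E v y" "\<And>b. b \<in> set Bd \<Longrightarrow> \<not> E v b" for Bc y Bd
  proof (rule ccontr)
    assume s: "\<not> ?thesis"
    have g: "gp (Pa @ [pf, v])" using pp xv unfolding gp_def by simp
    have le: "sp (Pa @ [pf, v] @ y # Bd) \<le> sp (P @ B)" using P(1) B(1) xv by simp
    have d: "detour (Pa @ [pf, v]) (y # Bd)"
      by (rule detour_cut'[OF F _ B(1) v(1-4) P(2) B(2) _ _ g, of "M @ pj # Pz"]) (use P B s le D(9) in auto)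
    \<comment> \<open>An exchange that saves no vertex would leave \<open>pf\<close>,
      \<open>pj\<close> and \<open>y\<close> as the only neighbours of \<open>v\<close>, and exactly
      three are impossible.\<close>
    have "length ((Pa @ [pf, v]) @ y # Bd) < length (P @ B)"
    proof (rule ccontr)
      assume "\<not> ?thesis"
      then have e: "M = []" "Pz = []" "Bc = []" using P(1) B(1) by auto
      have "{h\<in>set (P @ B). E v h} = {pf, pj, y}" using P B e by auto
      moreover have "card {pf, pj, y} = 3" using dist P(1) B(1) by auto
      ultimately show False using not3 by simp
    qed
    then show False using min_detour_le[OF m d] le P(1) by simp
  qed
  have h2: "sp (v # pj # Pz @ Ba @ [y]) \<le> 2"
    if B: "B = Ba @ y # Bb" "E v y" "\<And>b. b \<in> set Ba \<Longrightarrow> \<not> E v b" for Ba y Bb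
  proof (rule ccontr)
    assume s: "\<not> ?thesis"
    have g: "gp (v # pj # Pz)" using pend_suf[of "Pa @ pf # M" "pj # Pz" "[v]"] pe P xv by simp
    have le: "sp (v # pj # Pz @ Ba @ [y]) \<le> sp (P @ B)" using P(1) B(1) xv by simp
    have d: "detour (v # pj # Pz) (Ba @ [y])"
      by (rule detour_cut[OF F _ B(1) v(1-4) P(3) B(2) _ _ g, of "Pa @ pf # M"]) (use P B s le D(9) in auto)
    have "length ((v # pj # Pz) @ Ba @ [y]) < length (P @ B)"
    proof (rule ccontr)
      assume "\<not> ?thesis"
      then have e: "M = []" "Pa = []" "Bb = []" using P(1) B(1) by auto
      have "{h\<in>set (P @ B). E v h} = {pf, pj, y}" using P B e by auto
      moreover have "card {pf, pj, y} = 3" using dist P(1) B(1) by auto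
      ultimately show False using not3 by simp
    qed
    then show False using min_detour_le[OF m d] le P(1) by simp
  qed
  show False
  proof (rule nbr_cases[of B v])
    assume "\<And>b. b \<in> set B \<Longrightarrow> \<not> E v b"
    then show False using B by blast
  next
    fix Ba y Bd assume Y: "B = Ba @ y # Bd" "E v y" "\<And>b. b \<in> set (Ba @ Bd) \<Longrightarrow> \<not> E v b"
    have cyc: "icyc (y # (Bd @ Pa) @ pf # M @ pj # (Pz @ Ba))"
      using icyc_rot[of "P @ Ba" "y # Bd"] D(1) P(1) Y(1) by simp
    have tot: "sp (P @ B) = sp (y # (Bd @ Pa) @ pf # M @ pj # (Pz @ Ba))" using P(1) Y(1) by simp
    have 1: "sp (y # (Bd @ Pa) @ [pf]) \<le> 2" using h1[OF Y(1,2)] Y(3) xv by (simp add: algebra_simps)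
    have 2: "sp (pj # (Pz @ Ba) @ [y]) \<le> 2" using h2[OF Y(1,2)] Y(3) xv by (simp add: algebra_simps)
    show False
      by (rule mid_one_nbr[OF cyc, of v]) (use v vB P Y D(7,8) tot pp 1 2 in auto)
  next
    fix Ba y' G y Bd assume Y: "B = Ba @ y' # G @ y # Bd" "E v y'" "E v y" "\<And>b. b \<in> set (Ba @ Bd) \<Longrightarrow> \<not> E v b"
    have sG: "sp G = 0" using nosep_arc[OF F v(1-3) Y(1-3)] .
    have nG: "\<not> E v b" if "b \<in> set G" for b
    proof
      assume e: "E v b"
      have "finite {h\<in>C. E v h}" using C_cyc by (metis finite_Collect_conjI finite_set Collect_mem_eq)
      moreover have "{y', b, y} \<subseteq> {h\<in>C. E v h}" using Y e that D(5) by auto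
      ultimately have "card {y', b, y} \<le> 2" using C_two[OF v(1-3,5)] card_mono by (meson order_trans)
      moreover have "b \<noteq> y'" "b \<noteq> y" "y' \<noteq> y" using dist Y(1) that by auto
      ultimately show False by (auto simp: card_insert_if)
    qed
    have cyc: "icyc (y # (Bd @ Pa) @ pf # M @ pj # (Pz @ Ba) @ y' # G)"
      using icyc_rot[of "P @ Ba @ y' # G" "y # Bd"] D(1) P(1) Y(1) by simp
    have tot: "sp (P @ B) = sp (y # (Bd @ Pa) @ pf # M @ pj # (Pz @ Ba) @ y' # G)" using P(1) Y(1) by simp
    have 1: "sp (y # (Bd @ Pa) @ [pf]) \<le> 2" using h1[of "Ba @ y' # G" y Bd] Y xv by (simp add: algebra_simps)
    have 2: "sp (pj # (Pz @ Ba) @ [y']) \<le> 2" using h2[of Ba y' "G @ y # Bd"] Y xv by (simp add: algebra_simps)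
    show False
      by (rule mid_two_nbrs[OF cyc, of v]) (use v vB P Y D(7,8) tot pp 1 2 sG nG in auto)
  qed
qed

text \<open>With exactly one neighbour on the path, \<open>C_two\<close> allows at most two on the
  arc, and excluding the total three leaves just one there.\<close>

lemma detour_nonnbr:
  assumes m: "min_detour P B" and v: "v \<in> V" "v \<notin> C" "v \<noteq> x" "v \<notin> set P" "\<not> E v x" and pe: "pend P"
  shows "nosep (P @ B) v \<and> card {h\<in>set (P @ B). E v h} \<le> 2"
proof (cases "\<exists>b\<in>set B. E v b")
  case False
  then show ?thesis using detour_nonnbr_no_arc_nbr[OF m v pe] by blast
next
  case B: True
  have F: "detour P B" using m unfolding min_detour_def by blast
  note D = detourD[OF F]
  show ?thesis
  proof (rule nbr_cases[of P v])
    assume "\<And>b. b \<in> set P \<Longrightarrow> \<not> E v b"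
    then show ?thesis using detour_no_path_nbr[OF F v(1-3)] detour_nonnbr_no_path_nbr[OF F v] by blast
  next
    fix Pa pf M pj Pz assume "P = Pa @ pf # M @ pj # Pz" "E v pf" "E v pj" "\<And>b. b \<in> set (Pa @ Pz) \<Longrightarrow> \<not> E v b"
    then show ?thesis using detour_nonnbr_multiple[OF m v pe] B by blast
  next
    fix Pa p Pz assume P: "P = Pa @ p # Pz" "E v p" "\<And>b. b \<in> set (Pa @ Pz) \<Longrightarrow> \<not> E v b"
    have vB: "v \<notin> set (P @ B)" using v D(5) by auto
    have dist: "distinct (P @ B)" using icyc_distinct[OF D(1)] .
    have fin: "finite {h\<in>C. E v h}" using C_cyc by (metis finite_Collect_conjI finite_set Collect_mem_eq)
    have pC: "p \<notin> {h\<in>C. E v h}" using P(1) D(4) by auto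
    have "{h\<in>set (P @ B). E v h} = insert p {h\<in>set B. E v h}" using P by auto
    moreover have B2: "card {h\<in>set B. E v h} \<le> 2"
    proof -
      have "card {h\<in>set B. E v h} \<le> card {h\<in>C. E v h}" by (rule card_mono[OF fin]) (use D(5) in auto)
      then show ?thesis using C_two[OF v(1-3,5)] by linarith
    qed
    moreover have "p \<notin> {h\<in>set B. E v h}" using dist P(1) by auto
    ultimately have c: "card {h\<in>set (P @ B). E v h} = Suc (card {h\<in>set B. E v h})" by simp
    then have c2: "card {h\<in>set B. E v h} \<le> 1" using three_spokes[OF D(1) v(1) vB] B2 by fastforce
    obtain Ba y Bb where Y: "B = Ba @ y # Bb" "E v y" using B by (metis split_list)
    have "\<not> E v b" if "b \<in> set (Ba @ Bb)" for b
    proof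
      assume e: "E v b"
      have "b = y" by (rule card_le_one_eq[OF _ c2]) (use e that Y in auto)
      then show False using that dist Y(1) by auto
    qed
    then have "nosep (P @ B) v" using detour_nonnbr_single[OF m v pe P Y] by blast
    then show ?thesis using c c2 by simp
  qed
qed

end

section \<open>Neighbours of the hub against a minimal detour\<close>

context hub
begin

text \<open>The later of two spokes is taken because \<open>hub_nbr_leg\<close> needs a nonempty
  stretch in front of its spoke.\<close>

lemma last_spoke_leg:
  assumes "2 \<le> sp L"
  obtains X q Y where "L = X @ q # Y" "E x q" "X \<noteq> []"
proof -
  obtain A q M q' B where "L = A @ q # M @ q' # B" "E x q'" by (rule outer_spokes[OF assms]) (rule that)
  then show thesis using that[of "A @ q # M" q' B] by simp
qed

lemma not_two_triangles:
  assumes "E x v" "E x u" "E v u" "E x w" "E v w"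
  shows "u = w"
proof -
  have "{u, v} = {w, v}" using triangle_unique[of x u v w v] assms E_commute by blast
  then show ?thesis using assms E_irrefl by blast
qed

end

context wheel_ctx
begin

text \<open>The shape of an improper neighbour of \<open>x\<close>. Here \<open>e\<close> is the
  last spoke of the arc, \<open>b\<close> the one before it and \<open>u\<close> the first spoke of
  the path, so \<open>e\<close> is the common end of the two sectors that end at \<open>b\<close>
  and at \<open>u\<close>. The vertex sees both sectors and nothing of \<open>P2 @ Bt\<close>, the
  far side of the cycle. The mirror image at the first spoke of the arc is
  \<open>obs (rev P) (rev B)\<close>.\<close>

definition obs :: "'a list \<Rightarrow> 'a list \<Rightarrow> 'a \<Rightarrow> bool" where
  "obs P B v \<longleftrightarrow> (\<exists>P1 u P2 Bt b Bm e Bs. P = P1 @ u # P2 \<and> E x u \<and> sp P1 = 0 \<and> B = Bt @ b # Bm @ e # Bs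
     \<and> E x b \<and> E x e \<and> sp Bm = 0 \<and> sp Bs = 0 \<and> (\<exists>p\<in>set P1. E v p) \<and> (\<exists>y\<in>set (b # Bm). E v y)
     \<and> (\<forall>p\<in>set (P2 @ Bt). \<not> E v p))"

text \<open>\<open>y2\<close> and \<open>y1\<close> are the first and the last neighbour on the arc,
  possibly equal. The inequalities hold because no spoke lies strictly between them.\<close>

lemma arc_nbrs:
  assumes F: "detour P B" and v: "v \<in> V" "v \<notin> C" "v \<noteq> x" and B: "\<exists>b\<in>set B. E v b"
  obtains Ba y2 Bb Bc y1 Bd where "B = Ba @ y2 # Bb" "E v y2" "\<And>b. b \<in> set Ba \<Longrightarrow> \<not> E v b"
    "B = Bc @ y1 # Bd" "E v y1" "\<And>b. b \<in> set Bd \<Longrightarrow> \<not> E v b"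
    "sp B \<le> sp (Ba @ [y2]) + sp (y1 # Bd)" "sp Bc \<le> sp (Ba @ [y2])" "sp Bb \<le> sp (y1 # Bd)"
    "\<not> E x y2 \<Longrightarrow> sp Bc = sp Ba" "\<not> E x y1 \<Longrightarrow> sp Bb = sp Bd"
proof (rule nbr_cases[of B v])
  assume "\<And>b. b \<in> set B \<Longrightarrow> \<not> E v b"
  then show thesis using B by blast
next
  fix X c Z assume "B = X @ c # Z" "E v c" "\<And>b. b \<in> set (X @ Z) \<Longrightarrow> \<not> E v b"
  then show thesis using that[of X c Z X c Z] by simp
next
  fix X c M c' Z assume a: "B = X @ c # M @ c' # Z" "E v c" "E v c'" "\<And>b. b \<in> set (X @ Z) \<Longrightarrow> \<not> E v b"
  have "sp M = 0" using nosep_arc[OF F v a(1-3)] .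
  then show thesis using that[of X c "M @ c' # Z" "X @ c # M" c' Z] a by simp
qed

text \<open>With two spokes on \<open>y1 # Bd\<close> the cut through \<open>pf\<close>,
  \<open>v\<close> and \<open>y1\<close> is a smaller detour, unless \<open>pf\<close> is the last
  vertex of the path and the path would grow. In that case the cut towards the first arc neighbour
  \<open>y2\<close> leaves only one spoke on \<open>Ba @ [y2]\<close>, and this arc together with a
  later spoke is excluded by \<open>hub_nbr_leg\<close>.\<close>

lemma hub_nbr_clean_aux:
  assumes m: "min_detour P B" and v: "v \<in> V" "v \<notin> C" "v \<noteq> x" "v \<notin> set P" "E v x" and s: "sp P = 0"
    and P: "P = Pa @ pf # Pm" "E v pf" "\<And>b. b \<in> set Pa \<Longrightarrow> \<not> E v b"
    and B: "B = Bc @ y1 # Bd" "E v y1" "\<And>b. b \<in> set Bd \<Longrightarrow> \<not> E v b" and Bc: "0 < sp Bc"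
  shows "sp (y1 # Bd) \<le> 1"
proof (rule ccontr)
  assume big: "\<not> ?thesis"
  have F: "detour P B" using m unfolding min_detour_def by blast
  note D = detourD[OF F]
  have xv: "E x v" using v(5) E_commute by blast
  have vB: "v \<notin> set (P @ B)" using v D(5) by auto
  have dist: "distinct (P @ B)" using icyc_distinct[OF D(1)] .
  have sPa: "sp Pa = 0" "sp Pm = 0" "\<not> E x pf" using s P(1) by (auto split: if_splits)
  have sB: "4 \<le> sp B" using D(8) s by simp
  show False
  proof (cases "Pm = []")
    case False
    have le: "sp (Pa @ [pf, v] @ y1 # Bd) \<le> sp (P @ B)" using s sPa xv B(1) Bc by simp
    have d: "detour (Pa @ [pf, v]) (y1 # Bd)"
      by (rule detour_cut'[OF F P(1) B(1) v(1-4) P(2) B(2)])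
        (use P B False le D(9) big sPa xv in \<open>auto simp: gp_def\<close>)
    have "length (Pa @ [pf, v]) \<le> length P" using P(1) False by (cases Pm) auto
    moreover have "length ((Pa @ [pf, v]) @ y1 # Bd) < length (P @ B)"
      using P(1) B(1) False Bc by (cases Pm; cases Bc) auto
    ultimately show False using min_detour_le[OF m d] le by simp
  next
    case True
    have Pa: "Pa \<noteq> []" using detour_length2[OF F] P(1) True by auto
    have "\<exists>b\<in>set B. E v b" using B by auto
    then obtain Ba y2 Bb Bc' y1' Bd' where Y: "B = Ba @ y2 # Bb" "E v y2" "\<And>b. b \<in> set Ba \<Longrightarrow> \<not> E v b"
      "B = Bc' @ y1' # Bd'" "E v y1'" "\<And>b. b \<in> set Bd' \<Longrightarrow> \<not> E v b"
      "sp Bc' \<le> sp (Ba @ [y2])"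
      by (rule arc_nbrs[OF F v(1-3)]) (rule that)
    have same: "Bc' = Bc \<and> Bd' = Bd"
    proof -
      obtain W where "Bc' = Bc @ W \<and> W @ y1' # Bd' = y1 # Bd \<or> Bc' @ W = Bc \<and> y1' # Bd' = W @ y1 # Bd"
        using Y(4) B(1) append_eq_append_conv2[of Bc' "y1' # Bd'" Bc "y1 # Bd"] by auto
      then show ?thesis
      proof
        assume W: "Bc' = Bc @ W \<and> W @ y1' # Bd' = y1 # Bd"
        then show ?thesis using B(3) Y(5) by (cases W) auto
      next
        assume W: "Bc' @ W = Bc \<and> y1' # Bd' = W @ y1 # Bd"
        then show ?thesis using B(2) Y(6) by (cases W) auto
      qed
    qed
    have Bd: "1 \<le> sp Bd" using big by (auto split: if_splits)
    have BbW: "\<exists>W. Bb = W @ Bd"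
    proof -
      obtain W where "Ba = Bc @ W \<and> W @ y2 # Bb = y1 # Bd \<or> Ba @ W = Bc \<and> y2 # Bb = W @ y1 # Bd"
        using Y(1) B(1) append_eq_append_conv2[of Ba "y2 # Bb" Bc "y1 # Bd"] by auto
      then show ?thesis
      proof
        assume W: "Ba = Bc @ W \<and> W @ y2 # Bb = y1 # Bd"
        then show ?thesis using B(3) Y(2) by (cases W) auto
      next
        assume W: "Ba @ W = Bc \<and> y2 # Bb = W @ y1 # Bd"
        then show ?thesis by (cases W) auto
      qed
    qed
    then have spBb: "1 \<le> sp Bb" using Bd by auto
    have Ba1: "sp (Ba @ [y2]) \<le> 1"
    proof (rule ccontr)
      assume no: "\<not> ?thesis"
      have eq: "sp (v # pf # Pm @ Ba @ [y2]) + sp Bb = sp (P @ B) + 1" using s sPa xv Y(1) by simp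
      then have le: "sp (v # pf # Pm @ Ba @ [y2]) \<le> sp (P @ B)" using spBb by linarith
      have d: "detour (v # pf # Pm) (Ba @ [y2])"
        by (rule detour_cut[OF F P(1) Y(1) v(1-4) P(2) Y(2)])
          (use P Y Pa le D(9) no sPa xv True in \<open>auto simp: gp_def\<close>)
      have "length (v # pf # Pm) \<le> length P" using P(1) True Pa by (cases Pa) auto
      moreover have "length ((v # pf # Pm) @ Ba @ [y2]) < length (P @ B)"
        using P(1) Y(1) True Pa spBb by (cases Pa; cases Bb) auto
      ultimately show False using min_detour_le[OF m d] le by simp
    qed
    moreover have "sp Bc \<le> sp (Ba @ [y2])" using Y(7) same by simp
    ultimately have e1: "sp (Ba @ [y2]) = 1" "sp Bc = 1" using Bc by linarith+
    then have "2 \<le> sp Bd" using sB B(1) by (auto split: if_splits)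
    then obtain X q W where q: "Bd = X @ q # W" "E x q" "X \<noteq> []" by (rule last_spoke_leg)
    obtain W' where W': "Bb = W' @ X @ q # W" using BbW q by auto
    have cyc: "icyc (pf # Ba @ y2 # (W' @ X) @ q # (W @ Pa))"
      using icyc_rot[of Pa "pf # Ba @ y2 # W' @ X @ q # W"] D(1) P(1) True Y(1) W' by simp
    show False
      by (rule hub_nbr_leg[OF cyc, of v])
        (use v vB P Y(1-3) W' q D(7) e1 sPa True B(3) in auto)
  qed
qed

text \<open>Both outer stretches of the arc carry at most one spoke, whereas a path without spokes
  leaves at least four to the arc.\<close>

lemma hub_nbr_clean:
  assumes m: "min_detour P B" and v: "v \<in> V" "v \<notin> C" "v \<noteq> x" "v \<notin> set P" "E v x" and s: "sp P = 0"
    and P: "\<exists>b\<in>set P. E v b" and B: "\<exists>b\<in>set B. E v b"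
  shows "nosep (P @ B) v"
proof (rule ccontr)
  assume no: "\<not> ?thesis"
  have F: "detour P B" using m unfolding min_detour_def by blast
  note D = detourD[OF F]
  obtain Ba y2 Bb Bc y1 Bd where Y: "B = Ba @ y2 # Bb" "E v y2" "\<And>b. b \<in> set Ba \<Longrightarrow> \<not> E v b"
    "B = Bc @ y1 # Bd" "E v y1" "\<And>b. b \<in> set Bd \<Longrightarrow> \<not> E v b"
    "sp B \<le> sp (Ba @ [y2]) + sp (y1 # Bd)" by (rule arc_nbrs[OF F v(1-3) B]) (rule that)
  obtain Pa pf Pm where Pi: "P = Pa @ pf # Pm" "E v pf" "\<And>b. b \<in> set Pa \<Longrightarrow> \<not> E v b" by (rule first_nbr[OF P]) (rule that)
  obtain Pn pj Pz where Pj: "P = Pn @ pj # Pz" "E v pj" "\<And>b. b \<in> set Pz \<Longrightarrow> \<not> E v b" by (rule last_nbr[OF P]) (rule that)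
  have sP: "sp Pa = 0" "sp Pm = 0" using s Pi(1) by auto
  have sP': "sp Pn = 0" "sp Pz = 0" using s Pj(1) by auto
  have Bc: "0 < sp Bc"
  proof (rule ccontr)
    assume "\<not> 0 < sp Bc"
    then have "nosep (P @ B) v" using Pi Y sP by (intro nosep_inner[of _ Pa pf "Pm @ Bc" y1 Bd]) auto
    then show False using no by blast
  qed
  have Bb: "0 < sp Bb"
  proof (rule ccontr)
    assume "\<not> 0 < sp Bb"
    then have "nosep (P @ B) v" using Pj Y sP' by (intro nosep_outer[of _ Pn pj "Pz @ Ba" y2 Bb]) auto
    then show False using no by blast
  qed
  have 1: "sp (y1 # Bd) \<le> 1" using hub_nbr_clean_aux[OF m v s Pi Y(4-6) Bc] .
  have 2: "sp (y2 # rev Ba) \<le> 1"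
    by (rule hub_nbr_clean_aux[OF min_detour_rev[OF m] v(1-3) _ v(5), of "rev Pz" pj "rev Pn" "rev Bb" y2 "rev Ba"])
      (use v s Pj Y(1-3) Bb in auto)
  have "4 \<le> sp B" using D(8) s by simp
  then show False using Y(7) 1 2 by simp
qed

text \<open>A spoke strictly between two path neighbours is the only spoke of the path: if there
  were two, \<open>v\<close> would see the later one, and its triangle with \<open>x\<close> would
  be a second one besides that of the two spokes. Bridging \<open>M\<close> by \<open>v\<close>
  keeps the number of spokes and shortens the path, unless \<open>M\<close> is just the spoke, and
  then \<open>hub_nbr_leg\<close> applies.\<close>

lemma hub_nbr_no_arc_nbr:
  assumes m: "min_detour P B" and v: "v \<in> V" "v \<notin> C" "v \<noteq> x" "v \<notin> set P" "E v x" and pe: "pend P"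
    and B: "\<And>b. b \<in> set B \<Longrightarrow> \<not> E v b"
  shows "nosep (P @ B) v"
proof (rule nbr_cases[of P v])
  assume "\<And>b. b \<in> set P \<Longrightarrow> \<not> E v b"
  then show ?thesis using B by (intro nosep_none) auto
next
  fix X c Z assume "P = X @ c # Z" "\<And>b. b \<in> set (X @ Z) \<Longrightarrow> \<not> E v b"
  then show ?thesis using B by (intro nosep_one[of _ X c "Z @ B"]) auto
next
  fix Pa pf M pj Pz assume P: "P = Pa @ pf # M @ pj # Pz" and e: "E v pf" "E v pj"
    and no: "\<And>b. b \<in> set (Pa @ Pz) \<Longrightarrow> \<not> E v b"
  have F: "detour P B" using m unfolding min_detour_def by blast
  note D = detourD[OF F]
  have xv: "E x v" using v(5) E_commute by blast
  have vB: "v \<notin> set (P @ B)" using v D(5) by auto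
  have dist: "distinct (P @ B)" using icyc_distinct[OF D(1)] .
  have "sp M = 0"
  proof (rule ccontr)
    assume sM: "sp M \<noteq> 0"
    have pp: "sp (Pa @ pf # M) \<le> 1" using pend_pre[of "Pa @ pf # M" "pj # Pz"] pe P by simp
    then have M1: "sp M = 1" "sp Pa = 0" "\<not> E x pf" using sM by (auto split: if_splits)
    have P1: "sp (pj # Pz) = 0"
    proof (rule ccontr)
      assume "sp (pj # Pz) \<noteq> 0"
      then have "2 \<le> sp ((Pa @ pf # M) @ pj # Pz)" using M1 by auto
      moreover have "pend ((Pa @ pf # M) @ pj # Pz)" using pe P by simp
      ultimately obtain u u' Q where Q: "(Pa @ pf # M) @ pj # Pz = Q @ [u, u']" "sp Q = 0" "E x u" "E x u'"
        using pend_split by blast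
      have "Pz = []"
      proof (rule ccontr)
        assume "Pz \<noteq> []"
        then obtain Z' z where Z: "Pz = Z' @ [z]" by (metis append_butlast_last_id)
        then have "((Pa @ pf # M) @ pj # Z') @ [z] = (Q @ [u]) @ [u']" using Q(1) by simp
        then have "(Pa @ pf # M) @ pj # Z' = Q @ [u]" using append1_eq_conv by blast
        then have "\<exists>W. Q = (Pa @ pf # M) @ W" by (cases Z' rule: rev_cases) auto
        then show False using Q(2) sM by auto
      qed
      then have "(Pa @ pf # M) @ [pj] = (Q @ [u]) @ [u']" using Q(1) by simp
      then have "Pa @ pf # M = Q @ [u]" "pj = u'" using append1_eq_conv by blast+
      have uP: "u \<in> set P" "u \<noteq> u'" "E u u'"
      proof -
        have P': "P @ B = Q @ [u, u'] @ B" using P Q(1) by simp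
        then show "u \<in> set P" "u \<noteq> u'" using dist P Q(1) by auto
        have "ipath [u, u']" using icyc_sub[of Q "[u, u']" B] D(1) D(3) P' by simp
        then show "E u u'" by simp
      qed
      have "v = u" using not_two_triangles[of u' v u] xv Q e(2) \<open>pj = u'\<close> uP E_commute by blast
      then show False using uP v by blast
    qed
    have sPz: "sp Pz = 0" "\<not> E x pj" using P1 by (auto split: if_splits)
    have sP: "sp P = 1" using P M1 sPz by simp
    have Mne: "M \<noteq> []" using sM by auto
    show False
    proof (cases "length M \<le> 1")
      case False
      have d: "detour (Pa @ [pf, v, pj] @ Pz) B"
        by (rule detour_short[OF F P Mne v(1-4) e])
          (use no B xv M1 sPz sP D(8,9) in \<open>auto simp: gp_def\<close>)
      moreover have "length (Pa @ [pf, v, pj] @ Pz) < length P" using P False by simp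
      ultimately show False using min_detour_less[OF m] by blast
    next
      case True
      then obtain u where u: "M = [u]" using Mne by (cases M) auto
      have ux: "E x u" using u M1 by (auto split: if_splits)
      have "ipath [pf, u]" using icyc_sub[of Pa "[pf, u]" "pj # Pz @ B"] D(1) P u by simp
      then have pu: "E pf u" by simp
      have vu: "\<not> E v u"
      proof
        assume "E v u"
        then have "{pf, v} = {x, v}" using triangle_unique[of u pf v x v] e pu ux xv E_commute by blast
        then show False using D(4) P v by auto
      qed
      have "2 \<le> sp B" using detour_spokes(3)[OF F] .
      then obtain X q W where q: "B = X @ q # W" "E x q" "X \<noteq> []" by (rule last_spoke_leg)
      have cyc: "icyc (pf # [u] @ pj # (Pz @ X) @ q # (W @ Pa))"
        using icyc_rot[of Pa "pf # u # pj # Pz @ B"] D(1) P u q by simp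
      show False
        by (rule hub_nbr_leg[OF cyc, of v]) (use v vB P u q D(7) e ux M1 sPz no B vu in auto)
    qed
  qed
  then show ?thesis using P no B by (intro nosep_inner[of _ Pa pf M pj "Pz @ B"]) auto
qed

text \<open>There is at most one spoke on \<open>y1 # Bd\<close>, because a cut at \<open>pf\<close>
  through \<open>v\<close> would otherwise be smaller; where it saves no vertex,
  \<open>hub_nbr_leg\<close> applies. There is exactly one, as the neighbours would not be separated
  otherwise. It becomes \<open>e\<close>, and the last spoke before \<open>y1\<close> becomes
  \<open>b\<close>.\<close>

lemma hub_nbr_one_side:
  assumes m: "min_detour P B" and v: "v \<in> V" "v \<notin> C" "v \<noteq> x" "v \<notin> set P" "E v x"
    and P: "P = P1 @ u # P2" "E x u" "sp P1 = 0" and n1: "\<exists>p\<in>set P1. E v p" and n2: "\<And>p. p \<in> set P2 \<Longrightarrow> \<not> E v p"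
    and B: "\<exists>b\<in>set B. E v b" and no: "\<not> nosep (P @ B) v"
  shows "obs P B v"
proof -
  have F: "detour P B" using m unfolding min_detour_def by blast
  note D = detourD[OF F]
  have xv: "E x v" using v(5) E_commute by blast
  have vB: "v \<notin> set (P @ B)" using v D(5) by auto
  have dist: "distinct (P @ B)" using icyc_distinct[OF D(1)] .
  obtain Ba y2 Bb Bc y1 Bd where Y: "B = Ba @ y2 # Bb" "E v y2" "\<And>b. b \<in> set Ba \<Longrightarrow> \<not> E v b"
    "B = Bc @ y1 # Bd" "E v y1" "\<And>b. b \<in> set Bd \<Longrightarrow> \<not> E v b"
    "sp B \<le> sp (Ba @ [y2]) + sp (y1 # Bd)" "sp Bc \<le> sp (Ba @ [y2])" "sp Bb \<le> sp (y1 # Bd)"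
    by (rule arc_nbrs[OF F v(1-3) B]) (rule that)
  obtain Pa pf Pm where Pi: "P1 = Pa @ pf # Pm" "E v pf" "\<And>b. b \<in> set Pa \<Longrightarrow> \<not> E v b" by (rule first_nbr[OF n1]) (rule that)
  have sP: "sp Pa = 0" "sp Pm = 0" "\<not> E x pf" using P(3) Pi(1) by (auto split: if_splits)
  have P': "P = Pa @ pf # (Pm @ u # P2)" using P(1) Pi(1) by simp
  have small: "sp (y1 # Bd) \<le> 1"
  proof (rule ccontr)
    assume big: "\<not> ?thesis"
    have le: "sp (Pa @ [pf, v] @ y1 # Bd) \<le> sp (P @ B)" using P sP xv Y(4) by simp
    have d: "detour (Pa @ [pf, v]) (y1 # Bd)"
      by (rule detour_cut'[OF F P' Y(4) v(1-4) Pi(2) Y(5)])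
        (use Pi(3) Y(6) le D(9) big sP xv in \<open>auto simp: gp_def\<close>)
    have ex: "Pm = [] \<and> P2 = [] \<and> Bc = []"
    proof (rule ccontr)
      assume "\<not> ?thesis"
      then have "length ((Pa @ [pf, v]) @ y1 # Bd) < length (P @ B)" using P' Y(4) by auto
      then show False using min_detour_le[OF m d] le P' by simp
    qed
    then have P'': "P = Pa @ [pf, u]" and B': "B = y1 # Bd" using P' Y(4) by auto
    have "ipath [pf, u]" using icyc_sub[of Pa "[pf, u]" B] D(1,3) P'' by simp
    then have pu: "E pf u" by simp
    have "ipath [u, y1]" using icyc_sub[of "Pa @ [pf]" "[u, y1]" Bd] D(1) P'' B' by simp
    then have uy: "E u y1" by simp
    have vu: "\<not> E v u"
    proof
      assume "E v u"
      then have "{pf, v} = {x, v}" using triangle_unique[of u pf v x v] Pi(2) pu P(2) xv E_commute by blast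
      then show False using D(4) P'' v by auto
    qed
    have y1: "\<not> E x y1"
    proof
      assume "E x y1"
      then have "v = u" using not_two_triangles[of y1 v u] xv Y(5) uy P(2) E_commute by blast
      then show False using v P'' by auto
    qed
    then have "2 \<le> sp Bd" using big by simp
    then obtain X q W where q: "Bd = X @ q # W" "E x q" "X \<noteq> []" by (rule last_spoke_leg)
    have cyc: "icyc (pf # [u] @ y1 # X @ q # (W @ Pa))"
      using icyc_rot[of Pa "pf # u # B"] D(1) P'' B' q by simp
    show False
      by (rule hub_nbr_leg[OF cyc, of v]) (use v vB P'' B' q D(7) Pi Y(5,6) P(2) sP vu y1 in auto)
  qed
  have ex: "\<exists>b\<in>set (P1 @ [u]). E v b" using n1 by auto
  obtain Pn pj Pz where Pj: "P1 @ [u] = Pn @ pj # Pz" "E v pj" "\<And>b. b \<in> set Pz \<Longrightarrow> \<not> E v b" by (rule last_nbr[OF ex]) (rule that)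
  have PnP: "P = Pn @ pj # (Pz @ P2)" using P(1) Pj(1) by (metis append.assoc append_Cons append_Nil)
  have sPn: "sp Pn = 0"
  proof -
    have "\<exists>W. P1 = Pn @ W" using Pj(1) by (cases Pz rule: rev_cases) auto
    then show ?thesis using P(3) by auto
  qed
  have Bb: "0 < sp Bb"
  proof (rule ccontr)
    assume "\<not> 0 < sp Bb"
    then have "nosep (P @ B) v" using PnP Pj Y n2 sPn by (intro nosep_outer[of _ Pn pj "(Pz @ P2) @ Ba" y2 Bb]) auto
    then show False using no by blast
  qed
  have one: "sp (y1 # Bd) = 1" using small Bb Y(9) by linarith
  have "2 \<le> sp B" using detour_spokes(3)[OF F] .
  then have Bc1: "0 < sp Bc" using one Y(4) by auto
  have "0 < sp (y1 # Bd)" using one by simp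
  then obtain W1 e Bs where e: "y1 # Bd = W1 @ e # Bs" "E x e" "sp W1 = 0" by (rule first_spoke)
  have Bs: "sp Bs = 0" using one e by (auto split: if_splits)
  obtain Bt b W2 where b: "Bc = Bt @ b # W2" "E x b" "sp W2 = 0" using last_spoke[OF Bc1] .
  have B': "B = Bt @ b # (W2 @ W1) @ e # Bs" using Y(4) e b by simp
  \<comment> \<open>A neighbour before \<open>b\<close> would have the spoke \<open>b\<close>
    between itself and \<open>y1\<close>.\<close>
  have nbt: "\<not> E v p" if p: "p \<in> set Bt" for p
  proof
    assume ep: "E v p"
    obtain T1 T2 where T: "Bt = T1 @ p # T2" using p by (meson split_list)
    have "sp (T2 @ b # W2) = 0"
      by (rule nosep_arc[OF F v(1-3), of T1 p "T2 @ b # W2" y1 Bd]) (use T ep Y(4,5) b in auto)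
    then show False using b by simp
  qed
  have ny: "\<exists>y\<in>set (b # W2 @ W1). E v y"
  proof (rule ccontr)
    assume n: "\<not> ?thesis"
    then have "W1 = []" using e Y(5) by (cases W1) auto
    then have y1e: "y1 = e" "Bd = Bs" using e by auto
    have free: "\<not> E v p" if "p \<in> set Bc" for p using that nbt n b by auto
    have "nosep (P @ B) v"
      by (rule nosep_outer[of _ Pn pj "(Pz @ P2) @ Bc" y1 Bd]) (use PnP Y(4) Pj(3) n2 free sPn Bs y1e in auto)
    then show False using no by blast
  qed
  show ?thesis unfolding obs_def
    by (rule exI[of _ P1], rule exI[of _ u], rule exI[of _ P2], rule exI[of _ Bt], rule exI[of _ b],
        rule exI[of _ "W2 @ W1"], rule exI[of _ e], rule exI[of _ Bs])
      (use P B' b e Bs n1 n2 nbt ny in auto)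
qed

text \<open>A neighbour beyond \<open>u\<close> makes the cut path \<open>Pa @ [pf, v]\<close>
  strictly shorter than \<open>P\<close>, so spokes need not be compared.\<close>

lemma hub_nbr_two_sides:
  assumes m: "min_detour P B" and v: "v \<in> V" "v \<notin> C" "v \<noteq> x" "v \<notin> set P" "E v x"
    and P: "P = P1 @ u # P2" "E x u" "sp P1 = 0" and n1: "\<exists>p\<in>set P1. E v p" and n2: "\<exists>p\<in>set P2. E v p"
    and B: "B = Bc @ y1 # Bd" "E v y1" "\<And>b. b \<in> set Bd \<Longrightarrow> \<not> E v b"
  shows "sp (y1 # Bd) \<le> 1"
proof (rule ccontr)
  assume big: "\<not> ?thesis"
  have F: "detour P B" using m unfolding min_detour_def by blast
  note D = detourD[OF F]
  have xv: "E x v" using v(5) E_commute by blast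
  obtain Pa pf Pm where Pi: "P1 = Pa @ pf # Pm" "E v pf" "\<And>b. b \<in> set Pa \<Longrightarrow> \<not> E v b" by (rule first_nbr[OF n1]) (rule that)
  have sP: "sp Pa = 0" "sp Pm = 0" "\<not> E x pf" using P(3) Pi(1) by (auto split: if_splits)
  have P': "P = Pa @ pf # (Pm @ u # P2)" using P(1) Pi(1) by simp
  have le: "sp (Pa @ [pf, v] @ y1 # Bd) \<le> sp (P @ B)" using P sP xv B(1) by simp
  have d: "detour (Pa @ [pf, v]) (y1 # Bd)"
    by (rule detour_cut'[OF F P' B(1) v(1-4) Pi(2) B(2)])
      (use Pi(3) B(3) le D(9) big sP xv in \<open>auto simp: gp_def\<close>)
  have "P2 \<noteq> []" using n2 by auto
  then have "length (Pa @ [pf, v]) < length P" using P' by (cases P2) auto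
  then show False using min_detour_less[OF m d] by blast
qed

lemma hub_nbr_at_spoke:
  assumes m: "min_detour P B" and v: "v \<in> V" "v \<notin> C" "v \<noteq> x" "v \<notin> set P" "E v x"
    and P: "P = P1 @ u # P2" "E x u" "sp P1 = 0" "sp P2 = 0" "E v u" "\<And>b. b \<in> set (P1 @ P2) \<Longrightarrow> \<not> E v b"
    and B: "\<exists>b\<in>set B. E v b"
  shows "nosep (P @ B) v"
proof (rule ccontr)
  assume no: "\<not> ?thesis"
  have F: "detour P B" using m unfolding min_detour_def by blast
  note D = detourD[OF F]
  have xv: "E x v" using v(5) E_commute by blast
  have dist: "distinct (P @ B)" using icyc_distinct[OF D(1)] .
  obtain Ba y2 Bb Bc y1 Bd where Y: "B = Ba @ y2 # Bb" "E v y2" "\<And>b. b \<in> set Ba \<Longrightarrow> \<not> E v b"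
    "B = Bc @ y1 # Bd" "E v y1" "\<And>b. b \<in> set Bd \<Longrightarrow> \<not> E v b"
    and Y10: "\<not> E x y2 \<Longrightarrow> sp Bc = sp Ba" "\<not> E x y1 \<Longrightarrow> sp Bb = sp Bd"
    by (rule arc_nbrs[OF F v(1-3) B]) (rule that)
  have ns: "\<not> E x y" if "E v y" "y \<in> set B" for y
  proof
    assume "E x y"
    then have "u = y" using not_two_triangles[of v u y] xv P(2,5) that by blast
    then show False using dist P(1) that by auto
  qed
  have "y1 \<in> set B" "y2 \<in> set B" using arg_cong[OF Y(4), of set] arg_cong[OF Y(1), of set] by auto
  then have y: "\<not> E x y1" "\<not> E x y2" using ns Y(2,5) by auto
  have Bc: "0 < sp Bc"
  proof (rule ccontr)
    assume "\<not> 0 < sp Bc"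
    then have "nosep (P @ B) v" using P Y by (intro nosep_inner[of _ P1 u "P2 @ Bc" y1 Bd]) auto
    then show False using no by blast
  qed
  have Bb: "0 < sp Bb"
  proof (rule ccontr)
    assume "\<not> 0 < sp Bb"
    then have "nosep (P @ B) v" using P Y by (intro nosep_outer[of _ P1 u "P2 @ Ba" y2 Bb]) auto
    then show False using no by blast
  qed
  have s: "sp B = sp Ba + sp Bd" "0 < sp Ba" "0 < sp Bd" using Y10 y Bc Bb Y(4) by auto
  have sPB: "sp (P @ B) = 1 + sp Ba + sp Bd" using s P by simp
  show False
  proof (cases "P2 = []")
    case False
    have d: "detour (P1 @ [u, v]) (y1 # Bd)"
      by (rule detour_cut'[OF F P(1) Y(4) v(1-4) P(5) Y(5)])
        (use P False Y D(9) s sPB xv y in \<open>auto simp: gp_def\<close>)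
    have e: "sp ((P1 @ [u, v]) @ y1 # Bd) = 2 + sp Bd" using P xv y by simp
    have d2: "2 \<le> sp Bd" using detourD(8)[OF d] e by simp
    have "sp Ba \<noteq> 1"
    proof
      assume a: "sp Ba = 1"
      have "detour (v # u # P2) (Ba @ [y2])"
        by (rule detour_cut[OF F P(1) Y(1) v(1-4) P(5) Y(2)])
          (use P Y D(9) s sPB xv y a d2 Bb in \<open>auto simp: gp_def\<close>)
      then show False using detourD(8) a P xv y by fastforce
    qed
    moreover have "length (P1 @ [u, v]) \<le> length P" using P(1) False by (cases P2) auto
    ultimately show False using min_detour_le[OF m d] e sPB s by simp
  next
    case True
    have P1: "P1 \<noteq> []" using True detour_length2[OF F] P(1) by auto
    have d: "detour (v # u # P2) (Ba @ [y2])"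
      by (rule detour_cut[OF F P(1) Y(1) v(1-4) P(5) Y(2)])
        (use P P1 Y D(9) s sPB xv y in \<open>auto simp: gp_def\<close>)
    have e: "sp ((v # u # P2) @ Ba @ [y2]) = 2 + sp Ba" using P xv y by simp
    have d2: "2 \<le> sp Ba" using detourD(8)[OF d] e by simp
    have "sp Bd \<noteq> 1"
    proof
      assume a: "sp Bd = 1"
      have "detour (P1 @ [u, v]) (y1 # Bd)"
        by (rule detour_cut'[OF F P(1) Y(4) v(1-4) P(5) Y(5)])
          (use P Y D(9) s sPB xv y a d2 Bc in \<open>auto simp: gp_def\<close>)
      then show False using detourD(8) a P xv y by fastforce
    qed
    moreover have "length (v # u # P2) \<le> length P" using P(1) True P1 by (cases P1) auto
    ultimately show False using min_detour_le[OF m d] e sPB s by simp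
  qed
qed

text \<open>Two spokes on the path are adjacent, so by uniqueness of triangles \<open>v\<close> sees
  neither, and its path neighbours come before them. With one spoke, neighbours on both sides of it
  would leave at most two spokes on the arc; neighbours on one side give an obstruction at that
  end.\<close>

lemma detour_nbr:
  assumes m: "min_detour P B" and v: "v \<in> V" "v \<notin> C" "v \<noteq> x" "v \<notin> set P" "E v x" and pe: "pend P"
    and no: "\<not> nosep (P @ B) v"
  shows "obs P B v \<or> (sp P = 1 \<and> obs (rev P) (rev B) v)"
proof -
  have F: "detour P B" using m unfolding min_detour_def by blast
  note D = detourD[OF F]
  have xv: "E x v" using v(5) E_commute by blast
  have dist: "distinct (P @ B)" using icyc_distinct[OF D(1)] .
  have NP: "\<exists>b\<in>set P. E v b" using detour_no_path_nbr[OF F v(1-3)] no by blast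
  have NB: "\<exists>b\<in>set B. E v b" using hub_nbr_no_arc_nbr[OF m v pe] no by blast
  have "sp P \<noteq> 0" using hub_nbr_clean[OF m v _ NP NB] no by blast
  then consider "sp P = 1" | "sp P = 2" using detour_spokes(1)[OF F] by linarith
  then show ?thesis
  proof cases
    case 2
    then obtain Q u u' where Q: "P = Q @ [u, u']" "sp Q = 0" "E x u" "E x u'" using pe unfolding pend_def by auto
    have "ipath [u, u']" using icyc_sub[of Q "[u, u']" B] D(1,3) Q(1) by simp
    then have uu: "E u u'" by simp
    have "\<not> E v u" using not_two_triangles[of u v u'] Q(3,4) xv uu E_commute v(4) Q(1) by auto
    moreover have vu': "\<not> E v u'" using not_two_triangles[of u' v u] Q(3,4) xv uu E_commute v(4) Q(1) by auto
    ultimately have "\<exists>p\<in>set Q. E v p" using NP Q(1) by auto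
    then show ?thesis using hub_nbr_one_side[OF m v, of Q u "[u']"] Q vu' NB no by auto
  next
    case 1
    then have "0 < sp P" by simp
    then obtain P1 u P2 where P: "P = P1 @ u # P2" "E x u" "sp P1 = 0" by (rule first_spoke)
    have P2: "sp P2 = 0" using 1 P by simp
    have rm: "min_detour (rev P) (rev B)" using min_detour_rev[OF m] .
    have rno: "\<not> nosep (rev P @ rev B) v"
    proof
      assume "nosep (rev P @ rev B) v"
      then have "nosep (rev (rev B @ rev P)) v" using nosep_rev nosep_rot by blast
      then show False using no by simp
    qed
    show ?thesis
    proof (cases "\<exists>p\<in>set P1. E v p")
      case n1: True
      show ?thesis
      proof (cases "\<exists>p\<in>set P2. E v p")
        case False
        then show ?thesis using hub_nbr_one_side[OF m v P n1] NB no by blast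
      next
        case n2: True
        obtain Ba y2 Bb Bc y1 Bd where Y: "B = Ba @ y2 # Bb" "E v y2" "\<And>b. b \<in> set Ba \<Longrightarrow> \<not> E v b"
          "B = Bc @ y1 # Bd" "E v y1" "\<And>b. b \<in> set Bd \<Longrightarrow> \<not> E v b"
          "sp B \<le> sp (Ba @ [y2]) + sp (y1 # Bd)" by (rule arc_nbrs[OF F v(1-3) NB]) (rule that)
        have 1: "sp (y1 # Bd) \<le> 1" using hub_nbr_two_sides[OF m v P n1 n2 Y(4-6)] .
        have 2: "sp (y2 # rev Ba) \<le> 1"
          by (rule hub_nbr_two_sides[OF rm v(1-3) _ v(5), of "rev P2" u "rev P1" "rev Bb" y2 "rev Ba"])
            (use v P P2 n1 n2 Y(1-3) in auto)
        have "3 \<le> sp B" using detour_spokes(2)[OF F] \<open>sp P = 1\<close> by simp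
        then show ?thesis using 1 2 Y(7) by simp
      qed
    next
      case n1: False
      show ?thesis
      proof (cases "\<exists>p\<in>set P2. E v p")
        case True
        have "obs (rev P) (rev B) v"
          by (rule hub_nbr_one_side[OF rm v(1-3) _ v(5), of "rev P2" u "rev P1"])
            (use v P P2 True n1 NB rno in auto)
        then show ?thesis using 1 by blast
      next
        case False
        then have "E v u" using NP P n1 by auto
        then show ?thesis using hub_nbr_at_spoke[OF m v P P2] False n1 NB no by auto
      qed
    qed
  qed
qed

end

section \<open>Replacing corners\<close>

context hub
begin

lemma nosep_segment:
  assumes n: "nosep (X @ T @ Z) w" and o: "0 < sp (X @ Z)" and v: "\<not> E w v"
  shows "nosep (v # T) w"
  unfolding nosep_def
proof (intro allI impI)
  fix X' c Y c' Z' assume a: "v # T = X' @ c # Y @ c' # Z'" "E w c" "E w c'"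
  then obtain X'' where "X' = v # X''" using v by (cases X') auto
  then have T: "T = X'' @ c # Y @ c' # Z'" using a by simp
  have "nosep ((X @ X'') @ c # Y @ c' # (Z' @ Z)) w" using n T by simp
  from nosepD[OF this a(2,3)] show "sp Y = 0 \<or> sp (X' @ Z') = 0" using o by auto
qed

text \<open>The vertex that replaces the spoke \<open>e\<close> is chosen to cut off as much of the two sectors at \<open>e\<close> as
  possible; a twin of it is impossible by \<open>hub_nbr_leg\<close>, so no new improper vertices arise.\<close>

lemma corner:
  assumes cyc: "icyc (e # Lx @ a # M @ b # Rx)" and x: "x \<notin> set (e # Lx @ a # M @ b # Rx)"
    and s: "E x e" "E x a" "E x b" "sp Lx = 0" "sp Rx = 0" "4 \<le> sp (e # Lx @ a # M @ b # Rx)"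
    and Ob: "\<And>v. Ob v \<Longrightarrow> v \<in> V \<and> v \<notin> set (e # Lx @ a # M @ b # Rx) \<and> v \<noteq> x \<and> E v x
      \<and> (\<exists>y\<in>set (Lx @ [a]). E v y) \<and> (\<exists>y\<in>set (b # Rx). E v y) \<and> (\<forall>y\<in>set M. \<not> E v y)"
    and H1: "\<And>w. \<lbrakk>w \<in> V; w \<notin> set (e # Lx @ a # M @ b # Rx); w \<noteq> x; \<not> E w x\<rbrakk>
      \<Longrightarrow> nosep (e # Lx @ a # M @ b # Rx) w \<and> card {h\<in>set (e # Lx @ a # M @ b # Rx). E w h} \<le> 2"
    and H2: "\<And>w. \<lbrakk>w \<in> V; w \<notin> set (e # Lx @ a # M @ b # Rx); w \<noteq> x; E w x\<rbrakk>
      \<Longrightarrow> nosep (e # Lx @ a # M @ b # Rx) w \<or> Ob w \<or> Psi w"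
    and Psi: "\<And>w. Psi w \<Longrightarrow> \<exists>y\<in>set M. E w y"
    and H3: "\<And>v w y. \<lbrakk>Ob v; E w v; w \<in> V; w \<notin> set (e # Lx @ a # M @ b # Rx); w \<noteq> x; y \<in> set M; E w y\<rbrakk> \<Longrightarrow> False"
    and ex: "Ob v0"
  obtains v W1 L R W3 where "Ob v" "Lx @ [a] = W1 @ L" "L \<noteq> []" "b # Rx = R @ W3" "R \<noteq> []" "icyc (v # L @ M @ R)"
    "sp (v # L @ M @ R) = sp (e # Lx @ a # M @ b # Rx)"
    "\<And>w. \<lbrakk>w \<in> V; w \<notin> set (v # L @ M @ R); w \<noteq> x; \<not> E w x\<rbrakk>
      \<Longrightarrow> nosep (v # L @ M @ R) w \<and> card {h\<in>set (v # L @ M @ R). E w h} \<le> 2"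
    "\<And>w. \<lbrakk>w \<in> V; w \<notin> set (v # L @ M @ R); w \<noteq> x; E w x\<rbrakk> \<Longrightarrow> nosep (v # L @ M @ R) w \<or> (Psi w \<and> \<not> E w v)"
proof -
  let ?D = "e # Lx @ a # M @ b # Rx"
  \<comment> \<open>A candidate is kept with its last neighbour \<open>yL\<close> before
    \<open>M\<close> and its first neighbour \<open>yR\<close> after it, between which the new cycle
    is closed. Minimising \<open>length Lt + length Rh\<close> makes this cycle shortest.\<close>
  define S where "S = (\<lambda>(v, W1, yL, Lt, Rh, yR, W3). Ob v \<and> Lx @ [a] = W1 @ yL # Lt \<and> E v yL \<and> (\<forall>y\<in>set Lt. \<not> E v y)
     \<and> b # Rx = Rh @ yR # W3 \<and> E v yR \<and> (\<forall>y\<in>set Rh. \<not> E v y))"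
  let ?f = "\<lambda>(v, W1, yL, Lt, Rh, yR, W3). length Lt + length Rh"
  have split: "\<exists>W1 yL Lt Rh yR W3. S (v, W1, yL, Lt, Rh, yR, W3)" if Ov: "Ob v" for v
  proof -
    have 1: "\<exists>y\<in>set (Lx @ [a]). E v y" and 2: "\<exists>y\<in>set (b # Rx). E v y" using Ob[OF Ov] by blast+
    obtain W1 yL Lt where L: "Lx @ [a] = W1 @ yL # Lt" "E v yL" "\<And>y. y \<in> set Lt \<Longrightarrow> \<not> E v y"
      by (rule last_nbr[OF 1]) (rule that)
    obtain Rh yR W3 where R: "b # Rx = Rh @ yR # W3" "E v yR" "\<And>y. y \<in> set Rh \<Longrightarrow> \<not> E v y"
      by (rule first_nbr[OF 2]) (rule that)
    have "S (v, W1, yL, Lt, Rh, yR, W3)" unfolding S_def using Ov L R by simp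
    then show ?thesis by blast
  qed
  obtain z0 where "S z0" using split[OF ex] by blast
  then have "\<exists>z. S z \<and> (\<forall>z'. S z' \<longrightarrow> ?f z \<le> ?f z')" by (rule ex_has_least_nat)
  then obtain z where z: "S z" "\<And>z'. S z' \<Longrightarrow> ?f z \<le> ?f z'" by blast
  obtain v W1 yL Lt Rh yR W3 where zz: "z = (v, W1, yL, Lt, Rh, yR, W3)" by (cases z) blast
  have Ov: "Ob v" and L: "Lx @ [a] = W1 @ yL # Lt" "E v yL" "\<And>y. y \<in> set Lt \<Longrightarrow> \<not> E v y"
    and R: "b # Rx = Rh @ yR # W3" "E v yR" "\<And>y. y \<in> set Rh \<Longrightarrow> \<not> E v y"
    using z(1) unfolding zz S_def by auto
  have mini: "length Lt + length Rh \<le> length Lt' + length Rh'" if "S (w, W1', yL', Lt', Rh', yR', W3')" for w W1' yL' Lt' Rh' yR' W3'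
    using z(2)[OF that] unfolding zz by simp
  note vO = Ob[OF Ov]
  have xv: "E x v" using vO E_commute by blast
  define T where "T = yL # Lt @ M @ Rh @ [yR]"
  have D: "?D = e # W1 @ T @ W3" unfolding T_def using L(1) R(1) by (metis append.assoc append_Cons append_Nil)
  have dist: "distinct ?D" using icyc_distinct[OF cyc] .
  have distT: "distinct (e # W1 @ T @ W3)" using dist D by simp
  have TD: "set T \<subseteq> set ?D" using D by auto
  have la: "last (yL # Lt) = a" using L(1) by (metis last_appendR last_snoc list.distinct(1))
  have hb: "hd (Rh @ [yR]) = b" using R(1) by (cases Rh) auto
  have sL: "sp W1 = 0" "sp (yL # Lt) = 1"
  proof -
    have 1: "sp W1 + sp (yL # Lt) = 1" using arg_cong[OF L(1), of sp] s by simp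
    have "a \<in> set (yL # Lt)" using la last_in_set[of "yL # Lt"] by simp
    then have "0 < sp (yL # Lt)" using s(2) unfolding sp_pos_iff by blast
    then show "sp W1 = 0" "sp (yL # Lt) = 1" using 1 by linarith+
  qed
  have sR: "sp W3 = 0" "sp (Rh @ [yR]) = 1"
  proof -
    have 1: "sp (Rh @ [yR]) + sp W3 = 1" using arg_cong[OF R(1), of sp] s by simp
    have "b \<in> set (Rh @ [yR])" using hb hd_in_set[of "Rh @ [yR]"] by simp
    then have "0 < sp (Rh @ [yR])" using s(3) unfolding sp_pos_iff by blast
    then show "sp W3 = 0" "sp (Rh @ [yR]) = 1" using 1 by linarith+
  qed
  have sM: "1 \<le> sp M" using s by simp
  have sT: "sp T = 2 + sp M" using sL sR unfolding T_def by simp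
  have vT: "v \<notin> set T" "v \<notin> set ?D" using vO TD by auto
  have xT: "x \<notin> set T" using x TD by auto
  have cycT: "icyc (T @ (W3 @ e # W1))" using icyc_rot[of "e # W1" "T @ W3"] cyc D by simp
  have "icyc (yL # (Lt @ M @ Rh) @ yR # (W3 @ e # W1))" using cycT unfolding T_def by (simp del: icyc.simps)
  then have "icyc (v # yL # (Lt @ M @ Rh) @ [yR])"
    by (rule icyc_cut2) (use vT vO L(2,3) R(2,3) in \<open>auto simp: T_def\<close>)
  then have cyc': "icyc (v # T)" unfolding T_def by (simp del: icyc.simps)
  \<comment> \<open>Here \<open>z\<close> closes the arc \<open>T\<close>, and \<open>w\<close> has
    the same two neighbours at its ends. In \<open>hub_nbr_leg\<close> the vertex \<open>w\<close>
    plays the role of \<open>v\<close>, with \<open>[z]\<close> as the stretch between its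
    neighbours \<open>yR\<close> and \<open>yL\<close>.\<close>
  have twin: False
    if w: "w \<in> V" "w \<noteq> x" "E w x" "w \<noteq> z" "w \<notin> set T" "E w yL" "E w yR" "\<And>y. y \<in> set (Lt @ M @ Rh) \<Longrightarrow> \<not> E w y"
      and c: "icyc (z # T)" "E x z" for w z
  proof -
    have xw: "E x w" using w E_commute by blast
    have zT: "E z yL" "E z yR" using c(1) unfolding T_def by auto
    have zx: "z \<noteq> x" using c E_irrefl by blast
    have nwz: "\<not> E w z"
    proof
      assume "E w z"
      then have "{w, yL} = {w, x}" using triangle_unique[of z w yL w x] zT w xw c E_commute by blast
      then show False using xT w unfolding T_def by (auto simp: doubleton_eq_iff)
    qed
    have nL: "\<not> E x yL" using not_two_triangles[of yL z w] zT w xw c E_commute by blast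
    have nR: "\<not> E x yR" using not_two_triangles[of yR z w] zT w xw c E_commute by blast
    have "2 \<le> sp (Lt @ M @ Rh)" using sT nL nR unfolding T_def by simp
    then obtain X q Y where q: "Lt @ M @ Rh = X @ q # Y" "E x q" "X \<noteq> []" by (rule last_spoke_leg)
    have "icyc ([yR] @ (z # yL # Lt @ M @ Rh))" using icyc_rot[of "z # yL # Lt @ M @ Rh" "[yR]"] c(1) unfolding T_def by (simp del: icyc.simps)
    then have cy: "icyc (yR # [z] @ yL # X @ q # Y)" using q(1) by (simp del: icyc.simps)
    have XY: "set X \<union> {q} \<union> set Y = set (Lt @ M @ Rh)" using q(1) by auto
    have "\<not> E w y" if "y \<in> set (q # Y)" for y using w(8) XY that by auto
    moreover have "x \<notin> set (X @ q # Y)" "w \<notin> set (X @ q # Y)" using xT w(5) q(1)[symmetric] unfolding T_def by auto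
    ultimately show False
      using hub_nbr_leg[OF cy, of w] w nwz nL nR c(2) q zx xT unfolding T_def by auto
  qed
  \<comment> \<open>If nothing but \<open>e\<close> were cut off, \<open>v\<close> would be a twin
    of \<open>e\<close>.\<close>
  have K: "W3 @ W1 \<noteq> []"
  proof
    assume "W3 @ W1 = []"
    then have c: "icyc (e # T)" using cyc D by simp
    show False by (rule twin[of v e, OF _ _ _ _ _ L(2) R(2) _ c s(1)]) (use vO vT L(3) R(3) in auto)
  qed
  have nosepL: "nosep (v # T) w" if w: "\<And>y. y \<in> set (M @ Rh @ [yR]) \<Longrightarrow> \<not> E w y" for w
  proof (cases "\<exists>y\<in>set (yL # Lt). E w y")
    case False
    then show ?thesis using w by (intro nosep_one[of _ "[]" v T]) (auto simp: T_def)
  next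
    case True
    obtain Ya c Yb where Y: "yL # Lt = Ya @ c # Yb" "E w c" "\<And>y. y \<in> set Yb \<Longrightarrow> \<not> E w y"
      by (rule last_nbr[OF True]) (rule that)
    have "last (c # Yb) = a" using la Y(1) by simp
    then have "a \<in> set (c # Yb)" using last_in_set[of "c # Yb"] by simp
    then have "0 < sp (c # Yb)" using s(2) unfolding sp_pos_iff by blast
    then have "sp Ya = 0" using sL(2) unfolding Y(1) by auto
    moreover have "v # T = [] @ v # Ya @ c # (Yb @ M @ Rh @ [yR])" unfolding T_def using Y(1) by simp
    ultimately show ?thesis using w Y(3) by (intro nosep_inner[of _ "[]" v Ya c "Yb @ M @ Rh @ [yR]"]) auto
  qed
  have nosepR: "nosep (v # T) w" if w: "\<And>y. y \<in> set (yL # Lt @ M) \<Longrightarrow> \<not> E w y" for w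
  proof (cases "\<exists>y\<in>set (Rh @ [yR]). E w y")
    case False
    then show ?thesis using w by (intro nosep_one[of _ "[]" v T]) (auto simp: T_def)
  next
    case True
    obtain Ya c Yb where Y: "Rh @ [yR] = Ya @ c # Yb" "E w c" "\<And>y. y \<in> set Ya \<Longrightarrow> \<not> E w y"
      by (rule first_nbr[OF True]) (rule that)
    have "hd (Ya @ [c]) = b" using hb Y(1) by (cases Ya) auto
    then have "b \<in> set (Ya @ [c])" using hd_in_set[of "Ya @ [c]"] by simp
    then have "0 < sp (Ya @ [c])" using s(3) unfolding sp_pos_iff by blast
    then have "sp Yb = 0" using sR(2) unfolding Y(1) by auto
    moreover have "v # T = [] @ v # (yL # Lt @ M @ Ya) @ c # Yb" unfolding T_def using Y(1) by simp
    ultimately show ?thesis using w Y(3) by (intro nosep_outer[of _ "[]" v "yL # Lt @ M @ Ya" c Yb]) auto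
  qed
  \<comment> \<open>For such a pair the old cycle has the spoke \<open>e\<close> on one side and a
    spoke of \<open>M\<close> on the other, so \<open>nosep\<close> fails.\<close>
  have sides: "\<not> (c \<in> set (yL # Lt) \<and> c' \<in> set (Rh @ [yR]) \<and> E w c \<and> E w c')" if "nosep ?D w" for w c c'
  proof
    assume c: "c \<in> set (yL # Lt) \<and> c' \<in> set (Rh @ [yR]) \<and> E w c \<and> E w c'"
    obtain Ya Yb where Y: "yL # Lt = Ya @ c # Yb" using c by (meson split_list)
    obtain Yc Yd where Y': "Rh @ [yR] = Yc @ c' # Yd" using c by (meson split_list)
    have "?D = (e # W1 @ Ya) @ c # (Yb @ M @ Yc) @ c' # (Yd @ W3)" unfolding D T_def using Y Y' by simp
    then have "nosep ((e # W1 @ Ya) @ c # (Yb @ M @ Yc) @ c' # (Yd @ W3)) w" using that by simp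
    from nosepD[OF this] c show False using sM s(1) by auto
  qed
  \<comment> \<open>The vertices that were cut off see at most one end of \<open>T\<close>, because
    at least two of them are cut off.\<close>
  have inside: "nosep (v # T) w \<and> card {h\<in>set (v # T). E w h} \<le> 2" if w: "w \<in> set (W3 @ e # W1)" for w
  proof -
    have cr: "E w y \<longleftrightarrow> w = last (W3 @ e # W1) \<and> y = yL \<or> w = hd (W3 @ e # W1) \<and> y = yR" if "y \<in> set T" for y
      using icyc_cross[OF cycT that w] E_commute unfolding T_def by auto
    have hl: "last (W3 @ e # W1) \<noteq> hd (W3 @ e # W1)"
      using distT K by (cases W3; cases W1 rule: rev_cases) auto
    show ?thesis
    proof (cases "w = last (W3 @ e # W1)")
      case True
      then have n: "\<not> E w y" if "y \<in> set (Lt @ M @ Rh @ [yR])" for y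
        using cr[of y] that hl distT unfolding T_def by auto
      then have "{h\<in>set (v # T). E w h} \<subseteq> {v, yL}" unfolding T_def by auto
      then have "card {h\<in>set (v # T). E w h} \<le> 2" by (rule card_pair_le)
      then show ?thesis using nosepL[of w] n by auto
    next
      case False
      then have n: "\<not> E w y" if "y \<in> set (yL # Lt @ M @ Rh)" for y
        using cr[of y] that distT unfolding T_def by auto
      then have "{h\<in>set (v # T). E w h} \<subseteq> {v, yR}" unfolding T_def by auto
      then have "card {h\<in>set (v # T). E w h} \<le> 2" by (rule card_pair_le)
      then show ?thesis using nosepR[of w] n by auto
    qed
  qed
  have out: "w \<notin> set ?D \<or> w \<in> set (W3 @ e # W1)" if "w \<notin> set (v # T)" for w using that unfolding D by auto
  have seg: "nosep (v # T) w" if "nosep ?D w" "\<not> E w v" for w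
    by (rule nosep_segment[of "e # W1" T W3]) (use that D s(1) in auto)
  have free: "\<not> E w y" if "E w v" "w \<in> V" "w \<notin> set ?D" "w \<noteq> x" "y \<in> set M" for w y
    using H3[OF Ov that] by blast
  have onesided: "nosep (v # T) w" if "\<And>y. y \<in> set M \<Longrightarrow> \<not> E w y"
      "\<And>c c'. \<not> (c \<in> set (yL # Lt) \<and> c' \<in> set (Rh @ [yR]) \<and> E w c \<and> E w c')" for w
  proof (cases "\<exists>c\<in>set (yL # Lt). E w c")
    case True
    then show ?thesis using that by (intro nosepL) fastforce
  next
    case False
    then show ?thesis using that by (intro nosepR) fastforce
  qed
  have n1: "nosep (v # T) w \<and> card {h\<in>set (v # T). E w h} \<le> 2"
    if w: "w \<in> V" "w \<notin> set (v # T)" "w \<noteq> x" "\<not> E w x" for w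
  proof (cases "w \<in> set ?D")
    case True
    then show ?thesis using inside out w by blast
  next
    case False
    note h = H1[OF w(1) False w(3,4)]
    have "{h\<in>set T. E w h} \<subseteq> {h\<in>set ?D. E w h}" using TD by auto
    then have "card {h\<in>set T. E w h} \<le> card {h\<in>set ?D. E w h}" by (rule card_mono[rotated]) simp
    then have cT: "card {h\<in>set T. E w h} \<le> 2" using h by linarith
    show ?thesis
    proof (cases "E w v")
      case nv: False
      then have "{h\<in>set (v # T). E w h} = {h\<in>set T. E w h}" by auto
      then show ?thesis using cT seg h nv by simp
    next
      case wv: True
      then have "{h\<in>set (v # T). E w h} = insert v {h\<in>set T. E w h}" by auto
      then have "card {h\<in>set (v # T). E w h} = Suc (card {h\<in>set T. E w h})" using vT by simp
      \<comment> \<open>Adjacency to the new vertex \<open>v\<close> could raise the number of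
        neighbours to three, which is excluded.\<close>
      moreover have "card {h\<in>set (v # T). E w h} \<noteq> 3" using three_spokes[OF cyc' w(1,2)] by blast
      ultimately have "card {h\<in>set (v # T). E w h} \<le> 2" using cT by linarith
      moreover have "nosep (v # T) w" using onesided free[OF wv w(1) False w(3)] sides h by blast
      ultimately show ?thesis by blast
    qed
  qed
  have n2: "nosep (v # T) w \<or> (Psi w \<and> \<not> E w v)" if w: "w \<in> V" "w \<notin> set (v # T)" "w \<noteq> x" "E w x" for w
  proof (cases "w \<in> set ?D")
    case True
    then show ?thesis using inside out w by blast
  next
    case False
    consider "nosep ?D w" | "Psi w" | "Ob w" using H2[OF w(1) False w(3,4)] by blast
    then show ?thesis
    proof cases
      case 1
      then show ?thesis using seg onesided[of w] free[OF _ w(1) False w(3)] sides[OF 1] by blast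
    next
      case 2
      then show ?thesis using Psi[OF 2] free[OF _ w(1) False w(3)] by blast
    next
      case 3
      obtain W1' yL' Lt' Rh' yR' W3' where Sw: "S (w, W1', yL', Lt', Rh', yR', W3')" using split[OF 3] by blast
      then have L': "Lx @ [a] = W1' @ yL' # Lt'" "E w yL'" "\<And>y. y \<in> set Lt' \<Longrightarrow> \<not> E w y"
        and R': "b # Rx = Rh' @ yR' # W3'" "E w yR'" "\<And>y. y \<in> set Rh' \<Longrightarrow> \<not> E w y"
        unfolding S_def by auto
      have wM: "\<not> E w y" if "y \<in> set M" for y using Ob[OF 3] that by blast
      \<comment> \<open>If another candidate \<open>w\<close> sees both kept arcs, its extreme
        neighbours lie inside them; by the choice of \<open>v\<close> they are \<open>yL\<close> and
        \<open>yR\<close>, and \<open>w\<close> is a twin of \<open>v\<close>.\<close>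
      have "\<not> (c \<in> set (yL # Lt) \<and> c' \<in> set (Rh @ [yR]) \<and> E w c \<and> E w c')" for c c'
      proof
        assume c: "c \<in> set (yL # Lt) \<and> c' \<in> set (Rh @ [yR]) \<and> E w c \<and> E w c'"
        have lL: "\<exists>us. yL # Lt = us @ yL' # Lt'"
        proof -
          obtain us where "W1 = W1' @ us \<and> us @ yL # Lt = yL' # Lt' \<or> W1 @ us = W1' \<and> yL # Lt = us @ yL' # Lt'"
            using L(1) L'(1) append_eq_append_conv2[of W1 "yL # Lt" W1' "yL' # Lt'"] by auto
          then show ?thesis
          proof
            assume u: "W1 = W1' @ us \<and> us @ yL # Lt = yL' # Lt'"
            show ?thesis
            proof (cases us)
              case Nil
              then show ?thesis using u by auto
            next
              case (Cons u us')
              then have "Lt' = us' @ yL # Lt" using u by auto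
              then show ?thesis using L'(3) c by auto
            qed
          qed blast
        qed
        have lR: "\<exists>us. Rh @ [yR] = (Rh' @ [yR']) @ us"
        proof -
          have "(Rh @ [yR]) @ W3 = (Rh' @ [yR']) @ W3'" using R(1) R'(1) by simp
          then obtain us where "Rh @ [yR] = (Rh' @ [yR']) @ us \<and> us @ W3 = W3' \<or> (Rh @ [yR]) @ us = Rh' @ [yR'] \<and> W3 = us @ W3'"
            using append_eq_append_conv2[of "Rh @ [yR]" W3 "Rh' @ [yR']" W3'] by auto
          then show ?thesis
          proof
            assume u: "(Rh @ [yR]) @ us = Rh' @ [yR'] \<and> W3 = us @ W3'"
            show ?thesis
            proof (cases us rule: rev_cases)
              case Nil
              then show ?thesis using u by auto
            next
              case (snoc us' u')
              then have "Rh' = (Rh @ [yR]) @ us'" using u by auto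
              then show ?thesis using R'(3) c by auto
            qed
          qed blast
        qed
        obtain us where us: "yL # Lt = us @ yL' # Lt'" using lL by blast
        obtain us' where us': "Rh @ [yR] = (Rh' @ [yR']) @ us'" using lR by blast
        have "length Lt + 1 = length us + length Lt' + 1" using arg_cong[OF us, of length] by simp
        moreover have "length Rh + 1 = length Rh' + 1 + length us'" using arg_cong[OF us', of length] by simp
        ultimately have "us = []" "us' = []" using mini[OF Sw] by auto
        then have eq: "yL' = yL" "Lt' = Lt" "yR' = yR" "Rh' = Rh" using us us' by auto
        show False by (rule twin[of w v, OF _ _ _ _ _ _ _ _ cyc' xv]) (use w L' R' wM eq in auto)
      qed
      then show ?thesis using onesided[of w] wM by blast
    qed
  qed
  have eqT: "v # (yL # Lt) @ M @ (Rh @ [yR]) = v # T" unfolding T_def by simp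
  show thesis
  proof (rule that[of v W1 "yL # Lt" "Rh @ [yR]" W3, unfolded eqT])
    show "sp (v # T) = sp ?D" using sT s xv by simp
    show "b # Rx = (Rh @ [yR]) @ W3" using R(1) by simp
  qed (use Ov L(1) cyc' n1 n2 in auto)
qed

end

context hub
begin

lemma first_spoke_unique:
  assumes "X @ u # Y = X' @ u' # Y'" "sp X = 0" "sp X' = 0" "E x u" "E x u'"
  shows "X = X' \<and> u = u' \<and> Y = Y'"
proof -
  obtain us where "X = X' @ us \<and> us @ u # Y = u' # Y' \<or> X @ us = X' \<and> u # Y = us @ u' # Y'"
    using assms(1) append_eq_append_conv2[of X "u # Y" X' "u' # Y'"] by auto
  then show ?thesis
  proof
    assume "X = X' @ us \<and> us @ u # Y = u' # Y'"
    then show ?thesis using assms by (cases us) auto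
  next
    assume "X @ us = X' \<and> u # Y = us @ u' # Y'"
    then show ?thesis using assms by (cases us) auto
  qed
qed

lemma last_spoke_unique:
  assumes "X @ u # Y = X' @ u' # Y'" "sp Y = 0" "sp Y' = 0" "E x u" "E x u'"
  shows "X = X' \<and> u = u' \<and> Y = Y'"
proof -
  have "rev Y @ u # rev X = rev Y' @ u' # rev X'" using arg_cong[OF assms(1), of rev] by simp
  then show ?thesis using first_spoke_unique[of "rev Y" u "rev X" "rev Y'" u' "rev X'"] assms by simp
qed

text \<open>The exchange for an arbitrary candidate, not only the one chosen in
  \<open>corner\<close>. It is needed to verify hypothesis \<open>H3\<close> there, which speaks of
  all candidates.\<close>

lemma corner_cyc:
  assumes cyc: "icyc (e # Lx @ a # M @ b # Rx)"
    and s: "E x e" "E x a" "E x b" "sp Lx = 0" "sp Rx = 0"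
    and v: "v \<in> V" "v \<notin> set (e # Lx @ a # M @ b # Rx)"
      "\<exists>y\<in>set (Lx @ [a]). E v y" "\<exists>y\<in>set (b # Rx). E v y" "\<forall>y\<in>set M. \<not> E v y"
  obtains W1 L R W3 where "Lx @ [a] = W1 @ L" "b # Rx = R @ W3" "icyc (v # L @ M @ R)" "sp L = 1" "sp R = 1"
proof -
  obtain W1 yL Lt where L: "Lx @ [a] = W1 @ yL # Lt" "E v yL" "\<And>y. y \<in> set Lt \<Longrightarrow> \<not> E v y"
    by (rule last_nbr[OF v(3)]) (rule that)
  obtain Rh yR W3 where R: "b # Rx = Rh @ yR # W3" "E v yR" "\<And>y. y \<in> set Rh \<Longrightarrow> \<not> E v y"
    by (rule first_nbr[OF v(4)]) (rule that)
  have la: "last (yL # Lt) = a" using L(1) by (metis last_appendR last_snoc list.distinct(1))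
  have hb: "hd (Rh @ [yR]) = b" using R(1) by (cases Rh) auto
  have 1: "sp W1 + sp (yL # Lt) = 1" using arg_cong[OF L(1), of sp] s by simp
  have "a \<in> set (yL # Lt)" using la last_in_set[of "yL # Lt"] by simp
  then have "0 < sp (yL # Lt)" using s(2) unfolding sp_pos_iff by blast
  then have sL: "sp (yL # Lt) = 1" using 1 by linarith
  have 1: "sp (Rh @ [yR]) + sp W3 = 1" using arg_cong[OF R(1), of sp] s by simp
  have "b \<in> set (Rh @ [yR])" using hb hd_in_set[of "Rh @ [yR]"] by simp
  then have "0 < sp (Rh @ [yR])" using s(3) unfolding sp_pos_iff by blast
  then have sR: "sp (Rh @ [yR]) = 1" using 1 by linarith
  have D: "e # Lx @ a # M @ b # Rx = e # W1 @ (yL # (Lt @ M @ Rh) @ [yR]) @ W3"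
    using L(1) R(1) by (metis append.assoc append_Cons append_Nil)
  then have "icyc (yL # (Lt @ M @ Rh) @ yR # (W3 @ e # W1))"
    using icyc_rot[of "e # W1" "(yL # (Lt @ M @ Rh) @ [yR]) @ W3"] cyc by (simp del: icyc.simps)
  then have "icyc (v # yL # (Lt @ M @ Rh) @ [yR])"
    by (rule icyc_cut2) (use v L R arg_cong[OF D, of set] in auto)
  then show thesis using that[of W1 "yL # Lt" "Rh @ [yR]" W3] L(1) R(1) sL sR by simp
qed

end

section \<open>Vertices adjacent to an obstruction\<close>

context wheel_ctx
begin

text \<open>On the exchanged cycle \<open>w\<close> sees only \<open>v\<close> and \<open>y\<close>,
  three neighbours being excluded, so by \<open>two_nbrs\<close> both cycles through
  \<open>w\<close> have at least four spokes. The path part \<open>Mp\<close> has at most one spoke,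
  which puts \<open>y\<close> on the arc part \<open>Mb\<close>. Then \<open>[v, w]\<close> is the
  path of a detour with fewer spokes than the minimal one.\<close>

lemma corner_nonnbr:
  assumes m: "min_detour P B" and sP: "1 \<le> sp P"
    and cyc: "icyc (e # Lx @ a # (Mp @ Mb) @ b # Rx)" and x: "x \<notin> set (e # Lx @ a # (Mp @ Mb) @ b # Rx)"
    and s: "E x e" "E x a" "E x b" "sp Lx = 0" "sp Rx = 0" "4 \<le> sp (e # Lx @ a # (Mp @ Mb) @ b # Rx)" "sp Mp \<le> 1"
    and B: "B = X @ (Mb @ b # Rx) @ Y" "1 \<le> sp (X @ Y)"
    and v: "v \<in> V" "v \<notin> C" "v \<noteq> x" "E v x" "v \<notin> set (e # Lx @ a # (Mp @ Mb) @ b # Rx)"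
      "\<exists>y\<in>set (Lx @ [a]). E v y" "\<exists>y\<in>set (b # Rx). E v y" "\<And>y. y \<in> set (Mp @ Mb) \<Longrightarrow> \<not> E v y"
    and w: "w \<in> V" "w \<notin> set (e # Lx @ a # (Mp @ Mb) @ b # Rx)" "w \<noteq> x" "\<not> E w x" "E w v"
      "y \<in> set (Mp @ Mb)" "E w y" "card {h\<in>set (e # Lx @ a # (Mp @ Mb) @ b # Rx). E w h} \<le> 2"
      "w \<in> C \<Longrightarrow> sp Mb = 0"
  shows False
proof -
  have F: "detour P B" using m unfolding min_detour_def by blast
  note D = detourD[OF F]
  have nv: "\<forall>z\<in>set (Mp @ Mb). \<not> E v z" using v(8) by blast
  obtain W1 L R W3 where L: "Lx @ [a] = W1 @ L" and R: "b # Rx = R @ W3" and c: "icyc (v # L @ (Mp @ Mb) @ R)"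
    and sL: "sp L = 1" and sR: "sp R = 1"
    by (rule corner_cyc[OF cyc s(1-5) v(1,5-7) nv]) (rule that)
  have xv: "E x v" and xw: "\<not> E x w" using v w E_commute by blast+
  have LD: "set L \<subseteq> set (Lx @ [a])" "set R \<subseteq> set (b # Rx)" using arg_cong[OF L, of set] arg_cong[OF R, of set] by auto
  obtain Ma Mc where M: "Mp @ Mb = Ma @ y # Mc" using w(6) by (meson split_list)
  have c1: "icyc (v # (L @ Ma) @ y # (Mc @ R))" using c M by (simp del: icyc.simps)
  have dist: "distinct (v # (L @ Ma) @ y # (Mc @ R))" using icyc_distinct[OF c1] .
  have sub: "set ((L @ Ma) @ y # (Mc @ R)) \<subseteq> set (e # Lx @ a # (Mp @ Mb) @ b # Rx)" using LD M by auto
  have wn: "w \<notin> set (v # (L @ Ma) @ y # (Mc @ R))" using sub w E_irrefl by auto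
  have only: "\<not> E w z" if z: "z \<in> set (L @ Ma @ Mc @ R)" for z
  proof
    assume ez: "E w z"
    let ?N = "{h\<in>set ((L @ Ma) @ y # (Mc @ R)). E w h}"
    have "?N \<subseteq> {h\<in>set (e # Lx @ a # (Mp @ Mb) @ b # Rx). E w h}" using sub by auto
    then have "card ?N \<le> card {h\<in>set (e # Lx @ a # (Mp @ Mb) @ b # Rx). E w h}" by (rule card_mono[rotated]) simp
    then have 2: "card ?N \<le> 2" using w(8) by linarith
    have "{y, z} \<subseteq> ?N" using ez w(7) z by auto
    then have "card {y, z} \<le> card ?N" by (rule card_mono[rotated]) simp
    moreover have "y \<noteq> z" using dist z by auto
    ultimately have c2: "card ?N = 2" using 2 by simp
    have "{h\<in>set (v # (L @ Ma) @ y # (Mc @ R)). E w h} = insert v ?N" using w(5) by auto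
    moreover have "v \<notin> ?N" using dist by auto
    ultimately have "card {h\<in>set (v # (L @ Ma) @ y # (Mc @ R)). E w h} = 3" using c2 by simp
    then show False using three_spokes[OF c1 w(1) wn] by blast
  qed
  have xn: "x \<notin> set (v # (L @ Ma) @ y # (Mc @ R))" using sub x v(3) by auto
  have tot: "4 \<le> sp (v # (L @ Ma) @ y # (Mc @ R))"
  proof -
    have "sp (Mp @ Mb) = sp (Ma @ y # Mc)" using M by simp
    then show ?thesis using s sL sR xv by simp
  qed
  have 1: "4 \<le> sp (v # (L @ Ma) @ [y])"
    by (rule two_nbrs[OF c1 xn, of w]) (use w wn only sL sR tot in auto)
  have c2: "icyc (y # (Mc @ R) @ v # (L @ Ma))" using icyc_rot[of "v # L @ Ma" "y # Mc @ R"] c1 by (simp del: icyc.simps)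
  have 2: "4 \<le> sp (y # (Mc @ R) @ [v])"
    by (rule two_nbrs[OF c2, of w]) (use w wn xn only sL sR tot in auto)
  have y2: "2 \<le> sp (Ma @ [y])" using 1 sL xv by simp
  obtain us where "Mp = Ma @ us \<and> us @ Mb = y # Mc \<or> Mp @ us = Ma \<and> Mb = us @ y # Mc"
    using M append_eq_append_conv2[of Mp Mb Ma "y # Mc"] by auto
  then obtain Mb1 where Mb: "Ma = Mp @ Mb1" "Mb = Mb1 @ y # Mc"
  proof
    assume u: "Mp = Ma @ us \<and> us @ Mb = y # Mc"
    show thesis
    proof (cases us)
      case Nil
      then show thesis using that[of "[]"] u by simp
    next
      case (Cons z us')
      then have "Mp = (Ma @ [y]) @ us'" using u by simp
      then show thesis using s(7) y2 by simp
    qed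
  next
    assume "Mp @ us = Ma \<and> Mb = us @ y # Mc"
    then show thesis using that[of us] by simp
  qed
  have wC: "w \<notin> C"
  proof
    assume "w \<in> C"
    then have "sp Mb = 0" using w(9) by blast
    then have "sp (Ma @ [y]) \<le> sp Mp" using Mb by simp
    then show False using y2 s(7) by linarith
  qed
  have "icyc (w # y # (Mc @ R) @ [v])"
    by (rule icyc_cut2[OF c2]) (use w wn only sL in auto)
  then have h: "icyc ([v, w] @ (y # Mc @ R))" using icyc_rot[of "w # y # Mc @ R" "[v]"] by (simp del: icyc.simps)
  obtain A where A: "icyc (B @ A)" "set (B @ A) = C" using detour_arc[OF F] by blast
  have B': "B = (X @ Mb1) @ (y # Mc @ R) @ (W3 @ Y)" using B(1) Mb R by simp
  have "rim (((X @ Mb1)) @ ((y # Mc @ R) @ (W3 @ Y) @ A))" using A B' unfolding rim_def by simp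
  then have r: "rim ((y # Mc @ R) @ ((W3 @ Y) @ A @ X @ Mb1))" using rim_rot[of "X @ Mb1" "(y # Mc @ R) @ (W3 @ Y) @ A"] by simp
  have sB: "sp (y # Mc @ R) + 1 \<le> sp B" using B' B(2) by simp
  have le: "sp ([v, w] @ (y # Mc @ R)) < sp (P @ B)" using sB sP xw by simp
  have d: "detour [v, w] (y # Mc @ R)"
    by (rule detourI[OF h _ _ _ r]) (use v w wC 2 le D(9) xw in \<open>auto simp: gp_def\<close>)
  show False using min_detour_le[OF m d] le detour_length2[OF F] by simp
qed

text \<open>Here \<open>x\<close>, \<open>v\<close> and \<open>w\<close> form a triangle. If
  \<open>w\<close> sees the spoke-free stretch \<open>Mq\<close>, then \<open>w\<close>,
  \<open>v\<close> and the left sector lie on a cycle with exactly three spokes. Otherwise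
  \<open>[v, w]\<close>, two adjacent spokes, closes a detour with an arc shorter than
  \<open>B\<close>. \<open>Mr\<close> is empty in the first exchange; in the second it holds the
  vertex inserted by the first.\<close>

lemma corner_nbr:
  assumes m: "min_detour P B" and sP: "sp P = 1"
    and cyc: "icyc (e # Lx @ a # (Mq @ Mr @ Mb) @ b # Rx)" and x: "x \<notin> set (e # Lx @ a # (Mq @ Mr @ Mb) @ b # Rx)"
    and s: "E x e" "E x a" "E x b" "sp Lx = 0" "sp Rx = 0" "sp Mq = 0"
    and B: "B = X @ (Mb @ b # Rx) @ Y" "1 \<le> sp (X @ Y)"
    and v: "v \<in> V" "v \<notin> C" "v \<noteq> x" "E v x" "v \<notin> set (e # Lx @ a # (Mq @ Mr @ Mb) @ b # Rx)"
      "\<exists>y\<in>set (Lx @ [a]). E v y" "\<exists>y\<in>set (b # Rx). E v y" "\<And>y. y \<in> set (Mq @ Mr @ Mb) \<Longrightarrow> \<not> E v y"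
    and w: "w \<in> V" "w \<notin> set (e # Lx @ a # (Mq @ Mr @ Mb) @ b # Rx)" "w \<noteq> x" "E w x" "E w v" "w \<notin> C"
      "\<exists>y\<in>set (Mq @ Mb). E w y" "\<And>y. y \<in> set Mr \<Longrightarrow> \<not> E w y"
    and free: "\<And>y c. y \<in> set Mq \<Longrightarrow> E w y \<Longrightarrow> c \<in> set (Lx @ [a]) \<Longrightarrow> \<not> E w c"
  shows False
proof -
  have F: "detour P B" using m unfolding min_detour_def by blast
  note D = detourD[OF F]
  have nv: "\<forall>z\<in>set (Mq @ Mr @ Mb). \<not> E v z" using v(8) by blast
  obtain W1 L R W3 where L: "Lx @ [a] = W1 @ L" and R: "b # Rx = R @ W3" and c: "icyc (v # L @ (Mq @ Mr @ Mb) @ R)"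
    and sL: "sp L = 1" and sR: "sp R = 1"
    by (rule corner_cyc[OF cyc s(1-5) v(1,5-7) nv]) (rule that)
  have xv: "E x v" and xw: "E x w" using v w E_commute by blast+
  have LD: "set L \<subseteq> set (Lx @ [a])" "set R \<subseteq> set (b # Rx)" using arg_cong[OF L, of set] arg_cong[OF R, of set] by auto
  have sub: "set (L @ (Mq @ Mr @ Mb) @ R) \<subseteq> set (e # Lx @ a # (Mq @ Mr @ Mb) @ b # Rx)" using LD by auto
  have wn: "w \<notin> set (v # L @ (Mq @ Mr @ Mb) @ R)" using sub w E_irrefl by auto
  have xn: "x \<notin> set (v # L @ (Mq @ Mr @ Mb) @ R)" using sub x v(3) by auto
  have Rne: "R \<noteq> []" using sR by auto
  have Lne: "L \<noteq> []" using sL by auto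
  show False
  proof (cases "\<exists>y\<in>set Mq. E w y")
    case True
    obtain Ma y Mc where M: "Mq = Ma @ y # Mc" "E w y" "\<And>z. z \<in> set Ma \<Longrightarrow> \<not> E w z"
      by (rule first_nbr[OF True]) (rule that)
    have nL: "\<not> E w c" if "c \<in> set L" for c using free[of y c] M(1,2) LD that by auto
    have "icyc (v # (L @ Ma) @ y # (Mc @ Mr @ Mb @ R))" using c M by (simp del: icyc.simps)
    then have h: "icyc (w # v # (L @ Ma) @ [y])"
      by (rule icyc_cut2) (use w wn M nL Rne in auto)
    have "sp (w # v # (L @ Ma) @ [y]) = 3" using s(6) M(1) xv xw sL by (simp split: if_splits)
    moreover have "x \<notin> set (w # v # (L @ Ma) @ [y])" using xn w M by auto
    ultimately show False using sp_not_3[OF h] by blast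
  next
    case False
    then have ex: "\<exists>y\<in>set Mb. E w y" using w(7) by auto
    obtain Mb1 y Mc where M: "Mb = Mb1 @ y # Mc" "E w y" "\<And>z. z \<in> set Mc \<Longrightarrow> \<not> E w z"
      by (rule last_nbr[OF ex]) (rule that)
    have nR: "\<not> E w c" if cR: "c \<in> set R" for c
    proof
      assume ec: "E w c"
      \<comment> \<open>The value \<open>c = b\<close> would give two triangles on the edge between
        \<open>x\<close> and \<open>w\<close>; beyond \<open>b\<close>, the spoke \<open>b\<close>
        itself separates \<open>c\<close> from \<open>y\<close> on the arc.\<close>
      have "c \<in> set (b # Rx)" using LD cR by auto
      moreover have "c \<noteq> b"
      proof
        assume "c = b"
        then have "b = v" using not_two_triangles[of w b v] xw s(3) ec xv w(5) by blast
        then show False using v(5) by simp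
      qed
      ultimately obtain R1 R2 where "Rx = R1 @ c # R2" by (metis set_ConsD split_list)
      then have "sp (Mc @ b # R1) = 0"
        using nosep_arc[OF F w(1,6,3), of "X @ Mb1" y "Mc @ b # R1" c "R2 @ Y"] B(1) M ec by simp
      then show False using s(3) by simp
    qed
    have c2: "icyc (y # (Mc @ R) @ v # (L @ Mq @ Mr @ Mb1))"
      using icyc_rot[of "v # L @ Mq @ Mr @ Mb1" "y # Mc @ R"] c M by (simp del: icyc.simps)
    have "icyc (w # y # (Mc @ R) @ [v])"
      by (rule icyc_cut2[OF c2]) (use w wn M nR Lne in auto)
    then have h: "icyc ([v, w] @ (y # Mc @ R))" using icyc_rot[of "w # y # Mc @ R" "[v]"] by (simp del: icyc.simps)
    obtain A where A: "icyc (B @ A)" "set (B @ A) = C" using detour_arc[OF F] by blast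
    have B': "B = (X @ Mb1) @ (y # Mc @ R) @ (W3 @ Y)" using B(1) M R by simp
    have "rim (((X @ Mb1)) @ ((y # Mc @ R) @ (W3 @ Y) @ A))" using A B' unfolding rim_def by simp
    then have r: "rim ((y # Mc @ R) @ ((W3 @ Y) @ A @ X @ Mb1))" using rim_rot[of "X @ Mb1" "(y # Mc @ R) @ (W3 @ Y) @ A"] by simp
    have sB: "sp (y # Mc @ R) + 1 \<le> sp B" using B' B(2) by simp
    have le: "sp ([v, w] @ (y # Mc @ R)) \<le> sp (P @ B)" using sB sP xw xv by simp
    have d: "detour [v, w] (y # Mc @ R)"
    proof (rule detourI[OF h _ _ _ r])
      show "gp [v, w]" unfolding gp_def using xv xw by (metis append_Nil sp_simps(1))
    qed (use v w le D(9) sR xv xw in auto)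
    have "X @ Y \<noteq> []" using B(2) by (metis sp_simps(1) not_one_le_zero)
    then have "length (y # Mc @ R) < length B" using B' by auto
    then show False using min_detour_le[OF m d] le detour_length2[OF F] by simp
  qed
qed

text \<open>On the rim, the spoke \<open>e\<close> lies between \<open>y\<close> and
  \<open>c\<close> on one side, so \<open>nosep\<close> leaves no spoke on the other, which forces
  \<open>y = b\<close>. If \<open>c\<close> were a spoke too, \<open>b\<close> and \<open>c\<close>
  would both complete the edge between \<open>x\<close> and \<open>v\<close> to a triangle.\<close>

lemma obs_outside:
  assumes F: "detour P B" and r: "rim (B @ A)" and v: "v \<in> V" "v \<notin> C" "v \<noteq> x" "E v x"
    and B: "B = Bt @ b # Bm @ e # Bs" "E x b" "E x e" and y: "y \<in> set (b # Bm)" "E v y"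
    and c: "c \<in> set A" "E v c"
  shows "sp Bt = 0 \<and> \<not> E x c"
proof -
  obtain Ya Yb where Y: "b # Bm = Ya @ y # Yb" using y by (meson split_list)
  obtain A1 A2 where A: "A = A1 @ c # A2" using c by (meson split_list)
  have eq: "B @ A = (Bt @ Ya) @ y # (Yb @ e # Bs @ A1) @ c # A2" using B(1) Y A by simp
  have cyc: "icyc (B @ A)" "set (B @ A) = C" using r unfolding rim_def by auto
  have "nosep ((Bt @ Ya) @ y # (Yb @ e # Bs @ A1) @ c # A2) v" using C_nosep[OF cyc v(1-3)] eq by simp
  from nosepD[OF this y(2) c(2)] have o: "sp (Bt @ Ya) = 0" using B(3) by simp
  then have "Ya = []" using Y B(2) by (cases Ya) auto
  then have "y = b" using Y by simp
  have "\<not> E x c"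
  proof
    assume "E x c"
    then have "b = c" using not_two_triangles[of v b c] v(4) B(2) y(2) \<open>y = b\<close> c E_commute by blast
    then show False using icyc_distinct[OF cyc(1)] B(1) c by auto
  qed
  then show ?thesis using o by simp
qed

definition obstr :: "'a list \<Rightarrow> 'a list \<Rightarrow> 'a \<Rightarrow> bool" where
  "obstr P B v \<longleftrightarrow> v \<in> V \<and> v \<notin> C \<and> v \<notin> set P \<and> v \<noteq> x \<and> E v x \<and> obs P B v"

text \<open>\<open>u\<close> is determined as the first spoke of the path, and \<open>b\<close>,
  \<open>e\<close> as the last two of the arc. Hence the decomposition hidden in \<open>obs\<close>
  agrees with any given one.\<close>

lemma obs_unfold:
  assumes P: "P = P1 @ u # P2" "E x u" "sp P1 = 0" and B: "B = Bt @ b # Bm @ e # Bs" "E x b" "E x e" "sp Bm = 0" "sp Bs = 0"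
    and o: "obs P B v"
  shows "(\<exists>p\<in>set P1. E v p) \<and> (\<exists>y\<in>set (b # Bm). E v y) \<and> (\<forall>p\<in>set (P2 @ Bt). \<not> E v p)"
proof -
  obtain P1' u' P2' Bt' b' Bm' e' Bs' where z: "P = P1' @ u' # P2' \<and> E x u' \<and> sp P1' = 0 \<and> B = Bt' @ b' # Bm' @ e' # Bs'
     \<and> E x b' \<and> E x e' \<and> sp Bm' = 0 \<and> sp Bs' = 0 \<and> (\<exists>p\<in>set P1'. E v p) \<and> (\<exists>y\<in>set (b' # Bm'). E v y)
     \<and> (\<forall>p\<in>set (P2' @ Bt'). \<not> E v p)"
    using o unfolding obs_def by (elim exE) (rule that)
  then have P': "P = P1' @ u' # P2'" "E x u'" "sp P1' = 0"
    and B': "B = Bt' @ b' # Bm' @ e' # Bs'" "E x b'" "E x e'" "sp Bm' = 0" "sp Bs' = 0"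
    and c: "(\<exists>p\<in>set P1'. E v p) \<and> (\<exists>y\<in>set (b' # Bm'). E v y) \<and> (\<forall>p\<in>set (P2' @ Bt'). \<not> E v p)"
    by blast+
  have "P1 = P1' \<and> u = u' \<and> P2 = P2'" using first_spoke_unique[of P1 u P2 P1' u' P2'] P P' by simp
  moreover have 1: "Bt @ b # Bm = Bt' @ b' # Bm' \<and> e = e' \<and> Bs = Bs'"
    using last_spoke_unique[of "Bt @ b # Bm" e Bs "Bt' @ b' # Bm'" e' Bs'] B B' by simp
  moreover have "Bt = Bt' \<and> b = b' \<and> Bm = Bm'" using last_spoke_unique[of Bt b Bm Bt' b' Bm'] 1 B B' by simp
  ultimately show ?thesis using c by simp
qed

end

section \<open>Exchanges on a minimal detour\<close>

context wheel_ctx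
begin

lemma obs_shape:
  assumes F: "detour P B" and o: "obs P B v"
  obtains P1 u P2 Bt b Bm e Bs where "P = P1 @ u # P2" "E x u" "sp P1 = 0" "B = Bt @ b # Bm @ e # Bs"
    "E x b" "E x e" "sp Bm = 0" "sp Bs = 0"
proof -
  obtain P1 u P2 Bt b Bm e Bs where z: "P = P1 @ u # P2 \<and> E x u \<and> sp P1 = 0 \<and> B = Bt @ b # Bm @ e # Bs
     \<and> E x b \<and> E x e \<and> sp Bm = 0 \<and> sp Bs = 0 \<and> (\<exists>p\<in>set P1. E v p) \<and> (\<exists>y\<in>set (b # Bm). E v y)
     \<and> (\<forall>p\<in>set (P2 @ Bt). \<not> E v p)"
    using o unfolding obs_def by (elim exE) (rule that)
  show thesis by (rule that[of P1 u P2 Bt b Bm e Bs]) (use z in blast)+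
qed

text \<open>The cycle is read from \<open>e\<close>, so that the two sectors at \<open>e\<close>
  come first and last and the far side \<open>P2 @ Bt\<close> is the \<open>M\<close> of
  \<open>corner\<close>. Mirrored obstructions take the role of \<open>Psi\<close>; they occur only
  when the path has a single spoke, and are left to a second exchange.\<close>

lemma detour_corner:
  assumes m: "min_detour P B" and pe: "pend P"
    and P: "P = P1 @ u # P2" "E x u" "sp P1 = 0"
    and B: "B = Bt @ b # Bm @ e # Bs" "E x b" "E x e" "sp Bm = 0" "sp Bs = 0"
    and ex: "obstr P B v0"
  obtains v W1 L R W3 where "obstr P B v" "(Bs @ P1) @ [u] = W1 @ L" "L \<noteq> []" "b # Bm = R @ W3" "R \<noteq> []"
    "icyc (v # L @ (P2 @ Bt) @ R)" "sp (v # L @ (P2 @ Bt) @ R) = sp (P @ B)"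
    "\<And>w. \<lbrakk>w \<in> V; w \<notin> set (v # L @ (P2 @ Bt) @ R); w \<noteq> x; \<not> E w x\<rbrakk>
      \<Longrightarrow> nosep (v # L @ (P2 @ Bt) @ R) w \<and> card {h\<in>set (v # L @ (P2 @ Bt) @ R). E w h} \<le> 2"
    "\<And>w. \<lbrakk>w \<in> V; w \<notin> set (v # L @ (P2 @ Bt) @ R); w \<noteq> x; E w x\<rbrakk>
      \<Longrightarrow> nosep (v # L @ (P2 @ Bt) @ R) w \<or> (sp P = 1 \<and> obstr (rev P) (rev B) w \<and> \<not> E w v)"
proof -
  have F: "detour P B" using m unfolding min_detour_def by blast
  note D = detourD[OF F]
  let ?D = "e # (Bs @ P1) @ u # (P2 @ Bt) @ b # Bm"
  have PB: "P @ B = (P1 @ u # P2 @ Bt @ b # Bm) @ (e # Bs)" using P(1) B(1) by simp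
  have DPB: "?D = (e # Bs) @ (P1 @ u # P2 @ Bt @ b # Bm)" by simp
  have cyc: "icyc ?D" using icyc_rot[of "P1 @ u # P2 @ Bt @ b # Bm" "e # Bs"] D(1) PB by (simp del: icyc.simps)
  have setD: "set ?D = set (P @ B)" using PB by auto
  have spD: "sp ?D = sp (P @ B)" using PB by simp
  have nsD: "nosep ?D w" if "nosep (P @ B) w" for w
    using nosep_rot[of "P1 @ u # P2 @ Bt @ b # Bm" "e # Bs" w] that PB by simp
  have xD: "x \<notin> set ?D" using D(7) setD by simp
  obtain A where A: "icyc (B @ A)" "set (B @ A) = C" using detour_arc[OF F] by blast
  then have r: "rim (B @ A)" unfolding rim_def by simp
  have out: "w \<in> set A" if "w \<in> C" "w \<notin> set ?D" for w using that A(2) setD by auto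
  have notP: "w \<notin> set P" if "w \<notin> set ?D" for w using that setD by auto
  have oU: "(\<exists>p\<in>set P1. E w p) \<and> (\<exists>y\<in>set (b # Bm). E w y) \<and> (\<forall>p\<in>set (P2 @ Bt). \<not> E w p)" if "obs P B w" for w
    using obs_unfold[OF P B that] .
  have H1: "nosep ?D w \<and> card {h\<in>set ?D. E w h} \<le> 2" if w: "w \<in> V" "w \<notin> set ?D" "w \<noteq> x" "\<not> E w x" for w
  proof (cases "w \<in> C")
    case True
    then show ?thesis using detour_outside[OF m r out[OF True w(2)]] nsD w setD by auto
  next
    case False
    then show ?thesis using detour_nonnbr[OF m w(1) False w(3) notP[OF w(2)] w(4) pe] nsD setD by auto
  qed
  have H2: "nosep ?D w \<or> obstr P B w \<or> (sp P = 1 \<and> obstr (rev P) (rev B) w)"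
    if w: "w \<in> V" "w \<notin> set ?D" "w \<noteq> x" "E w x" for w
  proof (cases "w \<in> C")
    case True
    then show ?thesis using detour_outside[OF m r out[OF True w(2)]] nsD w setD by auto
  next
    case False
    then show ?thesis using detour_nbr[OF m w(1) False w(3) notP[OF w(2)] w(4) pe] nsD w notP[OF w(2)]
      unfolding obstr_def by auto
  qed
  have sP: "sp P = 1 + sp P2" using P by simp
  have rP: "rev P = rev P2 @ u # rev P1" using P(1) by simp
  have rB: "rev B = rev Bs @ e # rev Bm @ b # rev Bt" using B(1) by simp
  \<comment> \<open>A mirrored obstruction has its path neighbours beyond \<open>u\<close>, hence in
    \<open>P2\<close>, and sees nothing of \<open>P1\<close> or \<open>Bs\<close>.\<close>
  have psi: "(\<exists>p\<in>set P2. E w p) \<and> (\<forall>p\<in>set (Bs @ P1). \<not> E w p)" if o: "sp P = 1" "obs (rev P) (rev B) w" for w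
  proof -
    have "sp P2 = 0" using sP o by simp
    obtain P1' u' P2' Bt' b' Bm' e' Bs' where z: "rev P = P1' @ u' # P2' \<and> E x u' \<and> sp P1' = 0 \<and> rev B = Bt' @ b' # Bm' @ e' # Bs'
       \<and> E x b' \<and> E x e' \<and> sp Bm' = 0 \<and> sp Bs' = 0 \<and> (\<exists>p\<in>set P1'. E w p) \<and> (\<exists>y\<in>set (b' # Bm'). E w y)
       \<and> (\<forall>p\<in>set (P2' @ Bt'). \<not> E w p)"
      using o(2) unfolding obs_def by (elim exE) (rule that)
    have 1: "rev P2 = P1' \<and> u = u' \<and> rev P1 = P2'"
      using first_spoke_unique[of "rev P2" u "rev P1" P1' u' P2'] z rP \<open>sp P2 = 0\<close> P(2) by simp
    have zB: "rev Bs @ e # rev Bm @ b # rev Bt = Bt' @ b' # Bm' @ e' # Bs'" using z rB by simp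
    obtain us where "rev Bs = Bt' @ us \<and> us @ e # rev Bm @ b # rev Bt = b' # Bm' @ e' # Bs'
        \<or> rev Bs @ us = Bt' \<and> e # rev Bm @ b # rev Bt = us @ b' # Bm' @ e' # Bs'"
      using zB append_eq_append_conv2[of "rev Bs" "e # rev Bm @ b # rev Bt" Bt' "b' # Bm' @ e' # Bs'"] by auto
    then have "set Bs \<subseteq> set Bt'"
    proof
      assume u: "rev Bs = Bt' @ us \<and> us @ e # rev Bm @ b # rev Bt = b' # Bm' @ e' # Bs'"
      have "us = []"
      proof (rule ccontr)
        assume "us \<noteq> []"
        then have "b' \<in> set us" using u by (cases us) auto
        then have "b' \<in> set (rev Bs)" using u by (metis Un_iff set_append)
        then show False using B(5) z sp_0D[of Bs b'] by simp
      qed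
      then have "rev Bs = Bt'" using u by simp
      then show ?thesis by auto
    next
      assume "rev Bs @ us = Bt' \<and> e # rev Bm @ b # rev Bt = us @ b' # Bm' @ e' # Bs'"
      then have "Bt' = rev Bs @ us" by simp
      then show ?thesis by auto
    qed
    moreover have "set P1 = set P2'" "set P2 = set P1'" using 1 by (metis set_rev)+
    ultimately show ?thesis using z by auto
  qed
  have H3: False if o: "obstr P B v" and wv: "E w v" and w: "w \<in> V" "w \<notin> set ?D" "w \<noteq> x"
    and y: "y \<in> set (P2 @ Bt)" "E w y" for v w y
  proof -
    have v: "v \<in> V" "v \<notin> C" "v \<notin> set P" "v \<noteq> x" "E v x" "obs P B v" using o unfolding obstr_def by auto
    note ov = oU[OF v(6)]
    have xv: "E x v" using v E_commute by blast
    have vD: "v \<notin> set ?D" using v setD D(5) by auto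
    have vLx: "\<exists>y\<in>set ((Bs @ P1) @ [u]). E v y" using ov by auto
    have vRx: "\<exists>y\<in>set (b # Bm). E v y" and vM: "\<And>y. y \<in> set (P2 @ Bt) \<Longrightarrow> \<not> E v y" using ov by blast+
    have sLx: "sp (Bs @ P1) = 0" using P B by simp
    have s4: "4 \<le> sp ?D" using spD D(8) by simp
    have B': "B = [] @ (Bt @ b # Bm) @ (e # Bs)" using B(1) by simp
    have e1: "1 \<le> sp ([] @ (e # Bs))" using B(3) by simp
    have outA: "sp Bt = 0 \<and> \<not> E x w" if "w \<in> C"
    proof -
      obtain y' where "y' \<in> set (b # Bm)" "E v y'" using vRx by blast
      then show ?thesis using obs_outside[OF F r v(1,2,4,5) B(1-3) _ _ out[OF that w(2)]] wv E_commute by blast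
    qed
    show False
    proof (cases "E w x")
      case False
      have sP2: "sp P2 \<le> 1" using sP detour_spokes(1)[OF F] by simp
      show False
        by (rule corner_nonnbr[OF m _ cyc xD B(3) P(2) B(2) sLx B(4) s4 sP2 B' e1 v(1,2,4,5) vD vLx vRx vM w False wv y])
          (use sP H1[OF w False] outA in auto)
    next
      case wx: True
      have xw: "E x w" using wx E_commute by blast
      have wC: "w \<notin> C" using outA xw by blast
      \<comment> \<open>Two spokes on the path would be adjacent and form a second triangle at
        \<open>x\<close>, besides that of \<open>v\<close> and \<open>w\<close>.\<close>
      have sP1: "sp P = 1"
      proof (rule ccontr)
        assume "sp P \<noteq> 1"
        then obtain Q u1 u2 where Q: "P = Q @ [u1, u2]" "sp Q = 0" "E x u1" "E x u2" using pe sP unfolding pend_def by auto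
        have "ipath [u1, u2]" using icyc_sub[of Q "[u1, u2]" B] D(1,3) Q(1) by simp
        then have "E u1 u2" by simp
        then have "{u1, u2} = {v, w}" using triangle_unique[of x u1 u2 v w] Q(3,4) xv xw wv E_commute by blast
        then show False using v(3) Q(1) by auto
      qed
      have sP2: "sp P2 = 0" using sP sP1 by simp
      have nu: "\<not> E w u"
      proof
        assume "E w u"
        then have "u = v" using not_two_triangles[of w u v] xw P(2) xv wv by blast
        then show False using v(3) P(1) by simp
      qed
      have free: "\<not> E w c" if z: "z \<in> set P2" "E w z" "c \<in> set ((Bs @ P1) @ [u])" for z c
      proof
        assume ec: "E w c"
        then have c: "c \<in> set (Bs @ P1)" using z nu by auto
        obtain Ca Cb where Ca: "Bs @ P1 = Ca @ c # Cb" using c by (meson split_list)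
        obtain Za Zb where Za: "P2 = Za @ z # Zb" using z by (meson split_list)
        have "\<not> nosep ?D w"
        proof
          assume n: "nosep ?D w"
          have eq: "?D = (e # Ca) @ c # (Cb @ u # Za) @ z # (Zb @ Bt @ b # Bm)" unfolding Ca using Za by simp
          have "nosep ((e # Ca) @ c # (Cb @ u # Za) @ z # (Zb @ Bt @ b # Bm)) w" using n unfolding eq .
          from nosepD[OF this ec z(2)] show False using P(2) B(3) by simp
        qed
        then consider "obstr P B w" | "obstr (rev P) (rev B) w" using H2[OF w wx] by blast
        then show False
        proof cases
          case 1
          then show False using oU[of w] z unfolding obstr_def by auto
        next
          case 2
          then show False using psi[OF sP1, of w] c ec unfolding obstr_def by auto
        qed
      qed
      have cy: "icyc (e # (Bs @ P1) @ u # (P2 @ [] @ Bt) @ b # Bm)" "x \<notin> set (e # (Bs @ P1) @ u # (P2 @ [] @ Bt) @ b # Bm)"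
        using cyc xD by (simp_all del: icyc.simps)
      show False
        by (rule corner_nbr[OF m sP1 cy B(3) P(2) B(2) sLx B(4) sP2 B' e1 v(1,2,4,5), of w])
          (use vD vLx vRx vM w wx wv wC y free in auto)
    qed
  qed
  let ?psi = "\<lambda>w. sp P = 1 \<and> obstr (rev P) (rev B) w"
  obtain v W1 L R W3 where c: "obstr P B v" "(Bs @ P1) @ [u] = W1 @ L" "L \<noteq> []" "b # Bm = R @ W3" "R \<noteq> []"
    "icyc (v # L @ (P2 @ Bt) @ R)" "sp (v # L @ (P2 @ Bt) @ R) = sp ?D"
    "\<And>w. \<lbrakk>w \<in> V; w \<notin> set (v # L @ (P2 @ Bt) @ R); w \<noteq> x; \<not> E w x\<rbrakk>
      \<Longrightarrow> nosep (v # L @ (P2 @ Bt) @ R) w \<and> card {h\<in>set (v # L @ (P2 @ Bt) @ R). E w h} \<le> 2"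
    "\<And>w. \<lbrakk>w \<in> V; w \<notin> set (v # L @ (P2 @ Bt) @ R); w \<noteq> x; E w x\<rbrakk> \<Longrightarrow> nosep (v # L @ (P2 @ Bt) @ R) w \<or> (?psi w \<and> \<not> E w v)"
  proof (rule corner[of e "Bs @ P1" u "P2 @ Bt" b Bm "obstr P B" ?psi v0])
    show "icyc ?D" "x \<notin> set ?D" "E x e" "E x u" "E x b" "sp (Bs @ P1) = 0" "sp Bm = 0" "obstr P B v0" using cyc xD P B ex by auto
    show "4 \<le> sp ?D" using spD D(8) by simp
    fix v assume o: "obstr P B v"
    then have "obs P B v" unfolding obstr_def by blast
    note ov = oU[OF this]
    show "v \<in> V \<and> v \<notin> set ?D \<and> v \<noteq> x \<and> E v x \<and> (\<exists>y\<in>set ((Bs @ P1) @ [u]). E v y) \<and> (\<exists>y\<in>set (b # Bm). E v y)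
        \<and> (\<forall>y\<in>set (P2 @ Bt). \<not> E v y)"
      using o ov D(5) unfolding obstr_def setD by auto
  next
    fix w assume "w \<in> V" "w \<notin> set ?D" "w \<noteq> x" "\<not> E w x"
    then show "nosep ?D w \<and> card {h\<in>set ?D. E w h} \<le> 2" by (rule H1)
  next
    fix w assume "w \<in> V" "w \<notin> set ?D" "w \<noteq> x" "E w x"
    then show "nosep ?D w \<or> obstr P B w \<or> ?psi w" by (rule H2)
  next
    fix w assume "?psi w"
    then show "\<exists>y\<in>set (P2 @ Bt). E w y" using psi[of w] unfolding obstr_def by auto
  next
    fix v w y assume "obstr P B v" "E w v" "w \<in> V" "w \<notin> set ?D" "w \<noteq> x" "y \<in> set (P2 @ Bt)" "E w y"
    then show False by (rule H3)
  qed (rule that)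
  show thesis
  proof (rule that[OF c(1-6)])
    show "sp (v # L @ (P2 @ Bt) @ R) = sp (P @ B)" using c(7) spD by simp
    show "nosep (v # L @ (P2 @ Bt) @ R) w \<and> card {h\<in>set (v # L @ (P2 @ Bt) @ R). E w h} \<le> 2"
      if "w \<in> V" "w \<notin> set (v # L @ (P2 @ Bt) @ R)" "w \<noteq> x" "\<not> E w x" for w using c(8)[OF that] .
    show "nosep (v # L @ (P2 @ Bt) @ R) w \<or> (sp P = 1 \<and> obstr (rev P) (rev B) w \<and> \<not> E w v)"
      if "w \<in> V" "w \<notin> set (v # L @ (P2 @ Bt) @ R)" "w \<noteq> x" "E w x" for w using c(9)[OF that] by blast
  qed
qed

text \<open>The exchange is repeated at the first spoke \<open>e'\<close> of the arc, on the
  reversed cycle obtained from the first one. Now \<open>v\<close> belongs to the far side, so only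
  mirrored obstructions not adjacent to \<open>v\<close> are candidates; by \<open>n2\<close> these
  are all that matter. As nothing is left for the role of \<open>Psi\<close>, no improper vertex
  remains.\<close>

lemma detour_second_corner:
  assumes m: "min_detour P B" and sP1: "sp P = 1"
    and P: "P = P1 @ u # P2" "E x u" "sp P1 = 0"
    and B: "B = Bt @ b # Bm @ e # Bs" "E x b" "E x e" "sp Bm = 0" "sp Bs = 0"
    and v: "obstr P B v" and LR: "(Bs @ P1) @ [u] = W1 @ L" "L \<noteq> []" "b # Bm = R @ W3" "R \<noteq> []"
    and cyc: "icyc (v # L @ (P2 @ Bt) @ R)" and spD: "sp (v # L @ (P2 @ Bt) @ R) = sp (P @ B)"
    and n1: "\<And>w. \<lbrakk>w \<in> V; w \<notin> set (v # L @ (P2 @ Bt) @ R); w \<noteq> x; \<not> E w x\<rbrakk>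
      \<Longrightarrow> nosep (v # L @ (P2 @ Bt) @ R) w \<and> card {h\<in>set (v # L @ (P2 @ Bt) @ R). E w h} \<le> 2"
    and n2: "\<And>w. \<lbrakk>w \<in> V; w \<notin> set (v # L @ (P2 @ Bt) @ R); w \<noteq> x; E w x\<rbrakk>
      \<Longrightarrow> nosep (v # L @ (P2 @ Bt) @ R) w \<or> (sp P = 1 \<and> obstr (rev P) (rev B) w \<and> \<not> E w v)"
    and ex: "obstr (rev P) (rev B) v0" "\<not> E v0 v"
  obtains D where "icyc D" "x \<notin> set D" "sp D = sp (P @ B)"
    "\<And>w. \<lbrakk>w \<in> V; w \<notin> set D; w \<noteq> x; \<not> E w x\<rbrakk> \<Longrightarrow> nosep D w \<and> card {h\<in>set D. E w h} \<le> 2"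
    "\<And>w. \<lbrakk>w \<in> V; w \<notin> set D; w \<noteq> x; E w x\<rbrakk> \<Longrightarrow> nosep D w"
proof -
  have F: "detour P B" using m unfolding min_detour_def by blast
  note D = detourD[OF F]
  have rm: "min_detour (rev P) (rev B)" using min_detour_rev[OF m] .
  have rF: "detour (rev P) (rev B)" using detour_rev[OF F] .
  obtain A where A: "icyc (B @ A)" "set (B @ A) = C" using detour_arc[OF F] by blast
  have "rim (B @ A)" using A unfolding rim_def by blast
  from rim_rev[OF this] have "rim (rev A @ rev B)" by simp
  then have rr: "rim (rev B @ rev A)" by (rule rim_rot)
  have vp: "v \<in> V" "v \<notin> C" "v \<notin> set P" "v \<noteq> x" "E v x" "obs P B v" using v unfolding obstr_def by auto
  have ov: "(\<exists>p\<in>set P1. E v p) \<and> (\<exists>y\<in>set (b # Bm). E v y) \<and> (\<forall>p\<in>set (P2 @ Bt). \<not> E v p)"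
    using obs_unfold[OF P B vp(6)] .
  have xv: "E x v" using vp E_commute by blast
  have sP2: "sp P2 = 0" using P sP1 by simp
  \<comment> \<open>The arc has a spoke before \<open>b\<close>, so \<open>e'\<close> differs from
    \<open>b\<close> and \<open>e\<close>, and the two exchanges do not collide.\<close>
  have "3 \<le> sp B" using detour_spokes(2)[OF F] sP1 by simp
  then have "0 < sp Bt" using B by simp
  then obtain Bu e' Y where Bt: "Bt = Bu @ e' # Y" "E x e'" "sp Bu = 0" by (rule first_spoke)
  have hR: "hd R = b" using LR(3,4) by (cases R) auto
  \<comment> \<open>The spoke \<open>b'\<close> next to \<open>e'\<close> is sought on the exchanged
    cycle. It exists because \<open>R\<close> still begins with \<open>b\<close>.\<close>
  have "b \<in> set (Y @ R)" using hR hd_in_set[OF LR(4)] by simp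
  then have "0 < sp (Y @ R)" using B(2) unfolding sp_pos_iff by blast
  then obtain Rx0 b' W where YR: "Y @ R = Rx0 @ b' # W" "E x b'" "sp Rx0 = 0" by (rule first_spoke)
  have laL: "last L = u" using LR(1,2) by (metis last_appendR last_snoc)
  obtain L'' where L: "L = L'' @ [u]" using laL LR(2) by (metis append_butlast_last_id)
  have "(Bs @ P1) @ [u] = (W1 @ L'') @ [u]" using LR(1) L by simp
  then have L'': "Bs @ P1 = W1 @ L''" using append1_eq_conv by blast
  have sL'': "sp L'' = 0" using arg_cong[OF L'', of sp] P B by simp
  have setL'': "set L'' \<subseteq> set (Bs @ P1)" using arg_cong[OF L'', of set] by auto
  let ?D1 = "v # L @ (P2 @ Bt) @ R"
  let ?D2 = "e' # (rev Bu @ rev P2) @ u # ((rev L'' @ [v]) @ rev W) @ b' # rev Rx0"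
  have D1: "?D1 = v # L'' @ u # P2 @ Bu @ e' # Rx0 @ b' # W" using L Bt YR by simp
  have rD1: "rev ?D1 = (rev W @ b' # rev Rx0) @ (e' # rev Bu @ rev P2 @ u # rev L'' @ [v])" unfolding D1 by simp
  have D2: "?D2 = (e' # rev Bu @ rev P2 @ u # rev L'' @ [v]) @ (rev W @ b' # rev Rx0)" by simp
  have cyc2: "icyc ?D2" using icyc_rot[of "rev W @ b' # rev Rx0" "e' # rev Bu @ rev P2 @ u # rev L'' @ [v]"] icyc_rev[OF cyc]
    unfolding rD1 D2 by blast
  have set2: "set ?D2 = set ?D1" unfolding D1 by auto
  have sp2: "sp ?D2 = sp (P @ B)" using spD unfolding D1 by simp
  have ns2: "nosep ?D2 w" if "nosep ?D1 w" for w
    using nosep_rot[of "rev W @ b' # rev Rx0" "e' # rev Bu @ rev P2 @ u # rev L'' @ [v]" w] nosep_rev[OF that]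
    unfolding rD1 D2 by blast
  have rP: "rev P = rev P2 @ u # rev P1" using P(1) by simp
  have "B = Bu @ e' # (Y @ R) @ W3 @ e # Bs" using B(1) Bt(1) LR(3) by simp
  then have rB: "rev B = (rev Bs @ e # rev W3 @ rev W) @ b' # rev Rx0 @ e' # rev Bu" unfolding YR(1) by simp
  have o2: "(\<exists>p\<in>set (rev P2). E w p) \<and> (\<exists>y\<in>set (b' # rev Rx0). E w y) \<and> (\<forall>p\<in>set (rev P1 @ rev Bs @ e # rev W3 @ rev W). \<not> E w p)"
    if "obs (rev P) (rev B) w" for w
    using obs_unfold[OF rP P(2) _ rB YR(2) Bt(2) _ _ that] sP2 YR(3) Bt(3) by simp
  have vD: "v \<notin> set (P @ B)" using vp D(5) by auto
  have setB: "set B = set Bt \<union> set R \<union> set W3 \<union> {e} \<union> set Bs" using arg_cong[OF LR(3), of set] B(1) by auto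
  have D1PB: "set ?D1 \<subseteq> insert v (set (P @ B))" using setL'' L P(1) setB by auto
  have xD1: "x \<notin> set ?D1" using D1PB D(7) vp(4) by auto
  let ?ob = "\<lambda>w. obstr (rev P) (rev B) w \<and> \<not> E w v"
  have obv: "w \<in> V \<and> w \<notin> set ?D2 \<and> w \<noteq> x \<and> E w x \<and> (\<exists>y\<in>set ((rev Bu @ rev P2) @ [u]). E w y)
        \<and> (\<exists>y\<in>set (b' # rev Rx0). E w y) \<and> (\<forall>y\<in>set ((rev L'' @ [v]) @ rev W). \<not> E w y)"
    if o: "?ob w" for w
  proof -
    have w: "w \<in> V" "w \<notin> C" "w \<notin> set P" "w \<noteq> x" "E w x" "obs (rev P) (rev B) w" using o unfolding obstr_def by auto
    note ow = o2[OF w(6)]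
    have "w \<noteq> v" using ow ov by auto
    then have "w \<notin> set ?D1" using D1PB w D(5) by auto
    then show ?thesis using w ow o setL'' set2 by auto
  qed
  \<comment> \<open>Of the rim vertices off the exchanged cycle, those in \<open>W3 @ e # Bs\<close>
    are not seen by a mirrored obstruction, and one on the bypassed arc would force a stretch
    containing the spoke \<open>e\<close> to have none.\<close>
  have freeW: "\<not> E w' w" if o: "?ob w" and w': "w' \<in> C" "w' \<notin> set ?D1" for w w'
  proof
    assume e: "E w' w"
    have w: "w \<in> V" "w \<notin> C" "w \<notin> set P" "w \<noteq> x" "E w x" "obs (rev P) (rev B) w" using o unfolding obstr_def by auto
    note ow = o2[OF w(6)]
    have "w' \<in> set (W3 @ e # Bs) \<or> w' \<in> set A" using w' A(2) setB by auto
    then show False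
    proof
      assume "w' \<in> set (W3 @ e # Bs)"
      then show False using ow e E_commute by auto
    next
      assume a: "w' \<in> set A"
      obtain y' where y': "y' \<in> set (b' # rev Rx0)" "E w y'" using ow by blast
      have "sp (rev Bs @ e # rev W3 @ rev W) = 0 \<and> \<not> E x w'"
        by (rule obs_outside[OF rF rr w(1,2,4,5) rB YR(2) Bt(2) y']) (use a e E_commute in auto)
      then show False using B(3) by simp
    qed
  qed
  have H3: False if o: "?ob v'" and wv: "E w v'" and w: "w \<in> V" "w \<notin> set ?D2" "w \<noteq> x"
    and y: "y \<in> set ((rev L'' @ [v]) @ rev W)" "E w y" for v' w y
  proof -
    note v' = obv[OF o]
    have v'C: "v' \<notin> C" using o unfolding obstr_def by blast
    have xv': "E x v'" using v' E_commute by blast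
    have w1: "w \<notin> set ?D1" using w(2) unfolding set2 .
    have wC: "w \<notin> C" using freeW[OF o _ w1] wv by blast
    have sM: "sp (rev L'' @ [v]) \<le> 1" using sL'' by simp
    have Bx: "rev B = (rev Bs @ e # rev W3) @ (rev W @ b' # rev Rx0) @ (e' # rev Bu)" using rB by simp
    have sX: "1 \<le> sp ((rev Bs @ e # rev W3) @ (e' # rev Bu))" using B(3) by simp
    have sLx: "sp (rev Bu @ rev P2) = 0" "sp (rev Rx0) = 0" using Bt sP2 YR by auto
    have xD2: "x \<notin> set ?D2" using xD1 set2 by simp
    have s4: "4 \<le> sp ?D2" using sp2 D(8) by simp
    show False
    proof (cases "E w x")
      case False
      have c: "card {h\<in>set ?D2. E w h} \<le> 2" using n1[OF w(1) w1 w(3) False] unfolding set2 by blast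
      show False
        by (rule corner_nonnbr[OF rm _ cyc2 xD2 Bt(2) P(2) YR(2) sLx s4 sM Bx sX, of v' w y])
          (use sP1 v' v'C w wC wv False y c in auto)
    next
      case wx: True
      have xw: "E x w" using wx E_commute by blast
      have nu: "\<not> E w u"
      proof
        assume "E w u"
        then have "u = v'" using not_two_triangles[of w u v'] xw P(2) xv' wv by blast
        then show False using v' by auto
      qed
      have nv: "\<not> E w v"
      proof
        assume "E w v"
        then have "v = v'" using not_two_triangles[of w v v'] xw xv xv' wv by blast
        then show False using v' by auto
      qed
      have free: "\<not> E w c" if z: "z \<in> set (rev L'')" "E w z" "c \<in> set ((rev Bu @ rev P2) @ [u])" for z c
      proof
        assume ec: "E w c"
        then have c: "c \<in> set (rev Bu @ rev P2)" using z nu by auto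
        obtain Ca Cb where Ca: "rev Bu @ rev P2 = Ca @ c # Cb" using c by (meson split_list)
        obtain Za Zb where Za: "rev L'' = Za @ z # Zb" using z by (meson split_list)
        have "\<not> nosep ?D1 w"
        proof
          assume "nosep ?D1 w"
          then have n: "nosep ?D2 w" by (rule ns2)
          have eq: "?D2 = (e' # Ca) @ c # (Cb @ u # Za) @ z # ((Zb @ [v]) @ rev W @ b' # rev Rx0)" unfolding Ca Za by simp
          have "nosep ((e' # Ca) @ c # (Cb @ u # Za) @ z # ((Zb @ [v]) @ rev W @ b' # rev Rx0)) w" using n unfolding eq .
          from nosepD[OF this ec z(2)] show False using P(2) Bt(2) by simp
        qed
        then have "obs (rev P) (rev B) w" using n2[OF w(1) w1 w(3) wx] unfolding obstr_def by blast
        then show False using o2[of w] z setL'' by auto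
      qed
      have eqM: "(rev L'' @ [v]) @ rev W = rev L'' @ [v] @ rev W" by simp
      show False
        by (rule corner_nbr[OF rm _ cyc2[unfolded eqM] xD2[unfolded eqM] Bt(2) P(2) YR(2) sLx _ Bx sX, of v' w])
          (use sP1 sL'' v' v'C w wC wv wx y nv free in auto)
    qed
  qed
  obtain v' W1' L' R' W3' where c: "?ob v'" "L' \<noteq> []" "R' \<noteq> []"
    "(rev Bu @ rev P2) @ [u] = W1' @ L'" "b' # rev Rx0 = R' @ W3'"
    "icyc (v' # L' @ ((rev L'' @ [v]) @ rev W) @ R')"
    "sp (v' # L' @ ((rev L'' @ [v]) @ rev W) @ R') = sp ?D2"
    "\<And>w. \<lbrakk>w \<in> V; w \<notin> set (v' # L' @ ((rev L'' @ [v]) @ rev W) @ R'); w \<noteq> x; \<not> E w x\<rbrakk>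
      \<Longrightarrow> nosep (v' # L' @ ((rev L'' @ [v]) @ rev W) @ R') w \<and> card {h\<in>set (v' # L' @ ((rev L'' @ [v]) @ rev W) @ R'). E w h} \<le> 2"
    "\<And>w. \<lbrakk>w \<in> V; w \<notin> set (v' # L' @ ((rev L'' @ [v]) @ rev W) @ R'); w \<noteq> x; E w x\<rbrakk>
      \<Longrightarrow> nosep (v' # L' @ ((rev L'' @ [v]) @ rev W) @ R') w \<or> (False \<and> \<not> E w v')"
  proof (rule corner[of e' "rev Bu @ rev P2" u "(rev L'' @ [v]) @ rev W" b' "rev Rx0" ?ob "\<lambda>_. False" v0])
    show "icyc ?D2" "x \<notin> set ?D2" "E x e'" "E x u" "E x b'" "sp (rev Bu @ rev P2) = 0" "sp (rev Rx0) = 0"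
        "obstr (rev P) (rev B) v0 \<and> \<not> E v0 v" using cyc2 xD1 set2 P Bt YR sP2 ex by auto
    show "4 \<le> sp ?D2" using sp2 D(8) by simp
    fix w assume "?ob w"
    then show "w \<in> V \<and> w \<notin> set ?D2 \<and> w \<noteq> x \<and> E w x \<and> (\<exists>y\<in>set ((rev Bu @ rev P2) @ [u]). E w y)
        \<and> (\<exists>y\<in>set (b' # rev Rx0). E w y) \<and> (\<forall>y\<in>set ((rev L'' @ [v]) @ rev W). \<not> E w y)" by (rule obv)
  next
    fix w assume "w \<in> V" "w \<notin> set ?D2" "w \<noteq> x" "\<not> E w x"
    then show "nosep ?D2 w \<and> card {h\<in>set ?D2. E w h} \<le> 2" using n1[of w] ns2[of w] unfolding set2 by blast
  next
    fix w assume "w \<in> V" "w \<notin> set ?D2" "w \<noteq> x" "E w x"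
    then show "nosep ?D2 w \<or> ?ob w \<or> False" using n2[of w] ns2[of w] unfolding set2 by blast
  next
    fix v' w y assume "?ob v'" "E w v'" "w \<in> V" "w \<notin> set ?D2" "w \<noteq> x" "y \<in> set ((rev L'' @ [v]) @ rev W)" "E w y"
    then show False by (rule H3)
  next
    fix v' W1' L' R' W3' assume "?ob v'" "(rev Bu @ rev P2) @ [u] = W1' @ L'" "L' \<noteq> []" "b' # rev Rx0 = R' @ W3'" "R' \<noteq> []"
      "icyc (v' # L' @ ((rev L'' @ [v]) @ rev W) @ R')"
      "sp (v' # L' @ ((rev L'' @ [v]) @ rev W) @ R') = sp ?D2"
      "\<And>w. \<lbrakk>w \<in> V; w \<notin> set (v' # L' @ ((rev L'' @ [v]) @ rev W) @ R'); w \<noteq> x; \<not> E w x\<rbrakk>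
        \<Longrightarrow> nosep (v' # L' @ ((rev L'' @ [v]) @ rev W) @ R') w \<and> card {h\<in>set (v' # L' @ ((rev L'' @ [v]) @ rev W) @ R'). E w h} \<le> 2"
      "\<And>w. \<lbrakk>w \<in> V; w \<notin> set (v' # L' @ ((rev L'' @ [v]) @ rev W) @ R'); w \<noteq> x; E w x\<rbrakk>
        \<Longrightarrow> nosep (v' # L' @ ((rev L'' @ [v]) @ rev W) @ R') w \<or> (False \<and> \<not> E w v')"
    then show thesis by (intro that[of v' L' R' W1' W3'])
  qed simp
  have "set L' \<subseteq> set ?D2" "set R' \<subseteq> set ?D2" using arg_cong[OF c(4), of set] arg_cong[OF c(5), of set] by auto
  then have "x \<notin> set (v' # L' @ ((rev L'' @ [v]) @ rev W) @ R')" using obv[OF c(1)] xD1 unfolding set2[symmetric] by auto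
  moreover have "sp (v' # L' @ ((rev L'' @ [v]) @ rev W) @ R') = sp (P @ B)" using c(7) sp2 by simp
  ultimately show thesis using that[OF c(6) _ _ c(8)] c(9) by blast
qed

end

text \<open>The choice of the wheel in terms of lists: no cycle with fewer spokes satisfies the list
  version of properness. Four spokes are required so that this version can be translated back into
  sectors.\<close>

locale min_wheel_ctx = wheel_ctx +
  assumes minimal: "\<lbrakk>icyc L; x \<notin> set L; 4 \<le> sp L; sp L < n;
      \<And>v. \<lbrakk>v \<in> V; v \<notin> set L; v \<noteq> x\<rbrakk> \<Longrightarrow> nosep L v \<and> (\<not> E v x \<longrightarrow> card {h\<in>set L. E v h} \<le> 2)\<rbrakk> \<Longrightarrow> False"
begin

lemma no_pend_detour:
  assumes m: "min_detour P B" and pe: "pend P" and ex: "obstr P B v0"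
  shows False
proof -
  have F: "detour P B" using m unfolding min_detour_def by blast
  note D = detourD[OF F]
  have "obs P B v0" using ex unfolding obstr_def by blast
  then obtain P1 u P2 Bt b Bm e Bs where P: "P = P1 @ u # P2" "E x u" "sp P1 = 0"
    and B: "B = Bt @ b # Bm @ e # Bs" "E x b" "E x e" "sp Bm = 0" "sp Bs = 0"
    by (rule obs_shape[OF F]) (rule that)
  obtain v W1 L R W3 where c: "obstr P B v" "(Bs @ P1) @ [u] = W1 @ L" "L \<noteq> []" "b # Bm = R @ W3" "R \<noteq> []"
    "icyc (v # L @ (P2 @ Bt) @ R)" "sp (v # L @ (P2 @ Bt) @ R) = sp (P @ B)"
    "\<And>w. \<lbrakk>w \<in> V; w \<notin> set (v # L @ (P2 @ Bt) @ R); w \<noteq> x; \<not> E w x\<rbrakk>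
      \<Longrightarrow> nosep (v # L @ (P2 @ Bt) @ R) w \<and> card {h\<in>set (v # L @ (P2 @ Bt) @ R). E w h} \<le> 2"
    "\<And>w. \<lbrakk>w \<in> V; w \<notin> set (v # L @ (P2 @ Bt) @ R); w \<noteq> x; E w x\<rbrakk>
      \<Longrightarrow> nosep (v # L @ (P2 @ Bt) @ R) w \<or> (sp P = 1 \<and> obstr (rev P) (rev B) w \<and> \<not> E w v)"
    by (rule detour_corner[OF m pe P B ex]) (rule that)
  show False
  proof (cases "sp P = 1 \<and> (\<exists>w. obstr (rev P) (rev B) w \<and> \<not> E w v)")
    case True
    then obtain w0 where w0: "obstr (rev P) (rev B) w0" "\<not> E w0 v" and sP1: "sp P = 1" by blast
    obtain D' where d: "icyc D'" "x \<notin> set D'" "sp D' = sp (P @ B)"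
      "\<And>w. \<lbrakk>w \<in> V; w \<notin> set D'; w \<noteq> x; \<not> E w x\<rbrakk> \<Longrightarrow> nosep D' w \<and> card {h\<in>set D'. E w h} \<le> 2"
      "\<And>w. \<lbrakk>w \<in> V; w \<notin> set D'; w \<noteq> x; E w x\<rbrakk> \<Longrightarrow> nosep D' w"
      by (rule detour_second_corner[OF m sP1 P B c w0]) (assumption | rule that)+
    show False by (rule minimal[OF d(1,2)]) (use d(3-5) D(8,9) in auto)
  next
    case False
    have x: "x \<notin> set (v # L @ (P2 @ Bt) @ R)"
    proof -
      have "set L \<subseteq> set (P @ B)" "set R \<subseteq> set (P @ B)" using arg_cong[OF c(2), of set] arg_cong[OF c(4), of set] P B by auto
      then show ?thesis using D(7) P B c(1) unfolding obstr_def by auto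
    qed
    show False by (rule minimal[OF c(6) x]) (use c(7) D(8,9) c(8,9) False in auto)
  qed
qed

text \<open>After a reversal the path has two spokes only at its end. If no obstruction exists at
  either end of the arc, the minimal detour itself violates \<open>minimal\<close>.\<close>

lemma no_detour: "\<not> detour P B"
proof
  assume "detour P B"
  then obtain P0 B0 where m0: "min_detour P0 B0" by (rule min_detour_ex)
  have "\<exists>P B. min_detour P B \<and> pend P"
  proof (cases "pend P0")
    case False
    have "detour P0 B0" using m0 unfolding min_detour_def by blast
    then have "pend (rev P0)" using gp_pend[OF detourD(6)] False by blast
    then show ?thesis using min_detour_rev[OF m0] by blast
  qed (use m0 in blast)
  then obtain P B where m: "min_detour P B" and pe: "pend P" by blast
  have F: "detour P B" using m unfolding min_detour_def by blast
  note D = detourD[OF F]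
  obtain A where A: "icyc (B @ A)" "set (B @ A) = C" using detour_arc[OF F] by blast
  then have r: "rim (B @ A)" unfolding rim_def by simp
  have no1: "\<not> obstr P B v" for v using no_pend_detour[OF m pe] by blast
  have no2: "\<not> obstr (rev P) (rev B) v" if "sp P = 1" for v
    using no_pend_detour[OF min_detour_rev[OF m]] that unfolding pend_def by auto
  show False
  proof (rule minimal[OF D(1,7,8,9)])
    fix v assume v: "v \<in> V" "v \<notin> set (P @ B)" "v \<noteq> x"
    show "nosep (P @ B) v \<and> (\<not> E v x \<longrightarrow> card {h\<in>set (P @ B). E v h} \<le> 2)"
    proof (cases "v \<in> C")
      case True
      then have "v \<in> set A" using A(2) v by auto
      then show ?thesis using detour_outside[OF m r] by blast
    next
      case False
      have vP: "v \<notin> set P" using v by simp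
      show ?thesis
      proof (cases "E v x")
        case True
        then show ?thesis using detour_nbr[OF m v(1) False v(3) vP True pe] no1[of v] no2[of v] v False vP
          unfolding obstr_def by auto
      next
        case nx: False
        then show ?thesis using detour_nonnbr[OF m v(1) False v(3) vP nx pe] by blast
      qed
    qed
  qed
qed

lemma no_link: "\<not> link Q s t"
  using link_detour no_detour by blast

end

section \<open>Components and sectors\<close>

context sgraph
begin

text \<open>When a walk is extended by \<open>c\<close>, the path built so far is cut at the first
  vertex that equals or sees \<open>c\<close>; this keeps it induced.\<close>

lemma conn_path:
  assumes "conn Q" "a \<in> Q" "b \<in> Q"
  obtains p where "ipath p" "p \<noteq> []" "set p \<subseteq> Q" "hd p = a" "last p = b"
proof -
  have QV: "Q \<subseteq> V" using assms(1) unfolding conn_def by blast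
  have "(a, b) \<in> {(u, w). u \<in> Q \<and> w \<in> Q \<and> E u w}\<^sup>*" using assms unfolding conn_def by blast
  then have "\<exists>p. ipath p \<and> p \<noteq> [] \<and> set p \<subseteq> Q \<and> hd p = a \<and> last p = b"
  proof (induction rule: rtrancl_induct)
    case base
    show ?case using assms QV by (intro exI[of _ "[a]"]) auto
  next
    case (step b c)
    then obtain p where p: "ipath p" "p \<noteq> []" "set p \<subseteq> Q" "hd p = a" "last p = b" by blast
    have bc: "E b c" "c \<in> Q" using step by auto
    have "\<exists>z\<in>set p. z = c \<or> E z c" using p bc by (metis last_in_set)
    then obtain p1 z p2 where z: "p = p1 @ z # p2" "z = c \<or> E z c" "\<forall>y\<in>set p1. \<not> (y = c \<or> E y c)"
      using split_list_first_prop[of p "\<lambda>z. z = c \<or> E z c"] by blast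
    show ?case
    proof (cases "z = c")
      case True
      have "ipath (p1 @ [c])" using ipath_sub[of "[]" "p1 @ [c]" p2] p(1) z(1) True by simp
      then show ?thesis using p z(1) True bc by (intro exI[of _ "p1 @ [c]"]) (cases p1; auto)
    next
      case False
      have 1: "ipath (p1 @ [z])" using ipath_sub[of "[]" "p1 @ [z]" p2] p(1) z(1) by simp
      have "ipath ((p1 @ [z]) @ [c])" unfolding ipath_append[of "p1 @ [z]"] using 1 z False bc QV by auto
      then show ?thesis using p z(1) bc by (intro exI[of _ "p1 @ [z, c]"]) (cases p1; auto)
    qed
  qed
  then show thesis using that by blast
qed

lemma conn_insert:
  assumes "conn Q" "q \<in> Q" "E q w"
  shows "conn (insert w Q)"
proof -
  have "conn {w}" unfolding conn_def using E_V[OF E_sym[OF assms(3)]] by simp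
  then have "conn (Q \<union> {w})" by (rule conn_union[OF assms(1) _ assms(2) _ assms(3)]) simp
  then show ?thesis by simp
qed

lemma conn_meet:
  assumes "conn A" "conn B" "A \<inter> B \<noteq> {}"
  shows "conn (A \<union> B)"
proof -
  obtain z where z: "z \<in> A" "z \<in> B" using assms by blast
  let ?R = "\<lambda>Q. {(u, w). u \<in> Q \<and> w \<in> Q \<and> E u w}"
  have mono1: "(?R A)\<^sup>* \<subseteq> (?R (A \<union> B))\<^sup>*" by (rule rtrancl_mono) auto
  have mono2: "(?R B)\<^sup>* \<subseteq> (?R (A \<union> B))\<^sup>*" by (rule rtrancl_mono) auto
  have "(u, z) \<in> (?R (A \<union> B))\<^sup>* \<and> (z, u) \<in> (?R (A \<union> B))\<^sup>*" if "u \<in> A \<union> B" for u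
    using that
  proof
    assume "u \<in> A"
    then have "(u, z) \<in> (?R A)\<^sup>*" "(z, u) \<in> (?R A)\<^sup>*" using assms(1) z unfolding conn_def by blast+
    then show ?thesis using mono1 mono2 by blast
  next
    assume "u \<in> B"
    then have "(u, z) \<in> (?R B)\<^sup>*" "(z, u) \<in> (?R B)\<^sup>*" using assms(2) z unfolding conn_def by blast+
    then show ?thesis using mono1 mono2 by blast
  qed
  then have "(u, w) \<in> (?R (A \<union> B))\<^sup>*" if "u \<in> A \<union> B" "w \<in> A \<union> B" for u w
    using that by (meson rtrancl_trans)
  moreover have "A \<union> B \<subseteq> V" "A \<union> B \<noteq> {}" using assms unfolding conn_def by auto
  ultimately show ?thesis unfolding conn_def by blast
qed

end

section \<open>Sectors reached by one component\<close>

context min_wheel_ctx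
begin

lemma no_conn_link:
  assumes "conn Q" "Q \<inter> insert x C = {}" "\<And>q. q \<in> Q \<Longrightarrow> \<not> E x q" "q \<in> Q" "E q s" "q' \<in> Q" "E q' t" "sepC s t"
  shows False
proof -
  obtain p where p: "ipath p" "p \<noteq> []" "set p \<subseteq> Q" "hd p = q" "last p = q'" using conn_path[OF assms(1,4,6)] .
  have "sp p = 0" unfolding sp_0_iff using p assms(3) by auto
  then have "link p s t" unfolding link_def using p assms by auto
  then show False using no_link by blast
qed

text \<open>The vertices of \<open>G\<close> minus the closed neighbourhood of \<open>x\<close>,
  with rim vertices included.\<close>

definition far :: "'a set" where
  "far = {v\<in>V. v \<noteq> x \<and> \<not> E x v}"

definition far_step :: "('a \<times> 'a) set" where
  "far_step = {(a, b). a \<in> far \<and> b \<in> far \<and> E a b}"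

lemma sector_sepC:
  assumes r: "rim (e # X @ e' # Y)" and s: "E x e" "E x e'" and a: "a \<in> set X" "c \<in> C" "c \<notin> set (e # X @ [e'])"
  shows "sepC a c"
proof -
  have "c \<in> set Y" using r a unfolding rim_def by auto
  then obtain Y1 Y2 where Y: "Y = Y1 @ c # Y2" by (meson split_list)
  obtain X1 X2 where X: "X = X1 @ a # X2" using a by (meson split_list)
  have "rim (a # (X2 @ e' # Y1) @ c # (Y2 @ e # X1))" using rim_rot[of "e # X1" "a # X2 @ e' # Y"] r X Y by simp
  then show ?thesis by (rule sepCI) (use s in auto)
qed

lemma sector_nbr:
  assumes r: "rim (e # X @ e' # Y)" and a: "a \<in> set X" "c \<in> C" "E a c"
  shows "c \<in> set (e # X @ [e'])"
proof (rule ccontr)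
  assume c: "c \<notin> set (e # X @ [e'])"
  have cyc: "icyc ((e # X @ [e']) @ Y)" "set (e # X @ e' # Y) = C" using r unfolding rim_def by auto
  have cY: "c \<in> set Y" using cyc c a by auto
  have "a = e' \<or> a = e" using icyc_cross[OF cyc(1) _ cY, of a] a by auto
  then show False using icyc_distinct[OF cyc(1)] a(1) by auto
qed

text \<open>A walk among non-neighbours of \<open>x\<close> that leaves the rim from
  \<open>X\<close> stays in a connected set attached to \<open>X\<close>. A return outside
  \<open>X\<close> would create a link, since the ends of the sector separate its interior from the
  rest of the rim, and the ends themselves are neighbours of \<open>x\<close>.\<close>

lemma sector_component:
  assumes r: "rim (e # X @ e' # Y)" and s: "E x e" "E x e'" "sp X = 0" and w1: "w1 \<in> set X"
    and w: "(w1, w) \<in> far_step\<^sup>*"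
  shows "(w \<in> C \<longrightarrow> w \<in> set X) \<and> (w \<notin> C \<longrightarrow> (\<exists>Q. conn Q \<and> w \<in> Q \<and> Q \<subseteq> far - C \<and> (\<exists>q\<in>Q. \<exists>a\<in>set X. E q a)))"
  using w
proof (induction rule: rtrancl_induct)
  case base
  have "w1 \<in> C" using w1 r unfolding rim_def by auto
  then show ?case using w1 by blast
next
  case (step w w')
  have st: "w \<in> far" "w' \<in> far" "E w w'" using step(2) unfolding far_step_def by auto
  have ns: "w' \<noteq> e" "w' \<noteq> e'" using st(2) s unfolding far_def by auto
  have wV: "w' \<in> V" using st(2) unfolding far_def by blast
  show ?case
  proof (cases "w \<in> C")
    case True
    then have wX: "w \<in> set X" using step by blast
    show ?thesis
    proof (cases "w' \<in> C")
      case True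
      then show ?thesis using sector_nbr[OF r wX True st(3)] ns by auto
    next
      case False
      have "conn {w'}" unfolding conn_def using wV by simp
      then show ?thesis using False wX st E_commute by (intro conjI impI exI[of _ "{w'}"]) auto
    qed
  next
    case False
    then obtain Q q a where Q: "conn Q" "w \<in> Q" "Q \<subseteq> far - C" "q \<in> Q" "a \<in> set X" "E q a" using step by blast
    show ?thesis
    proof (cases "w' \<in> C")
      case True
      have "w' \<in> set X"
      proof (rule ccontr)
        assume "w' \<notin> set X"
        then have "sepC a w'" using sector_sepC[OF r s(1,2) Q(5) True] ns by auto
        then show False using no_conn_link[OF Q(1) _ _ Q(4,6,2) st(3)] Q(3) unfolding far_def by auto
      qed
      then show ?thesis using True by blast
    next
      case w': False
      have "conn (insert w' Q)" by (rule conn_insert[OF Q(1,2) st(3)])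
      then show ?thesis using w' Q st by (intro conjI impI exI[of _ "insert w' Q"]) auto
    qed
  qed
qed

text \<open>The hole passes through \<open>u\<close> and along the rim from \<open>X'\<close> through \<open>B\<close> to \<open>X\<close>, missing \<open>e'\<close> and \<open>g\<close>.\<close>

lemma two_sectors_aux:
  assumes r: "rim (e # X @ e' # A @ g # X' @ g' # B)"
    and s: "E x e" "E x e'" "E x g" "E x g'" "sp X = 0" "sp X' = 0"
    and u: "u \<in> V" "u \<notin> C" "E x u" "\<And>b. b \<in> set (g' # B @ [e]) \<Longrightarrow> \<not> E u b"
    and Z1: "ipath (u # Z1)" "set Z1 \<inter> insert x C = {}" "sp Z1 = 0" "a1 \<in> set X" "E (last (u # Z1)) a1"
    and Z2: "ipath (u # Z2)" "set Z2 \<inter> insert x C = {}" "sp Z2 = 0" "a2 \<in> set X'" "E (last (u # Z2)) a2"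
  shows False
proof -
  have C: "set (e # X @ e' # A @ g # X' @ g' # B) = C" and cyc: "icyc (e # X @ e' # A @ g # X' @ g' # B)"
    using r unfolding rim_def by auto
  have dist: "distinct (e # X @ e' # A @ g # X' @ g' # B)" using icyc_distinct[OF cyc] .
  have r': "rim (g # X' @ g' # (B @ e # X @ e' # A))" using rim_rot[of "e # X @ e' # A" "g # X' @ g' # B"] r by simp
  have ux: "u \<noteq> x" using u E_irrefl by blast
  have far1: "\<not> E x q" if "q \<in> set Z1" for q using sp_0D[OF Z1(3) that] .
  have far2: "\<not> E x q" if "q \<in> set Z2" for q using sp_0D[OF Z2(3) that] .
  \<comment> \<open>A leg sees the rim only within its own sector; any other rim neighbour would
    make it contain a link.\<close>
  have att1: "c \<in> set (e # X @ [e'])" if z: "z \<in> set Z1" "c \<in> C" "E z c" for z c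
  proof (rule ccontr)
    assume "c \<notin> set (e # X @ [e'])"
    then have "sepC a1 c" using sector_sepC[OF r s(1,2) Z1(4) z(2)] by blast
    moreover have "Z1 \<noteq> []" "ipath Z1" using z Z1 by auto
    ultimately show False
      using no_conn_link[OF conn_ipath[of Z1] Z1(2) far1 _ _ z(1,3), of "last Z1" a1] Z1(5) by auto
  qed
  have att2: "c \<in> set (g # X' @ [g'])" if z: "z \<in> set Z2" "c \<in> C" "E z c" for z c
  proof (rule ccontr)
    assume "c \<notin> set (g # X' @ [g'])"
    then have "sepC a2 c" using sector_sepC[OF r' s(3,4) Z2(4) z(2)] by blast
    moreover have "Z2 \<noteq> []" "ipath Z2" using z Z2 by auto
    ultimately show False
      using no_conn_link[OF conn_ipath[of Z2] Z2(2) far2 _ _ z(1,3), of "last Z2" a2] Z2(5) by auto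
  qed
  have a12: "a1 \<in> C" "a2 \<in> C" using C Z1 Z2 by auto
  have sep12: "sepC a1 a2" using sector_sepC[OF r s(1,2) Z1(4) a12(2)] Z2(4) dist by auto
  have noconn: "\<not> conn (set Z1 \<union> set Z2)" if "Z1 \<noteq> []" "Z2 \<noteq> []"
    using no_conn_link[of "set Z1 \<union> set Z2" "last Z1" a1 "last Z2" a2] that Z1 Z2 far1 far2 sep12 by auto
  have disj: "set Z1 \<inter> set Z2 = {}"
  proof (rule ccontr)
    assume a: "\<not> ?thesis"
    then have ne: "Z1 \<noteq> []" "Z2 \<noteq> []" by auto
    then have "conn (set Z1 \<union> set Z2)" using conn_meet[OF conn_ipath conn_ipath] a Z1(1) Z2(1) by auto
    then show False using noconn ne by blast
  qed
  have noE: "\<not> E z z'" if z: "z \<in> set Z1" "z' \<in> set Z2" for z z'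
  proof
    assume e: "E z z'"
    have ne: "Z1 \<noteq> []" "Z2 \<noteq> []" using z by auto
    have "conn (set Z1)" "conn (set Z2)" using conn_ipath ne Z1(1) Z2(1) by auto
    then have "conn (set Z1 \<union> set Z2)" using conn_union[OF _ _ z e] by blast
    then show False using noconn[OF ne] by blast
  qed
  \<comment> \<open>\<open>s'\<close> is the first vertex from \<open>e\<close> onwards that the
    first leg sees, and \<open>t'\<close> the last one up to \<open>g'\<close> that the second leg
    sees. Both legs are then shortened to end at their first vertex that sees \<open>s'\<close> or
    \<open>t'\<close>.\<close>
  have ex1: "\<exists>c\<in>set (e # X). \<exists>z\<in>set (u # Z1). E z c" using Z1(4,5) by (metis last_in_set list.distinct(1) list.set_intros(2))
  obtain Xa s' Xb where S: "e # X = Xa @ s' # Xb" "\<exists>z\<in>set (u # Z1). E z s'" "\<forall>c\<in>set Xa. \<not> (\<exists>z\<in>set (u # Z1). E z c)"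
    using split_list_first_prop[OF ex1] by (elim exE conjE bexE) (rule that; auto)
  have ex2: "\<exists>c\<in>set (X' @ [g']). \<exists>z\<in>set (u # Z2). E z c"
    using Z2(4,5) by (metis Un_iff last_in_set list.distinct(1) set_append)
  obtain Xc t' Xd where T: "X' @ [g'] = Xc @ t' # Xd" "\<exists>z\<in>set (u # Z2). E z t'" "\<forall>c\<in>set Xd. \<not> (\<exists>z\<in>set (u # Z2). E z c)"
    using split_list_last_prop[OF ex2] by (elim exE conjE bexE) (rule that; auto)
  obtain Z1a q Z1b where q: "u # Z1 = Z1a @ q # Z1b" "E q s'" "\<forall>y\<in>set Z1a. \<not> E y s'"
    using split_list_first_prop[OF S(2)] by blast
  obtain Z2a p Z2b where p: "u # Z2 = Z2a @ p # Z2b" "E p t'" "\<forall>y\<in>set Z2a. \<not> E y t'"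
    using split_list_first_prop[OF T(2)] by blast
  obtain Y1 where Y1: "Z1a @ [q] = u # Y1" using q(1) by (cases Z1a) auto
  obtain Y2 where Y2: "Z2a @ [p] = u # Y2" using p(1) by (cases Z2a) auto
  have Z1s: "Z1 = Y1 @ Z1b"
  proof -
    have "u # Z1 = (u # Y1) @ Z1b" using q(1) Y1[symmetric] by simp
    then show ?thesis by simp
  qed
  have Z2s: "Z2 = Y2 @ Z2b"
  proof -
    have "u # Z2 = (u # Y2) @ Z2b" using p(1) Y2[symmetric] by simp
    then show ?thesis by simp
  qed
  have lq: "last (u # Y1) = q" and lp: "last (u # Y2) = p" using Y1[symmetric] Y2[symmetric] by simp_all
  have onlyq: "z = q" if "z \<in> set (u # Y1)" "E z s'" for z using that q(3) unfolding Y1[symmetric] by auto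
  have onlyp: "z = p" if "z \<in> set (u # Y2)" "E z t'" for z using that p(3) unfolding Y2[symmetric] by auto
  have ip1: "ipath (u # Y1)" using ipath_sub[of "[]" "u # Y1" Z1b] Z1(1) Z1s by simp
  have ip2: "ipath (u # Y2)" using ipath_sub[of "[]" "u # Y2" Z2b] Z2(1) Z2s by simp
  let ?P = "rev Y1 @ u # Y2"
  let ?J = "t' # Xd @ B @ Xa @ [s']"
  have ip1r: "ipath (rev Y1 @ [u])" using ip1 ipath_rev[of "u # Y1"] by simp
  have ipP: "ipath ?P"
  proof -
    have "ipath ((rev Y1 @ [u]) @ Y2)" unfolding ipath_append[of "rev Y1 @ [u]" Y2]
      using ip1r ip2 ip1 disj noE Z1s Z2s by auto
    then show ?thesis by simp
  qed
  have e': "s' \<in> set (e # X)" "t' \<in> set (X' @ [g'])" using S(1) T(1) by auto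
  have Xac: "set Xa \<subseteq> set (e # X)" "set Xd \<subseteq> set (X' @ [g'])" using S(1) T(1) by auto
  have eqC: "X' @ g' # B @ e # X = Xc @ ?J @ Xb"
  proof -
    have "X' @ g' # B @ e # X = (X' @ [g']) @ B @ (e # X)" by simp
    then show ?thesis unfolding T(1) S(1) by simp
  qed
  have "rim ((X' @ g' # B @ e # X) @ (e' # A @ [g]))"
    using rim_rot[of "e # X @ e' # A @ [g]" "X' @ g' # B"] rim_rot[of "X' @ g' # B @ e # X" "e' # A @ [g]"] r
      rim_rot[of "e' # A @ [g]" "X' @ g' # B @ e # X"] by simp
  then have "rim (Xc @ (?J @ Xb @ e' # A @ [g]))" unfolding eqC by simp
  from rim_rot[OF this] have rJ: "rim (?J @ (Xb @ e' # A @ [g] @ Xc))" by simp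
  have ipJ: "ipath ?J" using icyc_sub[of "[]" ?J "Xb @ e' # A @ [g] @ Xc"] rJ unfolding rim_def by (simp del: icyc.simps ipath.simps)
  have JC: "set ?J \<subseteq> C" using rJ unfolding rim_def by auto
  have cr: "E z c \<longleftrightarrow> z = last ?P \<and> c = hd ?J \<or> z = hd ?P \<and> c = last ?J" if zP: "z \<in> set ?P" and cJ: "c \<in> set ?J" for z c
  proof -
    have hdP: "hd ?P = q" using lq by (cases Y1 rule: rev_cases) auto
    have laP: "last ?P = p" using lp by (cases Y2) auto
    have st: "s' \<noteq> t'" using e' dist by auto
    have cC: "c \<in> C" using cJ JC by blast
    have sx': "s' \<notin> set (g # X' @ [g'])" "t' \<notin> set (e # X @ [e'])" using e' dist by auto
    have Bn: "c \<notin> set (e # X @ [e'])" "c \<notin> set (g # X' @ [g'])" if "c \<in> set B" for c using that dist by auto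
    have Xn: "c \<notin> set (g # X' @ [g'])" if "c \<in> set Xa" for c using that Xac(1) dist by auto
    have Xn': "c \<notin> set (e # X @ [e'])" if "c \<in> set Xd" for c using that Xac(2) dist by auto
    have zc: "z \<in> set Y1 \<or> z = u \<or> z \<in> set Y2" using zP by auto
    have mid: "\<not> E z c" if cm: "c \<in> set (Xd @ B @ Xa)"
    proof
      assume ez: "E z c"
      consider "c \<in> set Xd" | "c \<in> set B" | "c \<in> set Xa" using cm by auto
      then show False
      proof cases
        case 1
        have "z \<notin> set Y1" using att1[of z c] Z1s ez Xn'[OF 1] cC by auto
        then have "z \<in> set (u # Z2)" using zc Z2s by auto
        then show False using T(3) 1 ez by blast
      next
        case 2
        have "z \<notin> set Y1" using att1[of z c] Z1s ez Bn[OF 2] cC by auto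
        moreover have "z \<notin> set Y2" using att2[of z c] Z2s ez Bn[OF 2] cC by auto
        moreover have "z \<noteq> u" using u(4)[of c] 2 ez by auto
        ultimately show False using zc by blast
      next
        case 3
        have "z \<notin> set Y2" using att2[of z c] Z2s ez Xn[OF 3] cC by auto
        then have "z \<in> set (u # Z1)" using zc Z1s by auto
        then show False using S(3) 3 ez by blast
      qed
    qed
    have qs: "z = q" if "c = s'" "E z c"
    proof -
      have "z \<notin> set Y2" using att2[of z s'] Z2s that sx' cC by auto
      then show ?thesis using zc onlyq[of z] that by auto
    qed
    have pt: "z = p" if "c = t'" "E z c"
    proof -
      have "z \<notin> set Y1" using att1[of z t'] Z1s that sx' cC by auto
      then show ?thesis using zc onlyp[of z] that by auto
    qed
    have "c = t' \<or> c = s' \<or> c \<in> set (Xd @ B @ Xa)" using cJ by auto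
    then have "E z c \<longleftrightarrow> z = p \<and> c = t' \<or> z = q \<and> c = s'" using mid qs pt q(2) p(2) by blast
    then show ?thesis using hdP laP by simp
  qed
  have PC: "set ?P \<inter> insert x C = {}" using Z1(2) Z2(2) Z1s Z2s u ux by auto
  have len: "3 \<le> length (?P @ ?J)" by simp
  have H: "icyc (?P @ ?J)" using icyc_append[of ?P ?J] ipP ipJ cr PC JC len by blast
  have sY: "sp Y1 = 0" "sp Y2 = 0" using Z1(3) Z2(3) Z1s Z2s by auto
  have sXa: "sp (Xa @ [s']) = 1"
  proof -
    have 1: "sp (Xa @ [s']) + sp Xb = 1" using arg_cong[OF S(1), of sp] s by simp
    have "e \<in> set (Xa @ [s'])" using S(1) by (cases Xa) auto
    then have "0 < sp (Xa @ [s'])" unfolding sp_pos_iff using s(1) by blast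
    then show ?thesis using 1 by linarith
  qed
  have sXd: "sp (t' # Xd) = 1"
  proof -
    have 1: "sp Xc + sp (t' # Xd) = 1" using arg_cong[OF T(1), of sp] s by simp
    have "last (t' # Xd) = g'" using arg_cong[OF T(1), of last] by simp
    then have "g' \<in> set (t' # Xd)" using last_in_set[of "t' # Xd"] by simp
    then have "0 < sp (t' # Xd)" unfolding sp_pos_iff using s(4) by blast
    then show ?thesis using 1 by linarith
  qed
  \<comment> \<open>The three are \<open>u\<close> and the sector ends \<open>e\<close> and
    \<open>g'\<close>. The spokes \<open>e'\<close>, \<open>g\<close> and those of \<open>A\<close>
    are saved.\<close>
  have "sp (?P @ ?J) = 3 + sp B" using sY sXa sXd u(3) by simp
  moreover have "n = 4 + sp A + sp B" using rim_sp[OF r] s by simp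
  ultimately have "detour ?P ?J"
    by (intro detourI[OF H _ _ PC rJ]) (use sY u(3) in \<open>auto simp: gp_def\<close>)
  then show False using no_detour by blast
qed

text \<open>The preceding lemma needs \<open>u\<close> to see nothing on
  \<open>g' # B @ [e]\<close>. If it sees something there, it sees nothing on
  \<open>e' # A @ [g]\<close>, and the hole is taken around the other side: seeing both would by
  \<open>nosep\<close> leave only the ends of one of the two sectors, which are spokes, and give two
  triangles on the edge between \<open>x\<close> and \<open>u\<close>.\<close>

lemma two_sectors:
  assumes r: "rim (e # X @ e' # A @ g # X' @ g' # B)"
    and s: "E x e" "E x e'" "E x g" "E x g'" "sp X = 0" "sp X' = 0"
    and u: "u \<in> V" "u \<notin> C" "E x u"
    and Z1: "ipath (u # Z1)" "set Z1 \<inter> insert x C = {}" "sp Z1 = 0" "a1 \<in> set X" "E (last (u # Z1)) a1"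
    and Z2: "ipath (u # Z2)" "set Z2 \<inter> insert x C = {}" "sp Z2 = 0" "a2 \<in> set X'" "E (last (u # Z2)) a2"
  shows False
proof (cases "\<exists>b\<in>set (g' # B @ [e]). E u b")
  case False
  then show False using two_sectors_aux[OF r s u _ Z1 Z2] by blast
next
  case True
  then obtain c where c: "c \<in> set (g' # B @ [e])" "E u c" by blast
  have ux: "u \<noteq> x" using u E_irrefl by blast
  have C: "set (e # X @ e' # A @ g # X' @ g' # B) = C" and cyc: "icyc (e # X @ e' # A @ g # X' @ g' # B)"
    using r unfolding rim_def by auto
  have dist: "distinct (e # X @ e' # A @ g # X' @ g' # B)" using icyc_distinct[OF cyc] .
  have no: "\<not> E u c'" if c': "c' \<in> set (e' # A @ [g])" for c'
  proof
    assume e: "E u c'"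
    have tr: "c = c'" if "E x c" "E x c'" using not_two_triangles[of u c c'] that u(3) c(2) e by blast
    obtain B1 B2 where B: "g' # B @ [e] = B1 @ c # B2" using c by (meson split_list)
    obtain A1 A2 where A: "e' # A @ [g] = A1 @ c' # A2" using c' by (meson split_list)
    have eq: "X @ e' # A @ g # X' @ g' # B @ [e] = (X @ A1) @ c' # (A2 @ X' @ B1) @ c # B2"
    proof -
      have "X @ e' # A @ g # X' @ g' # B @ [e] = X @ (e' # A @ [g]) @ X' @ (g' # B @ [e])" by simp
      then show ?thesis unfolding A B by simp
    qed
    have "rim (X @ e' # A @ g # X' @ g' # B @ [e])" using rim_rot[of "[e]" "X @ e' # A @ g # X' @ g' # B"] r by simp
    then have "rim ((X @ A1) @ c' # (A2 @ X' @ B1) @ c # B2)" unfolding eq .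
    then have "nosep ((X @ A1) @ c' # (A2 @ X' @ B1) @ c # B2) u" using C_nosep u ux unfolding rim_def by blast
    from nosepD[OF this e c(2)] show False
    proof
      assume 1: "sp (A2 @ X' @ B1) = 0"
      have "A2 = []"
      proof (rule ccontr)
        assume "A2 \<noteq> []"
        then have "last A2 = g" using arg_cong[OF A, of last] by simp
        then have "g \<in> set A2" using \<open>A2 \<noteq> []\<close> last_in_set by metis
        then show False using 1 s(3) sp_0D[of "A2 @ X' @ B1" g] by auto
      qed
      moreover have "B1 = []" using 1 B s(4) by (cases B1) auto
      ultimately have "c' = g" "c = g'" using A B arg_cong[OF A, of last] by auto
      then show False using tr s dist by auto
    next
      assume 2: "sp ((X @ A1) @ B2) = 0"
      have "B2 = []"
      proof (rule ccontr)
        assume "B2 \<noteq> []"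
        then have "last B2 = e" using arg_cong[OF B, of last] by simp
        then have "e \<in> set B2" using \<open>B2 \<noteq> []\<close> last_in_set by metis
        then show False using 2 s(1) sp_0D[of "(X @ A1) @ B2" e] by auto
      qed
      moreover have "A1 = []" using 2 A s(2) by (cases A1) auto
      ultimately have "c' = e'" "c = e" using A B arg_cong[OF B, of last] by auto
      then show False using tr s dist by auto
    qed
  qed
  have "rim (rev (e # X @ e' # A @ g # X' @ g' # B))" using rim_rev[OF r] .
  then have "rim ((rev B @ [g'] @ rev X' @ [g] @ rev A) @ (e' # rev X @ [e]))" by simp
  from rim_rot[OF this] have r': "rim (e' # rev X @ e # rev B @ g' # rev X' @ g # rev A)" by simp
  show False
    by (rule two_sectors_aux[OF r' s(2,1,4,3) _ _ u _ Z1(1-3) _ Z1(5) Z2(1-3) _ Z2(5)])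
      (use s no Z1 Z2 in auto)
qed

end

section \<open>Subdivided complete graphs and prisms\<close>

text \<open>Adjacency along a path. An explicitly described graph becomes a disjunction of such
  terms.\<close>

definition padj :: "'a list \<Rightarrow> 'a \<Rightarrow> 'a \<Rightarrow> bool" where
  "padj p x y \<longleftrightarrow> (x, y) \<in> symcl (set (vwalk_arcs p))"

lemma symcl_iff: "(x, y) \<in> symcl S \<longleftrightarrow> (x, y) \<in> S \<or> (y, x) \<in> S"
  unfolding symcl_def by auto

lemma padj_simps[simp]:
  "\<not> padj [] x y" "\<not> padj [a] x y"
  "padj (a # b # p) x y \<longleftrightarrow> x = a \<and> y = b \<or> x = b \<and> y = a \<or> padj (b # p) x y"
  unfolding padj_def symcl_iff by auto

lemma padj_in: "padj p x y \<Longrightarrow> x \<in> set p \<and> y \<in> set p"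
  by (induction p rule: induct_list012) auto

lemma padj_append:
  assumes "p \<noteq> []" "q \<noteq> []"
  shows "padj (p @ q) x y \<longleftrightarrow> padj p x y \<or> padj q x y \<or> x = last p \<and> y = hd q \<or> y = last p \<and> x = hd q"
  unfolding padj_def symcl_iff vwalk_arcs_append[OF assms] by auto

lemma padj_split: "padj (p @ b # q) x y \<longleftrightarrow> padj (p @ [b]) x y \<or> padj (b # q) x y"
proof (cases "p = []")
  case False
  then show ?thesis using padj_append[of p "b # q" x y] padj_append[of p "[b]" x y] by auto
qed simp

lemma padj_rev: "padj (rev p) x y \<longleftrightarrow> padj p x y"
proof (induction p rule: induct_list012)
  case (3 a b p)
  then show ?case using padj_split[of "rev p" b "[a]" x y] by auto
qed auto

text \<open>Subdividing \<open>(u, v)\<close> by the first new vertex \<open>w\<close> leaves the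
  edge \<open>(w, v)\<close>, to which the induction hypothesis applies.\<close>

lemma subdivide_path:
  assumes "subdivision_pair K H" "(u, v) \<in> parcs H" "distinct ws" "set ws \<inter> pverts H = {}"
  shows "\<exists>H'. subdivision_pair K H' \<and> pverts H' = pverts H \<union> set ws
     \<and> parcs H' = (parcs H - {(u, v), (v, u)}) \<union> symcl (set (vwalk_arcs (u # ws @ [v])))"
  using assms
proof (induction ws arbitrary: u H)
  case Nil
  interpret H: pair_bidirected_digraph H using bidirected_digraphI_subdivision[OF Nil(1)] .
  have "(v, u) \<in> parcs H" using Nil(2) H.arcs_symmetric by blast
  then show ?case using Nil by (intro exI[of _ H]) (auto simp: symcl_iff)
next
  case (Cons w ws)
  interpret H: pair_bidirected_digraph H using bidirected_digraphI_subdivision[OF Cons(2)] .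
  have uv: "u \<noteq> v" "u \<in> pverts H" "v \<in> pverts H"
    using H.pair_no_loops[OF Cons(3)] H.arc_fst_in_verts[OF Cons(3)] H.arc_snd_in_verts[OF Cons(3)] by auto
  have w: "w \<notin> pverts H" using Cons by auto
  have wn: "(w, y) \<notin> parcs H" "(y, w) \<notin> parcs H" for y
    using H.arc_fst_in_verts[of "(w, y)"] H.arc_snd_in_verts[of "(y, w)"] w by auto
  let ?H = "subdivide H (u, v) w"
  have sd: "subdivision_pair K ?H" using subdivision_pair_divide[OF Cons(3) w Cons(2)] .
  have "(w, v) \<in> parcs ?H" by simp
  moreover have "distinct ws" "set ws \<inter> pverts ?H = {}" using Cons by auto
  ultimately obtain H' where H': "subdivision_pair K H'" "pverts H' = pverts ?H \<union> set ws"
     "parcs H' = (parcs ?H - {(w, v), (v, w)}) \<union> symcl (set (vwalk_arcs (w # ws @ [v])))"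
    using Cons(1)[OF sd] by blast
  have "parcs H' = (parcs H - {(u, v), (v, u)}) \<union> symcl (set (vwalk_arcs (u # (w # ws) @ [v])))"
    unfolding H'(3) using wn uv w by (auto simp: symcl_iff)
  then show ?case using H' by (intro exI[of _ H']) auto
qed

text \<open>\<open>F\<close> collects the paths already laid and the edges still to be treated. It
  must not contain the current edge, which the subdivision removes.\<close>

lemma subdivide_edge:
  assumes "\<exists>H. subdivision_pair K H \<and> pverts H = U \<and> parcs H = symcl (insert (u, v) F)"
    and "(u, v) \<notin> F" "(v, u) \<notin> F" "distinct ws" "set ws \<inter> U = {}"
  shows "\<exists>H. subdivision_pair K H \<and> pverts H = U \<union> set ws \<and> parcs H = symcl (set (vwalk_arcs (u # ws @ [v])) \<union> F)"
proof -
  obtain H where H: "subdivision_pair K H" "pverts H = U" "parcs H = symcl (insert (u, v) F)" using assms(1) by blast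
  have "(u, v) \<in> parcs H" using H by (auto simp: symcl_iff)
  then obtain H' where H': "subdivision_pair K H'" "pverts H' = pverts H \<union> set ws"
     "parcs H' = (parcs H - {(u, v), (v, u)}) \<union> symcl (set (vwalk_arcs (u # ws @ [v])))"
    using subdivide_path[OF H(1)] assms(4,5) H(2) by blast
  have "parcs H' = symcl (set (vwalk_arcs (u # ws @ [v])) \<union> F)"
    unfolding H'(3) H(3) using assms(2,3) by (auto simp: symcl_iff)
  then show ?thesis using H' H(2) by blast
qed

lemma vwalk_arcs_sub: "(y, z) \<in> set (vwalk_arcs p) \<Longrightarrow> y \<in> set p \<and> z \<in> set p"
  by (induction p rule: induct_list012) auto

lemma complete_bidirected: "pair_bidirected_digraph \<lparr>pverts = U, parcs = {(u, v). (u, v) \<in> U \<times> U \<and> u \<noteq> v}\<rparr>"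
  by unfold_locales (auto simp: symmetric_def sym_def)

lemma complete4_arcs:
  assumes "a \<noteq> b" "a \<noteq> c" "a \<noteq> d" "b \<noteq> c" "b \<noteq> d" "c \<noteq> d"
  shows "{(u, v). (u, v) \<in> {a, b, c, d} \<times> {a, b, c, d} \<and> u \<noteq> v} = symcl {(a, b), (a, c), (a, d), (b, c), (b, d), (c, d)}"
  unfolding symcl_def using assms by auto

lemma distinct_reorder: "distinct xs \<Longrightarrow> set ys = set xs \<Longrightarrow> length ys = length xs \<Longrightarrow> distinct ys"
  by (metis card_distinct distinct_card)

text \<open>The six edges of the complete graph on \<open>a\<close>, \<open>b\<close>,
  \<open>c\<close>, \<open>d\<close> are replaced one after the other by their paths; an empty list
  leaves the edge as it is.\<close>

lemma subdivided_K4I: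
  assumes d: "distinct ([a, b, c, d] @ p1 @ p2 @ p3 @ p4 @ p5 @ p6)"
    and U: "pverts H = set ([a, b, c, d] @ p1 @ p2 @ p3 @ p4 @ p5 @ p6)"
    and A: "parcs H = symcl (set (vwalk_arcs (a # p1 @ [b])) \<union> set (vwalk_arcs (a # p2 @ [c])) \<union> set (vwalk_arcs (a # p3 @ [d]))
      \<union> set (vwalk_arcs (b # p4 @ [c])) \<union> set (vwalk_arcs (b # p5 @ [d])) \<union> set (vwalk_arcs (c # p6 @ [d])))"
  shows "is_subdivided_K4 H"
proof -
  let ?V = "{a, b, c, d}"
  let ?K = "\<lparr>pverts = ?V, parcs = {(u, v). (u, v) \<in> ?V \<times> ?V \<and> u \<noteq> v}\<rparr>"
  have K: "K\<^bsub>4\<^esub> (with_proj ?K)" unfolding complete_digraph_pair_def using d by auto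
  have "subdivision_pair ?K ?K" by (rule subdivision_pair_base[OF complete_bidirected])
  moreover have "parcs ?K = symcl {(a, b), (a, c), (a, d), (b, c), (b, d), (c, d)}"
    unfolding pair_pre_digraph.simps by (rule complete4_arcs) (use d in auto)
  ultimately have s0: "\<exists>H. subdivision_pair ?K H \<and> pverts H = ?V
      \<and> parcs H = symcl (insert (a, b) {(a, c), (a, d), (b, c), (b, d), (c, d)})" by (intro exI[of _ ?K]) simp
  define A1 where "A1 = set (vwalk_arcs (a # p1 @ [b]))"
  define A2 where "A2 = set (vwalk_arcs (a # p2 @ [c]))"
  define A3 where "A3 = set (vwalk_arcs (a # p3 @ [d]))"
  define A4 where "A4 = set (vwalk_arcs (b # p4 @ [c]))"
  define A5 where "A5 = set (vwalk_arcs (b # p5 @ [d]))"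
  define A6 where "A6 = set (vwalk_arcs (c # p6 @ [d]))"
  have n: "(y, z) \<in> A1 \<Longrightarrow> y \<in> set (a # p1 @ [b]) \<and> z \<in> set (a # p1 @ [b])"
    "(y, z) \<in> A2 \<Longrightarrow> y \<in> set (a # p2 @ [c]) \<and> z \<in> set (a # p2 @ [c])"
    "(y, z) \<in> A3 \<Longrightarrow> y \<in> set (a # p3 @ [d]) \<and> z \<in> set (a # p3 @ [d])"
    "(y, z) \<in> A4 \<Longrightarrow> y \<in> set (b # p4 @ [c]) \<and> z \<in> set (b # p4 @ [c])"
    "(y, z) \<in> A5 \<Longrightarrow> y \<in> set (b # p5 @ [d]) \<and> z \<in> set (b # p5 @ [d])" for y z
    unfolding A1_def A2_def A3_def A4_def A5_def by (rule vwalk_arcs_sub, assumption)+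
  \<comment> \<open>Each path already laid misses an end of every edge that is still to be
    subdivided.\<close>
  have x1: "(y, z) \<notin> A1" if "y = c \<or> y = d \<or> z = c \<or> z = d" for y z using n(1)[of y z] that d by auto
  have x2: "(y, z) \<notin> A2" if "y = b \<or> y = d \<or> z = b \<or> z = d" for y z using n(2)[of y z] that d by auto
  have x3: "(y, z) \<notin> A3" if "y = b \<or> y = c \<or> z = b \<or> z = c" for y z using n(3)[of y z] that d by auto
  have x4: "(y, z) \<notin> A4" if "y = a \<or> y = d \<or> z = a \<or> z = d" for y z using n(4)[of y z] that d by auto
  have x5: "(y, z) \<notin> A5" if "y = a \<or> y = c \<or> z = a \<or> z = c" for y z using n(5)[of y z] that d by auto
  have s1: "\<exists>H. subdivision_pair ?K H \<and> pverts H = ?V \<union> set p1 \<and> parcs H = symcl (A1 \<union> {(a, c), (a, d), (b, c), (b, d), (c, d)})"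
    unfolding A1_def by (rule subdivide_edge[OF s0]) (use d in auto)
  have "A1 \<union> {(a, c), (a, d), (b, c), (b, d), (c, d)} = insert (a, c) (A1 \<union> {(a, d), (b, c), (b, d), (c, d)})" by auto
  note s1 = s1[unfolded this]
  have s2: "\<exists>H. subdivision_pair ?K H \<and> pverts H = (?V \<union> set p1) \<union> set p2
      \<and> parcs H = symcl (A2 \<union> (A1 \<union> {(a, d), (b, c), (b, d), (c, d)}))"
    unfolding A2_def by (rule subdivide_edge[OF s1]) (use d x1 in auto)
  have "A2 \<union> (A1 \<union> {(a, d), (b, c), (b, d), (c, d)}) = insert (a, d) (A1 \<union> A2 \<union> {(b, c), (b, d), (c, d)})" by auto
  note s2 = s2[unfolded this]
  have s3: "\<exists>H. subdivision_pair ?K H \<and> pverts H = ((?V \<union> set p1) \<union> set p2) \<union> set p3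
      \<and> parcs H = symcl (A3 \<union> (A1 \<union> A2 \<union> {(b, c), (b, d), (c, d)}))"
    unfolding A3_def by (rule subdivide_edge[OF s2]) (use d x1 x2 in auto)
  have "A3 \<union> (A1 \<union> A2 \<union> {(b, c), (b, d), (c, d)}) = insert (b, c) (A1 \<union> A2 \<union> A3 \<union> {(b, d), (c, d)})" by auto
  note s3 = s3[unfolded this]
  have s4: "\<exists>H. subdivision_pair ?K H \<and> pverts H = (((?V \<union> set p1) \<union> set p2) \<union> set p3) \<union> set p4
      \<and> parcs H = symcl (A4 \<union> (A1 \<union> A2 \<union> A3 \<union> {(b, d), (c, d)}))"
    unfolding A4_def by (rule subdivide_edge[OF s3]) (use d x1 x2 x3 in auto)
  have "A4 \<union> (A1 \<union> A2 \<union> A3 \<union> {(b, d), (c, d)}) = insert (b, d) (A1 \<union> A2 \<union> A3 \<union> A4 \<union> {(c, d)})" by auto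
  note s4 = s4[unfolded this]
  have s5: "\<exists>H. subdivision_pair ?K H \<and> pverts H = ((((?V \<union> set p1) \<union> set p2) \<union> set p3) \<union> set p4) \<union> set p5
      \<and> parcs H = symcl (A5 \<union> (A1 \<union> A2 \<union> A3 \<union> A4 \<union> {(c, d)}))"
    unfolding A5_def by (rule subdivide_edge[OF s4]) (use d x1 x2 x3 x4 in auto)
  have "A5 \<union> (A1 \<union> A2 \<union> A3 \<union> A4 \<union> {(c, d)}) = insert (c, d) (A1 \<union> A2 \<union> A3 \<union> A4 \<union> A5)" by auto
  note s5 = s5[unfolded this]
  have s6: "\<exists>H. subdivision_pair ?K H \<and> pverts H = (((((?V \<union> set p1) \<union> set p2) \<union> set p3) \<union> set p4) \<union> set p5) \<union> set p6
      \<and> parcs H = symcl (A6 \<union> (A1 \<union> A2 \<union> A3 \<union> A4 \<union> A5))"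
    unfolding A6_def by (rule subdivide_edge[OF s5]) (use d x1 x2 x3 x4 x5 in auto)
  then obtain H' where H': "subdivision_pair ?K H'" "pverts H' = (((((?V \<union> set p1) \<union> set p2) \<union> set p3) \<union> set p4) \<union> set p5) \<union> set p6"
      "parcs H' = symcl (A6 \<union> (A1 \<union> A2 \<union> A3 \<union> A4 \<union> A5))" by blast
  have e1: "pverts H' = pverts H" unfolding H'(2) U by auto
  have "A6 \<union> (A1 \<union> A2 \<union> A3 \<union> A4 \<union> A5) = A1 \<union> A2 \<union> A3 \<union> A4 \<union> A5 \<union> A6" by auto
  then have e2: "parcs H' = parcs H" unfolding H'(3) A A1_def A2_def A3_def A4_def A5_def A6_def by simp
  have "H' = H" using e1 e2 by (cases H'; cases H) simp
  then show ?thesis unfolding is_subdivided_K4_def using K H'(1) by blast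
qed

text \<open>The excluded subgraphs in coordinates: four branch vertices with six possibly empty
  subdividing lists, and three paths of a prism with both ends split off, so that each has length at
  least one.\<close>

locale kfree = sgraph +
  assumes no_K4: "\<lbrakk>distinct ([a, b, c, d] @ p1 @ p2 @ p3 @ p4 @ p5 @ p6);
      set ([a, b, c, d] @ p1 @ p2 @ p3 @ p4 @ p5 @ p6) \<subseteq> V;
      \<And>y z. \<lbrakk>y \<in> set ([a, b, c, d] @ p1 @ p2 @ p3 @ p4 @ p5 @ p6); z \<in> set ([a, b, c, d] @ p1 @ p2 @ p3 @ p4 @ p5 @ p6)\<rbrakk> \<Longrightarrow>
        E y z \<longleftrightarrow> padj (a # p1 @ [b]) y z \<or> padj (a # p2 @ [c]) y z \<or> padj (a # p3 @ [d]) y z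
          \<or> padj (b # p4 @ [c]) y z \<or> padj (b # p5 @ [d]) y z \<or> padj (c # p6 @ [d]) y z\<rbrakk> \<Longrightarrow> False"
    and no_prism: "\<lbrakk>distinct ((a # p @ [a']) @ (b # q @ [b']) @ (c # r @ [c']));
      set ((a # p @ [a']) @ (b # q @ [b']) @ (c # r @ [c'])) \<subseteq> V;
      \<And>y z. \<lbrakk>y \<in> set ((a # p @ [a']) @ (b # q @ [b']) @ (c # r @ [c'])); z \<in> set ((a # p @ [a']) @ (b # q @ [b']) @ (c # r @ [c']))\<rbrakk> \<Longrightarrow>
        E y z \<longleftrightarrow> padj (a # p @ [a']) y z \<or> padj (b # q @ [b']) y z \<or> padj (c # r @ [c']) y z
          \<or> padj [a, b, c, a] y z \<or> padj [a', b', c', a'] y z\<rbrakk> \<Longrightarrow> False"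
begin

lemma ipath_padj: "ipath p \<Longrightarrow> y \<in> set p \<Longrightarrow> z \<in> set p \<Longrightarrow> E y z \<longleftrightarrow> padj p y z"
proof (induction p rule: induct_list012)
  case (3 a b p)
  then show ?case using E_commute E_irrefl padj_in[of "b # p" y z] by auto
qed (auto simp: E_irrefl)

lemma icyc_padj:
  assumes "icyc (a # L)" "y \<in> set (a # L)" "z \<in> set (a # L)"
  shows "E y z \<longleftrightarrow> padj (a # L @ [a]) y z"
proof -
  have L: "L \<noteq> []" "ipath L" "a \<notin> set L" "\<forall>b\<in>set L. E a b \<longleftrightarrow> b = hd L \<or> b = last L" using assms(1) by auto
  have "padj (a # L @ [a]) y z \<longleftrightarrow> y = a \<and> z = hd L \<or> y = hd L \<and> z = a \<or> padj L y z \<or> y = last L \<and> z = a \<or> z = last L \<and> y = a"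
    using L padj_append[of "[a]" "L @ [a]" y z] padj_append[of L "[a]" y z] by (auto simp: hd_append)
  moreover have "E y z \<longleftrightarrow> padj L y z" if "y \<in> set L" "z \<in> set L" using ipath_padj[OF L(2) that] .
  ultimately show ?thesis using assms L E_commute[of a] E_irrefl padj_in[of L y z] by (cases "y = a"; cases "z = a") auto
qed

text \<open>The branch vertices of the subdivided \<open>K4\<close> are \<open>u\<close>,
  \<open>a\<close>, \<open>b\<close> and \<open>c\<close>, its paths the three legs from
  \<open>u\<close> and the three arcs of the cycle. \<open>A3\<close> is reversed to run from
  \<open>a\<close> to \<open>c\<close>.\<close>

lemma no_spider:
  assumes H: "icyc (a # A1 @ b # A2 @ c # A3)"
    and l: "ipath (rev la @ u # lb)" "ipath (rev la @ u # lc)" "ipath (rev lb @ u # lc)"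
    and dj: "set (a # A1 @ b # A2 @ c # A3) \<inter> set (u # la @ lb @ lc) = {}"
    and cross: "\<And>h t. \<lbrakk>h \<in> set (a # A1 @ b # A2 @ c # A3); t \<in> set (u # la @ lb @ lc)\<rbrakk> \<Longrightarrow>
      E h t \<longleftrightarrow> h = a \<and> t = last (u # la) \<or> h = b \<and> t = last (u # lb) \<or> h = c \<and> t = last (u # lc)"
  shows False
proof -
  let ?H = "a # A1 @ b # A2 @ c # A3" and ?T = "u # la @ lb @ lc"
  have dH: "distinct ?H" using icyc_distinct[OF H] .
  have dT: "distinct ?T" using ipath_distinct[OF l(1)] ipath_distinct[OF l(2)] ipath_distinct[OF l(3)] by auto
  let ?U = "[u, a, b, c] @ la @ lb @ lc @ A1 @ rev A3 @ A2"
  have UU: "set ?U = set ?H \<union> set ?T" by auto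
  have legT: "padj (u # l @ [h]) y z \<longleftrightarrow> padj (u # l) y z \<or> y = last (u # l) \<and> z = h \<or> z = last (u # l) \<and> y = h" for l h y z
    using padj_append[of "u # l" "[h]" y z] by auto
  have TT: "E y z \<longleftrightarrow> padj (u # la) y z \<or> padj (u # lb) y z \<or> padj (u # lc) y z" if y: "y \<in> set ?T" and z: "z \<in> set ?T" for y z
  proof -
    have r: "padj (rev l @ u # l') y z \<longleftrightarrow> padj (u # l) y z \<or> padj (u # l') y z" for l l'
      using padj_split[of "rev l" u l' y z] padj_rev[of "u # l" y z] by simp
    have i: "y \<in> set (u # la) \<and> z \<in> set (u # la)" if "padj (u # la) y z" using padj_in[OF that] .
    have j: "y \<in> set (u # lb) \<and> z \<in> set (u # lb)" if "padj (u # lb) y z" using padj_in[OF that] .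
    have k: "y \<in> set (u # lc) \<and> z \<in> set (u # lc)" if "padj (u # lc) y z" using padj_in[OF that] .
    have nn: "\<not> padj (u # la) u u" "\<not> padj (u # lb) u u" "\<not> padj (u # lc) u u"
    proof -
      have s: "ipath (u # la)" "ipath (u # lb)" "ipath (u # lc)"
        using ipath_sub[of "[]" "rev la @ [u]" lb] ipath_sub[of "rev la" "u # lb" "[]"] ipath_sub[of "rev la" "u # lc" "[]"] l
          ipath_rev[of "u # la"] by auto
      show "\<not> padj (u # la) u u" "\<not> padj (u # lb) u u" "\<not> padj (u # lc) u u"
        using ipath_padj[OF s(1), of u u] ipath_padj[OF s(2), of u u] ipath_padj[OF s(3), of u u] E_irrefl by auto
    qed
    consider "y \<in> set (rev la @ u # lb)" "z \<in> set (rev la @ u # lb)" | "y \<in> set (rev la @ u # lc)" "z \<in> set (rev la @ u # lc)"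
      | "y \<in> set (rev lb @ u # lc)" "z \<in> set (rev lb @ u # lc)" using y z by auto
    then show ?thesis
    proof cases
      case 1
      have "\<not> padj (u # lc) y z" using k 1 dT nn by auto
      then show ?thesis using ipath_padj[OF l(1) 1] r by blast
    next
      case 2
      have "\<not> padj (u # lb) y z" using j 2 dT nn by auto
      then show ?thesis using ipath_padj[OF l(2) 2] r by blast
    next
      case 3
      have "\<not> padj (u # la) y z" using i 3 dT nn by auto
      then show ?thesis using ipath_padj[OF l(3) 3] r by blast
    qed
  qed
  have HH: "E y z \<longleftrightarrow> padj (a # A1 @ [b]) y z \<or> padj (b # A2 @ [c]) y z \<or> padj (a # rev A3 @ [c]) y z"
    if y: "y \<in> set ?H" and z: "z \<in> set ?H" for y z
  proof -
    have "E y z \<longleftrightarrow> padj (a # (A1 @ b # A2 @ c # A3) @ [a]) y z" using icyc_padj[OF H y z] .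
    also have "\<dots> \<longleftrightarrow> padj ((a # A1) @ b # (A2 @ c # A3 @ [a])) y z" by simp
    also have "\<dots> \<longleftrightarrow> padj (a # A1 @ [b]) y z \<or> padj ((b # A2) @ c # (A3 @ [a])) y z"
      using padj_split[of "a # A1" b "A2 @ c # A3 @ [a]" y z] by simp
    also have "\<dots> \<longleftrightarrow> padj (a # A1 @ [b]) y z \<or> padj (b # A2 @ [c]) y z \<or> padj (c # A3 @ [a]) y z"
      using padj_split[of "b # A2" c "A3 @ [a]" y z] by simp
    finally show ?thesis using padj_rev[of "c # A3 @ [a]" y z] by simp
  qed
  show False
  proof (rule no_K4[of u a b c la lb lc A1 "rev A3" A2])
    have "distinct (?H @ ?T)" unfolding distinct_append[of ?H ?T] using dH dT dj by blast
    then show "distinct ?U" by (rule distinct_reorder) (use UU in auto)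
    have "set ?H \<subseteq> V" "set ?T \<subseteq> V" using icyc_V[OF H] ipath_V[OF l(1)] ipath_V[OF l(2)] by auto
    then show "set ?U \<subseteq> V" unfolding UU by blast
    fix y z assume y: "y \<in> set ?U" and z: "z \<in> set ?U"
    have n1: "\<not> padj (a # A1 @ [b]) y z \<and> \<not> padj (b # A2 @ [c]) y z \<and> \<not> padj (a # rev A3 @ [c]) y z" if "y \<notin> set ?H \<or> z \<notin> set ?H"
      using that padj_in[of "a # A1 @ [b]" y z] padj_in[of "b # A2 @ [c]" y z] padj_in[of "a # rev A3 @ [c]" y z] by auto
    have n2: "\<not> padj (u # la) y z \<and> \<not> padj (u # lb) y z \<and> \<not> padj (u # lc) y z" if "y \<notin> set ?T \<or> z \<notin> set ?T"
      using that padj_in[of "u # la" y z] padj_in[of "u # lb" y z] padj_in[of "u # lc" y z] by auto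
    have lasts: "last (u # la) \<in> set ?T" "last (u # lb) \<in> set ?T" "last (u # lc) \<in> set ?T"
      using last_in_set[of "u # la"] last_in_set[of "u # lb"] last_in_set[of "u # lc"] by auto
    have abc: "a \<in> set ?H" "b \<in> set ?H" "c \<in> set ?H" by auto
    have disj: "v \<in> set ?T \<Longrightarrow> v \<notin> set ?H" for v using dj by blast
    consider "y \<in> set ?T" "z \<in> set ?T" | "y \<in> set ?H" "z \<in> set ?T" | "y \<in> set ?T" "z \<in> set ?H" | "y \<in> set ?H" "z \<in> set ?H"
      using y z unfolding UU by blast
    then show "E y z \<longleftrightarrow> padj (u # la @ [a]) y z \<or> padj (u # lb @ [b]) y z \<or> padj (u # lc @ [c]) y z
          \<or> padj (a # A1 @ [b]) y z \<or> padj (a # rev A3 @ [c]) y z \<or> padj (b # A2 @ [c]) y z"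
    proof cases
      case 1
      then have "y \<notin> set ?H" "z \<notin> set ?H" using disj by auto
      then show ?thesis using TT[OF 1] n1 abc unfolding legT by blast
    next
      case 2
      then have "y \<notin> set ?T" "z \<notin> set ?H" using disj by auto
      then show ?thesis using cross[OF 2] n1 n2 abc lasts unfolding legT by blast
    next
      case 3
      then have "y \<notin> set ?H" "z \<notin> set ?T" using disj by auto
      then show ?thesis using cross[OF 3(2,1)] E_commute[of y z] n1 n2 abc lasts unfolding legT by blast
    next
      case 4
      then have "y \<notin> set ?T" "z \<notin> set ?T" using disj by auto
      then show ?thesis using HH[OF 4] n2 lasts unfolding legT by blast
    qed
  qed
qed

lemma three_legs_adj:
  assumes l: "ipath (wa # la)" "ipath (wb # lb)" "ipath (wc # lc)"
    and ab: "\<forall>y\<in>set (wa # la). \<forall>z\<in>set (wb # lb). E y z \<longleftrightarrow> y = wa \<and> z = wb"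
    and ac: "\<forall>y\<in>set (wa # la). \<forall>z\<in>set (wc # lc). E y z \<longleftrightarrow> y = wa \<and> z = wc"
    and bc: "\<forall>y\<in>set (wb # lb). \<forall>z\<in>set (wc # lc). E y z \<longleftrightarrow> y = wb \<and> z = wc"
    and d: "distinct ((wa # la) @ (wb # lb) @ (wc # lc))"
    and y: "y \<in> set ((wa # la) @ (wb # lb) @ (wc # lc))" and z: "z \<in> set ((wa # la) @ (wb # lb) @ (wc # lc))"
  shows "E y z \<longleftrightarrow> padj (wa # la) y z \<or> padj (wb # lb) y z \<or> padj (wc # lc) y z
    \<or> padj [wa, wb] y z \<or> padj [wa, wc] y z \<or> padj [wb, wc] y z"
proof -
  define SA SB SC where "SA = set (wa # la)" and "SB = set (wb # lb)" and "SC = set (wc # lc)"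
  have dj: "SA \<inter> SB = {}" "SA \<inter> SC = {}" "SB \<inter> SC = {}" using d unfolding SA_def SB_def SC_def by auto
  have w: "wa \<in> SA" "wb \<in> SB" "wc \<in> SC" unfolding SA_def SB_def SC_def by auto
  have i: "padj (wa # la) y z \<Longrightarrow> y \<in> SA \<and> z \<in> SA" "padj (wb # lb) y z \<Longrightarrow> y \<in> SB \<and> z \<in> SB"
    "padj (wc # lc) y z \<Longrightarrow> y \<in> SC \<and> z \<in> SC"
    unfolding SA_def SB_def SC_def by (rule padj_in, assumption)+
  have p: "padj [v, v'] y z \<longleftrightarrow> y = v \<and> z = v' \<or> y = v' \<and> z = v" for v v' by auto
  have yS: "y \<in> SA \<or> y \<in> SB \<or> y \<in> SC" "z \<in> SA \<or> z \<in> SB \<or> z \<in> SC" using y z unfolding SA_def SB_def SC_def by auto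
  have fAA: "E y z \<longleftrightarrow> padj (wa # la) y z" if "y \<in> SA" "z \<in> SA" using ipath_padj[OF l(1)] that unfolding SA_def by blast
  have fBB: "E y z \<longleftrightarrow> padj (wb # lb) y z" if "y \<in> SB" "z \<in> SB" using ipath_padj[OF l(2)] that unfolding SB_def by blast
  have fCC: "E y z \<longleftrightarrow> padj (wc # lc) y z" if "y \<in> SC" "z \<in> SC" using ipath_padj[OF l(3)] that unfolding SC_def by blast
  have fAB: "E y z \<longleftrightarrow> y = wa \<and> z = wb" if "y \<in> SA" "z \<in> SB" using ab that unfolding SA_def SB_def by blast
  have fBA: "E y z \<longleftrightarrow> z = wa \<and> y = wb" if "z \<in> SA" "y \<in> SB" using ab E_commute that unfolding SA_def SB_def by blast
  have fAC: "E y z \<longleftrightarrow> y = wa \<and> z = wc" if "y \<in> SA" "z \<in> SC" using ac that unfolding SA_def SC_def by blast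
  have fCA: "E y z \<longleftrightarrow> z = wa \<and> y = wc" if "z \<in> SA" "y \<in> SC" using ac E_commute that unfolding SA_def SC_def by blast
  have fBC: "E y z \<longleftrightarrow> y = wb \<and> z = wc" if "y \<in> SB" "z \<in> SC" using bc that unfolding SB_def SC_def by blast
  have fCB: "E y z \<longleftrightarrow> z = wb \<and> y = wc" if "z \<in> SB" "y \<in> SC" using bc E_commute that unfolding SB_def SC_def by blast
  from yS show ?thesis
  proof (elim disjE)
    assume m: "y \<in> SA" "z \<in> SA"
    then have o: "y \<notin> SB" "y \<notin> SC" "z \<notin> SB" "z \<notin> SC" using dj by blast+
    then have q: "y \<noteq> wb" "y \<noteq> wc" "z \<noteq> wb" "z \<noteq> wc" using w by blast+
    have r: "\<not> padj (wb # lb) y z" "\<not> padj (wc # lc) y z" using i o by blast+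
    show ?thesis unfolding p using fAA[OF m] q r by blast
  next
    assume m: "y \<in> SA" "z \<in> SB"
    then have o: "y \<notin> SB" "y \<notin> SC" "z \<notin> SA" "z \<notin> SC" using dj by blast+
    then have q: "y \<noteq> wb" "y \<noteq> wc" "z \<noteq> wa" "z \<noteq> wc" using w by blast+
    have r: "\<not> padj (wa # la) y z" "\<not> padj (wb # lb) y z" "\<not> padj (wc # lc) y z" using i o by blast+
    show ?thesis unfolding p using fAB[OF m] q r by blast
  next
    assume m: "y \<in> SA" "z \<in> SC"
    then have o: "y \<notin> SB" "y \<notin> SC" "z \<notin> SA" "z \<notin> SB" using dj by blast+
    then have q: "y \<noteq> wb" "y \<noteq> wc" "z \<noteq> wa" "z \<noteq> wb" using w by blast+
    have r: "\<not> padj (wa # la) y z" "\<not> padj (wb # lb) y z" "\<not> padj (wc # lc) y z" using i o by blast+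
    show ?thesis unfolding p using fAC[OF m] q r by blast
  next
    assume m: "y \<in> SB" "z \<in> SA"
    then have o: "y \<notin> SA" "y \<notin> SC" "z \<notin> SB" "z \<notin> SC" using dj by blast+
    then have q: "y \<noteq> wa" "y \<noteq> wc" "z \<noteq> wb" "z \<noteq> wc" using w by blast+
    have r: "\<not> padj (wa # la) y z" "\<not> padj (wb # lb) y z" "\<not> padj (wc # lc) y z" using i o by blast+
    show ?thesis unfolding p using fBA[OF m(2,1)] q r by blast
  next
    assume m: "y \<in> SB" "z \<in> SB"
    then have o: "y \<notin> SA" "y \<notin> SC" "z \<notin> SA" "z \<notin> SC" using dj by blast+
    then have q: "y \<noteq> wa" "y \<noteq> wc" "z \<noteq> wa" "z \<noteq> wc" using w by blast+
    have r: "\<not> padj (wa # la) y z" "\<not> padj (wc # lc) y z" using i o by blast+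
    show ?thesis unfolding p using fBB[OF m] q r by blast
  next
    assume m: "y \<in> SB" "z \<in> SC"
    then have o: "y \<notin> SA" "y \<notin> SC" "z \<notin> SA" "z \<notin> SB" using dj by blast+
    then have q: "y \<noteq> wa" "y \<noteq> wc" "z \<noteq> wa" "z \<noteq> wb" using w by blast+
    have r: "\<not> padj (wa # la) y z" "\<not> padj (wb # lb) y z" "\<not> padj (wc # lc) y z" using i o by blast+
    show ?thesis unfolding p using fBC[OF m] q r by blast
  next
    assume m: "y \<in> SC" "z \<in> SA"
    then have o: "y \<notin> SA" "y \<notin> SB" "z \<notin> SB" "z \<notin> SC" using dj by blast+
    then have q: "y \<noteq> wa" "y \<noteq> wb" "z \<noteq> wb" "z \<noteq> wc" using w by blast+
    have r: "\<not> padj (wa # la) y z" "\<not> padj (wb # lb) y z" "\<not> padj (wc # lc) y z" using i o by blast+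
    show ?thesis unfolding p using fCA[OF m(2,1)] q r by blast
  next
    assume m: "y \<in> SC" "z \<in> SB"
    then have o: "y \<notin> SA" "y \<notin> SB" "z \<notin> SA" "z \<notin> SC" using dj by blast+
    then have q: "y \<noteq> wa" "y \<noteq> wb" "z \<noteq> wa" "z \<noteq> wc" using w by blast+
    have r: "\<not> padj (wa # la) y z" "\<not> padj (wb # lb) y z" "\<not> padj (wc # lc) y z" using i o by blast+
    show ?thesis unfolding p using fCB[OF m(2,1)] q r by blast
  next
    assume m: "y \<in> SC" "z \<in> SC"
    then have o: "y \<notin> SA" "y \<notin> SB" "z \<notin> SA" "z \<notin> SB" using dj by blast+
    then have q: "y \<noteq> wa" "y \<noteq> wb" "z \<noteq> wa" "z \<noteq> wb" using w by blast+
    have r: "\<not> padj (wa # la) y z" "\<not> padj (wb # lb) y z" using i o by blast+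
    show ?thesis unfolding p using fCC[OF m] q r by blast
  qed
qed

text \<open>Dropping \<open>A1\<close> leaves a subdivided \<open>K4\<close> with branch vertices
  \<open>wa\<close>, \<open>wb\<close>, \<open>wc\<close> and \<open>c\<close>. The paths to
  \<open>c\<close> are the third leg, the first leg continued through \<open>a\<close> along
  \<open>A3\<close>, and the second leg continued through \<open>b\<close> along
  \<open>A2\<close>.\<close>

lemma no_triangle_legs_arc:
  assumes H: "icyc (a # A1 @ b # A2 @ c # A3)" and A1: "A1 \<noteq> []"
    and l: "ipath (wa # la)" "ipath (wb # lb)" "ipath (wc # lc)"
    and ab: "\<forall>y\<in>set (wa # la). \<forall>z\<in>set (wb # lb). E y z \<longleftrightarrow> y = wa \<and> z = wb"
    and ac: "\<forall>y\<in>set (wa # la). \<forall>z\<in>set (wc # lc). E y z \<longleftrightarrow> y = wa \<and> z = wc"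
    and bc: "\<forall>y\<in>set (wb # lb). \<forall>z\<in>set (wc # lc). E y z \<longleftrightarrow> y = wb \<and> z = wc"
    and d: "distinct ((wa # la) @ (wb # lb) @ (wc # lc))"
    and dj: "set (a # A1 @ b # A2 @ c # A3) \<inter> set ((wa # la) @ (wb # lb) @ (wc # lc)) = {}"
    and cross: "\<forall>h\<in>set (a # A1 @ b # A2 @ c # A3). \<forall>t\<in>set ((wa # la) @ (wb # lb) @ (wc # lc)).
      E h t \<longleftrightarrow> h = a \<and> t = last (wa # la) \<or> h = b \<and> t = last (wb # lb) \<or> h = c \<and> t = last (wc # lc)"
  shows False
proof -
  let ?T = "(wa # la) @ (wb # lb) @ (wc # lc)" and ?K = "b # A2 @ c # A3 @ [a]"
  have KH: "set ?K \<subseteq> set (a # A1 @ b # A2 @ c # A3)" by auto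
  have "icyc (?K @ A1)" using icyc_rot[of "a # A1" "b # A2 @ c # A3"] icyc_rot[of "[b] @ A2 @ c # A3" "a # A1"] H by (simp del: icyc.simps)
  then have K: "ipath ?K" using icyc_sub[of "[]" ?K A1] A1 by (simp del: icyc.simps ipath.simps)
  let ?U = "[wc, wa, wb, c] @ [] @ [] @ lc @ [] @ (la @ a # rev A3) @ (lb @ b # A2)"
  have UU: "set ?U = set ?K \<union> set ?T" by auto
  have leg: "padj (wa # la @ [a]) y z \<longleftrightarrow> padj (wa # la) y z \<or> y = last (wa # la) \<and> z = a \<or> z = last (wa # la) \<and> y = a"
    "padj (wb # lb @ [b]) y z \<longleftrightarrow> padj (wb # lb) y z \<or> y = last (wb # lb) \<and> z = b \<or> z = last (wb # lb) \<and> y = b"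
    "padj (wc # lc @ [c]) y z \<longleftrightarrow> padj (wc # lc) y z \<or> y = last (wc # lc) \<and> z = c \<or> z = last (wc # lc) \<and> y = c" for y z
    using padj_append[of "wa # la" "[a]" y z] padj_append[of "wb # lb" "[b]" y z] padj_append[of "wc # lc" "[c]" y z] by auto
  have KK: "E y z \<longleftrightarrow> padj (b # A2 @ [c]) y z \<or> padj (a # rev A3 @ [c]) y z" if y: "y \<in> set ?K" and z: "z \<in> set ?K" for y z
  proof -
    have "E y z \<longleftrightarrow> padj ((b # A2) @ c # (A3 @ [a])) y z" using ipath_padj[OF K y z] by simp
    also have "\<dots> \<longleftrightarrow> padj (b # A2 @ [c]) y z \<or> padj (c # A3 @ [a]) y z"
      using padj_split[of "b # A2" c "A3 @ [a]" y z] by simp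
    finally show ?thesis using padj_rev[of "c # A3 @ [a]" y z] by simp
  qed
  have la: "padj (wa # (la @ a # rev A3) @ [c]) y z \<longleftrightarrow> padj (wa # la @ [a]) y z \<or> padj (a # rev A3 @ [c]) y z" for y z
    using padj_split[of "wa # la" a "rev A3 @ [c]" y z] by simp
  have lb: "padj (wb # (lb @ b # A2) @ [c]) y z \<longleftrightarrow> padj (wb # lb @ [b]) y z \<or> padj (b # A2 @ [c]) y z" for y z
    using padj_split[of "wb # lb" b "A2 @ [c]" y z] by simp
  show False
  proof (rule no_K4[of wc wa wb c "[]" "[]" lc "[]" "la @ a # rev A3" "lb @ b # A2"])
    have "distinct (?K @ ?T)" unfolding distinct_append[of ?K ?T] using ipath_distinct[OF K] d dj KH by blast
    then show "distinct ?U" by (rule distinct_reorder) (use UU in auto)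
    have "set ?K \<subseteq> V" "set ?T \<subseteq> V" using ipath_V[OF K] ipath_V[OF l(1)] ipath_V[OF l(2)] ipath_V[OF l(3)] by auto
    then show "set ?U \<subseteq> V" unfolding UU by blast
    fix y z assume y: "y \<in> set ?U" and z: "z \<in> set ?U"
    have n1: "\<not> padj (b # A2 @ [c]) y z \<and> \<not> padj (a # rev A3 @ [c]) y z" if "y \<notin> set ?K \<or> z \<notin> set ?K"
      using that padj_in[of "b # A2 @ [c]" y z] padj_in[of "a # rev A3 @ [c]" y z] by auto
    have n2: "\<not> padj (wa # la) y z \<and> \<not> padj (wb # lb) y z \<and> \<not> padj (wc # lc) y z
       \<and> \<not> padj [wc, wa] y z \<and> \<not> padj [wc, wb] y z \<and> \<not> padj [wa, wb] y z" if "y \<notin> set ?T \<or> z \<notin> set ?T"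
      using that padj_in[of "wa # la" y z] padj_in[of "wb # lb" y z] padj_in[of "wc # lc" y z] by auto
    have lasts: "last (wa # la) \<in> set ?T" "last (wb # lb) \<in> set ?T" "last (wc # lc) \<in> set ?T"
      using last_in_set[of "wa # la"] last_in_set[of "wb # lb"] last_in_set[of "wc # lc"] by auto
    have abc: "a \<in> set ?K" "b \<in> set ?K" "c \<in> set ?K" by auto
    have disj: "v \<in> set ?T \<Longrightarrow> v \<notin> set ?K" for v using dj KH by blast
    have p2: "padj [v, v'] y z \<longleftrightarrow> padj [v', v] y z" for v v' by auto
    consider "y \<in> set ?T" "z \<in> set ?T" | "y \<in> set ?K" "z \<in> set ?T" | "y \<in> set ?T" "z \<in> set ?K" | "y \<in> set ?K" "z \<in> set ?K"
      using y z unfolding UU by blast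
    then have "E y z \<longleftrightarrow> padj [wc, wa] y z \<or> padj [wc, wb] y z \<or> padj (wc # lc @ [c]) y z
          \<or> padj [wa, wb] y z \<or> padj (wa # (la @ a # rev A3) @ [c]) y z \<or> padj (wb # (lb @ b # A2) @ [c]) y z"
    proof cases
      case 1
      then have "y \<notin> set ?K" "z \<notin> set ?K" using disj by auto
      then show ?thesis using three_legs_adj[OF l ab ac bc d 1] n1 abc p2[of wa wc] p2[of wb wc] unfolding la lb leg by blast
    next
      case 2
      then have k: "y \<notin> set ?T" "z \<notin> set ?K" using disj by auto
      show ?thesis using cross[rule_format, OF subsetD[OF KH 2(1)] 2(2)] n1 n2 k abc lasts unfolding la lb leg by blast
    next
      case 3
      then have k: "y \<notin> set ?K" "z \<notin> set ?T" using disj by auto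
      show ?thesis using cross[rule_format, OF subsetD[OF KH 3(2)] 3(1)] E_commute[of y z] n1 n2 k abc lasts unfolding la lb leg by blast
    next
      case 4
      then have "y \<notin> set ?T" "z \<notin> set ?T" using disj by auto
      then show ?thesis using KK[OF 4] n2 lasts unfolding la lb leg by blast
    qed
    then show "E y z \<longleftrightarrow> padj (wc # [] @ [wa]) y z \<or> padj (wc # [] @ [wb]) y z \<or> padj (wc # lc @ [c]) y z
          \<or> padj (wa # [] @ [wb]) y z \<or> padj (wa # (la @ a # rev A3) @ [c]) y z \<or> padj (wb # (lb @ b # A2) @ [c]) y z"
      by (simp only: append_Nil)
  qed
qed

text \<open>A nonempty arc can be rotated to the place of \<open>A1\<close>. If all three are empty,
  the cycle is a triangle, and the legs join it to the other triangle as a prism.\<close>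

lemma no_triangle_legs:
  assumes H: "icyc (a # A1 @ b # A2 @ c # A3)"
    and l: "ipath (wa # la)" "ipath (wb # lb)" "ipath (wc # lc)"
    and ab: "\<forall>y\<in>set (wa # la). \<forall>z\<in>set (wb # lb). E y z \<longleftrightarrow> y = wa \<and> z = wb"
    and ac: "\<forall>y\<in>set (wa # la). \<forall>z\<in>set (wc # lc). E y z \<longleftrightarrow> y = wa \<and> z = wc"
    and bc: "\<forall>y\<in>set (wb # lb). \<forall>z\<in>set (wc # lc). E y z \<longleftrightarrow> y = wb \<and> z = wc"
    and d: "distinct ((wa # la) @ (wb # lb) @ (wc # lc))"
    and dj: "set (a # A1 @ b # A2 @ c # A3) \<inter> set ((wa # la) @ (wb # lb) @ (wc # lc)) = {}"
    and cross: "\<forall>h\<in>set (a # A1 @ b # A2 @ c # A3). \<forall>t\<in>set ((wa # la) @ (wb # lb) @ (wc # lc)).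
      E h t \<longleftrightarrow> h = a \<and> t = last (wa # la) \<or> h = b \<and> t = last (wb # lb) \<or> h = c \<and> t = last (wc # lc)"
  shows False
proof -
  consider "A1 \<noteq> []" | "A2 \<noteq> []" | "A3 \<noteq> []" | "A1 = []" "A2 = []" "A3 = []" by blast
  then show False
  proof cases
    case 1
    show False by (rule no_triangle_legs_arc[OF H 1 l ab ac bc d dj cross])
  next
    case 2
    have H': "icyc (b # A2 @ c # A3 @ a # A1)" using icyc_rot[of "a # A1" "b # A2 @ c # A3"] H by (simp del: icyc.simps)
    have ba: "\<forall>y\<in>set (wb # lb). \<forall>z\<in>set (wa # la). E y z \<longleftrightarrow> y = wb \<and> z = wa"
      using ab E_commute by blast
    have ca: "\<forall>y\<in>set (wc # lc). \<forall>z\<in>set (wa # la). E y z \<longleftrightarrow> y = wc \<and> z = wa"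
      using ac E_commute by blast
    show False
    proof (rule no_triangle_legs_arc[OF H' 2 l(2,3,1) bc ba ca])
      show "distinct ((wb # lb) @ (wc # lc) @ (wa # la))" using d by auto
      show "set (b # A2 @ c # A3 @ a # A1) \<inter> set ((wb # lb) @ (wc # lc) @ (wa # la)) = {}" using dj by auto
      show "\<forall>h\<in>set (b # A2 @ c # A3 @ a # A1). \<forall>t\<in>set ((wb # lb) @ (wc # lc) @ (wa # la)).
          E h t \<longleftrightarrow> h = b \<and> t = last (wb # lb) \<or> h = c \<and> t = last (wc # lc) \<or> h = a \<and> t = last (wa # la)"
      proof (intro ballI)
      fix h t assume "h \<in> set (b # A2 @ c # A3 @ a # A1)" "t \<in> set ((wb # lb) @ (wc # lc) @ (wa # la))"
      then have ht: "h \<in> set (a # A1 @ b # A2 @ c # A3)" "t \<in> set ((wa # la) @ (wb # lb) @ (wc # lc))" by auto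
      show "E h t \<longleftrightarrow> h = b \<and> t = last (wb # lb) \<or> h = c \<and> t = last (wc # lc) \<or> h = a \<and> t = last (wa # la)" using cross[rule_format, OF ht] by argo
      qed
    qed
  next
    case 3
    have H': "icyc (c # A3 @ a # A1 @ b # A2)" using icyc_rot[of "a # A1 @ b # A2" "c # A3"] H by (simp del: icyc.simps)
    have cb: "\<forall>y\<in>set (wc # lc). \<forall>z\<in>set (wb # lb). E y z \<longleftrightarrow> y = wc \<and> z = wb"
      using bc E_commute by blast
    have ca: "\<forall>y\<in>set (wc # lc). \<forall>z\<in>set (wa # la). E y z \<longleftrightarrow> y = wc \<and> z = wa"
      using ac E_commute by blast
    show False
    proof (rule no_triangle_legs_arc[OF H' 3 l(3,1,2) ca cb ab])
      show "distinct ((wc # lc) @ (wa # la) @ (wb # lb))" using d by auto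
      show "set (c # A3 @ a # A1 @ b # A2) \<inter> set ((wc # lc) @ (wa # la) @ (wb # lb)) = {}" using dj by auto
      show "\<forall>h\<in>set (c # A3 @ a # A1 @ b # A2). \<forall>t\<in>set ((wc # lc) @ (wa # la) @ (wb # lb)).
          E h t \<longleftrightarrow> h = c \<and> t = last (wc # lc) \<or> h = a \<and> t = last (wa # la) \<or> h = b \<and> t = last (wb # lb)"
      proof (intro ballI)
      fix h t assume "h \<in> set (c # A3 @ a # A1 @ b # A2)" "t \<in> set ((wc # lc) @ (wa # la) @ (wb # lb))"
      then have ht: "h \<in> set (a # A1 @ b # A2 @ c # A3)" "t \<in> set ((wa # la) @ (wb # lb) @ (wc # lc))" by auto
      show "E h t \<longleftrightarrow> h = c \<and> t = last (wc # lc) \<or> h = a \<and> t = last (wa # la) \<or> h = b \<and> t = last (wb # lb)" using cross[rule_format, OF ht] by argo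
      qed
    qed
  next
    case 4
    let ?T = "(wa # la) @ (wb # lb) @ (wc # lc)" and ?H = "[a, b, c]"
    let ?U = "(wa # la @ [a]) @ (wb # lb @ [b]) @ (wc # lc @ [c])"
    have H': "icyc ?H" using H 4 by simp
    have cross': "E h t \<longleftrightarrow> h = a \<and> t = last (wa # la) \<or> h = b \<and> t = last (wb # lb) \<or> h = c \<and> t = last (wc # lc)"
      if "h \<in> set ?H" "t \<in> set ?T" for h t by (rule cross[rule_format]) (use that 4 in auto)
    have UU: "set ?U = set ?H \<union> set ?T" by auto
    have leg: "padj (w # l @ [h]) y z \<longleftrightarrow> padj (w # l) y z \<or> y = last (w # l) \<and> z = h \<or> z = last (w # l) \<and> y = h" for w l h y z
      using padj_append[of "w # l" "[h]" y z] by auto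
    have tri: "padj [u, v, w, u] y z \<longleftrightarrow> padj [u, v] y z \<or> padj [u, w] y z \<or> padj [v, w] y z" for u v w y z by auto
    show False
    proof (rule no_prism[of wa la a wb lb b wc lc c])
      have "distinct (?H @ ?T)" unfolding distinct_append[of ?H ?T] using icyc_distinct[OF H'] d dj 4 by auto
      then show "distinct ?U" by (rule distinct_reorder) (use UU in auto)
      have "set ?H \<subseteq> V" "set ?T \<subseteq> V" using icyc_V[OF H'] ipath_V[OF l(1)] ipath_V[OF l(2)] ipath_V[OF l(3)] by auto
      then show "set ?U \<subseteq> V" unfolding UU by blast
      fix y z assume y: "y \<in> set ?U" and z: "z \<in> set ?U"
      have n1: "\<not> padj [a, b, c, a] y z" if "y \<notin> set ?H \<or> z \<notin> set ?H"
        using that padj_in[of "[a, b, c, a]" y z] by auto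
      have n2: "\<not> padj (wa # la) y z \<and> \<not> padj (wb # lb) y z \<and> \<not> padj (wc # lc) y z \<and> \<not> padj [wa, wb, wc, wa] y z" if "y \<notin> set ?T \<or> z \<notin> set ?T"
        using that padj_in[of "wa # la" y z] padj_in[of "wb # lb" y z] padj_in[of "wc # lc" y z] padj_in[of "[wa, wb, wc, wa]" y z] by auto
      have lasts: "last (wa # la) \<in> set ?T" "last (wb # lb) \<in> set ?T" "last (wc # lc) \<in> set ?T"
        using last_in_set[of "wa # la"] last_in_set[of "wb # lb"] last_in_set[of "wc # lc"] by auto
      have abc: "a \<in> set ?H" "b \<in> set ?H" "c \<in> set ?H" by auto
      have disj: "v \<in> set ?T \<Longrightarrow> v \<notin> set ?H" for v using dj 4 by auto
      have HH: "E y z \<longleftrightarrow> padj [a, b, c, a] y z" if "y \<in> set ?H" "z \<in> set ?H" using icyc_padj[OF H' that] by simp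
      consider "y \<in> set ?T" "z \<in> set ?T" | "y \<in> set ?H" "z \<in> set ?T" | "y \<in> set ?T" "z \<in> set ?H" | "y \<in> set ?H" "z \<in> set ?H"
        using y z unfolding UU by blast
      then show "E y z \<longleftrightarrow> padj (wa # la @ [a]) y z \<or> padj (wb # lb @ [b]) y z \<or> padj (wc # lc @ [c]) y z
            \<or> padj [wa, wb, wc, wa] y z \<or> padj [a, b, c, a] y z"
      proof cases
        case 1
        then have "y \<notin> set ?H" "z \<notin> set ?H" using disj by blast+
        then show ?thesis using three_legs_adj[OF l ab ac bc d 1] n1 abc tri[of wa wb wc y z] unfolding leg by blast
      next
        case 2
        then have k: "y \<notin> set ?T" "z \<notin> set ?H" using disj by blast+
        show ?thesis using cross'[OF 2] n1 n2 k abc lasts unfolding leg by blast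
      next
        case 3
        then have k: "y \<notin> set ?H" "z \<notin> set ?T" using disj by blast+
        show ?thesis using cross'[OF 3(2,1)] E_commute[of y z] n1 n2 k abc lasts unfolding leg by blast
      next
        case 4
        then have "y \<notin> set ?T" "z \<notin> set ?T" using disj by blast+
        then show ?thesis using HH[OF 4] n2 lasts unfolding leg by blast
      qed
    qed
  qed
qed

text \<open>An induced path \<open>R\<close> joins two feet, and a path from the third foot is
  stopped at the first vertex \<open>z\<close> that meets or sees \<open>R\<close>. If
  \<open>z\<close> lies on \<open>R\<close> or sees one vertex of it, the connection is a spider
  centred there. If the first and last vertex seen are not adjacent, the part between them is
  dropped and \<open>z\<close> is the centre. If they are adjacent, a triangle with three legs
  arises.\<close>

lemma no_tripod_core:
  assumes H: "icyc (a # A1 @ b # A2 @ c # A3)" and Q: "conn Q" and dj: "set (a # A1 @ b # A2 @ c # A3) \<inter> Q = {}"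
    and q: "qa \<in> Q" "qb \<in> Q" "qc \<in> Q"
    and cross: "\<And>h t. \<lbrakk>h \<in> set (a # A1 @ b # A2 @ c # A3); t \<in> Q\<rbrakk> \<Longrightarrow>
      E h t \<longleftrightarrow> h = a \<and> t = qa \<or> h = b \<and> t = qb \<or> h = c \<and> t = qc"
  shows False
proof -
  let ?H = "a # A1 @ b # A2 @ c # A3"
  obtain R where R: "ipath R" "R \<noteq> []" "set R \<subseteq> Q" "hd R = qa" "last R = qb" using conn_path[OF Q q(1,2)] .
  obtain p where p: "ipath p" "p \<noteq> []" "set p \<subseteq> Q" "hd p = qc" "last p = qa" using conn_path[OF Q q(3,1)] .
  have "qa \<in> set R" "qa \<in> set p" using R(2,4) p(2,5) hd_in_set last_in_set by metis+
  then have "\<exists>z\<in>set p. z \<in> set R \<or> (\<exists>r\<in>set R. E z r)" by blast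
  then obtain p1 z p2 where z: "p = p1 @ z # p2" "z \<in> set R \<or> (\<exists>r\<in>set R. E z r)"
      "\<forall>y\<in>set p1. \<not> (y \<in> set R \<or> (\<exists>r\<in>set R. E y r))"
    using split_list_first_prop[of p "\<lambda>z. z \<in> set R \<or> (\<exists>r\<in>set R. E z r)"] by blast
  have S: "ipath (p1 @ [z])" using ipath_sub[of "[]" "p1 @ [z]" p2] p(1) z(1) by simp
  have Sr: "ipath (z # rev p1)" using S ipath_rev[of "p1 @ [z]"] by simp
  have lS: "last (z # rev p1) = qc" using p(4) z(1) by (cases p1) auto
  have spider: False
    if "ipath (rev la @ u # lb)" "ipath (rev la @ u # lc)" "ipath (rev lb @ u # lc)" "set (u # la @ lb @ lc) \<subseteq> Q"
      "last (u # la) = qa" "last (u # lb) = qb" "last (u # lc) = qc" for u la lb lc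
  proof (rule no_spider[OF H that(1-3)])
    show "set ?H \<inter> set (u # la @ lb @ lc) = {}" using dj that(4) by blast
    fix h t assume "h \<in> set ?H" "t \<in> set (u # la @ lb @ lc)"
    then show "E h t \<longleftrightarrow> h = a \<and> t = last (u # la) \<or> h = b \<and> t = last (u # lb) \<or> h = c \<and> t = last (u # lc)"
      using cross[of h t] that(4-7) by blast
  qed
  show False
  proof (cases "z \<in> set R")
    case True
    have "p1 = []"
    proof (rule ccontr)
      assume "p1 \<noteq> []"
      then obtain p1' y where y: "p1 = p1' @ [y]" by (metis append_butlast_last_id)
      have "ipath [y, z]" using ipath_sub[of p1' "[y, z]" "[]"] S y by simp
      then have "E y z" by simp
      then show False using z(3) True y by auto
    qed
    then have zc: "z = qc" using z(1) p(4) by simp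
    obtain R1 R2 where Rs: "R = R1 @ z # R2" using True by (meson split_list)
    have i1: "ipath (rev (rev R1) @ z # R2)" using R(1) Rs by simp
    have i2: "ipath (rev (rev R1) @ z # [])" using ipath_sub[of "[]" "R1 @ [z]" R2] R(1) Rs by simp
    have "ipath (z # R2)" using ipath_sub[of R1 "z # R2" "[]"] R(1) Rs by simp
    then have i3: "ipath (rev R2 @ z # [])" using ipath_rev[of "z # R2"] by simp
    show False
      by (rule spider[OF i1 i2 i3]) (use R Rs zc in \<open>auto simp: last_rev hd_append split: if_splits\<close>)
  next
    case zR: False
    have zQ: "z \<in> Q" "set p1 \<subseteq> Q" using p(3) z(1) by auto
    have np: "y \<notin> set R" "r \<in> set R \<Longrightarrow> \<not> E y r" "r \<in> set R \<Longrightarrow> \<not> E r y" if "y \<in> set p1" for y r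
      using z(3) that E_commute by blast+
    show False
    proof (rule nbr_cases[of R z])
      assume "\<And>r. r \<in> set R \<Longrightarrow> \<not> E z r"
      then show False using z(2) zR by blast
    next
      fix R1 r R2 assume Rs: "R = R1 @ r # R2" and zr: "E z r" and no: "\<And>y. y \<in> set (R1 @ R2) \<Longrightarrow> \<not> E z y"
      have i1: "ipath (rev (rev R1) @ r # R2)" using R(1) Rs by simp
      have s1: "ipath (R1 @ [r])" using ipath_sub[of "[]" "R1 @ [r]" R2] R(1) Rs by simp
      have "ipath (r # R2)" using ipath_sub[of R1 "r # R2" "[]"] R(1) Rs by simp
      then have s2: "ipath (rev R2 @ [r])" using ipath_rev[of "r # R2"] by simp
      have dR: "distinct R" using ipath_distinct[OF R(1)] .
      have cr: "E y w \<longleftrightarrow> y = r \<and> w = z" if "y \<in> set R" "w \<in> set (z # rev p1)" for y w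
        using that np no zr Rs E_commute by auto
      have "ipath ((R1 @ [r]) @ (z # rev p1))" unfolding ipath_append[of "R1 @ [r]"]
        using s1 Sr cr Rs np(1) zR by (auto simp del: ipath.simps)
      then have i2: "ipath (rev (rev R1) @ r # (z # rev p1))" by (simp del: ipath.simps)
      have "ipath ((rev R2 @ [r]) @ (z # rev p1))" unfolding ipath_append[of "rev R2 @ [r]"]
        using s2 Sr cr Rs np(1) zR by (auto simp del: ipath.simps)
      then have i3: "ipath (rev R2 @ r # (z # rev p1))" by (simp del: ipath.simps)
      show False
        by (rule spider[OF i1 i2 i3]) (use R(3-5) Rs zQ lS in \<open>auto simp: last_rev hd_append split: if_splits\<close>)
    next
      fix R1 ri M rj R2 assume Rs: "R = R1 @ ri # M @ rj # R2" and zr: "E z ri" "E z rj"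
        and no: "\<And>y. y \<in> set (R1 @ R2) \<Longrightarrow> \<not> E z y"
      have dR: "distinct R" using ipath_distinct[OF R(1)] .
      have s1: "ipath (R1 @ [ri])" using ipath_sub[of "[]" "R1 @ [ri]" "M @ rj # R2"] R(1) Rs by simp
      have s2: "ipath (rj # R2)" using ipath_sub[of "R1 @ ri # M" "rj # R2" "[]"] R(1) Rs by simp
      have s1r: "ipath (ri # rev R1)" using s1 ipath_rev[of "R1 @ [ri]"] by simp
      have s2r: "ipath (rev R2 @ [rj])" using s2 ipath_rev[of "rj # R2"] by simp
      have cz: "E y w \<longleftrightarrow> w = z \<and> (y = ri \<or> y = rj)" if "y \<in> set (R1 @ [ri]) \<union> set (rj # R2)" "w \<in> set (z # rev p1)" for y w
        using that np no zr Rs E_commute by auto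
      have "ipath ((R1 @ [ri]) @ (M @ rj # R2))" using R(1) Rs by simp
      then have cR: "E y w \<longleftrightarrow> y = ri \<and> w = hd (M @ rj # R2)" if "y \<in> set (R1 @ [ri])" "w \<in> set (M @ rj # R2)" for y w
        using that unfolding ipath_append[of "R1 @ [ri]"] by auto
      show False
      proof (cases "M = []")
        case False
        have n12: "\<not> E y w" if "y \<in> set (R1 @ [ri])" "w \<in> set (rj # R2)" for y w
          using cR[of y w] that False dR Rs by (cases M) auto
        have z2: "ipath (z # rj # R2)" using s2 zr no zR Rs zQ Q dR unfolding conn_def by (auto simp del: ipath.simps simp: ipath.simps(2)[of z])
        have "ipath ((R1 @ [ri]) @ (z # rj # R2))" unfolding ipath_append[of "R1 @ [ri]"]
          using s1 z2 n12 cz[of _ z] zR Rs dR by (auto simp del: ipath.simps)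
        then have i1: "ipath (rev (ri # rev R1) @ z # (rj # R2))" by (simp del: ipath.simps)
        have "ipath ((R1 @ [ri]) @ (z # rev p1))" unfolding ipath_append[of "R1 @ [ri]"]
          using s1 Sr cz zR Rs np(1) dR by (auto simp del: ipath.simps)
        then have i2: "ipath (rev (ri # rev R1) @ z # rev p1)" by (simp del: ipath.simps)
        have "ipath ((rev R2 @ [rj]) @ (z # rev p1))" unfolding ipath_append[of "rev R2 @ [rj]"]
          using s2r Sr cz zR Rs np(1) dR by (auto simp del: ipath.simps)
        then have i3: "ipath (rev (rj # R2) @ z # rev p1)" by (simp del: ipath.simps)
        show False
          by (rule spider[OF i1 i2 i3]) (use R(3-5) Rs zQ lS in \<open>auto simp: last_rev hd_append split: if_splits\<close>)
      next
        case True
        have ab: "\<forall>y\<in>set (ri # rev R1). \<forall>w\<in>set (rj # R2). E y w \<longleftrightarrow> y = ri \<and> w = rj"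
          using cR True by auto
        have ac: "\<forall>y\<in>set (ri # rev R1). \<forall>w\<in>set (z # rev p1). E y w \<longleftrightarrow> y = ri \<and> w = z"
          using cz dR Rs by auto
        have bc: "\<forall>y\<in>set (rj # R2). \<forall>w\<in>set (z # rev p1). E y w \<longleftrightarrow> y = rj \<and> w = z"
          using cz dR Rs by auto
        have TQ: "set ((ri # rev R1) @ (rj # R2) @ (z # rev p1)) \<subseteq> Q" using R(3) Rs zQ by auto
        have la: "last (ri # rev R1) = qa" using R(4) Rs by (cases R1) auto
        have lb: "last (rj # R2) = qb" using R(5) Rs by simp
        show False
        proof (rule no_triangle_legs[OF H s1r s2 Sr ab ac bc])
          show "distinct ((ri # rev R1) @ (rj # R2) @ (z # rev p1))"
            using dR Rs zR np(1) ipath_distinct[OF S] by auto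
          show "set ?H \<inter> set ((ri # rev R1) @ (rj # R2) @ (z # rev p1)) = {}" using dj TQ by blast
          show "\<forall>h\<in>set ?H. \<forall>t\<in>set ((ri # rev R1) @ (rj # R2) @ (z # rev p1)).
              E h t \<longleftrightarrow> h = a \<and> t = last (ri # rev R1) \<or> h = b \<and> t = last (rj # R2) \<or> h = c \<and> t = last (z # rev p1)"
          proof (intro ballI)
          fix h t assume "h \<in> set ?H" "t \<in> set ((ri # rev R1) @ (rj # R2) @ (z # rev p1))"
          then show "E h t \<longleftrightarrow> h = a \<and> t = last (ri # rev R1) \<or> h = b \<and> t = last (rj # R2) \<or> h = c \<and> t = last (z # rev p1)"
            using cross[of h t] TQ unfolding la lb lS by blast
          qed
        qed
      qed
    qed
  qed
qed

lemma no_tripod_thm: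
  assumes H: "icyc H" and Q: "conn Q" and dj: "set H \<inter> Q = {}"
    and c3: "card {(h, q). h \<in> set H \<and> q \<in> Q \<and> E h q} = 3"
    and inj: "inj_on fst {(h, q). h \<in> set H \<and> q \<in> Q \<and> E h q}"
  shows False
proof -
  let ?S = "{(h, q). h \<in> set H \<and> q \<in> Q \<and> E h q}"
  obtain s1 s2 s3 where S: "?S = {s1, s2, s3}" and sd: "s1 \<noteq> s2" "s1 \<noteq> s3" "s2 \<noteq> s3"
    using c3 unfolding card_3_iff by auto
  obtain a qa where s1: "s1 = (a, qa)" by (cases s1)
  obtain b qb where s2: "s2 = (b, qb)" by (cases s2)
  obtain c qc where s3: "s3 = (c, qc)" by (cases s3)
  have "fst s1 \<noteq> fst s2" "fst s1 \<noteq> fst s3" "fst s2 \<noteq> fst s3"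
    using inj sd unfolding S inj_on_def by auto
  then have abc: "a \<noteq> b" "a \<noteq> c" "b \<noteq> c" using s1 s2 s3 by auto
  have "s1 \<in> ?S" "s2 \<in> ?S" "s3 \<in> ?S" unfolding S by auto
  then have m: "a \<in> set H" "b \<in> set H" "c \<in> set H" "qa \<in> Q" "qb \<in> Q" "qc \<in> Q" unfolding s1 s2 s3 by auto
  have cross: "E h t \<longleftrightarrow> h = a \<and> t = qa \<or> h = b \<and> t = qb \<or> h = c \<and> t = qc" if "h \<in> set H" "t \<in> Q" for h t
  proof -
    have "E h t \<longleftrightarrow> (h, t) \<in> ?S" using that by simp
    then show ?thesis unfolding S s1 s2 s3 by auto
  qed
  obtain X Y where XY: "H = X @ a # Y" using m(1) by (meson split_list)
  have H': "icyc (a # (Y @ X))" using icyc_rot[of X "a # Y"] H XY by (simp del: icyc.simps)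
  have setH: "set H = set (a # (Y @ X))" using XY by auto
  have bc: "b \<in> set (Y @ X)" "c \<in> set (Y @ X)" using m(2,3) abc XY by auto
  obtain B1 B2 where B: "Y @ X = B1 @ b # B2" using bc(1) by (meson split_list)
  have "c \<in> set B1 \<or> c \<in> set B2" using bc(2) abc unfolding B by auto
  then show False
  proof
    assume "c \<in> set B2"
    then obtain B3 B4 where B2: "B2 = B3 @ c # B4" by (meson split_list)
    have eq: "a # (Y @ X) = a # B1 @ b # B3 @ c # B4" using B B2 by simp
    show False
      by (rule no_tripod_core[OF H'[unfolded eq] Q _ m(4,5,6)]) (use dj cross setH[unfolded eq] in auto)
  next
    assume "c \<in> set B1"
    then obtain B3 B4 where B1: "B1 = B3 @ c # B4" by (meson split_list)
    have eq: "a # (Y @ X) = a # B3 @ c # B4 @ b # B2" using B B1 by simp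
    show False
      by (rule no_tripod_core[OF H'[unfolded eq] Q _ m(4,6,5)]) (use dj cross setH[unfolded eq] in auto)
  qed
qed

end

lemma prefix_before:
  assumes "L1 @ c # L2 = X @ d # Z" "c \<noteq> d" "c \<notin> set X"
  shows "\<exists>W. L1 = X @ d # W"
proof -
  obtain us where "L1 = X @ us \<and> us @ c # L2 = d # Z \<or> L1 @ us = X \<and> c # L2 = us @ d # Z"
    using assms(1) append_eq_append_conv2[of L1 "c # L2" X "d # Z"] by auto
  then show ?thesis
  proof
    assume "L1 = X @ us \<and> us @ c # L2 = d # Z"
    then show ?thesis using assms(2) by (cases us) auto
  next
    assume "L1 @ us = X \<and> c # L2 = us @ d # Z"
    then show ?thesis using assms(2,3) by (cases us) auto
  qed
qed

section \<open>Walks along an induced cycle\<close>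

context sgraph
begin

lemma ipath_succ: "ipath p \<Longrightarrow> successively E p"
proof (induction p rule: induct_list012)
  case (3 a b p)
  then show ?case by simp
qed auto

lemma icyc_succ:
  assumes "icyc L"
  shows "successively E L"
proof (cases L)
  case (Cons a M)
  then have M: "ipath M" "M \<noteq> []" "\<forall>b\<in>set M. E a b \<longleftrightarrow> b = hd M \<or> b = last M" using assms by auto
  then have "ipath M" "M \<noteq> []" "E a (hd M)" by auto
  then show ?thesis using Cons ipath_succ[of M] by (cases M) auto
qed simp

lemma cyc_walk_step:
  assumes L: "icyc (p @ Z)" and p: "p \<noteq> []" "E (last p) y" "y \<in> set Z"
  shows "Z = y # tl Z \<or> (\<exists>e. p = [e] \<and> rev Z = y # tl (rev Z))"
proof -
  have Z: "Z \<noteq> []" using p by auto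
  have "y = hd Z \<or> last p = hd p \<and> y = last Z" using icyc_cross[OF L last_in_set[OF p(1)] p(3)] p(2) by auto
  then show ?thesis
  proof
    assume "y = hd Z"
    then show ?thesis using Z by auto
  next
    assume a: "last p = hd p \<and> y = last Z"
    have "distinct p" using icyc_distinct[OF L] by simp
    then have "tl p = []" using a p(1) by (cases p) (auto split: if_splits)
    then have "p = [hd p]" using p(1) by (cases p) auto
    moreover have "rev Z = y # tl (rev Z)" using a Z by (metis hd_rev list.collapse rev_is_Nil_conv)
    ultimately show ?thesis by blast
  qed
qed

lemma icyc_reorient: "icyc (e # M) \<Longrightarrow> icyc (e # rev M)"
  using icyc_rev[of "e # M"] icyc_rot[of "rev M" "[e]"] by (simp del: icyc.simps)

text \<open>A walk along the cycle without repetition can choose a direction only at its first step,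
  so it begins one of the two readings of the cycle from \<open>e\<close>.\<close>

lemma cyc_walk:
  assumes "icyc (e # M)" "successively E p" "distinct p" "set p \<subseteq> set (e # M)" "p \<noteq> []" "hd p = e"
  shows "\<exists>Z. e # M = p @ Z \<or> e # rev M = p @ Z"
  using assms(2-)
proof (induction p rule: rev_induct)
  case (snoc y p)
  show ?case
  proof (cases "p = []")
    case True
    then show ?thesis using snoc by auto
  next
    case False
    have "successively E p" "E (last p) y" using snoc(2) False by (auto simp: successively_append_iff)
    moreover have "hd p = e" using snoc(6) False by simp
    ultimately obtain Z where Z: "e # M = p @ Z \<or> e # rev M = p @ Z" using snoc(1,3,4) False by auto
    have y: "y \<in> set (e # M)" "y \<notin> set p" using snoc by auto
    have both: "icyc (e # M)" "icyc (e # rev M)" using assms(1) icyc_reorient by auto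
    have yZ: "y \<in> set Z"
    proof -
      have "set (e # M) = set (p @ Z)" using Z by (metis list.simps(15) set_rev)
      then show ?thesis using y by auto
    qed
    have "icyc (p @ Z)" using Z both by metis
    from cyc_walk_step[OF this False \<open>E (last p) y\<close> yZ] show ?thesis
    proof
      assume "Z = y # tl Z"
      then have "p @ Z = (p @ [y]) @ tl Z" by (metis append.assoc append_Cons append_Nil)
      then show ?thesis using Z by metis
    next
      assume "\<exists>e. p = [e] \<and> rev Z = y # tl (rev Z)"
      then have p: "p = [e]" "rev Z = y # tl (rev Z)" using snoc(6) by auto
      then have "e # rev Z = (p @ [y]) @ tl (rev Z)" by simp
      moreover have "e # M = e # rev Z \<or> e # rev M = e # rev Z" using Z p(1) by auto
      ultimately show ?thesis by metis
    qed
  qed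
qed simp

end

context hub
begin

text \<open>Two enumerations of one induced cycle differ by a rotation and possibly a
  reversal.\<close>

lemma nosep_same:
  assumes a: "icyc as" and b: "icyc bs" and s: "set as = set bs" and n: "nosep as v"
  shows "nosep bs v"
proof -
  obtain c M where bs: "bs = c # M" using b by (cases bs) auto
  have "c \<in> set as" using s bs by simp
  then obtain X Y where as: "as = X @ c # Y" by (meson split_list)
  have a': "icyc (c # (Y @ X))" using icyc_rot[of X "c # Y"] a as by (simp del: icyc.simps)
  have n': "nosep (c # (Y @ X)) v" using nosep_rot[of X "c # Y" v] n as by simp
  have n'': "nosep (c # rev (Y @ X)) v" using nosep_rot[of "rev (Y @ X)" "[c]" v] nosep_rev[OF n'] by simp
  obtain Z where Z: "c # (Y @ X) = bs @ Z \<or> c # rev (Y @ X) = bs @ Z"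
    using cyc_walk[OF a' icyc_succ[OF b] icyc_distinct[OF b]] s as bs by auto
  have "length as = length bs" using icyc_distinct[OF a] icyc_distinct[OF b] s distinct_card by metis
  then have "length (c # (Y @ X)) = length bs" "length (c # rev (Y @ X)) = length bs" using as by auto
  then have "c # (Y @ X) = bs \<or> c # rev (Y @ X) = bs" using Z by (metis append_Nil2 length_append length_0_conv add_cancel_right_right)
  then show ?thesis using n' n'' by metis
qed

text \<open>The sector extends from the last spoke before \<open>Y\<close> to the first one in
  \<open>R1\<close>. If \<open>R1\<close> has no spoke, going around the cycle the next one is
  \<open>e\<close> again.\<close>

lemma sector_around:
  assumes c: "icyc ((e # L1) @ Y @ R1)" and e: "E x e" and s: "2 \<le> sp ((e # L1) @ Y @ R1)" "sp Y = 0" and R1: "R1 \<noteq> []"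
    and v: "\<And>b. b \<in> set ((e # L1) @ Y @ R1) \<Longrightarrow> E v b \<Longrightarrow> b = last (e # L1) \<or> b \<in> set Y \<or> b = hd R1"
  obtains f X f' Z where "icyc (f # X @ f' # Z)" "set (f # X @ f' # Z) = set ((e # L1) @ Y @ R1)" "E x f" "E x f'" "sp X = 0"
    "\<And>b. b \<in> set ((e # L1) @ Y @ R1) \<Longrightarrow> E v b \<Longrightarrow> b \<in> set (f # X @ [f'])"
proof -
  have "0 < sp (e # L1)" using e by simp
  then obtain U f W where U: "e # L1 = U @ f # W" "E x f" "sp W = 0" by (rule last_spoke)
  have la: "last (e # L1) \<in> set (f # W)" unfolding U(1) by simp
  show thesis
  proof (cases "0 < sp R1")
    case True
    then obtain W1 f' U' where R: "R1 = W1 @ f' # U'" "E x f'" "sp W1 = 0" by (rule first_spoke)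
    have h: "hd R1 \<in> set (W1 @ [f'])" unfolding R(1) by (cases W1) auto
    have c': "icyc (f # (W @ Y @ W1) @ f' # (U' @ U))"
      using icyc_rot[of U "f # W @ Y @ W1 @ f' # U'"] c unfolding U(1) R(1) by (simp del: icyc.simps)
    show thesis
    proof (rule that[OF c' _ U(2) R(2)])
      show "set (f # (W @ Y @ W1) @ f' # U' @ U) = set ((e # L1) @ Y @ R1)" unfolding U(1) R(1) by auto
      show "sp (W @ Y @ W1) = 0" using U R s by simp
      fix b assume "b \<in> set ((e # L1) @ Y @ R1)" "E v b"
      from v[OF this] show "b \<in> set (f # (W @ Y @ W1) @ [f'])" using la h by auto
    qed
  next
    case False
    have "U \<noteq> []"
    proof
      assume "U = []"
      then have "sp ((e # L1) @ Y @ R1) = 1" using U False s(2) by simp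
      then show False using s(1) by simp
    qed
    then obtain U2 where U2: "U = e # U2" using U(1) by (cases U) auto
    have h: "hd R1 \<in> set R1" using R1 by simp
    have c': "icyc (f # (W @ Y @ R1) @ e # U2)"
      using icyc_rot[of U "f # W @ Y @ R1"] c U2 unfolding U(1) by (simp del: icyc.simps)
    show thesis
    proof (rule that[OF c' _ U(2) e])
      show "set (f # (W @ Y @ R1) @ e # U2) = set ((e # L1) @ Y @ R1)" unfolding U(1) U2 by auto
      show "sp (W @ Y @ R1) = 0" using U False s by simp
      fix b assume "b \<in> set ((e # L1) @ Y @ R1)" "E v b"
      from v[OF this] show "b \<in> set (f # (W @ Y @ R1) @ [e])" using la h by auto
    qed
  qed
qed

text \<open>Four spokes guarantee a spoke \<open>e\<close> that \<open>v\<close> does not see,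
  because the first and the third are separated on both sides. Read from \<open>e\<close>, the cycle
  has no spoke strictly between the first and last neighbour of \<open>v\<close>, since
  \<open>e\<close> lies on the other side.\<close>

lemma nosep_sector:
  assumes L: "icyc L" and s: "4 \<le> sp L" and n: "nosep L v"
  obtains f X f' Z where "icyc (f # X @ f' # Z)" "set (f # X @ f' # Z) = set L" "E x f" "E x f'" "sp X = 0"
    "\<And>b. b \<in> set L \<Longrightarrow> E v b \<Longrightarrow> b \<in> set (f # X @ [f'])"
proof -
  note result = that
  have "0 < sp L" using s by simp
  then obtain A0 e0 A1 where 0: "L = A0 @ e0 # A1" "E x e0" "sp A0 = 0" by (rule first_spoke)
  have "0 < sp A1" using s 0 by simp
  then obtain B1 f1 A2 where 1: "A1 = B1 @ f1 # A2" "E x f1" "sp B1 = 0" by (rule first_spoke)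
  have "0 < sp A2" using s 0 1 by simp
  then obtain B2 f2 A3 where 2: "A2 = B2 @ f2 # A3" "E x f2" "sp B2 = 0" by (rule first_spoke)
  have 3: "0 < sp A3" using s 0 1 2 by simp
  have "\<not> (E v e0 \<and> E v f2)"
  proof
    assume a: "E v e0 \<and> E v f2"
    have "nosep (A0 @ e0 # (B1 @ f1 # B2) @ f2 # A3) v" using n 0 1 2 by simp
    from nosepD[OF this] a show False using 1 3 by simp
  qed
  then obtain e where e: "e \<in> set L" "E x e" "\<not> E v e" using 0 1 2 by auto
  obtain X0 R0 where X0: "L = X0 @ e # R0" using e(1) by (meson split_list)
  define R where "R = R0 @ X0"
  have R: "icyc (e # R)" "nosep (e # R) v" "set (e # R) = set L" "sp (e # R) = sp L"
    using L n icyc_rot[of X0 "e # R0"] nosep_rot[of X0 "e # R0" v] unfolding R_def X0 by (auto simp del: icyc.simps)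
  have gen: thesis if d: "e # R = (e # L1) @ Y @ R1" "sp Y = 0" "R1 \<noteq> []"
    and vb: "\<And>b. b \<in> set (e # R) \<Longrightarrow> E v b \<Longrightarrow> b = last (e # L1) \<or> b \<in> set Y \<or> b = hd R1" for L1 Y R1
  proof -
    have s2: "2 \<le> sp ((e # L1) @ Y @ R1)" using R(4) s d(1) by simp
    show thesis
    proof (rule sector_around[OF R(1)[unfolded d(1)] e(2) s2 d(2,3), of v])
      fix b assume "b \<in> set ((e # L1) @ Y @ R1)" "E v b"
      then show "b = last (e # L1) \<or> b \<in> set Y \<or> b = hd R1" using vb d(1) by metis
    next
      fix f X f' Z assume f: "icyc (f # X @ f' # Z)" "set (f # X @ f' # Z) = set ((e # L1) @ Y @ R1)" "E x f" "E x f'" "sp X = 0"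
        and b: "\<And>b. b \<in> set ((e # L1) @ Y @ R1) \<Longrightarrow> E v b \<Longrightarrow> b \<in> set (f # X @ [f'])"
      have sL: "set ((e # L1) @ Y @ R1) = set L" using R(3) d(1) by simp
      show thesis by (rule result[OF f(1) _ f(3-5)]) (use f(2) b sL in auto)
    qed
  qed
  show thesis
  proof (rule nbr_cases[of R v])
    assume no: "\<And>b. b \<in> set R \<Longrightarrow> \<not> E v b"
    have "R \<noteq> []" using R(1) by auto
    then show thesis using gen[of "[]" "[]" R] no e(3) by auto
  next
    fix X c Z assume c: "R = X @ c # Z" "E v c" "\<And>b. b \<in> set (X @ Z) \<Longrightarrow> \<not> E v b"
    show thesis using gen[of X "[]" "c # Z"] c e(3) by auto
  next
    fix X c Y c' Z assume c: "R = X @ c # Y @ c' # Z" "E v c" "E v c'" "\<And>b. b \<in> set (X @ Z) \<Longrightarrow> \<not> E v b"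
    have "nosep ((e # X) @ c # Y @ c' # Z) v" using R(2) c(1) by simp
    from nosepD[OF this c(2,3)] have "sp Y = 0" using e(2) by simp
    then show thesis using gen[of "X @ [c]" Y "c' # Z"] c e(3) by auto
  qed
qed

end

section \<open>Sectors in one component and sectors that meet\<close>

context min_wheel_ctx
begin

definition sec :: "'a \<Rightarrow> 'a list \<Rightarrow> 'a \<Rightarrow> bool" where
  "sec e X e' \<longleftrightarrow> (\<exists>Y. rim (e # X @ e' # Y)) \<and> E x e \<and> E x e' \<and> sp X = 0"

lemma sec_rev: "sec e X e' \<Longrightarrow> sec e' (rev X) e"
proof -
  assume s: "sec e X e'"
  then obtain Y where "rim (e # X @ e' # Y)" unfolding sec_def by blast
  then have "rim (e' # rev X @ e # rev Y)" using rim_flip[OF rim_swap[of e X e' Y]] by simp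
  then show ?thesis using s unfolding sec_def by auto
qed

text \<open>The interior \<open>X'\<close> is a path of non-neighbours of \<open>x\<close> that
  meets \<open>X\<close>, so \<open>sector_component\<close> keeps all of it in \<open>X\<close>;
  its ends then follow by \<open>sector_nbr\<close>.\<close>

lemma sec_interior_subset:
  assumes s: "sec e X e'" and t: "sec g X' g'" and c: "c \<in> set X" "c \<in> set X'"
  shows "set (g # X' @ [g']) \<subseteq> set (e # X @ [e'])"
proof -
  obtain Y where Y: "rim (e # X @ e' # Y)" "E x e" "E x e'" "sp X = 0" using s unfolding sec_def by blast
  obtain Y' where Y': "rim (g # X' @ g' # Y')" "E x g" "E x g'" "sp X' = 0" using t unfolding sec_def by blast
  have C': "set (g # X' @ g' # Y') = C" and cyc: "icyc (g # X' @ g' # Y')" using Y' unfolding rim_def by auto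
  have ip: "ipath (g # X' @ [g'])" if "Y' \<noteq> []" using icyc_sub[of "[]" "g # X' @ [g']" Y'] cyc that by (simp del: icyc.simps ipath.simps)
  have Y'ne: "Y' \<noteq> []" using rim_sp[OF Y'(1)] Y' n4 by auto
  have ipX: "ipath X'" using ipath_sub[of "[g]" X' "[g']"] ip[OF Y'ne] by simp
  have far: "set X' \<subseteq> far" using sp_0D[OF Y'(4)] C' icyc_V[OF cyc] x_C unfolding far_def by auto
  have "d \<in> set X" if "d \<in> set X'" for d
  proof -
    have "(c, d) \<in> far_step\<^sup>*" using conn_walk[OF ipX far c(2) that] unfolding far_step_def .
    then show ?thesis using sector_component[OF Y c(1)] C' that by auto
  qed
  then have sub: "set X' \<subseteq> set X" by blast
  have ne: "X' \<noteq> []" using c by auto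
  have "successively E ([g] @ X' @ [g'])" using ipath_succ[OF ip[OF Y'ne]] by simp
  then have "E g (hd X')" "E (last X') g'" using ne by (auto simp: successively_append_iff successively_Cons)
  then have "E (hd X') g" "E (last X') g'" using E_commute by blast+
  moreover have "hd X' \<in> set X" "last X' \<in> set X" "g \<in> C" "g' \<in> C" using sub ne C' by auto
  ultimately have "g \<in> set (e # X @ [e'])" "g' \<in> set (e # X @ [e'])" using sector_nbr[OF Y(1)] by blast+
  then show ?thesis using sub by auto
qed

lemma sec_eq:
  assumes "sec e X e'" "sec g X' g'" "c \<in> set X" "c \<in> set X'"
  shows "set (g # X' @ [g']) = set (e # X @ [e'])"
  using sec_interior_subset[OF assms] sec_interior_subset[OF assms(2,1,4,3)] by blast

lemma sec_walk:
  assumes t: "sec g X' g'" and r: "rim (g # M)"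
  shows "\<exists>Z. M = X' @ g' # Z \<or> rev M = X' @ g' # Z"
proof -
  obtain Y' where Y': "rim (g # X' @ g' # Y')" using t unfolding sec_def by blast
  have cyc: "icyc (g # X' @ g' # Y')" "set (g # X' @ g' # Y') = C" using Y' unfolding rim_def by auto
  have 1: "successively E (g # X' @ [g'])" using icyc_succ[OF cyc(1)] successively_append_iff[of E "g # X' @ [g']" Y'] by auto
  have 2: "distinct (g # X' @ [g'])" using icyc_distinct[OF cyc(1)] by auto
  have 3: "set (g # X' @ [g']) \<subseteq> set (g # M)" using cyc(2) r unfolding rim_def by auto
  have 4: "icyc (g # M)" using r unfolding rim_def by blast
  have "\<exists>Z. g # M = (g # X' @ [g']) @ Z \<or> g # rev M = (g # X' @ [g']) @ Z"
    by (rule cyc_walk[OF 4 1 2 3]) auto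
  then show ?thesis by auto
qed

lemma sec_disjoint_rim:
  assumes s: "sec e X e'" and t: "sec g X' g'" and d: "set (e # X @ [e']) \<inter> set (g # X' @ [g']) = {}"
  shows "(\<exists>A B. rim (e # X @ e' # A @ g # X' @ g' # B)) \<or> (\<exists>A B. rim (e # X @ e' # A @ g' # rev X' @ g # B))"
proof -
  obtain Y where Y: "rim (e # X @ e' # Y)" using s unfolding sec_def by blast
  obtain Y' where "rim (g # X' @ g' # Y')" using t unfolding sec_def by blast
  then have "g \<in> C" unfolding rim_def by auto
  then have "g \<in> set Y" using Y d unfolding rim_def by auto
  then obtain A0 B0 where AB: "Y = A0 @ g # B0" by (meson split_list)
  have r: "rim (g # (B0 @ e # X @ e' # A0))" using rim_rot[of "e # X @ e' # A0" "g # B0"] Y AB by simp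
  obtain Z where "B0 @ e # X @ e' # A0 = X' @ g' # Z \<or> rev (B0 @ e # X @ e' # A0) = X' @ g' # Z" using sec_walk[OF t r] by blast
  then show ?thesis
  proof
    assume "B0 @ e # X @ e' # A0 = X' @ g' # Z"
    then obtain W where "B0 = X' @ g' # W" using prefix_before[of B0 e _ X' g' Z] d by auto
    then show ?thesis using Y AB by auto
  next
    assume "rev (B0 @ e # X @ e' # A0) = X' @ g' # Z"
    then have "rev A0 @ e' # (rev X @ e # rev B0) = X' @ g' # Z" by simp
    then obtain W where "rev A0 = X' @ g' # W" using prefix_before[of "rev A0" e' _ X' g' Z] d by auto
    then have "A0 = rev W @ g' # rev X'" by (metis rev_append rev_rev_ident rev.simps(2) append.assoc append_Cons append_Nil)
    then show ?thesis using Y AB by auto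
  qed
qed

lemma sec_touch:
  assumes s: "sec e X e'" and a: "a \<in> set X" "(a, z) \<in> far_step\<^sup>*" "E z u" and u: "u \<in> C"
  shows "u \<in> set (e # X @ [e'])"
proof -
  obtain Y where Y: "rim (e # X @ e' # Y)" "E x e" "E x e'" "sp X = 0" using s unfolding sec_def by blast
  note sc = sector_component[OF Y a(1,2)]
  show ?thesis
  proof (cases "z \<in> C")
    case True
    then show ?thesis using sector_nbr[OF Y(1) _ u a(3)] sc by blast
  next
    case False
    then obtain Q q b where Q: "conn Q" "z \<in> Q" "Q \<subseteq> far - C" "q \<in> Q" "b \<in> set X" "E q b" using sc by blast
    show ?thesis
    proof (rule ccontr)
      assume "u \<notin> set (e # X @ [e'])"
      then have "sepC b u" using sector_sepC[OF Y(1-3) Q(5) u] by blast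
      then show False using no_conn_link[OF Q(1) _ _ Q(4,6,2) a(3)] Q(3) unfolding far_def by auto
    qed
  qed
qed

lemma sec_leg:
  assumes s: "sec e X e'" and a: "a \<in> set X" "(a, z) \<in> far_step\<^sup>*" "E z u" and u: "u \<notin> C" "E x u"
  obtains Z b where "ipath (u # Z)" "set Z \<inter> insert x C = {}" "sp Z = 0" "b \<in> set X" "E (last (u # Z)) b"
proof -
  obtain Y where Y: "rim (e # X @ e' # Y)" "E x e" "E x e'" "sp X = 0" using s unfolding sec_def by blast
  note sc = sector_component[OF Y a(1,2)]
  have uV: "u \<in> V" using E_V[OF E_sym[OF u(2)]] .
  show thesis
  proof (cases "z \<in> C")
    case True
    then show thesis using that[of "[]" z] sc uV a(3) E_commute by auto
  next
    case False
    then obtain Q q b where Q: "conn Q" "z \<in> Q" "Q \<subseteq> far - C" "q \<in> Q" "b \<in> set X" "E q b" using sc by blast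
    have c: "conn (insert u Q)" by (rule conn_insert[OF Q(1,2) a(3)])
    obtain p where p: "ipath p" "p \<noteq> []" "set p \<subseteq> insert u Q" "hd p = u" "last p = q"
      using conn_path[OF c, of u q] Q(4) by blast
    then obtain Z where Z: "p = u # Z" by (cases p) auto
    have "u \<notin> set Z" using ipath_distinct[OF p(1)] Z by simp
    then have ZQ: "set Z \<subseteq> Q" using p(3) Z by auto
    have "sp Z = 0" unfolding sp_0_iff using ZQ Q(3) unfolding far_def by auto
    moreover have "set Z \<inter> insert x C = {}" using ZQ Q(3) unfolding far_def by auto
    ultimately show thesis using that[of Z b] p Z Q by auto
  qed
qed

text \<open>The walk ends on the rim, hence inside \<open>X\<close> by
  \<open>sector_component\<close>, and sectors that share an interior vertex coincide.\<close>

theorem same_component: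
  assumes s: "sec e X e'" and t: "sec g X' g'" and a: "a \<in> set X" "b \<in> set X'" "(a, b) \<in> far_step\<^sup>*"
  shows "set (g # X' @ [g']) = set (e # X @ [e'])"
proof -
  obtain Y where Y: "rim (e # X @ e' # Y)" "E x e" "E x e'" "sp X = 0" using s unfolding sec_def by blast
  obtain Y' where Y': "rim (g # X' @ g' # Y')" using t unfolding sec_def by blast
  then have "b \<in> C" using a(2) unfolding rim_def by auto
  then have "b \<in> set X" using sector_component[OF Y a(1,3)] by blast
  then show ?thesis using sec_eq[OF s t _ a(2)] by blast
qed

text \<open>If \<open>u\<close> lies on the rim, each of the two sectors contains it. Otherwise it
  has a leg into the interior of each, which \<open>two_sectors\<close> excludes for disjoint
  sectors.\<close>

theorem through_nbr:
  assumes s: "sec e X e'" and t: "sec g X' g'" and u: "E x u"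
    and a: "a \<in> set X" "(a, z) \<in> far_step\<^sup>*" "E z u" and b: "b \<in> set X'" "(b, z') \<in> far_step\<^sup>*" "E z' u"
  shows "set (e # X @ [e']) \<inter> set (g # X' @ [g']) \<noteq> {}"
proof (cases "u \<in> C")
  case True
  then show ?thesis using sec_touch[OF s a True] sec_touch[OF t b True] by blast
next
  case False
  have uV: "u \<in> V" using E_V[OF E_sym[OF u]] .
  obtain Z1 b1 where Z1: "ipath (u # Z1)" "set Z1 \<inter> insert x C = {}" "sp Z1 = 0" "b1 \<in> set X" "E (last (u # Z1)) b1"
    by (rule sec_leg[OF s a False u])
  obtain Z2 b2 where Z2: "ipath (u # Z2)" "set Z2 \<inter> insert x C = {}" "sp Z2 = 0" "b2 \<in> set X'" "E (last (u # Z2)) b2"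
    by (rule sec_leg[OF t b False u])
  have se: "E x e" "E x e'" "sp X = 0" "E x g" "E x g'" "sp X' = 0" using s t unfolding sec_def by auto
  show ?thesis
  proof
    assume "set (e # X @ [e']) \<inter> set (g # X' @ [g']) = {}"
    from sec_disjoint_rim[OF s t this] show False
    proof (elim disjE exE)
      fix A B assume r: "rim (e # X @ e' # A @ g # X' @ g' # B)"
      show False by (rule two_sectors[OF r se(1,2,4,5,3,6) uV False u Z1 Z2])
    next
      fix A B assume r: "rim (e # X @ e' # A @ g' # rev X' @ g # B)"
      show False by (rule two_sectors[OF r se(1,2,5,4,3) _ uV False u Z1 Z2(1,2,3) _ Z2(5)]) (use se Z2 in auto)
    qed
  qed
qed

lemma sec_end_nbr:
  assumes s: "sec e X e'" and X: "X \<noteq> []" and c: "c = e \<or> c = e'"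
  obtains y where "y \<in> set X" "E c y"
proof -
  obtain Y where Y: "rim (e # X @ e' # Y)" using s unfolding sec_def by blast
  then have "successively E ([e] @ X @ e' # Y)" using icyc_succ[of "e # X @ e' # Y"] unfolding rim_def by simp
  then have "E e (hd X)" "E (last X) e'" using X by (auto simp: successively_append_iff successively_Cons)
  then show thesis using that[of "hd X"] that[of "last X"] c X E_commute by auto
qed

text \<open>A rim vertex has two neighbours on the rim, but three sectors ending at \<open>c\<close>
  would provide three.\<close>

lemma sec_star:
  assumes s: "sec e1 X1 f1" "sec e2 X2 f2" "sec e3 X3 f3" and ne: "X1 \<noteq> []" "X2 \<noteq> []" "X3 \<noteq> []"
    and d: "set X1 \<inter> set X2 = {}" "set X1 \<inter> set X3 = {}" "set X2 \<inter> set X3 = {}"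
    and c: "c = e1 \<or> c = f1" "c = e2 \<or> c = f2" "c = e3 \<or> c = f3"
  shows False
proof -
  obtain y1 where y1: "y1 \<in> set X1" "E c y1" using sec_end_nbr[OF s(1) ne(1) c(1)] .
  obtain y2 where y2: "y2 \<in> set X2" "E c y2" using sec_end_nbr[OF s(2) ne(2) c(2)] .
  obtain y3 where y3: "y3 \<in> set X3" "E c y3" using sec_end_nbr[OF s(3) ne(3) c(3)] .
  have inC: "set X \<subseteq> C \<and> e \<in> C \<and> e' \<in> C" if "sec e X e'" for e X e' using that unfolding sec_def rim_def by auto
  have "c \<in> C" using inC[OF s(1)] c(1) by auto
  then obtain M where M: "rim (c # M)" by (rule rim_start)
  have two: "b = hd M \<or> b = last M" if "b \<in> C" "E c b" for b
    using M that E_irrefl unfolding rim_def by auto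
  have "y1 = hd M \<or> y1 = last M" "y2 = hd M \<or> y2 = last M" "y3 = hd M \<or> y3 = last M"
    using two y1 y2 y3 inC[OF s(1)] inC[OF s(2)] inC[OF s(3)] by blast+
  moreover have "y1 \<noteq> y2" "y1 \<noteq> y3" "y2 \<noteq> y3" using y1 y2 y3 d by auto
  ultimately show False by metis
qed

text \<open>Three sectors that share their ends cyclically exhaust the rim, which would have only
  the spokes \<open>a\<close>, \<open>b\<close>, \<open>c\<close>.\<close>

lemma sec_cycle:
  assumes s: "sec a X1 b" "sec b X2 c" "sec a X3 c" and ne: "X1 \<noteq> []" "X2 \<noteq> []" "X3 \<noteq> []"
    and d: "set X1 \<inter> set X2 = {}" "set X1 \<inter> set X3 = {}" and abc: "a \<noteq> b" "a \<noteq> c" "b \<noteq> c"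
  shows False
proof -
  obtain Y where Y: "rim (a # X1 @ b # Y)" using s(1) unfolding sec_def by blast
  have E: "E x a" "E x b" "E x c" "sp X1 = 0" "sp X2 = 0" "sp X3 = 0" using s unfolding sec_def by auto
  have r: "rim (b # (Y @ a # X1))" using rim_rot[of "a # X1" "b # Y"] Y by simp
  have aX: "a \<notin> set X2" using E sp_0D by blast
  obtain Z where "Y @ a # X1 = X2 @ c # Z \<or> rev (Y @ a # X1) = X2 @ c # Z" using sec_walk[OF s(2) r] by blast
  then obtain W where W: "Y = X2 @ c # W"
  proof
    assume "Y @ a # X1 = X2 @ c # Z"
    then show thesis using prefix_before[of Y a X1 X2 c Z] abc aX that by auto
  next
    assume "rev (Y @ a # X1) = X2 @ c # Z"
    then have "hd (rev X1) = hd X2" using ne by (metis append.assoc hd_append2 rev_append rev.simps(2) rev_is_Nil_conv)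
    then have "hd X2 \<in> set X1" using ne hd_in_set[of "rev X1"] by simp
    then show thesis using d ne by auto
  qed
  have dist: "distinct (a # X1 @ b # Y)" using Y icyc_distinct unfolding rim_def by blast
  obtain Z' where "X1 @ b # Y = X3 @ c # Z' \<or> rev (X1 @ b # Y) = X3 @ c # Z'" using sec_walk[OF s(3) Y] by blast
  then have "rev W = X3"
  proof
    assume "X1 @ b # Y = X3 @ c # Z'"
    then have "hd X1 = hd X3" using ne by (metis hd_append2)
    then have "hd X3 \<in> set X1" using ne hd_in_set[of X1] by simp
    then show ?thesis using d ne by auto
  next
    assume "rev (X1 @ b # Y) = X3 @ c # Z'"
    then have e: "rev W @ c # (rev X2 @ b # rev X1) = X3 @ c # Z'" using W by simp
    have "c \<notin> set (rev W)" "c \<notin> set (rev X2 @ b # rev X1)" using dist W by auto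
    then show ?thesis using append_Cons_eq_iff[of c "rev W" "rev X2 @ b # rev X1" X3 Z'] e by blast
  qed
  then have "sp W = 0" using E by auto
  then have "n = 3" using rim_sp[OF Y] W E by simp
  then show False using n4 by simp
qed

text \<open>Distinct sectors have disjoint interiors and thus meet in spokes. If two of the three
  common spokes coincide, \<open>sec_star\<close> applies, and \<open>sec_cycle\<close>
  otherwise.\<close>

theorem three_sectors:
  assumes s: "sec e1 X1 f1" "sec e2 X2 f2" "sec e3 X3 f3" and ne: "X1 \<noteq> []" "X2 \<noteq> []" "X3 \<noteq> []"
    and d: "set (e1 # X1 @ [f1]) \<noteq> set (e2 # X2 @ [f2])" "set (e1 # X1 @ [f1]) \<noteq> set (e3 # X3 @ [f3])"
      "set (e2 # X2 @ [f2]) \<noteq> set (e3 # X3 @ [f3])"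
    and i: "set (e1 # X1 @ [f1]) \<inter> set (e2 # X2 @ [f2]) \<noteq> {}" "set (e1 # X1 @ [f1]) \<inter> set (e3 # X3 @ [f3]) \<noteq> {}"
      "set (e2 # X2 @ [f2]) \<inter> set (e3 # X3 @ [f3]) \<noteq> {}"
  shows False
proof -
  have E: "E x e1" "E x f1" "sp X1 = 0" "E x e2" "E x f2" "sp X2 = 0" "E x e3" "E x f3" "sp X3 = 0" using s unfolding sec_def by auto
  have dj: "set X1 \<inter> set X2 = {}" "set X1 \<inter> set X3 = {}" "set X2 \<inter> set X3 = {}"
    using sec_eq[OF s(1,2)] sec_eq[OF s(1,3)] sec_eq[OF s(2,3)] d by blast+
  have ends: "e \<noteq> e'" if t: "sec e X e'" for e X e'
    using t icyc_distinct unfolding sec_def rim_def by fastforce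
  have share: "\<exists>c. (c = e \<or> c = e') \<and> (c = g \<or> c = g')"
    if h: "set (e # X @ [e']) \<inter> set (g # X' @ [g']) \<noteq> {}" "set X \<inter> set X' = {}" "sp X = 0" "sp X' = 0"
      "E x e" "E x e'" "E x g" "E x g'" for e X e' g X' g'
  proof -
    obtain c where c: "c \<in> set (e # X @ [e'])" "c \<in> set (g # X' @ [g'])" using h(1) by blast
    have "c \<notin> set X" "c \<notin> set X'" using c h sp_0D[of X c] sp_0D[of X' c] by auto
    then show ?thesis using c by auto
  qed
  obtain c12 where c12: "c12 = e1 \<or> c12 = f1" "c12 = e2 \<or> c12 = f2" using share[OF i(1) dj(1)] E by blast
  obtain c13 where c13: "c13 = e1 \<or> c13 = f1" "c13 = e3 \<or> c13 = f3" using share[OF i(2) dj(2)] E by blast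
  obtain c23 where c23: "c23 = e2 \<or> c23 = f2" "c23 = e3 \<or> c23 = f3" using share[OF i(3) dj(3)] E by blast
  note st = sec_star[OF s ne dj]
  have n1: "c12 \<noteq> c13" using st[of c12] c12 c13 by metis
  have n2: "c12 \<noteq> c23" using st[of c12] c12 c23 by metis
  have n3: "c13 \<noteq> c23" using st[of c13] c13 c23 by metis
  have orient: "\<exists>X''. sec a X'' b \<and> set X'' = set X" if h: "sec e X e'" "a = e \<or> a = e'" "b = e \<or> b = e'" "a \<noteq> b" for a b e X e'
  proof (cases "a = e")
    case True
    then show ?thesis using h by (intro exI[of _ X]) auto
  next
    case False
    then show ?thesis using h sec_rev[OF h(1)] by (intro exI[of _ "rev X"]) auto
  qed
  obtain Y1 where Y1: "sec c13 Y1 c12" "set Y1 = set X1" using orient[OF s(1) c13(1) c12(1)] n1 by blast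
  obtain Y2 where Y2: "sec c12 Y2 c23" "set Y2 = set X2" using orient[OF s(2) c12(2) c23(1) n2] by blast
  obtain Y3 where Y3: "sec c13 Y3 c23" "set Y3 = set X3" using orient[OF s(3) c13(2) c23(2) n3] by blast
  have "Y1 \<noteq> []" "Y2 \<noteq> []" "Y3 \<noteq> []" using ne Y1(2) Y2(2) Y3(2) by auto
  then show False using sec_cycle[OF Y1(1) Y2(1) Y3(1)] dj Y1(2) Y2(2) Y3(2) n1 n2 n3 by auto
qed

end

section \<open>Wheels\<close>

definition adj :: "'a pair_pre_digraph \<Rightarrow> 'a \<Rightarrow> 'a \<Rightarrow> bool" where
  "adj G a b \<longleftrightarrow> (a, b) \<in> parcs G"

lemma nbhd_adj: "nbhd G x = {y. adj G x y}"
  unfolding nbhd_def adj_def by simp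

lemma sgraph_adj:
  assumes "pair_graph G"
  shows "sgraph (pverts G) (adj G)"
proof -
  interpret pair_graph G by fact
  have 1: "finite (pverts G)" using pair_finite_verts .
  have 2: "adj G b a" if "adj G a b" for a b using that arcs_symmetric unfolding adj_def by blast
  have 3: "\<not> adj G a a" for a using pair_no_loops[of "(a, a)"] unfolding adj_def by auto
  have 4: "a \<in> pverts G" if "adj G a b" for a b using that arc_fst_in_verts[of "(a, b)"] unfolding adj_def by auto
  show ?thesis using 1 2 3 4 by (rule sgraph.intro)
qed

definition ind :: "'a pair_pre_digraph \<Rightarrow> 'a set \<Rightarrow> 'a pair_pre_digraph" where
  "ind G U = \<lparr>pverts = U, parcs = {(a, b). a \<in> U \<and> b \<in> U \<and> adj G a b}\<rparr>"

lemma induced_freeD: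
  assumes "pair_graph G" "induced_free P G" "U \<subseteq> pverts G"
  shows "\<not> P (ind G U)"
proof -
  interpret pair_graph G by fact
  have "pair_wf_digraph (ind G U)" by unfold_locales (auto simp: ind_def)
  then have w: "wf_digraph (with_proj (ind G U))" unfolding wf_digraph_wp_iff .
  have "pair_wf_digraph G" by unfold_locales
  then have w': "wf_digraph (with_proj G)" unfolding wf_digraph_wp_iff .
  have "induced_subgraph (with_proj (ind G U)) (with_proj G)"
    unfolding induced_subgraph_def subgraph_def compatible_def using w w' assms(3) by (auto simp: ind_def adj_def)
  then show ?thesis using assms(2) unfolding induced_free_def by blast
qed

lemma symcl_Un_iff: "(y, z) \<in> symcl (A \<union> B) \<longleftrightarrow> (y, z) \<in> symcl A \<or> (y, z) \<in> symcl B"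
  by (auto simp: symcl_iff)

lemma kfree_adj:
  assumes G: "pair_graph G" "induced_free is_subdivided_K4 G" "induced_free is_prism G"
  shows "kfree (pverts G) (adj G)"
proof (intro kfree.intro sgraph_adj[OF G(1)] kfree_axioms.intro)
  fix a b c d :: 'a and p1 p2 p3 p4 p5 p6
  let ?U = "set ([a, b, c, d] @ p1 @ p2 @ p3 @ p4 @ p5 @ p6)"
  assume d: "distinct ([a, b, c, d] @ p1 @ p2 @ p3 @ p4 @ p5 @ p6)" and U: "?U \<subseteq> pverts G"
    and e: "\<And>y z. y \<in> ?U \<Longrightarrow> z \<in> ?U \<Longrightarrow> adj G y z \<longleftrightarrow> padj (a # p1 @ [b]) y z \<or> padj (a # p2 @ [c]) y z \<or> padj (a # p3 @ [d]) y z
          \<or> padj (b # p4 @ [c]) y z \<or> padj (b # p5 @ [d]) y z \<or> padj (c # p6 @ [d]) y z"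
  have "is_subdivided_K4 (ind G ?U)"
  proof (rule subdivided_K4I[OF d])
    show "pverts (ind G ?U) = ?U" by (simp add: ind_def)
    let ?A = "set (vwalk_arcs (a # p1 @ [b])) \<union> set (vwalk_arcs (a # p2 @ [c])) \<union> set (vwalk_arcs (a # p3 @ [d]))
      \<union> set (vwalk_arcs (b # p4 @ [c])) \<union> set (vwalk_arcs (b # p5 @ [d])) \<union> set (vwalk_arcs (c # p6 @ [d]))"
    have "(y, z) \<in> parcs (ind G ?U) \<longleftrightarrow> (y, z) \<in> symcl ?A" for y z
    proof -
      have A: "(y, z) \<in> symcl ?A \<longleftrightarrow> padj (a # p1 @ [b]) y z \<or> padj (a # p2 @ [c]) y z \<or> padj (a # p3 @ [d]) y z
          \<or> padj (b # p4 @ [c]) y z \<or> padj (b # p5 @ [d]) y z \<or> padj (c # p6 @ [d]) y z"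
        by (simp only: symcl_Un_iff padj_def disj_assoc)
      have I: "y \<in> ?U \<and> z \<in> ?U" if "(y, z) \<in> symcl ?A"
        using that unfolding A by (elim disjE) (drule padj_in, auto)+
      have "(y, z) \<in> parcs (ind G ?U) \<longleftrightarrow> y \<in> ?U \<and> z \<in> ?U \<and> adj G y z" by (simp add: ind_def)
      then show ?thesis using e[of y z] I unfolding A by blast
    qed
    then show "parcs (ind G ?U) = symcl ?A" by (intro set_eqI) (metis surj_pair)
  qed
  then show False using induced_freeD[OF G(1,2) U] by blast
next
  fix a a' b b' c c' :: 'a and p q r
  let ?L = "(a # p @ [a']) @ (b # q @ [b']) @ (c # r @ [c'])"
  assume d: "distinct ?L" and U: "set ?L \<subseteq> pverts G"
    and e: "\<And>y z. y \<in> set ?L \<Longrightarrow> z \<in> set ?L \<Longrightarrow> adj G y z \<longleftrightarrow> padj (a # p @ [a']) y z \<or> padj (b # q @ [b']) y z \<or> padj (c # r @ [c']) y z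
          \<or> padj [a, b, c, a] y z \<or> padj [a', b', c', a'] y z"
  let ?A = "set (vwalk_arcs (a # p @ [a'])) \<union> set (vwalk_arcs (b # q @ [b'])) \<union> set (vwalk_arcs (c # r @ [c']))
     \<union> {(hd (a # p @ [a']), hd (b # q @ [b'])), (hd (b # q @ [b']), hd (c # r @ [c'])), (hd (c # r @ [c']), hd (a # p @ [a']))}
     \<union> {(last (a # p @ [a']), last (b # q @ [b'])), (last (b # q @ [b']), last (c # r @ [c'])), (last (c # r @ [c']), last (a # p @ [a']))}"
  have "(y, z) \<in> parcs (ind G (set ?L)) \<longleftrightarrow> (y, z) \<in> symcl ?A" for y z
  proof -
    have t: "(y, z) \<in> symcl {(hd (a # p @ [a']), hd (b # q @ [b'])), (hd (b # q @ [b']), hd (c # r @ [c'])), (hd (c # r @ [c']), hd (a # p @ [a']))}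
        \<longleftrightarrow> padj [a, b, c, a] y z" unfolding symcl_iff by auto
    have t': "(y, z) \<in> symcl {(last (a # p @ [a']), last (b # q @ [b'])), (last (b # q @ [b']), last (c # r @ [c'])), (last (c # r @ [c']), last (a # p @ [a']))}
        \<longleftrightarrow> padj [a', b', c', a'] y z" unfolding symcl_iff by auto
    have A: "(y, z) \<in> symcl ?A \<longleftrightarrow> padj (a # p @ [a']) y z \<or> padj (b # q @ [b']) y z \<or> padj (c # r @ [c']) y z
          \<or> padj [a, b, c, a] y z \<or> padj [a', b', c', a'] y z"
      by (simp only: symcl_Un_iff t t' padj_def disj_assoc)
    have I: "y \<in> set ?L \<and> z \<in> set ?L" if "(y, z) \<in> symcl ?A"
      using that unfolding A by (elim disjE) (drule padj_in, auto)+
    have "(y, z) \<in> parcs (ind G (set ?L)) \<longleftrightarrow> y \<in> set ?L \<and> z \<in> set ?L \<and> adj G y z" by (simp add: ind_def)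
    then show ?thesis using e[of y z] I unfolding A by blast
  qed
  then have pa: "parcs (ind G (set ?L)) = symcl ?A" by (intro set_eqI) (metis surj_pair)
  have pv: "pverts (ind G (set ?L)) = set (a # p @ [a']) \<union> set (b # q @ [b']) \<union> set (c # r @ [c'])"
    unfolding ind_def by auto
  have l: "2 \<le> length (a # p @ [a'])" "2 \<le> length (b # q @ [b'])" "2 \<le> length (c # r @ [c'])" by simp_all
  have "is_prism (ind G (set ?L))" unfolding is_prism_def using l d pv pa by (intro exI conjI)
  then show False using induced_freeD[OF G(1,3) U] by blast
qed

text \<open>Triangles cannot share an edge, as they would form a diamond or a \<open>K4\<close>. Two
  triangles sharing one vertex have no further edge between them, because it would produce such a
  pair, and so they form a bowtie.\<close>

lemma tgraph_adj:
  assumes G: "pair_graph G" "induced_free is_subdivided_K4 G" "induced_free is_diamond G" "induced_free is_bowtie G" "induced_free is_prism G"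
  shows "tgraph (pverts G) (adj G)"
proof -
  interpret K: kfree "pverts G" "adj G" using kfree_adj[OF G(1,2,5)] .
  have dia: "c = e" if h: "adj G a b" "adj G a c" "adj G b c" "adj G a e" "adj G b e" for a b c e
  proof (rule ccontr)
    assume ce: "c \<noteq> e"
    have sy: "adj G b a" "adj G c a" "adj G c b" "adj G e a" "adj G e b" using h K.E_sym by blast+
    have ne: "a \<noteq> b" "a \<noteq> c" "a \<noteq> e" "b \<noteq> c" "b \<noteq> e" using h K.E_irrefl by blast+
    have V: "{a, b, c, e} \<subseteq> pverts G" using h sy K.E_V by blast
    show False
    proof (cases "adj G c e")
      case True
      then have ec: "adj G e c" using K.E_sym by blast
      show False
      proof (rule K.no_K4[of a b c e "[]" "[]" "[]" "[]" "[]" "[]"])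
        show "distinct ([a, b, c, e] @ [] @ [] @ [] @ [] @ [] @ [])" using ne ce by simp
        show "set ([a, b, c, e] @ [] @ [] @ [] @ [] @ [] @ []) \<subseteq> pverts G" using V by simp
        fix y z assume "y \<in> set ([a, b, c, e] @ [] @ [] @ [] @ [] @ [] @ [])" "z \<in> set ([a, b, c, e] @ [] @ [] @ [] @ [] @ [] @ [])"
        then have "y = a \<or> y = b \<or> y = c \<or> y = e" "z = a \<or> z = b \<or> z = c \<or> z = e" by simp_all
        then show "adj G y z \<longleftrightarrow> padj (a # [] @ [b]) y z \<or> padj (a # [] @ [c]) y z \<or> padj (a # [] @ [e]) y z
            \<or> padj (b # [] @ [c]) y z \<or> padj (b # [] @ [e]) y z \<or> padj (c # [] @ [e]) y z"
          by (elim disjE) (simp_all add: True ec h sy ne ce ne[symmetric] ce[symmetric] K.E_irrefl)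
      qed
    next
      case False
      then have n: "\<not> adj G e c" using K.E_sym by blast
      have "is_diamond (ind G {a, b, c, e})" unfolding is_diamond_def
      proof (intro exI conjI)
        show "distinct [a, b, c, e]" using ne ce by auto
        show "pverts (ind G {a, b, c, e}) = {a, b, c, e}" by (simp add: ind_def)
        show "parcs (ind G {a, b, c, e}) = symcl {(a, b), (a, c), (a, e), (b, c), (b, e)}"
          unfolding ind_def symcl_def using h sy n False K.E_irrefl by auto
      qed
      then show False using induced_freeD[OF G(1,3) V] by blast
    qed
  qed
  have tri: "{b, c} = {d, e}" if h: "adj G a b" "adj G b c" "adj G a c" "adj G a d" "adj G d e" "adj G a e" for a b c d e
  proof (rule ccontr)
    assume no: "{b, c} \<noteq> {d, e}"
    have sy: "adj G b a" "adj G c b" "adj G c a" "adj G d a" "adj G e d" "adj G e a" using h K.E_sym by blast+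
    have ne: "a \<noteq> b" "b \<noteq> c" "a \<noteq> c" "a \<noteq> d" "d \<noteq> e" "a \<noteq> e" using h K.E_irrefl by blast+
    have q: "b \<noteq> d" "b \<noteq> e" "c \<noteq> d" "c \<noteq> e"
      using dia[of a b c e] dia[of a b c d] dia[of a c b e] dia[of a c b d] h sy no by blast+
    have nn: "\<not> adj G b d" "\<not> adj G b e" "\<not> adj G c d" "\<not> adj G c e"
      using dia[of a b c d] dia[of a b c e] dia[of a c b d] dia[of a c b e] h sy q by blast+
    then have nn': "\<not> adj G d b" "\<not> adj G e b" "\<not> adj G d c" "\<not> adj G e c" using K.E_sym by blast+
    have V: "{a, b, c, d, e} \<subseteq> pverts G" using h sy K.E_V by blast
    have "is_bowtie (ind G {a, b, c, d, e})" unfolding is_bowtie_def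
    proof (intro exI conjI)
      show "distinct [a, b, c, d, e]" using ne q by auto
      show "pverts (ind G {a, b, c, d, e}) = {a, b, c, d, e}" by (simp add: ind_def)
      have "(y, z) \<in> parcs (ind G {a, b, c, d, e}) \<longleftrightarrow> (y, z) \<in> symcl {(a, b), (b, c), (c, a), (a, d), (d, e), (e, a)}" for y z
      proof (cases "y \<in> {a, b, c, d, e} \<and> z \<in> {a, b, c, d, e}")
        case True
        then have "y = a \<or> y = b \<or> y = c \<or> y = d \<or> y = e" "z = a \<or> z = b \<or> z = c \<or> z = d \<or> z = e" by simp_all
        then show ?thesis
          by (elim disjE) (simp_all add: ind_def symcl_iff h sy nn nn' ne q ne[symmetric] q[symmetric] K.E_irrefl)
      next
        case False
        then show ?thesis unfolding ind_def symcl_iff by auto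
      qed
      then show "parcs (ind G {a, b, c, d, e}) = symcl {(a, b), (b, c), (c, a), (a, d), (d, e), (e, a)}"
        by (intro set_eqI) (metis surj_pair)
    qed
    then show False using induced_freeD[OF G(1,4) V] by blast
  qed
  show ?thesis
    by (intro tgraph.intro K.sgraph_axioms tgraph_axioms.intro K.no_tripod_thm tri)
qed

section \<open>Holes, sectors and components in terms of lists\<close>

context kfree
begin

lemma ipathI: "distinct p \<Longrightarrow> set p \<subseteq> V \<Longrightarrow> (\<forall>y\<in>set p. \<forall>z\<in>set p. E y z \<longleftrightarrow> padj p y z) \<Longrightarrow> ipath p"
proof (induction p)
  case (Cons a p)
  show ?case
  proof (cases p)
    case Nil
    then show ?thesis using Cons by simp
  next
    case p: (Cons b q)
    have pa: "padj (a # p) y z \<longleftrightarrow> y = a \<and> z = b \<or> y = b \<and> z = a \<or> padj p y z" for y z unfolding p by simp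
    have "\<forall>y\<in>set p. \<forall>z\<in>set p. E y z \<longleftrightarrow> padj p y z"
    proof (intro ballI)
      fix y z assume yz: "y \<in> set p" "z \<in> set p"
      then have "y \<noteq> a" "z \<noteq> a" using Cons(2) by auto
      then show "E y z \<longleftrightarrow> padj p y z" using Cons(4) yz pa[of y z] by auto
    qed
    then have "ipath p" using Cons by auto
    moreover have "E a c \<longleftrightarrow> c = hd p" if c: "c \<in> set p" for c
    proof -
      have "\<not> padj p a c" using padj_in[of p a c] Cons(2) by auto
      moreover have "c \<noteq> a" using c Cons(2) by auto
      ultimately show ?thesis using Cons(4) c pa[of a c] p by auto
    qed
    ultimately show ?thesis using Cons(2,3) by auto
  qed
qed simp

lemma icycI:
  assumes d: "distinct (a # L)" and l: "2 \<le> length L" and V: "set (a # L) \<subseteq> V"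
    and e: "\<And>y z. y \<in> set (a # L) \<Longrightarrow> z \<in> set (a # L) \<Longrightarrow> E y z \<longleftrightarrow> padj (a # L @ [a]) y z"
  shows "icyc (a # L)"
proof -
  have ne: "L \<noteq> []" using l by auto
  have pa: "padj (a # L @ [a]) y z \<longleftrightarrow> y = a \<and> z = hd L \<or> y = hd L \<and> z = a \<or> padj L y z \<or> y = last L \<and> z = a \<or> z = last L \<and> y = a" for y z
    using ne padj_append[of "[a]" "L @ [a]" y z] padj_append[of L "[a]" y z] by (auto simp: hd_append)
  have "\<forall>y\<in>set L. \<forall>z\<in>set L. E y z \<longleftrightarrow> padj L y z" using e pa d by auto
  then have "ipath L" using ipathI[of L] d V by auto
  moreover have "E a c \<longleftrightarrow> c = hd L \<or> c = last L" if c: "c \<in> set L" for c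
  proof -
    have "\<not> padj L a c" using padj_in[of L a c] d by auto
    moreover have "c \<noteq> a" using c d by auto
    ultimately show ?thesis using e[of a c] c pa[of a c] by auto
  qed
  ultimately show ?thesis using d l V by auto
qed

end

lemma pcas_arcs: "pcas u es v \<Longrightarrow> es = vwalk_arcs (map fst es @ [v]) \<and> pawalk_verts u es = map fst es @ [v] \<and> hd (map fst es @ [v]) = u"
proof (induction es arbitrary: u)
  case (Cons e es)
  then have "fst e = u" and IH: "es = vwalk_arcs (map fst es @ [v])" "pawalk_verts (snd e) es = map fst es @ [v]" "hd (map fst es @ [v]) = snd e"
    by auto
  have "vwalk_arcs (fst e # (map fst es @ [v])) = (fst e, hd (map fst es @ [v])) # vwalk_arcs (map fst es @ [v])" by simp
  then show ?case using IH \<open>fst e = u\<close> by (metis append_Cons list.map(2) list.sel(1) pawalk_verts.simps(2) prod.collapse)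
qed simp

lemma pcas_vwalk: "p \<noteq> [] \<Longrightarrow> pcas (hd p) (vwalk_arcs p) (last p) \<and> pawalk_verts (hd p) (vwalk_arcs p) = p
    \<and> fst ` set (vwalk_arcs p) = set (butlast p) \<and> Suc (length (vwalk_arcs p)) = length p"
  by (induction p rule: induct_list012) auto

lemma hole_icyc:
  assumes K: "kfree (pverts G) (adj G)" and h: "hole G C"
  obtains cs where "sgraph.icyc (pverts G) (adj G) cs" "set cs = C"
proof -
  interpret K: kfree "pverts G" "adj G" by fact
  obtain es where es: "pre_digraph.cycle (with_proj G) es" "4 \<le> length es" "C = fst ` set es" "arcs (with_proj G \<restriction> C) = symcl (set es)"
    using h unfolding hole_def by blast
  obtain u where u: "pre_digraph.awalk (with_proj G) u es u" "distinct (tl (pawalk_verts u es))" "es \<noteq> []"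
    using es(1) unfolding pre_digraph.cycle_def awalk_verts_with_proj_eq by blast
  have aw: "set es \<subseteq> parcs G" "pcas u es u" using u(1) unfolding pre_digraph.awalk_def cas_with_proj_eq by auto
  note pc = pcas_arcs[OF aw(2)]
  \<comment> \<open>The vertex list of a closed walk repeats its start at the end;
    \<open>u # L\<close> omits the repetition.\<close>
  obtain L where L: "map fst es = u # L" using pc u(3) by (cases es) auto
  have arcs: "set es = set (vwalk_arcs (u # L @ [u]))" using pc L by (metis append_Cons)
  have d: "distinct (u # L)" using u(2) pc L by auto
  have C: "C = set (u # L)" using es(3) arg_cong[OF L, of set] by simp
  have len: "length es = Suc (length L)" using arg_cong[OF L, of length] by simp
  have A: "arcs (with_proj G \<restriction> C) = {e \<in> parcs G. fst e \<in> C \<and> snd e \<in> C}" by (simp add: induce_subgraph_def)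
  have CV: "C \<subseteq> pverts G" using es(3) aw(1) K.E_V unfolding adj_def by fastforce
  have "K.icyc (u # L)"
  proof (rule K.icycI[OF d])
    show "2 \<le> length L" using len es(2) by simp
    show "set (u # L) \<subseteq> pverts G" using C CV by simp
    fix y z assume "y \<in> set (u # L)" "z \<in> set (u # L)"
    then have "adj G y z \<longleftrightarrow> (y, z) \<in> arcs (with_proj G \<restriction> C)" unfolding A adj_def using C by simp
    also have "\<dots> \<longleftrightarrow> padj (u # L @ [u]) y z" unfolding es(4) padj_def arcs by (rule refl)
    finally show "adj G y z \<longleftrightarrow> padj (u # L @ [u]) y z" .
  qed
  then show thesis using that C by blast
qed

lemma icyc_hole:
  assumes K: "kfree (pverts G) (adj G)" and c: "sgraph.icyc (pverts G) (adj G) cs" "4 \<le> length cs"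
  shows "hole G (set cs)"
proof -
  interpret K: kfree "pverts G" "adj G" by fact
  obtain u L where cs: "cs = u # L" using c by (cases cs) auto
  let ?p = "u # L @ [u]"
  let ?es = "vwalk_arcs ?p"
  note pc = pcas_vwalk[of ?p]
  have pl: "hd ?p = u" "last ?p = u" "butlast ?p = u # L" by auto
  have P: "pcas u ?es u" "pawalk_verts u ?es = ?p" "fst ` set ?es = set (u # L)" "length ?es = Suc (length L)" using pc pl by auto
  have sub: "y \<in> set (u # L) \<and> z \<in> set (u # L)" if "(y, z) \<in> set ?es" for y z using vwalk_arcs_sub[OF that] by auto
  have adj: "adj G y z" if "(y, z) \<in> set ?es" for y z
  proof -
    have "padj ?p y z" using that unfolding padj_def symcl_iff by blast
    then show ?thesis using K.icyc_padj[of u L y z] c(1) cs sub[OF that] by auto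
  qed
  have dist: "distinct (u # L)" using K.icyc_distinct c(1) cs by blast
  have uV: "u \<in> pverts G" using K.icyc_V c(1) cs by auto
  have "pre_digraph.awalk (with_proj G) u ?es u"
    unfolding pre_digraph.awalk_def cas_with_proj_eq using P(1) adj uV unfolding adj_def by auto
  moreover have "distinct (tl (pawalk_verts u ?es))" unfolding P(2) using dist by auto
  moreover have "?es \<noteq> []" using P(4) by auto
  ultimately have 1: "pre_digraph.cycle (with_proj G) ?es"
    unfolding pre_digraph.cycle_def awalk_verts_with_proj_eq by blast
  have A: "arcs (with_proj G \<restriction> set cs) = {e \<in> parcs G. fst e \<in> set cs \<and> snd e \<in> set cs}" by (simp add: induce_subgraph_def)
  have "(y, z) \<in> arcs (with_proj G \<restriction> set cs) \<longleftrightarrow> (y, z) \<in> symcl (set ?es)" for y z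
  proof -
    have "(y, z) \<in> arcs (with_proj G \<restriction> set cs) \<longleftrightarrow> y \<in> set cs \<and> z \<in> set cs \<and> adj G y z" unfolding A adj_def by auto
    also have "\<dots> \<longleftrightarrow> y \<in> set cs \<and> z \<in> set cs \<and> padj ?p y z" using K.icyc_padj[of u L y z] c(1) cs by auto
    also have "\<dots> \<longleftrightarrow> padj ?p y z" using padj_in[of ?p y z] cs by auto
    finally show ?thesis unfolding padj_def .
  qed
  then have 2: "arcs (with_proj G \<restriction> set cs) = symcl (set ?es)" by (intro set_eqI) (metis surj_pair)
  show ?thesis unfolding hole_def
    using 1 2 P(3,4) c(2) cs by (intro exI[of _ ?es]) auto
qed

lemma arcs_ends_induce: "(y, z) \<in> arcs_ends (with_proj G \<restriction> C) \<longleftrightarrow> y \<in> C \<and> z \<in> C \<and> adj G y z"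
  unfolding arcs_ends_def arc_to_ends_def induce_subgraph_def adj_def by force

lemma successively_arcs: "successively P p \<longleftrightarrow> (\<forall>(y, z)\<in>set (vwalk_arcs p). P y z)"
  by (induction p rule: induct_list012) auto

lemma vpath_induce:
  "vpath p (with_proj G \<restriction> C) \<longleftrightarrow> p \<noteq> [] \<and> distinct p \<and> set p \<subseteq> C \<and> successively (adj G) p"
proof
  assume "vpath p (with_proj G \<restriction> C)"
  then have a: "p \<noteq> []" "distinct p" "set p \<subseteq> C" "set (vwalk_arcs p) \<subseteq> arcs_ends (with_proj G \<restriction> C)"
    unfolding vpath_def vwalk_def by auto
  have "adj G y z" if "(y, z) \<in> set (vwalk_arcs p)" for y z using that a(4) arcs_ends_induce[of y z G C] by blast
  then have "successively (adj G) p" unfolding successively_arcs by auto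
  then show "p \<noteq> [] \<and> distinct p \<and> set p \<subseteq> C \<and> successively (adj G) p" using a by blast
next
  assume a: "p \<noteq> [] \<and> distinct p \<and> set p \<subseteq> C \<and> successively (adj G) p"
  have "set (vwalk_arcs p) \<subseteq> arcs_ends (with_proj G \<restriction> C)"
  proof
    fix e assume e: "e \<in> set (vwalk_arcs p)"
    obtain y z where yz: "e = (y, z)" by (cases e)
    then have "(y, z) \<in> set (vwalk_arcs p)" using e by simp
    then show "e \<in> arcs_ends (with_proj G \<restriction> C)"
      using a vwalk_arcs_sub[of y z p] yz unfolding successively_arcs by (auto simp: arcs_ends_induce)
  qed
  then show "vpath p (with_proj G \<restriction> C)" unfolding vpath_def vwalk_def using a by auto
qed

text \<open>A path in the subgraph induced on the rim is a walk along the cycle, so one of the two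
  readings from its first vertex begins with it.\<close>

lemma sector_path_icyc:
  assumes K: "kfree (pverts G) (adj G)" and c: "sgraph.icyc (pverts G) (adj G) cs" "set cs = C" and p: "sector_path G C x p"
  obtains e X e' Z where "p = e # X @ [e']" "sgraph.icyc (pverts G) (adj G) (e # X @ e' # Z)" "set (e # X @ e' # Z) = C"
    "adj G x e" "adj G x e'" "\<forall>y\<in>set X. \<not> adj G x y" "path_interior p = set X"
proof -
  interpret K: kfree "pverts G" "adj G" by fact
  have p': "distinct p" "set p \<subseteq> C" "successively (adj G) p" "2 \<le> length p"
    "hd p \<in> spokes G C x" "last p \<in> spokes G C x" "path_interior p \<inter> spokes G C x = {}"
    using p unfolding sector_path_def vpath_induce by auto
  obtain e p1 where "p = e # p1" "p1 \<noteq> []" using p'(4) by (cases p) (auto simp: Suc_le_eq)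
  then obtain X e' where pe: "p = e # X @ [e']" by (metis append_butlast_last_id)
  have pin: "path_interior p = set X" unfolding path_interior_def pe by simp
  have "e \<in> set cs" using p'(2) pe c(2) by auto
  then obtain A B where AB: "cs = A @ e # B" by (meson split_list)
  have i: "K.icyc (e # (B @ A))" using K.icyc_rot[of A "e # B"] c(1) AB by (simp del: K.icyc.simps)
  have s: "set (e # (B @ A)) = C" using c(2) AB by auto
  obtain Z where Z: "e # (B @ A) = p @ Z \<or> e # rev (B @ A) = p @ Z"
    using K.cyc_walk[OF i p'(3,1)] p'(2) s pe by auto
  then have "K.icyc (p @ Z) \<and> set (p @ Z) = C"
  proof
    assume h: "e # (B @ A) = p @ Z"
    show ?thesis using i s unfolding h by blast
  next
    assume h: "e # rev (B @ A) = p @ Z"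
    have "K.icyc (e # rev (B @ A))" "set (e # rev (B @ A)) = C" using K.icyc_reorient[OF i] s by auto
    then show ?thesis unfolding h by blast
  qed
  then have "K.icyc (e # X @ e' # Z)" "set (e # X @ e' # Z) = C" unfolding pe by (auto simp del: K.icyc.simps)
  moreover have "adj G x e" "adj G x e'" using p'(5,6) pe unfolding spokes_def nbhd_adj by auto
  moreover have "\<forall>y\<in>set X. \<not> adj G x y" using p'(7) p'(2) pin pe unfolding spokes_def nbhd_adj by auto
  ultimately show thesis using that[OF pe] pin by blast
qed

lemma icyc_sector_path:
  assumes K: "kfree (pverts G) (adj G)" and c: "sgraph.icyc (pverts G) (adj G) (e # X @ e' # Z)"
    and s: "adj G x e" "adj G x e'" "\<forall>y\<in>set X. \<not> adj G x y"
  shows "sector_path G (set (e # X @ e' # Z)) x (e # X @ [e'])"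
proof -
  interpret K: kfree "pverts G" "adj G" by fact
  have "successively (adj G) (e # X @ e' # Z)" using K.icyc_succ[OF c] .
  then have "successively (adj G) (e # X @ [e'])" using successively_append_iff[of "adj G" "e # X @ [e']" Z] by auto
  moreover have "distinct (e # X @ [e'])" using K.icyc_distinct[OF c] by auto
  ultimately have "vpath (e # X @ [e']) (with_proj G \<restriction> set (e # X @ e' # Z))" unfolding vpath_induce by auto
  moreover have "path_interior (e # X @ [e']) = set X" unfolding path_interior_def by simp
  ultimately show ?thesis unfolding sector_path_def spokes_def nbhd_adj using s by auto
qed

lemma components_reach:
  assumes D: "D \<in> components_without G Y" and ab: "a \<in> verts D" "b \<in> verts D"
  shows "verts D \<subseteq> pverts G - Y \<and> (a, b) \<in> {(u, w). u \<in> verts D \<and> w \<in> verts D \<and> adj G u w}\<^sup>*"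
proof -
  let ?H = "with_proj G \<restriction> (pverts G - Y)"
  have i: "induced_subgraph D ?H" and sc: "strongly_connected D"
    using D unfolding components_without_def pre_digraph.sccs_def by auto
  have sub: "verts D \<subseteq> pverts G - Y" "arcs D \<subseteq> parcs G" "tail D = fst" "head D = snd"
    using i unfolding induced_subgraph_def subgraph_def compatible_def induce_subgraph_def by auto
  have ar: "adj G u w" if "(u, w) \<in> arcs_ends D" for u w
    using that sub unfolding arcs_ends_def arc_to_ends_def adj_def by auto
  have "a \<rightarrow>\<^sup>*\<^bsub>D\<^esub> b" using sc ab unfolding strongly_connected_def by blast
  then have "(a, b) \<in> rtrancl_on (verts D) (arcs_ends D)" unfolding reachable_def .
  then have "(a, b) \<in> {(u, w). u \<in> verts D \<and> w \<in> verts D \<and> adj G u w}\<^sup>*"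
  proof (induction rule: rtrancl_on_induct)
    case (step y z)
    then show ?case using ar[of y z] by (auto intro: rtrancl_into_rtrancl)
  qed simp
  then show ?thesis using sub by blast
qed

text \<open>\<open>u\<close> is the only vertex of \<open>S\<close> outside \<open>far\<close>, so a
  walk to \<open>u\<close> stays in \<open>far\<close> until it first arrives there.\<close>

lemma (in min_wheel_ctx) far_reach:
  assumes a: "a \<in> far" and r: "(a, u) \<in> {(p, q). p \<in> S \<and> q \<in> S \<and> E p q}\<^sup>*" and S: "S \<subseteq> insert u far" and u: "u \<notin> far"
  shows "\<exists>z. (a, z) \<in> far_step\<^sup>* \<and> E z u"
proof -
  have "(\<exists>z. (a, z) \<in> far_step\<^sup>* \<and> E z u) \<or> (b \<in> far \<and> (a, b) \<in> far_step\<^sup>*)"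
    if "(a, b) \<in> {(p, q). p \<in> S \<and> q \<in> S \<and> E p q}\<^sup>*" for b
    using that
  proof (induction rule: rtrancl_induct)
    case base
    then show ?case using a by blast
  next
    case (step b c)
    have bc: "c \<in> S" "E b c" using step(2) by auto
    show ?case
    proof (cases "\<exists>z. (a, z) \<in> far_step\<^sup>* \<and> E z u")
      case True
      then show ?thesis by blast
    next
      case False
      then have b: "b \<in> far" "(a, b) \<in> far_step\<^sup>*" using step by auto
      then have "c \<noteq> u" using bc False by blast
      then have "c \<in> far" using bc S by blast
      moreover then have "(b, c) \<in> far_step" using b bc unfolding far_step_def by blast
      ultimately show ?thesis using b by (meson rtrancl_into_rtrancl)
    qed
  qed
  from this[OF r] show ?thesis using u by blast
qed

text \<open>The sector containing all neighbours of a vertex yields \<open>nosep\<close> for one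
  enumeration of the rim, and \<open>nosep_same\<close> transfers it to all others.\<close>

lemma proper_wheel_ctx:
  assumes K: "kfree (pverts G) (adj G)" and T: "tgraph (pverts G) (adj G)" and w: "proper_wheel G C x"
  shows "wheel_ctx (pverts G) (adj G) x C"
proof -
  have xV: "x \<in> pverts G" and hl: "hole G C" and xC: "x \<notin> C" and s3: "3 \<le> card (spokes G C x)"
    using w unfolding proper_wheel_def wheel_def by auto
  interpret H: hub "pverts G" "adj G" x by (intro hub.intro T hub_axioms.intro xV)
  obtain cs where cs: "H.icyc cs" "set cs = C" by (rule hole_icyc[OF K hl])
  have sp: "spokes G C x = {h\<in>C. adj G x h}" unfolding spokes_def nbhd_adj by auto
  show ?thesis
  proof (intro wheel_ctx.intro H.hub_axioms wheel_ctx_axioms.intro)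
    show "\<exists>cs. H.icyc cs \<and> set cs = C" using cs by blast
    show "x \<notin> C" by fact
    have "H.sp cs = card (spokes G C x)" using H.sp_card[OF H.icyc_distinct[OF cs(1)]] cs(2) sp by simp
    moreover have "H.sp cs \<noteq> 3" using H.sp_not_3[OF cs(1)] xC cs(2) by simp
    ultimately show "4 \<le> card {h\<in>C. adj G x h}" using s3 sp by simp
  next
    fix bs v assume bs: "H.icyc bs" "set bs = C" and v: "v \<in> pverts G" "v \<notin> C" "v \<noteq> x"
    have "proper_vertex G C x v" using w v unfolding proper_wheel_def by blast
    then obtain p where p: "sector_path G C x p" "nbhd G v \<inter> C \<subseteq> set p" using v unfolding proper_vertex_def by blast
    obtain e X e' Z where s: "p = e # X @ [e']" "H.icyc (e # X @ e' # Z)" "set (e # X @ e' # Z) = C"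
      "adj G x e" "adj G x e'" "\<forall>y\<in>set X. \<not> adj G x y" "path_interior p = set X"
      by (rule sector_path_icyc[OF K cs p(1)])
    have "H.nosep (e # X @ e' # Z) v"
    proof (rule H.nosep_inner[of _ "[]" e X e' Z])
      show "H.sp X = 0" unfolding H.sp_0_iff using s(6) .
      fix b assume b: "b \<in> set ([] @ Z)"
      show "\<not> adj G v b"
      proof
        assume "adj G v b"
        then have "b \<in> set p" using p(2) b s(3) unfolding nbhd_adj by auto
        then show False using H.icyc_distinct[OF s(2)] b s(1) by auto
      qed
    qed simp
    then show "H.nosep bs v" using H.nosep_same[OF s(2) bs(1)] s(3) bs(2) by simp
  next
    fix v assume v: "v \<in> pverts G" "v \<notin> C" "v \<noteq> x" "\<not> adj G v x"
    have "proper_vertex G C x v" using w v unfolding proper_wheel_def by blast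
    then have "\<not> card (nbhd G v \<inter> C) > 2" using v unfolding proper_vertex_def nbhd_adj by blast
    moreover have "nbhd G v \<inter> C = {h\<in>C. adj G v h}" unfolding nbhd_adj by auto
    ultimately show "card {h\<in>C. adj G v h} \<le> 2" by simp
  qed
qed

text \<open>A cycle that met the hypotheses of \<open>minimal\<close> would be the rim of a proper
  wheel with fewer spokes; \<open>nosep_sector\<close> provides the sectors demanded by
  properness.\<close>

lemma min_proper_wheel_ctx:
  assumes K: "kfree (pverts G) (adj G)" and T: "tgraph (pverts G) (adj G)" and w: "proper_wheel G C x"
    and m: "\<And>C'. proper_wheel G C' x \<Longrightarrow> card (spokes G C x) \<le> card (spokes G C' x)"
  shows "min_wheel_ctx (pverts G) (adj G) x C"
proof -
  interpret W: wheel_ctx "pverts G" "adj G" x C using proper_wheel_ctx[OF K T w] .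
  have sp: "spokes G C' x = {h\<in>C'. adj G x h}" for C' unfolding spokes_def nbhd_adj by auto
  show ?thesis
  proof (intro min_wheel_ctx.intro W.wheel_ctx_axioms min_wheel_ctx_axioms.intro)
    fix L assume L: "W.icyc L" "x \<notin> set L" "4 \<le> W.sp L" "W.sp L < W.n"
      and v: "\<And>v. \<lbrakk>v \<in> pverts G; v \<notin> set L; v \<noteq> x\<rbrakk> \<Longrightarrow> W.nosep L v \<and> (\<not> adj G v x \<longrightarrow> card {h\<in>set L. adj G v h} \<le> 2)"
    have spL: "W.sp L = card (spokes G (set L) x)" using W.sp_card[OF W.icyc_distinct[OF L(1)]] sp by simp
    have "4 \<le> length L" using L(3) length_filter_le[of "adj G x" L] unfolding W.sp_def by linarith
    then have "wheel G (set L) x" unfolding wheel_def using icyc_hole[OF K L(1)] W.x_V L(2,3) spL by simp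
    moreover have "proper_vertex G (set L) x u" if u: "u \<in> pverts G" for u
    proof (cases "u \<in> insert x (set L)")
      case True
      then show ?thesis unfolding proper_vertex_def by blast
    next
      case False
      then have pv: "W.nosep L u" "\<not> adj G u x \<longrightarrow> card {h\<in>set L. adj G u h} \<le> 2" using v[OF u] by auto
      obtain f X f' Z where f: "W.icyc (f # X @ f' # Z)" "set (f # X @ f' # Z) = set L" "adj G x f" "adj G x f'" "W.sp X = 0"
        "\<And>b. b \<in> set L \<Longrightarrow> adj G u b \<Longrightarrow> b \<in> set (f # X @ [f'])"
        by (rule W.nosep_sector[OF L(1,3) pv(1)]) (rule that)
      have "sector_path G (set L) x (f # X @ [f'])"
        using icyc_sector_path[OF K f(1,3,4)] f(5) unfolding f(2) W.sp_0_iff by blast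
      moreover have "nbhd G u \<inter> set L \<subseteq> set (f # X @ [f'])" using f(6) unfolding nbhd_adj by blast
      moreover have "nbhd G u \<inter> set L = {h\<in>set L. adj G u h}" unfolding nbhd_adj by auto
      moreover have "x \<in> nbhd G u \<longleftrightarrow> adj G u x" unfolding nbhd_adj by simp
      ultimately show ?thesis unfolding proper_vertex_def using pv(2) by (metis not_le)
    qed
    ultimately have "proper_wheel G (set L) x" unfolding proper_wheel_def by blast
    then have "card (spokes G C x) \<le> card (spokes G (set L) x)" by (rule m)
    then show False using L(4) spL sp[of C] unfolding W.n_def by simp
  qed
qed

lemma card_le_oneI: "(\<And>a b. a \<in> S \<Longrightarrow> b \<in> S \<Longrightarrow> a = b) \<Longrightarrow> card S \<le> 1"
proof -
  assume a: "\<And>a b. a \<in> S \<Longrightarrow> b \<in> S \<Longrightarrow> a = b"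
  show ?thesis
  proof (cases "S = {}")
    case False
    then obtain s where "s \<in> S" by blast
    then have "S = {s}" using a by blast
    then show ?thesis by simp
  qed simp
qed

lemma three_elements:
  assumes "\<not> card S \<le> 2"
  obtains a b c where "a \<in> S" "b \<in> S" "c \<in> S" "a \<noteq> b" "a \<noteq> c" "b \<noteq> c"
proof -
  have "3 \<le> card S" using assms by simp
  then obtain T where "T \<subseteq> S" "card T = 3" by (meson obtain_subset_with_card_n)
  then show thesis using that unfolding card_3_iff by blast
qed

theorem theorem3p16:
  fixes G :: "'a pair_pre_digraph" and C :: "'a set" and x :: 'a
  assumes "pair_graph G"
    and "induced_free is_subdivided_K4 G"
    and "induced_free is_diamond G"
    and "induced_free is_bowtie G"
    and "induced_free is_prism G"
    and "induced_free is_K33 G"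
    and "proper_wheel G C x"
    and "\<And>C'. proper_wheel G C' x \<Longrightarrow> card (spokes G C x) \<le> card (spokes G C' x)"
  shows "(\<forall>D \<in> components_without G (closed_nbhd G x).
            card (sectors_with_interior_in G C x (verts D)) \<le> 1)
       \<and> (\<forall>u \<in> nbhd G x. \<forall>D \<in> components_without G (closed_nbhd G x - {u}). u \<in> verts D \<longrightarrow>
            card (sectors_with_interior_in G C x (verts D)) \<le> 2
          \<and> (\<forall>S1 \<in> sectors_with_interior_in G C x (verts D).
             \<forall>S2 \<in> sectors_with_interior_in G C x (verts D). S1 \<inter> S2 \<noteq> {}))"
proof -
  note K = kfree_adj[OF assms(1,2,5)] and T = tgraph_adj[OF assms(1-5)]
  interpret M: min_wheel_ctx "pverts G" "adj G" x C using min_proper_wheel_ctx[OF K T assms(7,8)] .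
  obtain cs where cs: "M.icyc cs" "set cs = C" using M.C_cyc by blast
  have far: "M.far = pverts G - closed_nbhd G x" unfolding M.far_def closed_nbhd_def nbhd_adj by auto
  have sec: "\<exists>e X e'. A = set (e # X @ [e']) \<and> M.sec e X e' \<and> X \<noteq> [] \<and> set X \<subseteq> Y"
    if A: "A \<in> sectors_with_interior_in G C x Y" for A Y
  proof -
    obtain p where p: "A = set p" "sector_path G C x p" "path_interior p \<noteq> {}" "path_interior p \<subseteq> Y"
      using A unfolding sectors_with_interior_in_def by blast
    obtain e X e' Z where s: "p = e # X @ [e']" "M.icyc (e # X @ e' # Z)" "set (e # X @ e' # Z) = C"
      "adj G x e" "adj G x e'" "\<forall>y\<in>set X. \<not> adj G x y" "path_interior p = set X"
      by (rule sector_path_icyc[OF K cs p(2)])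
    have "M.sec e X e'" unfolding M.sec_def M.rim_def M.sp_0_iff using s by blast
    moreover have "A = set (e # X @ [e'])" "X \<noteq> []" "set X \<subseteq> Y" using p s(1,7) by auto
    ultimately show ?thesis by (intro exI conjI)
  qed
  have 1: "card (sectors_with_interior_in G C x (verts D)) \<le> 1" if D: "D \<in> components_without G (closed_nbhd G x)" for D
  proof (rule card_le_oneI)
    fix A B assume A: "A \<in> sectors_with_interior_in G C x (verts D)" and B: "B \<in> sectors_with_interior_in G C x (verts D)"
    obtain e X e' where a: "A = set (e # X @ [e'])" "M.sec e X e'" "X \<noteq> []" "set X \<subseteq> verts D" using sec[OF A] by (elim exE conjE) (rule that)
    obtain g X' g' where b: "B = set (g # X' @ [g'])" "M.sec g X' g'" "X' \<noteq> []" "set X' \<subseteq> verts D" using sec[OF B] by (elim exE conjE) (rule that)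
    have m: "hd X \<in> set X" "hd X' \<in> set X'" using a(3) b(3) by auto
    have r: "verts D \<subseteq> M.far" "(hd X, hd X') \<in> {(u, w). u \<in> verts D \<and> w \<in> verts D \<and> adj G u w}\<^sup>*"
      using components_reach[OF D, of "hd X" "hd X'"] m a(4) b(4) unfolding far by auto
    have "{(u, w). u \<in> verts D \<and> w \<in> verts D \<and> adj G u w} \<subseteq> M.far_step" using r(1) unfolding M.far_step_def by auto
    then have "(hd X, hd X') \<in> M.far_step\<^sup>*" using r(2) rtrancl_mono by blast
    then show "A = B" using M.same_component[OF a(2) b(2) m] a(1) b(1) by blast
  qed
  have 2: "card (sectors_with_interior_in G C x (verts D)) \<le> 2
          \<and> (\<forall>S1 \<in> sectors_with_interior_in G C x (verts D).
             \<forall>S2 \<in> sectors_with_interior_in G C x (verts D). S1 \<inter> S2 \<noteq> {})"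
    if u: "u \<in> nbhd G x" and D: "D \<in> components_without G (closed_nbhd G x - {u})" and uD: "u \<in> verts D" for u D
  proof -
    have xu: "adj G x u" using u unfolding nbhd_adj by simp
    then have ufar: "u \<notin> M.far" unfolding M.far_def by blast
    \<comment> \<open>Apart from \<open>u\<close>, the component consists of non-neighbours of
      \<open>x\<close>, so every walk in it from the interior of a sector to \<open>u\<close> is one
      to which \<open>far_reach\<close> applies.\<close>
    have DV: "verts D \<subseteq> insert u M.far" using components_reach[OF D uD uD] unfolding far by auto
    have reach: "\<exists>z. (hd X, z) \<in> M.far_step\<^sup>* \<and> adj G z u" if s: "M.sec e X e'" "X \<noteq> []" "set X \<subseteq> verts D" for e X e'
    proof -
      have hX: "hd X \<in> verts D" using s by auto
      have "\<not> adj G x (hd X)" using s(1,2) M.sp_0_iff[of X] unfolding M.sec_def by auto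
      then have "hd X \<in> M.far" using hX DV xu by auto
      then show ?thesis using M.far_reach[OF _ _ DV ufar] components_reach[OF D hX uD] by blast
    qed
    have meet: "A \<inter> B \<noteq> {}" if A: "A \<in> sectors_with_interior_in G C x (verts D)" and B: "B \<in> sectors_with_interior_in G C x (verts D)" for A B
    proof -
      obtain e X e' where a: "A = set (e # X @ [e'])" "M.sec e X e'" "X \<noteq> []" "set X \<subseteq> verts D" using sec[OF A] by (elim exE conjE) (rule that)
      obtain g X' g' where b: "B = set (g # X' @ [g'])" "M.sec g X' g'" "X' \<noteq> []" "set X' \<subseteq> verts D" using sec[OF B] by (elim exE conjE) (rule that)
      have m: "hd X \<in> set X" "hd X' \<in> set X'" using a(3) b(3) by auto
      obtain z where z: "(hd X, z) \<in> M.far_step\<^sup>*" "adj G z u" using reach[OF a(2-4)] by blast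
      obtain z' where z': "(hd X', z') \<in> M.far_step\<^sup>*" "adj G z' u" using reach[OF b(2-4)] by blast
      show ?thesis using M.through_nbr[OF a(2) b(2) xu m(1) z m(2) z'] a(1) b(1) by blast
    qed
    have "card (sectors_with_interior_in G C x (verts D)) \<le> 2"
    proof (rule ccontr)
      assume "\<not> ?thesis"
      then obtain A B C' where m: "A \<in> sectors_with_interior_in G C x (verts D)" "B \<in> sectors_with_interior_in G C x (verts D)"
        "C' \<in> sectors_with_interior_in G C x (verts D)" and d: "A \<noteq> B" "A \<noteq> C'" "B \<noteq> C'" by (rule three_elements)
      obtain e1 X1 f1 where a: "A = set (e1 # X1 @ [f1])" "M.sec e1 X1 f1" "X1 \<noteq> []" using sec[OF m(1)] by (elim exE conjE) (rule that)
      obtain e2 X2 f2 where b: "B = set (e2 # X2 @ [f2])" "M.sec e2 X2 f2" "X2 \<noteq> []" using sec[OF m(2)] by (elim exE conjE) (rule that)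
      obtain e3 X3 f3 where c: "C' = set (e3 # X3 @ [f3])" "M.sec e3 X3 f3" "X3 \<noteq> []" using sec[OF m(3)] by (elim exE conjE) (rule that)
      show False
        using M.three_sectors[OF a(2) b(2) c(2) a(3) b(3) c(3)] d meet[OF m(1,2)] meet[OF m(1,3)] meet[OF m(2,3)]
        unfolding a(1) b(1) c(1) by blast
    qed
    then show ?thesis using meet by blast
  qed
  show ?thesis using 1 2 by blast
qed

end
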